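(* Let $M\le N$ be positive integers, let $W$ be an $M$-dimensional subspace of $\overline{\mathbb Q}^N$, and let $\Psi:\overline{\mathbb Q}^N\to\overline{\mathbb Q}^M$ be a surjective linear transformation with $W\cap\ker\Psi=\{\mathbf 0\}$. Then $$1=H(W)\cdot U(W,\Psi).$$
   Context: Choose a basis $\{\mathbf w_1,\dots,\mathbf w_M\}$ of $W$ and a number field $K$ containing the entries of all $\mathbf w_m$ and of the matrix of $\Psi$. For a place $v$ of $K$ over the place $p$ of $\mathbb Q$: $d=[K:\mathbb Q]$, $d_v=[K_v:\mathbb Q_p]$, $\|\cdot\|_v$ the unique extension to $K_v$ of the usual absolute value on $\mathbb Q_p$, $|x|_v=\|x\|_v^{d_v/d}$, extended uniquely to $\Omega_v$, the completion of an algebraic closure of $K_v$. On $\wedge^M(\Omega_v^N)$ use the basis $\{\bigwedge_{i\in I}\mathbf e_i: I\subset\{1,\dots,N\},|I|=M\}$ ($\mathbf e_i$ the standard basis), and for $\mathbf x=\sum_I x_I\bigwedge_{i\in I}\mathbf e_i$ set $H_v(\mathbf x)=\max_I|x_I|_v$. For $\phi$ in the dual of $\wedge^M(\Omega_v^N)$ set $\nu_v(\phi)=\sup\{|\phi(\mathbf x)|_v: H_v(\mathbf x)\le1\}$, and for $\mathbf w\in\wedge^M(\Omega_v^N)$ and $\psi$ in the dual set $U_v(\mathbf w,\psi)=\inf\{\nu_v(\psi-\phi):\phi\text{ in the dual},\ \phi(\mathbf w)=0\}$. Let $\wedge^M(\Psi):\wedge^M(\Omega_v^N)\to\Omega_v$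 be the unique linear map with $\wedge^M(\Psi)(\mathbf u_1\wedge\cdots\wedge\mathbf u_M)=\det$ of the $M\times M$ matrix with rows $\Psi(\mathbf u_1),\dots,\Psi(\mathbf u_M)$. Define $H(W)=\prod_v H_v(\mathbf w_1\wedge\cdots\wedge\mathbf w_M)$ and $U(W,\Psi)=\prod_v U_v(\mathbf w_1\wedge\cdots\wedge\mathbf w_M,\wedge^M(\Psi))$, products over all places $v$ of $K$ (these are independent of $K$ and of the chosen basis). *)

theory Defs
  imports
    "HOL-Analysis.Analysis"
    "HOL-Algebra.Algebraic_Closure_Type"
    "Jordan_Normal_Form.VS_Connect"
begin

section \<open>Completions and extensions of absolute values\<close>

definition abs_value :: "('a, 'm) ring_scheme \<Rightarrow> ('a \<Rightarrow> real) \<Rightarrow> bool" where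
  "abs_value R a \<longleftrightarrow>
     (\<forall>x\<in>carrier R. 0 \<le> a x \<and> (a x = 0 \<longleftrightarrow> x = \<zero>\<^bsub>R\<^esub>)) \<and>
     (\<forall>x\<in>carrier R. \<forall>y\<in>carrier R. a (x \<otimes>\<^bsub>R\<^esub> y) = a x * a y \<and> a (x \<oplus>\<^bsub>R\<^esub> y) \<le> a x + a y)"

definition cauchy_seqs :: "('a, 'm) ring_scheme \<Rightarrow> ('a \<Rightarrow> real) \<Rightarrow> (nat \<Rightarrow> 'a) set" where
  "cauchy_seqs R a = {s. (\<forall>n. s n \<in> carrier R) \<and>
     (\<forall>e>0. \<exists>k. \<forall>m\<ge>k. \<forall>n\<ge>k. a (s m \<ominus>\<^bsub>R\<^esub> s n) < e)}"

definition null_seqs :: "('a, 'm) ring_scheme \<Rightarrow> ('a \<Rightarrow> real) \<Rightarrow> (nat \<Rightarrow> 'a) set" where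
  "null_seqs R a = {s. (\<forall>n. s n \<in> carrier R) \<and> (\<lambda>n. a (s n)) \<longlonglongrightarrow> 0}"

definition cauchy_ring :: "('a, 'm) ring_scheme \<Rightarrow> ('a \<Rightarrow> real) \<Rightarrow> (nat \<Rightarrow> 'a) ring" where
  "cauchy_ring R a = \<lparr>carrier = cauchy_seqs R a,
     mult = (\<lambda>s t n. s n \<otimes>\<^bsub>R\<^esub> t n), one = (\<lambda>n. \<one>\<^bsub>R\<^esub>),
     zero = (\<lambda>n. \<zero>\<^bsub>R\<^esub>), add = (\<lambda>s t n. s n \<oplus>\<^bsub>R\<^esub> t n)\<rparr>"

definition completion :: "('a, 'm) ring_scheme \<Rightarrow> ('a \<Rightarrow> real) \<Rightarrow> (nat \<Rightarrow> 'a) set ring" where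
  "completion R a = cauchy_ring R a Quot null_seqs R a"

definition completion_emb ::
  "('a, 'm) ring_scheme \<Rightarrow> ('a \<Rightarrow> real) \<Rightarrow> 'a \<Rightarrow> (nat \<Rightarrow> 'a) set" where
  "completion_emb R a x = null_seqs R a +>\<^bsub>cauchy_ring R a\<^esub> (\<lambda>n. x)"

text \<open>The limit below does not depend on the representative.\<close>

definition completion_abs :: "('a \<Rightarrow> real) \<Rightarrow> (nat \<Rightarrow> 'a) set \<Rightarrow> real" where
  "completion_abs a C = (THE r. \<forall>s\<in>C. (\<lambda>n. a (s n)) \<longlonglongrightarrow> r)"

text \<open>The unique extension of the absolute value \<open>a\<close> of the complete field \<open>R\<close> to its algebraic
  closure; being extensional makes it unique as a HOL function.\<close>

definition closure_abs ::
  "('a, 'm) ring_scheme \<Rightarrow> ('a \<Rightarrow> real) \<Rightarrow> (('a list \<times> nat) multiset \<Rightarrow> 'a) \<Rightarrow> real" where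
  "closure_abs R a = (THE b. b \<in> extensional (carrier (field.alg_closure R)) \<and>
     abs_value (field.alg_closure R) b \<and>
     (\<forall>x\<in>carrier R. b (ring.indexed_const R x) = a x))"


section \<open>Places of a number field\<close>

type_synonym qbar = "rat alg_closure"

definition number_field :: "qbar set \<Rightarrow> bool" where
  "number_field K \<longleftrightarrow> subfield K class_ring \<and> ring.finite_dimension class_ring \<rat> K"

abbreviation field_of :: "qbar set \<Rightarrow> qbar ring" where
  "field_of K \<equiv> class_ring\<lparr>carrier := K\<rparr>"

definition global_degree :: "qbar set \<Rightarrow> nat" where
  "global_degree K = ring.dim class_ring \<rat> K"

definition padic_abs :: "nat \<Rightarrow> rat \<Rightarrow> real" where
  "padic_abs p x = (if x = 0 then 0 else
     real p powi (int (multiplicity (int p) (snd (quotient_of x))) -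
                  int (multiplicity (int p) (fst (quotient_of x)))))"

definition usual_abs_values :: "(rat \<Rightarrow> real) set" where
  "usual_abs_values = insert (\<lambda>x. \<bar>of_rat x\<bar>) {padic_abs p | p. Factorial_Ring.prime p}"

text \<open>A place \<open>v\<close> is represented by the absolute value \<open>\<parallel>_\<parallel>\<^sub>v\<close> on \<open>K\<close>, i.e. by the unique absolute
  value in the equivalence class \<open>v\<close> whose restriction to the rationals is the usual archimedean
  or a usual \<open>p\<close>-adic absolute value.\<close>

definition places :: "qbar set \<Rightarrow> (qbar \<Rightarrow> real) set" where
  "places K = {v \<in> extensional K. abs_value (field_of K) v \<and>
     (\<exists>u\<in>usual_abs_values. \<forall>x. v (of_rat x) = u x)}"

text \<open>\<open>K\<^sub>v\<close>, and inside it the closure of the rationals, which is \<open>\<rat>\<^sub>p\<close> (the real numbers if \<open>v\<close> is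
  archimedean).\<close>

definition local_field :: "qbar set \<Rightarrow> (qbar \<Rightarrow> real) \<Rightarrow> (nat \<Rightarrow> qbar) set ring" where
  "local_field K v = completion (field_of K) v"

definition local_base :: "qbar set \<Rightarrow> (qbar \<Rightarrow> real) \<Rightarrow> (nat \<Rightarrow> qbar) set set" where
  "local_base K v = {C \<in> carrier (local_field K v). \<exists>s\<in>C. \<forall>n. s n \<in> \<rat>}"

definition local_degree :: "qbar set \<Rightarrow> (qbar \<Rightarrow> real) \<Rightarrow> nat" where
  "local_degree K v =
     ring.dim (local_field K v) (local_base K v) (carrier (local_field K v))"

text \<open>\<open>|x|\<^sub>v = \<parallel>x\<parallel>\<^sub>v\<close> to the power \<open>d\<^sub>v/d\<close> on \<open>K\<^sub>v\<close>, then on its algebraic closure, then on the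
  completion \<open>\<Omega>\<^sub>v\<close> of the latter.\<close>

definition local_abs :: "qbar set \<Rightarrow> (qbar \<Rightarrow> real) \<Rightarrow> (nat \<Rightarrow> qbar) set \<Rightarrow> real" where
  "local_abs K v C =
     completion_abs v C powr (real (local_degree K v) / real (global_degree K))"

type_synonym local_closure_elem =
  "((nat \<Rightarrow> qbar) set list \<times> nat) multiset \<Rightarrow> (nat \<Rightarrow> qbar) set"

type_synonym omega_elem = "(nat \<Rightarrow> local_closure_elem) set"

definition local_closure :: "qbar set \<Rightarrow> (qbar \<Rightarrow> real) \<Rightarrow> local_closure_elem ring" where
  "local_closure K v = field.alg_closure (local_field K v)"

definition local_closure_abs :: "qbar set \<Rightarrow> (qbar \<Rightarrow> real) \<Rightarrow> local_closure_elem \<Rightarrow> real" where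
  "local_closure_abs K v = closure_abs (local_field K v) (local_abs K v)"

definition Omega :: "qbar set \<Rightarrow> (qbar \<Rightarrow> real) \<Rightarrow> omega_elem ring" where
  "Omega K v = completion (local_closure K v) (local_closure_abs K v)"

definition Omega_abs :: "qbar set \<Rightarrow> (qbar \<Rightarrow> real) \<Rightarrow> omega_elem \<Rightarrow> real" where
  "Omega_abs K v = completion_abs (local_closure_abs K v)"

definition Omega_emb :: "qbar set \<Rightarrow> (qbar \<Rightarrow> real) \<Rightarrow> qbar \<Rightarrow> omega_elem" where
  "Omega_emb K v x = completion_emb (local_closure K v) (local_closure_abs K v)
     (ring.indexed_const (local_field K v) (completion_emb (field_of K) v x))"

text \<open>The product over all places, as the unconditional limit of the finite partial products; almost
  all factors are 1 in the cases of interest.\<close>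

definition place_prod :: "qbar set \<Rightarrow> ((qbar \<Rightarrow> real) \<Rightarrow> real) \<Rightarrow> real" where
  "place_prod K f = Lim (finite_subsets_at_top (places K)) (prod f)"


section \<open>Exterior powers\<close>

text \<open>\<open>R\<^sup>N\<close> is the library's module of functions on \<open>{0..<N}\<close>, and its \<open>M\<close>-th exterior power is the
  free module on the basis vectors \<open>\<And>\<^bsub>i\<in>I\<^esub> e\<^sub>i\<close>, indexed by the \<open>M\<close>-element sets \<open>I\<close>, with the
  factors taken in increasing order of \<open>i\<close>.\<close>

definition ext_index :: "nat \<Rightarrow> nat \<Rightarrow> nat set set" where
  "ext_index M N = {I. I \<subseteq> {..<N} \<and> card I = M}"

abbreviation ext_power ::
  "('a, 'm) ring_scheme \<Rightarrow> nat \<Rightarrow> nat \<Rightarrow> ('a, nat set \<Rightarrow> 'a) module" where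
  "ext_power R M N \<equiv> ring.func_space R (ext_index M N)"

definition ring_det :: "('a, 'm) ring_scheme \<Rightarrow> nat \<Rightarrow> (nat \<Rightarrow> nat \<Rightarrow> 'a) \<Rightarrow> 'a" where
  "ring_det R M A = (\<Oplus>\<^bsub>R\<^esub>\<pi>\<in>{\<pi>. \<pi> permutes {..<M}}.
     (if evenperm \<pi> then \<one>\<^bsub>R\<^esub> else \<ominus>\<^bsub>R\<^esub> \<one>\<^bsub>R\<^esub>) \<otimes>\<^bsub>R\<^esub> (\<Otimes>\<^bsub>R\<^esub>i\<in>{..<M}. A i (\<pi> i)))"

text \<open>Coordinates of \<open>u\<^sub>0 \<and> \<dots> \<and> u\<^bsub>M-1\<^esub>\<close>: multilinear and alternating expansion gives at \<open>I\<close> the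
  minor of the matrix with rows \<open>u\<^sub>i\<close> on the columns in \<open>I\<close>.\<close>

definition wedge ::
  "('a, 'm) ring_scheme \<Rightarrow> nat \<Rightarrow> nat \<Rightarrow> (nat \<Rightarrow> nat \<Rightarrow> 'a) \<Rightarrow> nat set \<Rightarrow> 'a" where
  "wedge R M N u =
     (\<lambda>I\<in>ext_index M N. ring_det R M (\<lambda>i j. u i (sorted_list_of_set I ! j)))"

definition self_module :: "('a, 'm) ring_scheme \<Rightarrow> ('a, 'a) module" where
  "self_module R = \<lparr>carrier = carrier R, mult = mult R, one = \<one>\<^bsub>R\<^esub>, zero = \<zero>\<^bsub>R\<^esub>,
     add = add R, smult = mult R\<rparr>"

definition ext_dual ::
  "('a, 'm) ring_scheme \<Rightarrow> nat \<Rightarrow> nat \<Rightarrow> ((nat set \<Rightarrow> 'a) \<Rightarrow> 'a) set" where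
  "ext_dual R M N = module_hom R (ext_power R M N) (self_module R) \<inter>
     extensional (carrier (ext_power R M N))"

text \<open>\<open>A\<close> is the \<open>M \<times> N\<close> matrix of the linear map whose exterior power is taken; the argument of
  \<open>ring_det\<close> is the matrix whose \<open>i\<close>-th row is the image of \<open>u\<^sub>i\<close>.\<close>

definition ext_map ::
  "('a, 'm) ring_scheme \<Rightarrow> nat \<Rightarrow> nat \<Rightarrow> (nat \<Rightarrow> nat \<Rightarrow> 'a) \<Rightarrow> (nat set \<Rightarrow> 'a) \<Rightarrow> 'a" where
  "ext_map R M N A = (THE \<phi>. \<phi> \<in> ext_dual R M N \<and>
     (\<forall>u\<in>{..<M} \<rightarrow> carrier (ring.func_space R {..<N}). \<phi> (wedge R M N u) =
        ring_det R M (\<lambda>i k. \<Oplus>\<^bsub>R\<^esub>j\<in>{..<N}. A k j \<otimes>\<^bsub>R\<^esub> u i j)))"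

definition ext_height :: "('a \<Rightarrow> real) \<Rightarrow> nat \<Rightarrow> nat \<Rightarrow> (nat set \<Rightarrow> 'a) \<Rightarrow> real" where
  "ext_height a M N x = Max ((\<lambda>I. a (x I)) ` ext_index M N)"

definition dual_norm ::
  "('a, 'm) ring_scheme \<Rightarrow> ('a \<Rightarrow> real) \<Rightarrow> nat \<Rightarrow> nat \<Rightarrow> ((nat set \<Rightarrow> 'a) \<Rightarrow> 'a) \<Rightarrow> real" where
  "dual_norm R a M N \<phi> =
     Sup {a (\<phi> x) | x. x \<in> carrier (ext_power R M N) \<and> ext_height a M N x \<le> 1}"

definition local_U ::
  "('a, 'm) ring_scheme \<Rightarrow> ('a \<Rightarrow> real) \<Rightarrow> nat \<Rightarrow> nat \<Rightarrow>
     (nat set \<Rightarrow> 'a) \<Rightarrow> ((nat set \<Rightarrow> 'a) \<Rightarrow> 'a) \<Rightarrow> real" where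
  "local_U R a M N w \<psi> =
     Inf {dual_norm R a M N (\<lambda>x\<in>carrier (ext_power R M N). \<psi> x \<ominus>\<^bsub>R\<^esub> \<phi> x) | \<phi>.
            \<phi> \<in> ext_dual R M N \<and> \<phi> w = \<zero>\<^bsub>R\<^esub>}"


section \<open>The global quantities\<close>

text \<open>\<open>H(W)\<close> and \<open>U(W,\<Psi>)\<close>, computed from a basis \<open>w 0, \<dots>, w (M-1)\<close> of \<open>W\<close> and a number field \<open>K\<close>
  containing the entries of the \<open>w m\<close> and of the matrix of \<open>\<Psi>\<close>.\<close>

definition Omega_vec ::
  "qbar set \<Rightarrow> (qbar \<Rightarrow> real) \<Rightarrow> nat \<Rightarrow> qbar vec \<Rightarrow> nat \<Rightarrow> omega_elem" where
  "Omega_vec K v N x = (\<lambda>j\<in>{..<N}. Omega_emb K v (x $ j))"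

definition Omega_wedge ::
  "qbar set \<Rightarrow> (qbar \<Rightarrow> real) \<Rightarrow> nat \<Rightarrow> nat \<Rightarrow> (nat \<Rightarrow> qbar vec) \<Rightarrow> nat set \<Rightarrow> omega_elem" where
  "Omega_wedge K v M N w = wedge (Omega K v) M N (\<lambda>m. Omega_vec K v N (w m))"

definition Omega_ext_map ::
  "qbar set \<Rightarrow> (qbar \<Rightarrow> real) \<Rightarrow> nat \<Rightarrow> nat \<Rightarrow> (qbar vec \<Rightarrow> qbar vec) \<Rightarrow>
     (nat set \<Rightarrow> omega_elem) \<Rightarrow> omega_elem" where
  "Omega_ext_map K v M N \<Psi> =
     ext_map (Omega K v) M N (\<lambda>k j. Omega_emb K v (\<Psi> (unit_vec N j) $ k))"

definition height_H :: "qbar set \<Rightarrow> nat \<Rightarrow> nat \<Rightarrow> (nat \<Rightarrow> qbar vec) \<Rightarrow> real" where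
  "height_H K M N w =
     place_prod K (\<lambda>v. ext_height (Omega_abs K v) M N (Omega_wedge K v M N w))"

definition distance_U ::
  "qbar set \<Rightarrow> nat \<Rightarrow> nat \<Rightarrow> (nat \<Rightarrow> qbar vec) \<Rightarrow> (qbar vec \<Rightarrow> qbar vec) \<Rightarrow> real" where
  "distance_U K M N w \<Psi> =
     place_prod K (\<lambda>v. local_U (Omega K v) (Omega_abs K v) M N
       (Omega_wedge K v M N w) (Omega_ext_map K v M N \<Psi>))"

abbreviation qbar_space :: "nat \<Rightarrow> (qbar, qbar vec) module" where
  "qbar_space n \<equiv> module_vec TYPE(qbar) n"

end

theory Submission
  imports Defs "Jordan_Normal_Form.Char_Poly"
begin

text \<open>Over any valued field, the distance from a linear form \<open>\<psi>\<close> to the forms vanishing at \<open>w\<close> is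
  \<open>|\<psi>(w)|/H(w)\<close>. So at every place the local factors of \<open>H(W)\<close> and \<open>U(W,\<Psi>)\<close> multiply to \<open>|D|\<^sub>v\<close>, where
  \<open>D = det (\<Psi>(w\<^sub>1), \<dots>, \<Psi>(w\<^sub>M))\<close> lies in \<open>K\<close> and is nonzero because \<open>W\<close> meets the kernel trivially, and
  the theorem is the product formula for \<open>D\<close>.

  For the product formula, fix a usual absolute value of the rationals, extend it to an absolute value
  \<open>P\<close> of the algebraic numbers, and let \<open>\<beta>\<close> run over the conjugates of a primitive element \<open>\<alpha>\<close>. The places
  above it are the \<open>x \<mapsto> P(\<sigma>\<^sub>\<beta>(x))\<close>, and the local degree counts the \<open>\<beta>\<close> that give the same place:
  interpolation shows that it is at least this number, and weak approximation that the local degrees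
  sum to at most \<open>[K:\<rat>]\<close>. The product formula thus reduces to that of the norm of \<open>x\<close>, a rational
  number.\<close>

section \<open>Absolute values\<close>

text \<open>The description defining \<open>closure_abs\<close> denotes only if the absolute value
  of a complete field extends to the algebraic closure in exactly one way. Existence comes from
  Zorn's lemma for submultiplicative seminorms, an argument that treats archimedean and p-adic
  values alike; the same theorem supplies both the values on the closure of \<open>K\<^sub>v\<close>
  and the extension \<open>P\<close>. Uniqueness is the equivalence of norms on a finite-dimensional
  space over a complete field.

  The exponent \<open>d\<^sub>v/d\<close> is applied on \<open>K\<^sub>v\<close>, before this
  extension, and powers of an absolute value in general keep the triangle inequality only for
  exponents at most 1. Hence \<open>d\<^sub>v \<le> d\<close> must be known before anything can be
  said about \<open>Omega\<close>. Afterwards \<open>Omega\<close> enters only as a valued field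
  with a homomorphism from \<open>K\<close> under which \<open>x\<close> has the value
  \<open>v x powr (d\<^sub>v/d)\<close>.

  The two estimates for local degrees close up by counting: the fibres of the map from conjugates to
  places have \<open>d\<close> elements in all, so each local degree equals its fibre size, and a
  place outside the image would exceed the total.\<close>

locale valued_field = field R for R :: "('a, 'm) ring_scheme" (structure) +
  fixes a :: "'a \<Rightarrow> real"
  assumes abs_value: "abs_value R a"
begin

lemma abs_nonneg: "x \<in> carrier R \<Longrightarrow> 0 \<le> a x"
  and abs_eq_0: "x \<in> carrier R \<Longrightarrow> a x = 0 \<longleftrightarrow> x = \<zero>"
  and abs_mult: "x \<in> carrier R \<Longrightarrow> y \<in> carrier R \<Longrightarrow> a (x \<otimes> y) = a x * a y"
  and abs_add_le: "x \<in> carrier R \<Longrightarrow> y \<in> carrier R \<Longrightarrow> a (x \<oplus> y) \<le> a x + a y"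
  using abs_value unfolding abs_value_def by auto

lemma abs_zero [simp]: "a \<zero> = 0"
  using abs_eq_0 by auto

lemma abs_pos: "x \<in> carrier R \<Longrightarrow> x \<noteq> \<zero> \<Longrightarrow> 0 < a x"
  using abs_nonneg abs_eq_0 by (metis order_le_less)

lemma abs_one [simp]: "a \<one> = 1"
  using abs_mult[of \<one> \<one>] abs_pos[of \<one>] by auto

lemma abs_minus [simp]: "x \<in> carrier R \<Longrightarrow> a (\<ominus> x) = a x"
proof -
  assume x: "x \<in> carrier R"
  have "a (\<ominus> \<one>) * a (\<ominus> \<one>) = 1"
    using abs_mult[of "\<ominus> \<one>" "\<ominus> \<one>"] by (simp add: l_minus r_minus)
  hence "a (\<ominus> \<one>) = 1"
    using abs_nonneg[of "\<ominus> \<one>"] by (metis a_inv_closed abs_of_nonneg one_closed power2_eq_square real_sqrt_abs real_sqrt_one)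
  thus ?thesis using abs_mult[of "\<ominus> \<one>" x] x by (simp add: l_minus)
qed

lemma abs_diff_le: "x \<in> carrier R \<Longrightarrow> y \<in> carrier R \<Longrightarrow> a (x \<ominus> y) \<le> a x + a y"
  using abs_add_le[of x "\<ominus> y"] by (simp add: a_minus_def)

lemma abs_diff_commute: "x \<in> carrier R \<Longrightarrow> y \<in> carrier R \<Longrightarrow> a (x \<ominus> y) = a (y \<ominus> x)"
  using abs_minus[of "x \<ominus> y"] by (simp add: a_minus_def minus_add a_comm)

lemma abs_triangle:
  assumes "x \<in> carrier R" "y \<in> carrier R" "z \<in> carrier R"
  shows "a (x \<ominus> z) \<le> a (x \<ominus> y) + a (y \<ominus> z)"
proof -
  have "x \<ominus> z = (x \<ominus> y) \<oplus> (y \<ominus> z)"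
    using assms by (simp add: a_minus_def) (metis a_assoc a_inv_closed add.m_closed l_neg l_zero)
  thus ?thesis using abs_add_le[of "x \<ominus> y" "y \<ominus> z"] assms by simp
qed

lemma abs_diff_ge: "x \<in> carrier R \<Longrightarrow> y \<in> carrier R \<Longrightarrow> \<bar>a x - a y\<bar> \<le> a (x \<ominus> y)"
  using abs_triangle[of x y \<zero>] abs_triangle[of y x \<zero>] abs_diff_commute[of x y]
  by (auto simp: a_minus_def)

lemma abs_pow: "x \<in> carrier R \<Longrightarrow> a (x [^] (n::nat)) = a x ^ n"
  by (induction n) (auto simp: abs_mult)

lemma abs_inv: "x \<in> carrier R \<Longrightarrow> x \<noteq> \<zero> \<Longrightarrow> a (inv x) = inverse (a x)"
  using abs_mult[of x "inv x"] abs_pos[of x] by (simp add: field_Units divide_simps inverse_eq_divide mult.commute)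

end

section \<open>Convergence and Cauchy sequences in a valued field\<close>

definition abs_tendsto :: "('a, 'm) ring_scheme \<Rightarrow> ('a \<Rightarrow> real) \<Rightarrow> (nat \<Rightarrow> 'a) \<Rightarrow> 'a \<Rightarrow> bool" where
  "abs_tendsto R a s l \<longleftrightarrow> (\<lambda>n. a (s n \<ominus>\<^bsub>R\<^esub> l)) \<longlonglongrightarrow> 0"

text \<open>Completeness is relative to a subset, with the limit inside it: it will be applied to
  the closure of the rationals in \<open>K\<^sub>v\<close> and to the image of a complete field
  inside its algebraic closure.\<close>

definition abs_complete :: "('a, 'm) ring_scheme \<Rightarrow> ('a \<Rightarrow> real) \<Rightarrow> 'a set \<Rightarrow> bool" where
  "abs_complete R a F \<longleftrightarrow>
     (\<forall>s\<in>cauchy_seqs R a. (\<forall>n. s n \<in> F) \<longrightarrow> (\<exists>l\<in>F. abs_tendsto R a s l))"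

context valued_field
begin

lemma cauchy_seqsD:
  "s \<in> cauchy_seqs R a \<Longrightarrow> s n \<in> carrier R"
  "s \<in> cauchy_seqs R a \<Longrightarrow> 0 < e \<Longrightarrow> \<exists>k. \<forall>m\<ge>k. \<forall>n\<ge>k. a (s m \<ominus> s n) < e"
  unfolding cauchy_seqs_def by auto

lemma null_seqsD:
  "s \<in> null_seqs R a \<Longrightarrow> s n \<in> carrier R"
  "s \<in> null_seqs R a \<Longrightarrow> (\<lambda>n. a (s n)) \<longlonglongrightarrow> 0"
  unfolding null_seqs_def by auto

lemma abs_tendsto_cauchy:
  assumes "\<And>n. s n \<in> carrier R" "l \<in> carrier R" "abs_tendsto R a s l"
  shows "s \<in> cauchy_seqs R a"
  unfolding cauchy_seqs_def
proof (safe)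
  fix e :: real assume e: "e > 0"
  have "\<forall>\<^sub>F n in sequentially. a (s n \<ominus> l) < e/2"
    using assms(3) e unfolding abs_tendsto_def by (intro order_tendstoD(2)) auto
  then obtain k where k: "\<And>n. n \<ge> k \<Longrightarrow> a (s n \<ominus> l) < e/2" unfolding eventually_sequentially by auto
  have "a (s m \<ominus> s n) < e" if "m \<ge> k" "n \<ge> k" for m n
    using abs_triangle[of "s m" l "s n"] k[OF that(1)] k[OF that(2)] abs_diff_commute[of l "s n"] assms
    by simp
  thus "\<exists>k. \<forall>m\<ge>k. \<forall>n\<ge>k. a (s m \<ominus> s n) < e" by blast
qed (use assms in auto)

lemma cauchy_abs_convergent:
  assumes "s \<in> cauchy_seqs R a"
  shows "convergent (\<lambda>n. a (s n))"
proof -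
  have "Cauchy (\<lambda>n. a (s n))"
    unfolding Cauchy_altdef2 dist_real_def
  proof safe
    fix e :: real assume "e > 0"
    then obtain k where k: "\<And>m n. m \<ge> k \<Longrightarrow> n \<ge> k \<Longrightarrow> a (s m \<ominus> s n) < e"
      using cauchy_seqsD(2)[OF assms] by blast
    have "\<bar>a (s n) - a (s k)\<bar> < e" if "n \<ge> k" for n
      using abs_diff_ge[of "s n" "s k"] k[OF that, of k] cauchy_seqsD(1)[OF assms]
      by (meson order_refl order_le_less_trans)
    thus "\<exists>N. \<forall>n\<ge>N. \<bar>a (s n) - a (s N)\<bar> < e" by blast
  qed
  thus ?thesis by (simp add: Cauchy_convergent_iff)
qed

lemma cauchy_bounded:
  assumes "s \<in> cauchy_seqs R a"
  shows "\<exists>B>0. \<forall>n. a (s n) \<le> B"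
proof -
  have "Bseq (\<lambda>n. a (s n))" using cauchy_abs_convergent[OF assms] convergent_imp_Bseq by blast
  then obtain B where "B > 0" "\<And>n. norm (a (s n)) \<le> B" unfolding Bseq_def by auto
  thus ?thesis by (intro exI[of _ B]) (auto simp: abs_le_iff)
qed

lemma tendsto_zero_sandwich:
  fixes f g :: "nat \<Rightarrow> real"
  assumes "\<And>n. 0 \<le> f n" "\<And>n. f n \<le> g n" "g \<longlonglongrightarrow> 0"
  shows "f \<longlonglongrightarrow> 0"
  by (rule tendsto_sandwich[of "\<lambda>_. 0" f _ g]) (use assms in auto)

lemma abs_tendsto_add:
  assumes "\<And>n. s n \<in> carrier R" "\<And>n. t n \<in> carrier R" "l \<in> carrier R" "k \<in> carrier R"
    "abs_tendsto R a s l" "abs_tendsto R a t k"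
  shows "abs_tendsto R a (\<lambda>n. s n \<oplus> t n) (l \<oplus> k)"
  unfolding abs_tendsto_def
proof (rule tendsto_zero_sandwich)
  fix n
  have "(s n \<oplus> t n) \<ominus> (l \<oplus> k) = (s n \<ominus> l) \<oplus> (t n \<ominus> k)"
    using assms(1-4) by (simp add: a_minus_def minus_add a_ac)
  thus "a ((s n \<oplus> t n) \<ominus> (l \<oplus> k)) \<le> a (s n \<ominus> l) + a (t n \<ominus> k)"
    using assms(1-4) abs_add_le by simp
qed (use assms in \<open>auto intro!: abs_nonneg tendsto_eq_intros simp: abs_tendsto_def\<close>)

lemma abs_tendsto_mult:
  assumes "\<And>n. s n \<in> carrier R" "\<And>n. t n \<in> carrier R" "l \<in> carrier R" "k \<in> carrier R"
    "abs_tendsto R a s l" "abs_tendsto R a t k"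
  shows "abs_tendsto R a (\<lambda>n. s n \<otimes> t n) (l \<otimes> k)"
proof -
  obtain B where B: "B > 0" "\<And>n. a (s n) \<le> B"
    using cauchy_bounded[OF abs_tendsto_cauchy[OF assms(1,3,5)]] by blast
  show ?thesis unfolding abs_tendsto_def
  proof (rule tendsto_zero_sandwich)
    fix n
    have "(s n \<otimes> t n) \<ominus> (l \<otimes> k) = (s n \<otimes> (t n \<ominus> k)) \<oplus> (s n \<ominus> l) \<otimes> k"
    proof -
      have "(s n \<otimes> (t n \<ominus> k)) \<oplus> (s n \<ominus> l) \<otimes> k
        = s n \<otimes> t n \<oplus> (\<ominus> (s n \<otimes> k) \<oplus> s n \<otimes> k) \<oplus> \<ominus> (l \<otimes> k)"
        using assms(1-4) by (simp add: a_minus_def r_distr l_distr l_minus r_minus a_assoc)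
      thus ?thesis using assms(1-4) by (simp add: a_minus_def l_neg)
    qed
    hence "a ((s n \<otimes> t n) \<ominus> (l \<otimes> k)) \<le> a (s n) * a (t n \<ominus> k) + a (s n \<ominus> l) * a k"
      using assms(1-4) abs_add_le[of "s n \<otimes> (t n \<ominus> k)" "(s n \<ominus> l) \<otimes> k"] by (simp add: abs_mult)
    also have "\<dots> \<le> B * a (t n \<ominus> k) + a (s n \<ominus> l) * a k"
      using B abs_nonneg assms(1-4) by (intro add_mono mult_right_mono) auto
    finally show "a ((s n \<otimes> t n) \<ominus> (l \<otimes> k)) \<le> B * a (t n \<ominus> k) + a (s n \<ominus> l) * a k" .
  qed (use assms in \<open>auto intro!: abs_nonneg tendsto_eq_intros simp: abs_tendsto_def\<close>)
qed

lemma abs_tendsto_minus: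
  assumes "\<And>n. s n \<in> carrier R" "l \<in> carrier R" "abs_tendsto R a s l"
  shows "abs_tendsto R a (\<lambda>n. \<ominus> s n) (\<ominus> l)"
proof -
  have "\<ominus> s n \<ominus> \<ominus> l = \<ominus> (s n \<ominus> l)" for n
    using assms(1)[of n] assms(2) by (simp add: a_minus_def minus_add)
  thus ?thesis using assms unfolding abs_tendsto_def by simp
qed

lemma abs_tendsto_abs:
  assumes "\<And>n. s n \<in> carrier R" "l \<in> carrier R" "abs_tendsto R a s l"
  shows "(\<lambda>n. a (s n)) \<longlonglongrightarrow> a l"
proof -
  have "(\<lambda>n. a (s n) - a l) \<longlonglongrightarrow> 0"
    by (rule tendsto_rabs_zero_cancel, rule tendsto_zero_sandwich[OF _ _ assms(3)[unfolded abs_tendsto_def]])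
      (use assms abs_diff_ge in auto)
  thus ?thesis by (rule LIM_zero_cancel)
qed

lemma abs_tendsto_const: "l \<in> carrier R \<Longrightarrow> abs_tendsto R a (\<lambda>n. l) l"
  unfolding abs_tendsto_def by (simp add: a_minus_def r_neg)

lemma abs_tendsto_unique:
  assumes "\<And>n. s n \<in> carrier R" "l \<in> carrier R" "k \<in> carrier R"
    "abs_tendsto R a s l" "abs_tendsto R a s k"
  shows "l = k"
proof -
  have "(\<lambda>n. a (s n \<ominus> l) + a (s n \<ominus> k)) \<longlonglongrightarrow> 0"
    using assms(4,5) unfolding abs_tendsto_def by (auto intro!: tendsto_eq_intros)
  moreover have "a (l \<ominus> k) \<le> a (s n \<ominus> l) + a (s n \<ominus> k)" for n
    using abs_triangle[of l "s n" k] abs_diff_commute[of l "s n"] assms by simp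
  ultimately have "a (l \<ominus> k) \<le> 0"
    by (meson LIMSEQ_le_const)
  hence "l \<ominus> k = \<zero>" using abs_nonneg[of "l \<ominus> k"] abs_eq_0[of "l \<ominus> k"] assms by auto
  thus ?thesis using assms r_right_minus_eq by blast
qed

lemma abs_tendsto_inv:
  assumes "\<And>n. s n \<in> carrier R" "\<And>n. s n \<noteq> \<zero>" "l \<in> carrier R" "l \<noteq> \<zero>" "abs_tendsto R a s l"
  shows "abs_tendsto R a (\<lambda>n. inv (s n)) (inv l)"
proof -
  have *: "inv (s n) \<ominus> inv l = \<ominus> (inv (s n) \<otimes> inv l \<otimes> (s n \<ominus> l))" for n
  proof -
    have U: "s n \<in> Units R" "l \<in> Units R" using assms field_Units by auto
    have C: "inv (s n) \<in> carrier R" "inv l \<in> carrier R" "s n \<in> carrier R" "l \<in> carrier R" using U by auto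
    have "inv (s n) \<otimes> inv l \<otimes> (s n \<ominus> l) = inv (s n) \<otimes> inv l \<otimes> s n \<ominus> inv (s n) \<otimes> inv l \<otimes> l"
      using C by (simp add: a_minus_def r_distr r_minus)
    also have "inv (s n) \<otimes> inv l \<otimes> s n = inv (s n) \<otimes> s n \<otimes> inv l" using C by (simp add: m_ac)
    also have "inv (s n) \<otimes> inv l \<otimes> l = inv (s n) \<otimes> (inv l \<otimes> l)" using C by (simp add: m_assoc)
    also have "inv (s n) \<otimes> s n \<otimes> inv l \<ominus> inv (s n) \<otimes> (inv l \<otimes> l) = inv l \<ominus> inv (s n)" using U by simp
    finally show ?thesis using U by (simp add: a_minus_def minus_add a_comm)
  qed
  have "(\<lambda>n. inverse (a (s n)) * inverse (a l) * a (s n \<ominus> l)) \<longlonglongrightarrow> inverse (a l) * inverse (a l) * 0"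
    using abs_tendsto_abs[OF assms(1,3,5)] assms(5) abs_pos[OF assms(3,4)] unfolding abs_tendsto_def
    by (intro tendsto_intros) auto
  moreover have "a (inv (s n) \<ominus> inv l) = inverse (a (s n)) * inverse (a l) * a (s n \<ominus> l)" for n
    unfolding * using assms(1)[of n] assms(2)[of n] assms(3,4) by (simp add: abs_mult abs_inv field_Units)
  ultimately show ?thesis unfolding abs_tendsto_def by simp
qed

end

section \<open>The completion of a valued field\<close>

context valued_field
begin

lemma cauchy_const: "x \<in> carrier R \<Longrightarrow> (\<lambda>n. x) \<in> cauchy_seqs R a"
  by (auto simp: cauchy_seqs_def a_minus_def r_neg)

lemma cauchy_add:
  assumes "s \<in> cauchy_seqs R a" "t \<in> cauchy_seqs R a"
  shows "(\<lambda>n. s n \<oplus> t n) \<in> cauchy_seqs R a"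
  unfolding cauchy_seqs_def
proof safe
  fix e :: real assume e: "e > 0"
  obtain k1 where k1: "\<And>m n. m \<ge> k1 \<Longrightarrow> n \<ge> k1 \<Longrightarrow> a (s m \<ominus> s n) < e/2"
    using cauchy_seqsD(2)[OF assms(1), of "e/2"] e by auto
  obtain k2 where k2: "\<And>m n. m \<ge> k2 \<Longrightarrow> n \<ge> k2 \<Longrightarrow> a (t m \<ominus> t n) < e/2"
    using cauchy_seqsD(2)[OF assms(2), of "e/2"] e by auto
  have "a ((s m \<oplus> t m) \<ominus> (s n \<oplus> t n)) < e" if "m \<ge> max k1 k2" "n \<ge> max k1 k2" for m n
  proof -
    have C: "s m \<in> carrier R" "s n \<in> carrier R" "t m \<in> carrier R" "t n \<in> carrier R"
      using cauchy_seqsD assms by auto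
    have "(s m \<oplus> t m) \<ominus> (s n \<oplus> t n) = (s m \<ominus> s n) \<oplus> (t m \<ominus> t n)"
      using C by (simp add: a_minus_def minus_add a_ac)
    thus ?thesis using abs_add_le[of "s m \<ominus> s n" "t m \<ominus> t n"] C k1[of m n] k2[of m n] that by simp
  qed
  thus "\<exists>k. \<forall>m\<ge>k. \<forall>n\<ge>k. a ((s m \<oplus> t m) \<ominus> (s n \<oplus> t n)) < e" by blast
qed (use assms cauchy_seqsD in auto)

lemma cauchy_mult:
  assumes "s \<in> cauchy_seqs R a" "t \<in> cauchy_seqs R a"
  shows "(\<lambda>n. s n \<otimes> t n) \<in> cauchy_seqs R a"
  unfolding cauchy_seqs_def
proof safe
  fix e :: real assume e: "e > 0"
  obtain B1 where B1: "B1 > 0" "\<And>n. a (s n) \<le> B1" using cauchy_bounded[OF assms(1)] by blast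
  obtain B2 where B2: "B2 > 0" "\<And>n. a (t n) \<le> B2" using cauchy_bounded[OF assms(2)] by blast
  obtain k1 where k1: "\<And>m n. m \<ge> k1 \<Longrightarrow> n \<ge> k1 \<Longrightarrow> a (s m \<ominus> s n) < e/2/B2"
    using cauchy_seqsD(2)[OF assms(1), of "e/2/B2"] e B2 by (auto)
  obtain k2 where k2: "\<And>m n. m \<ge> k2 \<Longrightarrow> n \<ge> k2 \<Longrightarrow> a (t m \<ominus> t n) < e/2/B1"
    using cauchy_seqsD(2)[OF assms(2), of "e/2/B1"] e B1 by auto
  have "a ((s m \<otimes> t m) \<ominus> (s n \<otimes> t n)) < e" if "m \<ge> max k1 k2" "n \<ge> max k1 k2" for m n
  proof -
    have C: "s m \<in> carrier R" "s n \<in> carrier R" "t m \<in> carrier R" "t n \<in> carrier R"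
      using cauchy_seqsD assms by auto
    have "s m \<otimes> (t m \<ominus> t n) \<oplus> (s m \<ominus> s n) \<otimes> t n
      = s m \<otimes> t m \<oplus> (\<ominus> (s m \<otimes> t n) \<oplus> s m \<otimes> t n) \<oplus> \<ominus> (s n \<otimes> t n)"
      using C by (simp add: a_minus_def r_distr l_distr l_minus r_minus a_assoc)
    hence "(s m \<otimes> t m) \<ominus> (s n \<otimes> t n) = s m \<otimes> (t m \<ominus> t n) \<oplus> (s m \<ominus> s n) \<otimes> t n"
      using C by (simp add: a_minus_def l_neg)
    hence "a ((s m \<otimes> t m) \<ominus> (s n \<otimes> t n)) \<le> a (s m) * a (t m \<ominus> t n) + a (s m \<ominus> s n) * a (t n)"
      using abs_add_le[of "s m \<otimes> (t m \<ominus> t n)" "(s m \<ominus> s n) \<otimes> t n"] C by (simp add: abs_mult)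
    also have "\<dots> \<le> B1 * a (t m \<ominus> t n) + a (s m \<ominus> s n) * B2"
      using B1 B2 C abs_nonneg by (intro add_mono mult_right_mono mult_left_mono) auto
    also have "\<dots> < B1 * (e/2/B1) + (e/2/B2) * B2"
      using B1 B2 k1[of m n] k2[of m n] that
      by (intro add_strict_mono mult_strict_left_mono mult_strict_right_mono) auto
    also have "\<dots> = e" using B1 B2 by simp
    finally show ?thesis .
  qed
  thus "\<exists>k. \<forall>m\<ge>k. \<forall>n\<ge>k. a ((s m \<otimes> t m) \<ominus> (s n \<otimes> t n)) < e" by blast
qed (use assms cauchy_seqsD in auto)

lemma cauchy_minus: "s \<in> cauchy_seqs R a \<Longrightarrow> (\<lambda>n. \<ominus> s n) \<in> cauchy_seqs R a"
  using cauchy_mult[OF cauchy_const[of "\<ominus> \<one>"], of s] cauchy_seqsD(1)[of s] by (simp add: l_minus)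

lemma null_imp_cauchy: "s \<in> null_seqs R a \<Longrightarrow> s \<in> cauchy_seqs R a"
  using abs_tendsto_cauchy[of s \<zero>] null_seqsD[of s] by (simp add: abs_tendsto_def a_minus_def)

lemma cauchy_ring_simps:
  "carrier (cauchy_ring R a) = cauchy_seqs R a"
  "s \<otimes>\<^bsub>cauchy_ring R a\<^esub> t = (\<lambda>n. s n \<otimes> t n)"
  "s \<oplus>\<^bsub>cauchy_ring R a\<^esub> t = (\<lambda>n. s n \<oplus> t n)"
  "\<one>\<^bsub>cauchy_ring R a\<^esub> = (\<lambda>n. \<one>)"
  "\<zero>\<^bsub>cauchy_ring R a\<^esub> = (\<lambda>n. \<zero>)"
  by (simp_all add: cauchy_ring_def)

lemma cauchy_ring_cring: "cring (cauchy_ring R a)"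
proof (intro cringI abelian_groupI comm_monoidI, unfold cauchy_ring_simps)
  fix s assume "s \<in> cauchy_seqs R a"
  thus "\<exists>t\<in>cauchy_seqs R a. (\<lambda>n. t n \<oplus> s n) = (\<lambda>n. \<zero>)"
    using cauchy_minus cauchy_seqsD(1) by (intro bexI[of _ "\<lambda>n. \<ominus> s n"]) (auto simp: l_neg)
qed (auto intro!: cauchy_add cauchy_mult cauchy_const
  simp: cauchy_seqsD(1) a_ac m_ac l_distr r_distr)

lemma cauchy_ring_minus:
  assumes "s \<in> cauchy_seqs R a"
  shows "\<ominus>\<^bsub>cauchy_ring R a\<^esub> s = (\<lambda>n. \<ominus> s n)"
proof -
  interpret CR: cring "cauchy_ring R a" by (rule cauchy_ring_cring)
  have "(\<lambda>n. \<ominus> s n) \<oplus>\<^bsub>cauchy_ring R a\<^esub> s = \<zero>\<^bsub>cauchy_ring R a\<^esub>"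
    using assms cauchy_seqsD(1) by (auto simp: cauchy_ring_simps l_neg)
  thus ?thesis using assms cauchy_minus
    by (intro CR.minus_equality) (auto simp: cauchy_ring_simps)
qed

lemma null_ideal: "ideal (null_seqs R a) (cauchy_ring R a)"
proof -
  interpret CR: cring "cauchy_ring R a" by (rule cauchy_ring_cring)
  have smult: "(\<lambda>n. t n \<otimes> s n) \<in> null_seqs R a"
    if s: "s \<in> null_seqs R a" and t: "t \<in> cauchy_seqs R a" for s t
  proof -
    obtain B where B: "B > 0" "\<And>n. a (t n) \<le> B" using cauchy_bounded[OF t] by blast
    have C: "s n \<in> carrier R" "t n \<in> carrier R" for n using null_seqsD s cauchy_seqsD t by auto
    have "(\<lambda>n. a (t n \<otimes> s n)) \<longlonglongrightarrow> 0"
      by (rule tendsto_zero_sandwich[of _ "\<lambda>n. B * a (s n)"])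
        (use B C abs_nonneg null_seqsD(2)[OF s] in
          \<open>auto simp: abs_mult intro!: mult_right_mono tendsto_mult_right_zero\<close>)
    thus ?thesis using C by (simp add: null_seqs_def)
  qed
  show ?thesis
  proof (rule idealI)
    show "subgroup (null_seqs R a) (add_monoid (cauchy_ring R a))"
    proof (rule CR.add.subgroupI)
      show "null_seqs R a \<subseteq> carrier (cauchy_ring R a)"
        using null_imp_cauchy by (auto simp: cauchy_ring_simps)
      show "null_seqs R a \<noteq> {}"
        by (auto simp: null_seqs_def intro!: exI[of _ "\<lambda>n. \<zero>"])
      fix s assume s: "s \<in> null_seqs R a"
      show "\<ominus>\<^bsub>cauchy_ring R a\<^esub> s \<in> null_seqs R a"
        using s by (subst cauchy_ring_minus) (auto simp: null_imp_cauchy null_seqs_def)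
      fix t assume t: "t \<in> null_seqs R a"
      have "(\<lambda>n. a (s n \<oplus> t n)) \<longlonglongrightarrow> 0"
        by (rule tendsto_zero_sandwich[of _ "\<lambda>n. a (s n) + a (t n)"])
          (use s t abs_nonneg abs_add_le in \<open>auto simp: null_seqs_def intro!: tendsto_eq_intros\<close>)
      thus "s \<oplus>\<^bsub>cauchy_ring R a\<^esub> t \<in> null_seqs R a"
        using s t by (auto simp: cauchy_ring_simps null_seqs_def)
    qed
  next
    fix s t assume "s \<in> null_seqs R a" "t \<in> carrier (cauchy_ring R a)"
    hence *: "(\<lambda>n. t n \<otimes> s n) \<in> null_seqs R a" and "(\<lambda>n. s n \<otimes> t n) = (\<lambda>n. t n \<otimes> s n)"
      using smult cauchy_seqsD(1) null_seqsD(1) by (auto simp: cauchy_ring_simps m_comm)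
    thus "t \<otimes>\<^bsub>cauchy_ring R a\<^esub> s \<in> null_seqs R a" "s \<otimes>\<^bsub>cauchy_ring R a\<^esub> t \<in> null_seqs R a"
      by (simp_all add: cauchy_ring_simps)
  qed (rule CR.ring_axioms)
qed

lemma null_abelian_subgroup: "abelian_subgroup (null_seqs R a) (cauchy_ring R a)"
  by (intro abelian_subgroupI3 ideal.axioms(1)[OF null_ideal] cring.axioms(1)[OF cauchy_ring_cring]
    ring.is_abelian_group)

abbreviation lim_class :: "(nat \<Rightarrow> 'a) \<Rightarrow> (nat \<Rightarrow> 'a) set" where
  "lim_class s \<equiv> null_seqs R a +>\<^bsub>cauchy_ring R a\<^esub> s"

lemma lim_class_hom: "lim_class \<in> Ring.ring_hom (cauchy_ring R a) (completion R a)"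
  unfolding completion_def by (rule ideal.rcos_ring_hom[OF null_ideal])

lemma completion_cring: "cring (completion R a)"
  unfolding completion_def by (rule ideal.quotient_is_cring[OF null_ideal cauchy_ring_cring])

lemma lim_class_closed: "s \<in> cauchy_seqs R a \<Longrightarrow> lim_class s \<in> carrier (completion R a)"
  using Ring.ring_hom_closed[OF lim_class_hom] by (simp add: cauchy_ring_simps)

lemma mem_lim_class_iff:
  assumes "s \<in> cauchy_seqs R a"
  shows "t \<in> lim_class s \<longleftrightarrow> t \<in> cauchy_seqs R a \<and> (\<lambda>n. t n \<ominus> s n) \<in> null_seqs R a"
proof
  assume "t \<in> lim_class s"
  then obtain z where z: "z \<in> null_seqs R a" "t = (\<lambda>n. z n \<oplus> s n)"
    by (auto simp: a_r_coset_def' cauchy_ring_simps)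
  have "t n \<ominus> s n = z n" for n
    using null_seqsD(1)[OF z(1), of n] cauchy_seqsD(1)[OF assms, of n]
    by (simp add: z(2) a_minus_def a_assoc r_neg)
  thus "t \<in> cauchy_seqs R a \<and> (\<lambda>n. t n \<ominus> s n) \<in> null_seqs R a"
    using z assms null_imp_cauchy cauchy_add by auto
next
  assume *: "t \<in> cauchy_seqs R a \<and> (\<lambda>n. t n \<ominus> s n) \<in> null_seqs R a"
  have "t = (\<lambda>n. (t n \<ominus> s n) \<oplus> s n)"
    using * cauchy_seqsD(1)[OF assms] cauchy_seqsD(1)[of t] by (auto simp: a_minus_def a_assoc l_neg)
  thus "t \<in> lim_class s" using * by (auto simp: a_r_coset_def' cauchy_ring_simps)
qed

lemma self_mem_lim_class: "s \<in> cauchy_seqs R a \<Longrightarrow> s \<in> lim_class s"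
  using cauchy_seqsD(1)[of s] by (subst mem_lim_class_iff) (auto simp: null_seqs_def a_minus_def r_neg)

lemma lim_class_eq:
  assumes "s \<in> cauchy_seqs R a" "t \<in> lim_class s"
  shows "lim_class t = lim_class s"
  using abelian_subgroup.a_repr_independence'[OF _ assms(2)] null_abelian_subgroup assms(1) by (simp add: cauchy_ring_simps)

lemma completion_rep:
  assumes "Z \<in> carrier (completion R a)"
  obtains s where "s \<in> cauchy_seqs R a" "Z = lim_class s"
  using assms unfolding completion_def FactRing_def A_RCOSETS_def' by (auto simp: cauchy_ring_simps)

lemma mem_completion:
  assumes "Z \<in> carrier (completion R a)" "s \<in> Z"
  shows "s \<in> cauchy_seqs R a" "Z = lim_class s"
proof -
  obtain t where t: "t \<in> cauchy_seqs R a" "Z = lim_class t" by (rule completion_rep[OF assms(1)])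
  have st: "s \<in> lim_class t" using assms(2) t(2) by simp
  show "s \<in> cauchy_seqs R a" using st mem_lim_class_iff[OF t(1)] by simp
  show "Z = lim_class s" using lim_class_eq[OF t(1) st] t(2) by simp
qed

lemma completion_abs_lim_class:
  assumes "s \<in> cauchy_seqs R a"
  shows "(\<lambda>n. a (s n)) \<longlonglongrightarrow> completion_abs a (lim_class s)"
proof -
  obtain r where r: "(\<lambda>n. a (s n)) \<longlonglongrightarrow> r"
    using cauchy_abs_convergent[OF assms] unfolding convergent_def by blast
  have all: "(\<lambda>n. a (t n)) \<longlonglongrightarrow> r" if t: "t \<in> lim_class s" for t
  proof -
    have *: "t \<in> cauchy_seqs R a" "(\<lambda>n. a (t n \<ominus> s n)) \<longlonglongrightarrow> 0"
      using t mem_lim_class_iff[OF assms] null_seqsD by auto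
    have "(\<lambda>n. a (t n) - a (s n)) \<longlonglongrightarrow> 0"
      by (rule tendsto_rabs_zero_cancel, rule tendsto_zero_sandwich[OF _ _ *(2)])
        (use cauchy_seqsD(1) assms * abs_diff_ge in auto)
    thus ?thesis using tendsto_add[OF _ r] by fastforce
  qed
  have "completion_abs a (lim_class s) = r"
    unfolding completion_abs_def
    using all self_mem_lim_class[OF assms] by (intro the_equality) (auto intro: LIMSEQ_unique)
  thus ?thesis using r by simp
qed

lemma completion_abs_eqI:
  "s \<in> cauchy_seqs R a \<Longrightarrow> (\<lambda>n. a (s n)) \<longlonglongrightarrow> r \<Longrightarrow> completion_abs a (lim_class s) = r"
  using completion_abs_lim_class LIMSEQ_unique by blast

lemma lim_class_simps:
  assumes "s \<in> cauchy_seqs R a" "t \<in> cauchy_seqs R a"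
  shows "lim_class s \<oplus>\<^bsub>completion R a\<^esub> lim_class t = lim_class (\<lambda>n. s n \<oplus> t n)"
    "lim_class s \<otimes>\<^bsub>completion R a\<^esub> lim_class t = lim_class (\<lambda>n. s n \<otimes> t n)"
    "lim_class s \<ominus>\<^bsub>completion R a\<^esub> lim_class t = lim_class (\<lambda>n. s n \<ominus> t n)"
proof -
  interpret C: cring "completion R a" by (rule completion_cring)
  interpret CR: cring "cauchy_ring R a" by (rule cauchy_ring_cring)
  interpret h: ring_hom_ring "cauchy_ring R a" "completion R a" lim_class
    by (rule ring_hom_ringI2[OF CR.ring_axioms C.ring_axioms lim_class_hom])
  show 1: "lim_class s \<oplus>\<^bsub>completion R a\<^esub> lim_class t = lim_class (\<lambda>n. s n \<oplus> t n)"
    "lim_class s \<otimes>\<^bsub>completion R a\<^esub> lim_class t = lim_class (\<lambda>n. s n \<otimes> t n)"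
    using h.hom_add[of s t] h.hom_mult[of s t] assms by (simp_all add: cauchy_ring_simps)
  show "lim_class s \<ominus>\<^bsub>completion R a\<^esub> lim_class t = lim_class (\<lambda>n. s n \<ominus> t n)"
    using h.hom_add[of s "\<ominus>\<^bsub>cauchy_ring R a\<^esub> t"] h.hom_a_inv[of t] assms cauchy_minus
    by (simp add: cauchy_ring_simps cauchy_ring_minus a_minus_def)
qed

lemma lim_class_zero: "\<zero>\<^bsub>completion R a\<^esub> = lim_class (\<lambda>n. \<zero>)"
proof -
  interpret C: cring "completion R a" by (rule completion_cring)
  interpret CR: cring "cauchy_ring R a" by (rule cauchy_ring_cring)
  show ?thesis using Ring.ring_hom_zero[OF lim_class_hom CR.ring_axioms C.ring_axioms]
    by (simp add: cauchy_ring_simps)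
qed

lemma lim_class_one: "\<one>\<^bsub>completion R a\<^esub> = lim_class (\<lambda>n. \<one>)"
  using Ring.ring_hom_one[OF lim_class_hom] by (simp add: cauchy_ring_simps)

lemma completion_abs_eq_0_iff:
  assumes "s \<in> cauchy_seqs R a"
  shows "completion_abs a (lim_class s) = 0 \<longleftrightarrow> lim_class s = \<zero>\<^bsub>completion R a\<^esub>"
proof
  assume "completion_abs a (lim_class s) = 0"
  hence "(\<lambda>n. a (s n \<ominus> \<zero>)) \<longlonglongrightarrow> 0"
    using completion_abs_lim_class[OF assms] cauchy_seqsD(1)[OF assms] by (simp add: a_minus_def)
  hence "s \<in> lim_class (\<lambda>n. \<zero>)"
    using assms cauchy_seqsD(1) by (subst mem_lim_class_iff) (auto intro: cauchy_const simp: null_seqs_def)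
  thus "lim_class s = \<zero>\<^bsub>completion R a\<^esub>"
    using lim_class_eq[OF cauchy_const[of \<zero>]] lim_class_zero by simp
next
  assume "lim_class s = \<zero>\<^bsub>completion R a\<^esub>"
  moreover have "completion_abs a (lim_class (\<lambda>n. \<zero>)) = 0"
    by (rule completion_abs_eqI) (auto intro: cauchy_const)
  ultimately show "completion_abs a (lim_class s) = 0" unfolding lim_class_zero by simp
qed

text \<open>A positive limit of the absolute values keeps the sequence away from zero from some
  index on. The value \<open>\<one>\<close> at the finitely many possible zeros only keeps the terms
  defined.\<close>

lemma cauchy_inv:
  assumes s: "s \<in> cauchy_seqs R a" "(\<lambda>n. a (s n)) \<longlonglongrightarrow> r" "r > 0"
  defines "t \<equiv> (\<lambda>n. if s n = \<zero> then \<one> else inv (s n))"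
  shows "t \<in> cauchy_seqs R a" "\<exists>k. \<forall>n\<ge>k. s n \<otimes> t n = \<one>"
proof -
  have "\<forall>\<^sub>F n in sequentially. r/2 < a (s n)"
    using order_tendstoD(1)[OF s(2), of "r/2"] s(3) by simp
  then obtain k where k: "\<And>n. n \<ge> k \<Longrightarrow> r/2 < a (s n)" unfolding eventually_sequentially by auto
  have nz: "s n \<noteq> \<zero>" if "n \<ge> k" for n using k[OF that] s(3) by auto
  have C: "s n \<in> carrier R" for n by (rule cauchy_seqsD(1)[OF s(1)])
  show "\<exists>k. \<forall>n\<ge>k. s n \<otimes> t n = \<one>"
    using nz C by (intro exI[of _ k]) (auto simp: t_def field_Units)
  have tC: "t n \<in> carrier R" for n using C by (auto simp: t_def field_Units)
  show "t \<in> cauchy_seqs R a"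
    unfolding cauchy_seqs_def
  proof safe
    fix e :: real assume e: "e > 0"
    \<comment> \<open>The distance of two inverses is \<open>a (s n \<ominus> s m)\<close> divided
      by \<open>a (s m) * a (s n)\<close>, and both factors exceed \<open>r/2\<close>.\<close>
    then obtain l where l: "\<And>m n. m \<ge> l \<Longrightarrow> n \<ge> l \<Longrightarrow> a (s m \<ominus> s n) < e * (r/2) * (r/2)"
      using cauchy_seqsD(2)[OF s(1), of "e * (r/2) * (r/2)"] s(3) by auto
    have "a (t m \<ominus> t n) < e" if "m \<ge> max k l" "n \<ge> max k l" for m n
    proof -
      have U: "s m \<otimes> t m = \<one>" "s n \<otimes> t n = \<one>" using nz that C by (auto simp: t_def field_Units)
      have "t m \<otimes> t n \<otimes> (s n \<ominus> s m) = (s n \<otimes> t n) \<otimes> t m \<ominus> (s m \<otimes> t m) \<otimes> t n"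
        using C tC by (simp add: a_minus_def r_distr r_minus m_ac)
      also have "\<dots> = t m \<ominus> t n" using U tC by simp
      finally have eq: "t m \<ominus> t n = t m \<otimes> t n \<otimes> (s n \<ominus> s m)" ..
      have "a (s m) * a (s n) * a (t m \<ominus> t n) = (a (s m) * a (t m)) * (a (s n) * a (t n)) * a (s n \<ominus> s m)"
        using C tC by (simp add: eq abs_mult)
      also have "\<dots> = a (s n \<ominus> s m)"
        using U C tC by (simp flip: abs_mult)
      also have "\<dots> < e * (r/2) * (r/2)" using l that by simp
      finally have "a (s m) * a (s n) * a (t m \<ominus> t n) < e * (r/2) * (r/2)" .
      moreover have "(r/2) * (r/2) * a (t m \<ominus> t n) \<le> a (s m) * a (s n) * a (t m \<ominus> t n)"
        using k[of m] k[of n] that s(3) C tC abs_nonneg by (intro mult_right_mono mult_mono) auto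
      ultimately have "(r/2) * (r/2) * a (t m \<ominus> t n) < (r/2) * (r/2) * e" by (simp add: mult_ac)
      thus ?thesis using s(3) by (simp add: mult_less_cancel_left)
    qed
    thus "\<exists>k. \<forall>m\<ge>k. \<forall>n\<ge>k. a (t m \<ominus> t n) < e" by blast
  qed (rule tC)
qed

lemma completion_valued_field: "valued_field (completion R a) (completion_abs a)"
proof -
  interpret C: cring "completion R a" by (rule completion_cring)
  have av: "abs_value (completion R a) (completion_abs a)"
    unfolding abs_value_def
  proof (intro conjI ballI)
    fix Z assume "Z \<in> carrier (completion R a)"
    then obtain s where s: "s \<in> cauchy_seqs R a" "Z = lim_class s" by (rule completion_rep)
    have sC: "s n \<in> carrier R" for n by (rule cauchy_seqsD(1)[OF s(1)])
    show "0 \<le> completion_abs a Z"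
      using completion_abs_lim_class[OF s(1)] sC abs_nonneg unfolding s(2)
      by (intro LIMSEQ_le_const) auto
    show "(completion_abs a Z = 0) = (Z = \<zero>\<^bsub>completion R a\<^esub>)"
      using completion_abs_eq_0_iff s by simp
    fix Y assume "Y \<in> carrier (completion R a)"
    then obtain t where t: "t \<in> cauchy_seqs R a" "Y = lim_class t" by (rule completion_rep)
    have tC: "t n \<in> carrier R" for n by (rule cauchy_seqsD(1)[OF t(1)])
    note lims = completion_abs_lim_class[OF s(1)] completion_abs_lim_class[OF t(1)]
    have "(\<lambda>n. a (s n \<otimes> t n)) \<longlonglongrightarrow> completion_abs a Z * completion_abs a Y"
      using tendsto_mult[OF lims] sC tC s(2) t(2) by (simp add: abs_mult)
    thus "completion_abs a (Z \<otimes>\<^bsub>completion R a\<^esub> Y) = completion_abs a Z * completion_abs a Y"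
      unfolding s(2) t(2) lim_class_simps(2)[OF s(1) t(1)]
      by (rule completion_abs_eqI[OF cauchy_mult[OF s(1) t(1)]])
    show "completion_abs a (Z \<oplus>\<^bsub>completion R a\<^esub> Y) \<le> completion_abs a Z + completion_abs a Y"
      using completion_abs_lim_class[OF cauchy_add[OF s(1) t(1)]] tendsto_add[OF lims] sC tC abs_add_le
      unfolding s(2) t(2) lim_class_simps(1)[OF s(1) t(1)]
      by (intro LIMSEQ_le) auto
  qed
  have "field (completion R a)"
  proof (rule C.cring_fieldI2)
    have "completion_abs a \<one>\<^bsub>completion R a\<^esub> = 1"
      unfolding lim_class_one by (rule completion_abs_eqI) (auto intro: cauchy_const)
    thus "\<zero>\<^bsub>completion R a\<^esub> \<noteq> \<one>\<^bsub>completion R a\<^esub>" using av C.one_closed unfolding abs_value_def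
      by (metis zero_neq_one)
    fix Z assume Z: "Z \<in> carrier (completion R a)" "Z \<noteq> \<zero>\<^bsub>completion R a\<^esub>"
    obtain s where s: "s \<in> cauchy_seqs R a" "Z = lim_class s" by (rule completion_rep[OF Z(1)])
    have "completion_abs a Z > 0" using av Z unfolding abs_value_def by (metis order_le_less)
    then obtain t where t: "t \<in> cauchy_seqs R a" "\<exists>k. \<forall>n\<ge>k. s n \<otimes> t n = \<one>"
      using cauchy_inv[OF s(1) completion_abs_lim_class[OF s(1)]] s(2) by blast
    then obtain k where k: "\<And>n. n \<ge> k \<Longrightarrow> s n \<otimes> t n = \<one>" by blast
    have st: "(\<lambda>n. s n \<otimes> t n) \<in> cauchy_seqs R a" using s t cauchy_mult by blast
    have "(\<lambda>n. a (s n \<otimes> t n \<ominus> \<one>)) \<longlonglongrightarrow> 0"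
      by (rule tendsto_eventually) (use k in \<open>auto simp: eventually_sequentially a_minus_def r_neg intro!: exI[of _ k]\<close>)
    hence "(\<lambda>n. s n \<otimes> t n) \<in> lim_class (\<lambda>n. \<one>)"
      using st cauchy_seqsD(1)[OF st] by (subst mem_lim_class_iff) (auto simp: cauchy_const null_seqs_def)
    hence "Z \<otimes>\<^bsub>completion R a\<^esub> lim_class t = \<one>\<^bsub>completion R a\<^esub>"
      using lim_class_eq[OF cauchy_const[of \<one>]] s t by (simp add: lim_class_simps lim_class_one)
    thus "\<exists>Y\<in>carrier (completion R a). Z \<otimes>\<^bsub>completion R a\<^esub> Y = \<one>\<^bsub>completion R a\<^esub>"
      using lim_class_closed[OF t(1)] by blast
  qed
  thus ?thesis using av unfolding valued_field_def valued_field_axioms_def by blast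
qed

lemma completion_emb_hom: "completion_emb R a \<in> Ring.ring_hom R (completion R a)"
  unfolding completion_emb_def
  by (rule ring_hom_memI) (auto simp: lim_class_closed cauchy_const lim_class_simps lim_class_one)

lemma completion_abs_emb: "x \<in> carrier R \<Longrightarrow> completion_abs a (completion_emb R a x) = a x"
  unfolding completion_emb_def by (rule completion_abs_eqI) (auto intro: cauchy_const)

lemma completion_emb_diff:
  assumes "x \<in> carrier R" "y \<in> carrier R"
  shows "completion_emb R a (x \<ominus> y) = completion_emb R a x \<ominus>\<^bsub>completion R a\<^esub> completion_emb R a y"
  unfolding completion_emb_def using lim_class_simps(3)[OF assms[THEN cauchy_const]] by simp

lemma completion_abs_emb_diff:
  assumes "x \<in> carrier R" "y \<in> carrier R"
  shows "completion_abs a (completion_emb R a x \<ominus>\<^bsub>completion R a\<^esub> completion_emb R a y) = a (x \<ominus> y)"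
  using completion_abs_emb[of "x \<ominus> y"] assms unfolding completion_emb_diff[OF assms] by simp

text \<open>For fixed \<open>n\<close> the difference is the class of the sequence of all
  \<open>s n \<ominus> s m\<close>; a bound that holds for all large \<open>m\<close> is inherited
  by its absolute value.\<close>

lemma completion_rep_tendsto:
  assumes "Z \<in> carrier (completion R a)" "s \<in> Z"
  shows "abs_tendsto (completion R a) (completion_abs a) (\<lambda>n. completion_emb R a (s n)) Z"
proof -
  note s = mem_completion[OF assms]
  have sC: "s n \<in> carrier R" for n by (rule cauchy_seqsD(1)[OF s(1)])
  have eq: "completion_emb R a (s n) \<ominus>\<^bsub>completion R a\<^esub> Z = lim_class (\<lambda>m. s n \<ominus> s m)" for n
    unfolding s(2) completion_emb_def by (rule lim_class_simps(3)[OF cauchy_const[OF sC] s(1)])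
  have c: "(\<lambda>m. s n \<ominus> s m) \<in> cauchy_seqs R a" for n
    using cauchy_add[OF cauchy_const[OF sC] cauchy_minus[OF s(1)]] by (simp add: a_minus_def)
  show ?thesis unfolding abs_tendsto_def eq
  proof (rule LIMSEQ_I)
    fix e :: real assume "e > 0"
    then obtain k where k: "\<And>m n. m \<ge> k \<Longrightarrow> n \<ge> k \<Longrightarrow> a (s m \<ominus> s n) < e/2"
      using cauchy_seqsD(2)[OF s(1), of "e/2"] by auto
    have "norm (completion_abs a (lim_class (\<lambda>m. s n \<ominus> s m)) - 0) < e" if "n \<ge> k" for n
    proof -
      have "completion_abs a (lim_class (\<lambda>m. s n \<ominus> s m)) \<le> e/2"
        using k[OF that] by (intro LIMSEQ_le_const2[OF completion_abs_lim_class[OF c]]) (auto intro: less_imp_le)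
      moreover have "0 \<le> completion_abs a (lim_class (\<lambda>m. s n \<ominus> s m))"
        using sC abs_nonneg by (intro LIMSEQ_le_const[OF completion_abs_lim_class[OF c]]) auto
      ultimately show ?thesis using \<open>e > 0\<close> by simp
    qed
    thus "\<exists>no. \<forall>n\<ge>no. norm (completion_abs a (lim_class (\<lambda>m. s n \<ominus> s m)) - 0) < e" by blast
  qed
qed

text \<open>Converse of \<open>completion_rep_tendsto\<close>: a class contains every sequence of
  \<open>R\<close> that converges to it. Thus having a representative with terms in a given subset
  means being a limit of elements of that subset.\<close>

lemma completion_mem_of_tendsto:
  assumes "Z \<in> carrier (completion R a)" "\<And>n. s n \<in> carrier R"
    "abs_tendsto (completion R a) (completion_abs a) (\<lambda>n. completion_emb R a (s n)) Z"
  shows "s \<in> Z"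
proof -
  interpret C: valued_field "completion R a" "completion_abs a" by (rule completion_valued_field)
  interpret h: ring_hom_ring R "completion R a" "completion_emb R a"
    by (rule ring_hom_ringI2[OF ring_axioms C.ring_axioms completion_emb_hom])
  have eC: "completion_emb R a (s n) \<in> carrier (completion R a)" for n using assms(2) by simp
  have ediff: "completion_abs a (completion_emb R a (s m) \<ominus>\<^bsub>completion R a\<^esub> completion_emb R a (s n)) = a (s m \<ominus> s n)" for m n
    using completion_abs_emb_diff assms(2) by blast
  have "(\<lambda>n. completion_emb R a (s n)) \<in> cauchy_seqs (completion R a) (completion_abs a)"
    using C.abs_tendsto_cauchy[OF eC assms(1,3)] .
  hence sc: "s \<in> cauchy_seqs R a" using assms(2) by (simp add: cauchy_seqs_def ediff)
  have "lim_class s = Z"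
    using C.abs_tendsto_unique[OF eC lim_class_closed[OF sc] assms(1)
        completion_rep_tendsto[OF lim_class_closed[OF sc] self_mem_lim_class[OF sc]] assms(3)] .
  thus ?thesis using self_mem_lim_class[OF sc] by simp
qed

lemma completion_dense:
  assumes "Z \<in> carrier (completion R a)" "e > 0"
  obtains x where "x \<in> carrier R"
    "completion_abs a (completion_emb R a x \<ominus>\<^bsub>completion R a\<^esub> Z) < e"
proof -
  obtain s where s: "s \<in> cauchy_seqs R a" "Z = lim_class s" by (rule completion_rep[OF assms(1)])
  have "abs_tendsto (completion R a) (completion_abs a) (\<lambda>n. completion_emb R a (s n)) Z"
    using completion_rep_tendsto[OF assms(1)] self_mem_lim_class s by blast
  hence "\<forall>\<^sub>F n in sequentially. completion_abs a (completion_emb R a (s n) \<ominus>\<^bsub>completion R a\<^esub> Z) < e"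
    unfolding abs_tendsto_def using assms(2) by (rule order_tendstoD(2))
  then obtain n where "completion_abs a (completion_emb R a (s n) \<ominus>\<^bsub>completion R a\<^esub> Z) < e"
    by (auto simp: eventually_sequentially)
  thus ?thesis using that cauchy_seqsD(1)[OF s(1)] by blast
qed

text \<open>Each term \<open>S n\<close> is replaced by an element of \<open>R\<close> within
  \<open>1/(n+1)\<close>; the resulting sequence is Cauchy in \<open>R\<close>, and its class is the
  limit of \<open>S\<close>.\<close>

lemma completion_complete:
  "abs_complete (completion R a) (completion_abs a) (carrier (completion R a))"
  unfolding abs_complete_def
proof (intro ballI impI)
  interpret C: valued_field "completion R a" "completion_abs a" by (rule completion_valued_field)
  let ?A = "completion_abs a" and ?e = "completion_emb R a"
  interpret h: ring_hom_ring R "completion R a" ?e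
    by (rule ring_hom_ringI2[OF ring_axioms C.ring_axioms completion_emb_hom])
  fix S assume S: "S \<in> cauchy_seqs (completion R a) ?A"
  note SC = C.cauchy_seqsD(1)[OF S]
  have "\<exists>x. x \<in> carrier R \<and> ?A (?e x \<ominus>\<^bsub>completion R a\<^esub> S n) < 1 / real (Suc n)" for n
    using completion_dense[OF SC[of n], of "1 / real (Suc n)"] by (metis of_nat_0_less_iff zero_less_Suc zero_less_divide_1_iff)
  then obtain x where x: "\<And>n. x n \<in> carrier R" "\<And>n. ?A (?e (x n) \<ominus>\<^bsub>completion R a\<^esub> S n) < 1 / real (Suc n)"
    by metis
  have ediff: "?A (?e (x m) \<ominus>\<^bsub>completion R a\<^esub> ?e (x n)) = a (x m \<ominus> x n)" for m n
    using completion_abs_emb_diff x(1) by blast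
  have lim0: "(\<lambda>n. ?A (?e (x n) \<ominus>\<^bsub>completion R a\<^esub> S n)) \<longlonglongrightarrow> 0"
    by (rule tendsto_zero_sandwich[OF _ _ LIMSEQ_inverse_real_of_nat])
      (use x SC C.abs_nonneg less_imp_le[OF x(2)] in \<open>auto simp: inverse_eq_divide\<close>)
  have xc: "x \<in> cauchy_seqs R a"
    unfolding cauchy_seqs_def
  proof safe
    fix e :: real assume e: "e > 0"
    obtain k1 where k1: "\<And>m n. m \<ge> k1 \<Longrightarrow> n \<ge> k1 \<Longrightarrow> ?A (S m \<ominus>\<^bsub>completion R a\<^esub> S n) < e/3"
      using C.cauchy_seqsD(2)[OF S, of "e/3"] e by auto
    have "\<forall>\<^sub>F n in sequentially. ?A (?e (x n) \<ominus>\<^bsub>completion R a\<^esub> S n) < e/3"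
      using order_tendstoD(2)[OF lim0, of "e/3"] e by simp
    then obtain k2 where k2: "\<And>n. n \<ge> k2 \<Longrightarrow> ?A (?e (x n) \<ominus>\<^bsub>completion R a\<^esub> S n) < e/3"
      unfolding eventually_sequentially by auto
    have "a (x m \<ominus> x n) < e" if "m \<ge> max k1 k2" "n \<ge> max k1 k2" for m n
    proof -
      have "a (x m \<ominus> x n) \<le> ?A (?e (x m) \<ominus>\<^bsub>completion R a\<^esub> S m) + ?A (S m \<ominus>\<^bsub>completion R a\<^esub> ?e (x n))"
        unfolding ediff[symmetric] by (rule C.abs_triangle) (use x SC in auto)
      also have "?A (S m \<ominus>\<^bsub>completion R a\<^esub> ?e (x n)) \<le> ?A (S m \<ominus>\<^bsub>completion R a\<^esub> S n) + ?A (S n \<ominus>\<^bsub>completion R a\<^esub> ?e (x n))"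
        by (rule C.abs_triangle) (use x SC in auto)
      also have "?A (S n \<ominus>\<^bsub>completion R a\<^esub> ?e (x n)) = ?A (?e (x n) \<ominus>\<^bsub>completion R a\<^esub> S n)"
        by (rule C.abs_diff_commute) (use x SC in auto)
      finally show ?thesis using k1[of m n] k2[of m] k2[of n] that by simp
    qed
    thus "\<exists>k. \<forall>m\<ge>k. \<forall>n\<ge>k. a (x m \<ominus> x n) < e" by blast
  qed (rule x)
  let ?Z = "lim_class x"
  note ZC = lim_class_closed[OF xc]
  have "abs_tendsto (completion R a) ?A (\<lambda>n. ?e (x n)) ?Z"
    using completion_rep_tendsto[OF ZC self_mem_lim_class[OF xc]] .
  hence lim1: "(\<lambda>n. ?A (?e (x n) \<ominus>\<^bsub>completion R a\<^esub> S n) + ?A (?e (x n) \<ominus>\<^bsub>completion R a\<^esub> ?Z)) \<longlonglongrightarrow> 0"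
    using lim0 unfolding abs_tendsto_def by (auto intro!: tendsto_eq_intros)
  have "abs_tendsto (completion R a) ?A S ?Z"
    unfolding abs_tendsto_def
  proof (rule tendsto_zero_sandwich[OF _ _ lim1])
    fix n show "?A (S n \<ominus>\<^bsub>completion R a\<^esub> ?Z) \<le> ?A (?e (x n) \<ominus>\<^bsub>completion R a\<^esub> S n) + ?A (?e (x n) \<ominus>\<^bsub>completion R a\<^esub> ?Z)"
      using C.abs_triangle[of "S n" "?e (x n)" ?Z] C.abs_diff_commute[of "S n" "?e (x n)"] SC x ZC by simp
  qed (use SC ZC C.abs_nonneg in simp)
  thus "\<exists>l\<in>carrier (completion R a). abs_tendsto (completion R a) ?A S l" using ZC by blast
qed

end

section \<open>Extending absolute values to algebraic extensions\<close>

text \<open>A submultiplicative seminorm defined on a subring is encoded by its epigraph: a subsemiring of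
  \<open>L \<times> [0,\<infinity>)\<close>. A maximal one comes from a multiplicative \<open>N\<close>: if \<open>r < N(f)\<close> then \<open>N(f\<^sup>-\<^sup>n) r\<^sup>n\<close> is bounded,
  since otherwise \<open>(f, r)\<close> could be adjoined; letting \<open>r\<close> tend to \<open>N(f)\<close>, \<open>N(f) N(1/f) \<le> 1\<close>.\<close>

locale abs_extension = field L for L :: "('a, 'm) ring_scheme" (structure) +
  fixes F :: "'a set" and a :: "'a \<Rightarrow> real"
  assumes subfield_F: "subfield F L"
    and abs_value_F: "abs_value (L\<lparr>carrier := F\<rparr>) a"
    and algebraic_F: "x \<in> carrier L \<Longrightarrow> (algebraic over F) x"
begin

definition presemi :: "('a \<times> real) set \<Rightarrow> bool" where
  "presemi G \<longleftrightarrow> G \<subseteq> carrier L \<times> {0..} \<and> (\<forall>x\<in>F. \<forall>r\<ge>a x. (x, r) \<in> G) \<and>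
     (\<forall>x r y s. (x, r) \<in> G \<longrightarrow> (y, s) \<in> G \<longrightarrow> (x \<oplus> y, r + s) \<in> G \<and> (x \<otimes> y, r * s) \<in> G)"

text \<open>The extra condition prevents collapse: a bound below 1 at \<open>\<one>\<close> would,
  through its powers, force the seminorm to vanish.\<close>

definition normsemi :: "('a \<times> real) set \<Rightarrow> bool" where
  "normsemi G \<longleftrightarrow> presemi G \<and> (\<forall>r. (\<one>, r) \<in> G \<longrightarrow> 1 \<le> r)"

text \<open>A Horner scheme: polynomials in \<open>x\<close> with coefficients from
  \<open>G\<close>, each with the bound obtained by giving \<open>x\<close> the value
  \<open>C\<close>. This is the semiring generated by \<open>G\<close> and
  \<open>(x, C)\<close>.\<close>

inductive_set adj :: "('a \<times> real) set \<Rightarrow> 'a \<Rightarrow> real \<Rightarrow> ('a \<times> real) set" for G x C where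
  base: "(g, r) \<in> G \<Longrightarrow> (g, r) \<in> adj G x C"
| step: "(g, r) \<in> G \<Longrightarrow> (y, s) \<in> adj G x C \<Longrightarrow> (g \<oplus> x \<otimes> y, r + C * s) \<in> adj G x C"

lemma F_valued: "valued_field (L\<lparr>carrier := F\<rparr>) a"
  using subfield_iff(2)[OF subfield_F] abs_value_F
  by (simp add: valued_field_def valued_field_axioms_def)

lemma F_subset: "x \<in> F \<Longrightarrow> x \<in> carrier L"
  using subfieldE(3)[OF subfield_F] by blast

lemma F_zero: "\<zero> \<in> F" and F_one: "\<one> \<in> F"
  using subringE(2,3)[OF subfieldE(1)[OF subfield_F]] by auto

lemma a_zero: "a \<zero> = 0"
  using valued_field.abs_zero[OF F_valued] by simp

lemma a_one: "a \<one> = 1"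
  using valued_field.abs_one[OF F_valued] by simp

lemma a_nonneg: "x \<in> F \<Longrightarrow> 0 \<le> a x"
  using valued_field.abs_nonneg[OF F_valued] by simp

lemma presemiD:
  assumes "presemi G"
  shows "(x, r) \<in> G \<Longrightarrow> x \<in> carrier L" "(x, r) \<in> G \<Longrightarrow> 0 \<le> r"
    "x \<in> F \<Longrightarrow> a x \<le> r \<Longrightarrow> (x, r) \<in> G"
    "(x, r) \<in> G \<Longrightarrow> (y, s) \<in> G \<Longrightarrow> (x \<oplus> y, r + s) \<in> G"
    "(x, r) \<in> G \<Longrightarrow> (y, s) \<in> G \<Longrightarrow> (x \<otimes> y, r * s) \<in> G"
  using assms unfolding presemi_def by blast+

lemma presemi_up:
  assumes "presemi G" "(x, r) \<in> G" "r \<le> s" shows "(x, s) \<in> G"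
  using presemiD(4)[OF assms(1,2) presemiD(3)[OF assms(1) F_zero, of "s - r"]] assms
    presemiD(1)[OF assms(1,2)] by (simp add: a_zero)

lemma presemi_zero: "presemi G \<Longrightarrow> (\<zero>, 0) \<in> G"
  by (rule presemiD(3)) (auto simp: F_zero a_zero)

lemma presemi_one: "presemi G \<Longrightarrow> (\<one>, 1) \<in> G"
  by (rule presemiD(3)) (auto simp: F_one a_one)

context
  fixes G x C
  assumes G: "presemi G" and x: "x \<in> carrier L" and C: "(0::real) \<le> C"
begin

lemma adj_carrier: "(y, s) \<in> adj G x C \<Longrightarrow> y \<in> carrier L \<and> 0 \<le> s"
  by (induction rule: adj.induct) (use x C presemiD(1,2)[OF G] in auto)

lemma adj_add_G:
  assumes "(g, q) \<in> G" "(y, s) \<in> adj G x C"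
  shows "(g \<oplus> y, q + s) \<in> adj G x C"
  using assms(2)
proof cases
  case base thus ?thesis using assms(1) presemiD(4)[OF G] by (intro adj.base) auto
next
  case (step h r y' s')
  have "((g \<oplus> h) \<oplus> x \<otimes> y', (q + r) + C * s') \<in> adj G x C"
    using step assms(1) presemiD(4)[OF G] by (intro adj.step) auto
  thus ?thesis using step adj_carrier[OF step(4)] presemiD(1)[OF G] assms(1) x
    by (simp add: a_assoc add.assoc)
qed

lemma adj_add:
  assumes "(y, s) \<in> adj G x C" "(z, t) \<in> adj G x C"
  shows "(y \<oplus> z, s + t) \<in> adj G x C"
  using assms
proof (induction arbitrary: z t rule: adj.induct)
  case (base g r)
  thus ?case by (rule adj_add_G)
next
  case (step g r y s)
  have cr: "g \<in> carrier L" "y \<in> carrier L" using step.hyps adj_carrier presemiD(1)[OF G] by auto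
  show ?case using step.prems
  proof cases
    case base
    have "(z \<oplus> (g \<oplus> x \<otimes> y), t + (r + C * s)) \<in> adj G x C"
      by (rule adj_add_G[OF base adj.step[OF step.hyps(1,2)]])
    thus ?thesis using cr x presemiD(1)[OF G base] by (simp add: a_comm add.commute)
  next
    case z: (step h r' z' t')
    have "((g \<oplus> h) \<oplus> x \<otimes> (y \<oplus> z'), (r + r') + C * (s + t')) \<in> adj G x C"
      using step.hyps z presemiD(4)[OF G] step.IH by (intro adj.step) auto
    moreover have "(g \<oplus> h) \<oplus> x \<otimes> (y \<oplus> z') = (g \<oplus> x \<otimes> y) \<oplus> (h \<oplus> x \<otimes> z')"
      using cr x presemiD(1)[OF G z(3)] adj_carrier[OF z(4)] by (simp add: r_distr a_ac)
    ultimately show ?thesis using z by (simp add: algebra_simps)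
  qed
qed

lemma adj_mult_G:
  assumes "(h, q) \<in> G" "(y, s) \<in> adj G x C"
  shows "(h \<otimes> y, q * s) \<in> adj G x C"
  using assms(2)
proof (induction rule: adj.induct)
  case (base g r)
  thus ?case using assms(1) presemiD(5)[OF G] by (intro adj.base) auto
next
  case (step g r y s)
  have "(h \<otimes> g \<oplus> x \<otimes> (h \<otimes> y), q * r + C * (q * s)) \<in> adj G x C"
    using step assms(1) presemiD(5)[OF G] by (intro adj.step) auto
  moreover have "h \<otimes> g \<oplus> x \<otimes> (h \<otimes> y) = h \<otimes> (g \<oplus> x \<otimes> y)"
    using x assms(1) presemiD(1)[OF G] step.hyps adj_carrier by (simp add: r_distr m_lcomm)
  ultimately show ?case by (simp add: algebra_simps)
qed

lemma adj_mult_x: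
  assumes "(y, s) \<in> adj G x C"
  shows "(x \<otimes> y, C * s) \<in> adj G x C"
  using adj.step[OF presemi_zero[OF G] assms] adj_carrier[OF assms] x by simp

lemma adj_mult:
  assumes "(y, s) \<in> adj G x C" "(z, t) \<in> adj G x C"
  shows "(y \<otimes> z, s * t) \<in> adj G x C"
  using assms(1)
proof (induction rule: adj.induct)
  case (base g r)
  thus ?case using assms(2) by (rule adj_mult_G)
next
  case (step g r y s)
  have cr: "g \<in> carrier L" "y \<in> carrier L" "z \<in> carrier L"
    using step.hyps adj_carrier presemiD(1)[OF G] assms(2) by auto
  have "(g \<otimes> z \<oplus> x \<otimes> (y \<otimes> z), r * t + C * (s * t)) \<in> adj G x C"
    by (intro adj_add adj_mult_G adj_mult_x step.IH step.hyps assms(2))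
  moreover have "g \<otimes> z \<oplus> x \<otimes> (y \<otimes> z) = (g \<oplus> x \<otimes> y) \<otimes> z"
    using cr x by (simp add: l_distr m_assoc)
  ultimately show ?case by (simp add: algebra_simps)
qed

lemma adj_x: "(x, C) \<in> adj G x C"
  using adj_mult_x[OF adj.base[OF presemi_one[OF G]]] x by simp

lemma adj_presemi: "presemi (adj G x C)"
  unfolding presemi_def using adj_carrier adj_add adj_mult adj.base presemiD(3)[OF G] by auto

end

text \<open>Maximality turns a missing pair into an algebraic relation: adjoining
  \<open>(x, C)\<close> can fail only by producing a bound below 1 for \<open>\<one>\<close>, which
  is then a polynomial in \<open>x\<close> of small cost.\<close>

lemma normsemi_adj:
  assumes G: "normsemi G" and max: "\<forall>G'. normsemi G' \<longrightarrow> G \<subseteq> G' \<longrightarrow> G' = G"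
    and x: "x \<in> carrier L" "0 \<le> C" "(x, C) \<notin> G"
  shows "\<exists>q<1. (\<one>, q) \<in> adj G x C"
proof -
  have pre: "presemi G" using G unfolding normsemi_def by simp
  have "G \<subseteq> adj G x C" by (rule subrelI) (rule adj.base)
  hence "\<not> normsemi (adj G x C)"
    using max[rule_format, of "adj G x C"] adj_x[OF pre x(1,2)] x(3) by auto
  thus ?thesis using adj_presemi[OF pre x(1,2)] unfolding normsemi_def by (auto simp: not_le)
qed

text \<open>Zorn's lemma, started from the epigraph of \<open>a\<close> on \<open>F\<close>. Two
  pairs in the union of a chain already lie in one member, so the closure conditions
  survive.\<close>

lemma exists_max_normsemi: "\<exists>G. normsemi G \<and> (\<forall>G'. normsemi G' \<longrightarrow> G \<subseteq> G' \<longrightarrow> G' = G)"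
proof -
  interpret F: valued_field "L\<lparr>carrier := F\<rparr>" a by (rule F_valued)
  have Fcl: "x \<oplus> y \<in> F" "x \<otimes> y \<in> F" if "x \<in> F" "y \<in> F" for x y
    using subringE(6,7)[OF subfieldE(1)[OF subfield_F]] that by auto
  have "normsemi {(x, r). x \<in> F \<and> a x \<le> r}"
    unfolding normsemi_def presemi_def
  proof (intro conjI allI impI)
    show "{(x, r). x \<in> F \<and> a x \<le> r} \<subseteq> carrier L \<times> {0..}"
      using F_subset a_nonneg by (force intro: order_trans)
    fix x r y s assume "(x, r) \<in> {(x, r). x \<in> F \<and> a x \<le> r}" "(y, s) \<in> {(x, r). x \<in> F \<and> a x \<le> r}"
    hence *: "x \<in> F" "y \<in> F" "a x \<le> r" "a y \<le> s" by auto
    show "(x \<oplus> y, r + s) \<in> {(x, r). x \<in> F \<and> a x \<le> r}"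
      using * F.abs_add_le[of x y] Fcl by simp
    have "a x * a y \<le> r * s" using * a_nonneg by (intro mult_mono) (auto intro: order_trans)
    thus "(x \<otimes> y, r * s) \<in> {(x, r). x \<in> F \<and> a x \<le> r}"
      using * F.abs_mult[of x y] Fcl by simp
  qed (auto simp: a_one)
  hence "\<exists>M\<in>{G. normsemi G}. \<forall>Z\<in>{G. normsemi G}. M \<subseteq> Z \<longrightarrow> Z = M"
  proof (intro subset_Zorn_nonempty)
    fix \<C> assume \<C>: "\<C> \<noteq> {}" "subset.chain {G. normsemi G} \<C>"
    have n: "normsemi G" if "G \<in> \<C>" for G using \<C>(2) that unfolding subset_chain_def by auto
    hence p: "presemi G" if "G \<in> \<C>" for G using that unfolding normsemi_def by auto
    have "presemi (\<Union>\<C>)"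
      unfolding presemi_def
    proof (intro conjI allI impI ballI)
      show "\<Union>\<C> \<subseteq> carrier L \<times> {0..}" using p unfolding presemi_def by blast
      fix x r assume "x \<in> F" "a x \<le> r"
      thus "(x, r) \<in> \<Union>\<C>" using \<C>(1) presemiD(3)[OF p] by blast
    next
      fix x r y s assume "(x, r) \<in> \<Union>\<C>" "(y, s) \<in> \<Union>\<C>"
      then obtain G1 G2 where "G1 \<in> \<C>" "G2 \<in> \<C>" "(x, r) \<in> G1" "(y, s) \<in> G2" by blast
      moreover have "G1 \<subseteq> G2 \<or> G2 \<subseteq> G1" using \<C>(2) calculation(1,2) unfolding subset_chain_def by blast
      ultimately obtain G where G: "G \<in> \<C>" "(x, r) \<in> G" "(y, s) \<in> G" by blast
      show "(x \<oplus> y, r + s) \<in> \<Union>\<C>" "(x \<otimes> y, r * s) \<in> \<Union>\<C>"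
        using G presemiD(4,5)[OF p[OF G(1)] G(2,3)] by blast+
    qed
    thus "\<Union>\<C> \<in> {G. normsemi G}" using n unfolding normsemi_def by blast
  qed blast
  thus ?thesis by blast
qed

text \<open>The value at \<open>C\<close> of the polynomial formed by the second components, leading
  coefficient first as in \<open>eval\<close>: the bound that the list of pairs certifies for the
  value at \<open>x\<close> of the first components.\<close>

fun cost :: "real \<Rightarrow> ('a \<times> real) list \<Rightarrow> real" where
  "cost C [] = 0"
| "cost C (p # ps) = snd p * C ^ length ps + cost C ps"

lemma cost_snoc: "cost C (ps @ [p]) = C * cost C ps + snd p"
  by (induction ps) (auto simp: algebra_simps)

lemma cost_replicate: "cost C (replicate n (\<zero>, 0) @ ps) = cost C ps"
  by (induction n) auto

lemma cost_nonneg: "0 \<le> C \<Longrightarrow> (\<And>p. p \<in> set ps \<Longrightarrow> 0 \<le> snd p) \<Longrightarrow> 0 \<le> cost C ps"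
  by (induction ps) auto

lemma cost_le:
  assumes "1 \<le> C" "\<And>p. p \<in> set ps \<Longrightarrow> 0 \<le> snd p" "length ps \<le> Suc N"
  shows "cost C ps \<le> sum_list (map snd ps) * C ^ N"
  using assms(2,3)
proof (induction ps)
  case (Cons p ps)
  have "snd p * C ^ length ps \<le> snd p * C ^ N"
    using Cons.prems assms(1) by (intro mult_left_mono power_increasing) auto
  thus ?case using Cons by (auto simp: algebra_simps)
qed simp

text \<open>One reduction step modulo a monic relation: a leading term with coefficient
  \<open>h\<close> is replaced by \<open>h\<close> times a polynomial of lower degree, merged
  coefficientwise with the remaining terms.\<close>

lemma eval_lincomb:
  assumes "length qs = length rs" "set (map fst qs) \<subseteq> carrier L" "set (map fst rs) \<subseteq> carrier L"
    "h \<in> carrier L" "x \<in> carrier L"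
  shows "eval (map fst (map2 (\<lambda>(c, \<rho>) (k, r). (h \<otimes> c \<oplus> k, t * \<rho> + r)) qs rs)) x
      = h \<otimes> eval (map fst qs) x \<oplus> eval (map fst rs) x"
  using assms(1-3)
proof (induction qs rs rule: list_induct2)
  case (Cons q qs r rs)
  have cr: "fst q \<in> carrier L" "fst r \<in> carrier L" "x [^] length rs \<in> carrier L"
    "eval (map fst qs) x \<in> carrier L" "eval (map fst rs) x \<in> carrier L"
    using Cons.prems assms(5) by (auto intro!: eval_in_carrier)
  thus ?case using Cons cr assms(4) by (simp add: split_beta l_distr r_distr m_assoc a_ac)
qed (use assms in auto)

lemma cost_lincomb:
  assumes "length qs = length rs"
  shows "cost C (map2 (\<lambda>(c, \<rho>) (k, r). (f c k, t * \<rho> + r)) qs rs) = t * cost C qs + cost C rs"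
  using assms by (induction qs rs rule: list_induct2) (auto simp: algebra_simps)

text \<open>The elements with some finite bound form a subfield \<open>A\<close>. If
  \<open>x\<close> lay outside it, let \<open>n\<close> be the degree of its minimal polynomial over
  \<open>A\<close>, and take \<open>C\<close> so large that replacing the power \<open>x^n\<close>
  by lower powers does not raise the cost. Then every element of \<open>adj G x C\<close> is a
  polynomial of degree below \<open>n\<close> of no greater cost. For \<open>\<one>\<close> this
  polynomial must be the constant \<open>\<one>\<close>, whose cost is at least 1, against
  \<open>normsemi_adj\<close>.\<close>

lemma max_normsemi_total:
  assumes G: "normsemi G" and max: "\<forall>G'. normsemi G' \<longrightarrow> G \<subseteq> G' \<longrightarrow> G' = G"
    and x: "x \<in> carrier L"
  shows "\<exists>r. (x, r) \<in> G"
proof (rule ccontr)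
  assume not: "\<nexists>r. (x, r) \<in> G"
  have pre: "presemi G" using G unfolding normsemi_def by simp
  note D = presemiD[OF pre]
  define A where "A = fst ` G"
  have A_iff: "y \<in> A \<longleftrightarrow> (\<exists>r. (y, r) \<in> G)" for y unfolding A_def by force
  have FA: "F \<subseteq> A" using D(3)[OF _ order_refl] unfolding A_iff subset_iff by blast
  have mOne: "\<ominus> \<one> \<in> F" using subringE(5)[OF subfieldE(1)[OF subfield_F] F_one] .
  have subA: "subring A L"
  proof (rule subringI)
    show "A \<subseteq> carrier L" using D(1) by (auto simp: A_iff)
    show "\<one> \<in> A" using FA F_one by blast
    fix h assume h: "h \<in> A"
    then obtain r where "(h, r) \<in> G" by (auto simp: A_iff)
    hence "(\<ominus> \<one> \<otimes> h, a (\<ominus> \<one>) * r) \<in> G" using D(3)[OF mOne] D(5) by blast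
    thus "\<ominus> h \<in> A" using \<open>(h, r) \<in> G\<close> D(1) by (auto simp: A_iff l_minus)
    fix k assume "k \<in> A"
    thus "h \<otimes> k \<in> A" "h \<oplus> k \<in> A" using h D(4,5) by (auto simp: A_iff) blast+
  qed
  \<comment> \<open>The ring generated by \<open>F\<close> and \<open>k\<close> is a field because
    \<open>k\<close> is algebraic over \<open>F\<close>; it lies in \<open>A\<close>, and so does
    the inverse of \<open>k\<close>.\<close>
  have sfA: "subfield A L"
  proof (rule subfieldI'[OF subA])
    fix k assume k: "k \<in> A - {\<zero>}"
    have kc: "k \<in> carrier L" using k subringE(1)[OF subA] by blast
    have "subfield (simple_extension F k) L"
      using simple_extension_is_subfield[OF subfield_F kc] algebraic_F[OF kc] by simp
    moreover have "k \<in> simple_extension F k"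
      by (rule simple_extension_mem[OF subfieldE(1)[OF subfield_F] kc])
    ultimately have "inv k \<in> simple_extension F k" using subfield_m_inv(1) k by blast
    thus "inv k \<in> A" using simple_extension_subring_incl[OF subA FA] k by blast
  qed
  have algA: "(algebraic over A) x" by (rule algebraic_mono[OF FA algebraic_F[OF x]])
  define p where "p = Irr A x"
  have p: "p \<in> carrier (A[X])" "lead_coeff p = \<one>" "eval p x = \<zero>"
    using IrrE[OF sfA x algA] by (auto simp: p_def)
  have pne: "p \<noteq> []"
    unfolding p_def by (rule pirreducibleE(1)[OF subA IrrE(1,2)[OF sfA x algA]])
  define ps where "ps = tl p"
  define n where "n = length ps"
  have pps: "p = \<one> # ps" using pne p(2) by (cases p) (auto simp: ps_def)
  have psA: "set ps \<subseteq> A" using p(1) pps by (auto simp flip: univ_poly_carrier simp: polynomial_def)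
  have Ac: "A \<subseteq> carrier L" using subringE(1)[OF subA] .
  have n0: "n \<noteq> 0"
  proof
    assume "n = 0" hence "p = [\<one>]" using pps n_def by simp
    thus False using p(3) x by simp
  qed
  have ind: "independent A (exp_base x n)"
    using exp_base_independent[OF sfA x algA] pps by (simp add: n_def flip: p_def)
  have "\<exists>qs. set qs \<subseteq> G \<and> map fst qs = map (\<lambda>c. \<ominus> c) ps"
    using psA
  proof (induction ps)
    case (Cons c ps)
    then obtain qs where qs: "set qs \<subseteq> G" "map fst qs = map (\<lambda>c. \<ominus> c) ps" by auto
    have "\<ominus> c \<in> A" using Cons.prems subringE(5)[OF subA] by simp
    then obtain r where "(\<ominus> c, r) \<in> G" by (auto simp: A_iff)
    thus ?case using qs by (intro exI[of _ "(\<ominus> c, r) # qs"]) auto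
  qed auto
  then obtain qs where qs: "set qs \<subseteq> G" "map fst qs = map (\<lambda>c. \<ominus> c) ps" by blast
  have lqs: "length qs = n" using qs(2) n_def by (metis length_map)
  have evm: "eval (map (\<lambda>c. \<ominus> c) ps) x = \<ominus> eval ps x"
    using psA
  proof (induction ps)
    case (Cons c ps)
    have "eval ps x \<in> carrier L" using Cons.prems Ac x by (intro eval_in_carrier) auto
    moreover have "c \<in> carrier L" using Cons.prems Ac by auto
    ultimately show ?case using Cons x by (simp add: l_minus minus_add)
  qed simp
  have psc: "eval ps x \<in> carrier L" using psA Ac x by (intro eval_in_carrier) auto
  have "x [^] n \<oplus> eval ps x = \<zero>" using p(3) x pps n_def by simp
  hence xn: "x [^] n = eval (map fst qs) x"
    unfolding qs(2) evm using psc x by (metis minus_equality minus_minus nat_pow_closed)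
  \<comment> \<open>With this choice the lower-degree expression \<open>qs\<close> for
    \<open>x^n\<close> costs at most \<open>C^n\<close>, the price of \<open>x^n\<close>
    itself.\<close>
  define C where "C = 1 + sum_list (map snd qs)"
  have snn: "0 \<le> snd p" if "p \<in> G" for p using D(2)[of "fst p" "snd p"] that by simp
  have snnq: "0 \<le> snd p" if "set ys \<subseteq> G" "p \<in> set ys" for ys p using snn subsetD[OF that] by blast
  have "0 \<le> sum_list (map snd qs)" using snnq[OF qs(1)] by (intro sum_list_nonneg) (simp only: set_map, blast)
  hence C1: "1 \<le> C" unfolding C_def by simp
  have "cost C qs \<le> sum_list (map snd qs) * C ^ (n - 1)"
    by (rule cost_le) (use C1 snnq[OF qs(1)] lqs in \<open>blast, blast, simp\<close>)
  also have "\<dots> \<le> C * C ^ (n - 1)" using C1 by (intro mult_right_mono) (auto simp: C_def)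
  also have "\<dots> = C ^ n" using n0 by (metis power_eq_if)
  finally have costq: "cost C qs \<le> C ^ n" .
  have rep: "\<exists>ps. set ps \<subseteq> G \<and> length ps = n \<and> eval (map fst ps) x = y \<and> cost C ps \<le> s"
    if "(y, s) \<in> adj G x C" for y s
    using that
  proof (induction rule: adj.induct)
    case (base g r)
    have "set [fst (g, r)] \<subseteq> carrier L" using D(1)[OF base] by simp
    hence "eval (map fst (replicate (n - 1) (\<zero>, 0) @ [(g, r)])) x = g"
      using eval_replicate[of "[g]" x "n - 1"] x by simp
    moreover have "cost C (replicate (n - 1) (\<zero>, 0) @ [(g, r)]) = r"
      by (simp add: cost_replicate)
    ultimately show ?case using base n0 presemi_zero[OF pre]
      by (intro exI[of _ "replicate (n - 1) (\<zero>, 0) @ [(g, r)]"]) auto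
  next
    case (step g r y s)
    then obtain us where us: "set us \<subseteq> G" "length us = n" "eval (map fst us) x = y" "cost C us \<le> s" by blast
    have usc: "set (map fst us) \<subseteq> carrier L" using us(1) D(1) by auto
    have gc: "g \<in> carrier L" "y \<in> carrier L" using D(1)[OF step(1)] us(3) eval_in_carrier[OF usc x] by auto
    \<comment> \<open>Multiplying by \<open>x\<close> and adding \<open>g\<close> appends
      \<open>g\<close> as the constant coefficient. The list now has \<open>n + 1\<close> entries,
      and its head \<open>h\<close> is the coefficient of \<open>x^n\<close> that has to be
      reduced.\<close>
    obtain h ws where hw: "us @ [(g, r)] = h # ws" by (cases "us @ [(g, r)]") auto
    have lws: "length ws = n" using arg_cong[OF hw, of length] us(2) by simp
    have "set (h # ws) \<subseteq> G" unfolding hw[symmetric] using us(1) step(1) by simp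
    hence hws: "h \<in> G" "set ws \<subseteq> G" by simp_all
    have wsc: "set (map fst ws) \<subseteq> carrier L" "fst h \<in> carrier L" using hws D(1) by (auto, metis D(1) prod.collapse)
    have qsc: "set (map fst qs) \<subseteq> carrier L" using qs(1) D(1) by auto
    define vs where "vs = map2 (\<lambda>(c, \<rho>) (k, r). (fst h \<otimes> c \<oplus> k, snd h * \<rho> + r)) qs ws"
    have "eval (map fst vs) x = fst h \<otimes> x [^] n \<oplus> eval (map fst ws) x"
      unfolding vs_def xn by (rule eval_lincomb) (use wsc qsc x lqs lws in auto)
    also have "\<dots> = eval (map fst (us @ [(g, r)])) x" unfolding hw by (simp add: lws)
    also have "\<dots> = g \<oplus> x \<otimes> y"
      using eval_append_aux[OF usc gc(1) x] us(3) gc x by (simp add: m_comm a_comm)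
    finally have 1: "eval (map fst vs) x = g \<oplus> x \<otimes> y" .
    have "cost C vs = snd h * cost C qs + cost C ws"
      unfolding vs_def by (rule cost_lincomb) (use wsc qsc x lqs lws in auto)
    also have "\<dots> \<le> snd h * C ^ n + cost C ws"
      using costq snn[OF hws(1)] by (simp add: mult_left_mono)
    also have "\<dots> = C * cost C us + r"
      using cost_snoc[of C us "(g, r)"] unfolding hw by (simp add: lws)
    also have "\<dots> \<le> r + C * s" using us(4) C1 by (simp add: mult_left_mono)
    finally have 2: "cost C vs \<le> r + C * s" .
    have 3: "length vs = n" by (simp add: vs_def lqs lws)
    have "set vs \<subseteq> G"
    proof
      fix v assume "v \<in> set vs"
      then obtain c k where v: "(c, k) \<in> set (zip qs ws)" "v = (fst h \<otimes> fst c \<oplus> fst k, snd h * snd c + snd k)"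
        unfolding vs_def by force
      have "c \<in> G" "k \<in> G" using set_zip_leftD[OF v(1)] set_zip_rightD[OF v(1)] qs(1) hws by auto
      hence "(fst c, snd c) \<in> G" "(fst k, snd k) \<in> G" "(fst h, snd h) \<in> G" using hws by simp_all
      thus "v \<in> G" unfolding v(2) by (intro D(4) D(5))
    qed
    thus ?case using 1 2 3 by blast
  qed
  have xC: "(x, C) \<notin> G" using not by blast
  have C0: "0 \<le> C" using C1 by simp
  obtain q where q: "q < 1" "(\<one>, q) \<in> adj G x C"
    using normsemi_adj[OF G max x C0 xC] by blast
  obtain us where us: "set us \<subseteq> G" "length us = n" "eval (map fst us) x = \<one>" "cost C us \<le> q"
    using rep[OF q(2)] by blast
  \<comment> \<open>Two expansions of \<open>\<one>\<close> in the powers of \<open>x\<close> below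
    \<open>n\<close>. They coincide by independence over \<open>A\<close>, so the last coefficient
    in \<open>us\<close> is \<open>\<one>\<close>.\<close>
  have 1: "combine (map fst us) (exp_base x n) = \<one>"
    using combine_eq_eval[of "map fst us" x] us by simp
  have 2: "combine (replicate (n - 1) \<zero> @ [\<one>]) (exp_base x n) = \<one>"
    using combine_eq_eval[of "replicate (n - 1) \<zero> @ [\<one>]" x] eval_replicate[of "[\<one>]" x "n - 1"] x n0
    by simp
  have "\<one> \<in> Span A (exp_base x n)"
    using Span_eq_combine_set[OF sfA exp_base_closed[OF x], of n] 2 subringE(2,3)[OF subA]
    by (auto intro!: exI[of _ "replicate (n - 1) \<zero> @ [\<one>]"])
  from unique_decomposition[OF sfA ind this]
  have "map fst us = replicate (n - 1) \<zero> @ [\<one>]"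
  proof (rule ex1E)
    fix Ks assume "\<forall>Ks'. set Ks' \<subseteq> A \<and> length Ks' = length (exp_base x n) \<and> \<one> = combine Ks' (exp_base x n) \<longrightarrow> Ks' = Ks"
    moreover have "set (map fst us) \<subseteq> A" using us(1) by (auto simp: A_def)
    moreover have "set (replicate (n - 1) \<zero> @ [\<one>]) \<subseteq> A" using subringE(2,3)[OF subA] by auto
    moreover have "length (map fst us) = length (exp_base x n)"
      "length (replicate (n - 1) \<zero> @ [\<one>]) = length (exp_base x n)"
      using us(2) n0 by (simp_all add: exp_base_def)
    ultimately show ?thesis using 1[symmetric] 2[symmetric] by metis
  qed
  hence "fst (last us) = \<one>" and "us \<noteq> []"
    using last_map[of us fst] us(2) n0 by auto
  then obtain us' u where u: "us = us' @ [u]" "fst u = \<one>" by (metis append_butlast_last_id)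
  hence "(\<one>, snd u) \<in> G" using us(1) by (metis in_set_conv_decomp prod.collapse subsetD)
  hence "1 \<le> snd u" using G unfolding normsemi_def by blast
  also have "\<dots> \<le> cost C us"
    unfolding u(1) cost_snoc using C1 cost_nonneg[of C us'] snnq[OF us(1)] u(1) by simp
  finally show False using us(4) q(1) by simp
qed

section \<open>Multiplicativity of a maximal seminorm\<close>

definition semi_norm :: "('a \<times> real) set \<Rightarrow> 'a \<Rightarrow> real" where
  "semi_norm G x = Inf {r. (x, r) \<in> G}"

context
  fixes G
  assumes G: "normsemi G" and max: "\<forall>G'. normsemi G' \<longrightarrow> G \<subseteq> G' \<longrightarrow> G' = G"
begin

abbreviation N :: "'a \<Rightarrow> real" where "N \<equiv> semi_norm G"

lemma pre: "presemi G" using G unfolding normsemi_def by simp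

lemma N_le: "(x, r) \<in> G \<Longrightarrow> N x \<le> r"
  unfolding semi_norm_def using presemiD(2)[OF pre] by (intro cInf_lower bdd_belowI[of _ 0]) auto

lemma N_greatest:
  assumes "x \<in> carrier L" "\<And>r. (x, r) \<in> G \<Longrightarrow> c \<le> r" shows "c \<le> N x"
  unfolding semi_norm_def
  by (rule cInf_greatest) (use assms max_normsemi_total[OF G max assms(1)] in auto)

lemma N_nonneg: "x \<in> carrier L \<Longrightarrow> 0 \<le> N x"
  using presemiD(2)[OF pre] by (auto intro: N_greatest)

lemma N_less_iff:
  assumes "x \<in> carrier L" shows "N x < r \<Longrightarrow> (x, r) \<in> G"
proof -
  assume *: "N x < r"
  show "(x, r) \<in> G"
  proof (rule ccontr)
    assume "(x, r) \<notin> G"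
    hence "r \<le> s" if "(x, s) \<in> G" for s using that presemi_up[OF pre that, of r] by (meson linear)
    hence "r \<le> N x" using assms by (intro N_greatest) auto
    thus False using * by simp
  qed
qed

lemma N_add:
  assumes "x \<in> carrier L" "y \<in> carrier L" shows "N (x \<oplus> y) \<le> N x + N y"
proof (rule field_le_epsilon)
  fix e :: real assume "e > 0"
  hence "(x, N x + e/2) \<in> G" "(y, N y + e/2) \<in> G" using assms by (auto intro: N_less_iff)
  thus "N (x \<oplus> y) \<le> N x + N y + e" using N_le[OF presemiD(4)[OF pre]] by fastforce
qed

text \<open>The infimum is taken over the bounds of one factor at a time; a bound or a value equal
  to zero is treated apart, since the argument divides by it.\<close>

lemma N_mult:
  assumes "x \<in> carrier L" "y \<in> carrier L" shows "N (x \<otimes> y) \<le> N x * N y"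
proof -
  have 1: "N (x \<otimes> y) \<le> r * s" if "(x, r) \<in> G" "(y, s) \<in> G" for r s
    using N_le[OF presemiD(5)[OF pre]] that by blast
  have 2: "N (x \<otimes> y) \<le> r * N y" if r: "(x, r) \<in> G" for r
  proof (cases "r = 0")
    case True thus ?thesis using 1[OF r] max_normsemi_total[OF G max assms(2)] by auto
  next
    case False
    hence r0: "r > 0" using presemiD(2)[OF pre r] by simp
    have "N (x \<otimes> y) / r \<le> N y"
      by (rule N_greatest[OF assms(2)]) (use 1[OF r] r0 in \<open>simp add: field_simps\<close>)
    thus ?thesis using r0 by (simp add: field_simps)
  qed
  show ?thesis
  proof (cases "N y = 0")
    case True thus ?thesis using 2 max_normsemi_total[OF G max assms(1)] by auto
  next
    case False
    hence r0: "N y > 0" using N_nonneg[OF assms(2)] by simp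
    have "N (x \<otimes> y) / N y \<le> N x"
      by (rule N_greatest[OF assms(1)]) (use 2 r0 in \<open>simp add: field_simps\<close>)
    thus ?thesis using r0 by (simp add: field_simps)
  qed
qed

lemma N_F: "x \<in> F \<Longrightarrow> N x \<le> a x"
  using N_le presemiD(3)[OF pre] by blast

lemma N_one: "N \<one> = 1"
proof (rule antisym)
  show "N \<one> \<le> 1" using N_F[OF F_one] a_one by simp
  show "1 \<le> N \<one>" using G unfolding normsemi_def by (intro N_greatest) auto
qed

text \<open>By \<open>normsemi_adj\<close>, \<open>\<one>\<close> is a polynomial in
  \<open>f\<close> of cost \<open>q < 1\<close> when \<open>f\<close> is priced at \<open>r\<close>.
  Multiplied by a high power of \<open>g\<close>, the inverse of \<open>f\<close>, this bounds
  \<open>t m\<close> by \<open>q\<close> times the maximum of \<open>t\<close> up to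
  \<open>m\<close>. Beyond the degree \<open>D\<close> the sequence \<open>t\<close> can therefore
  never reach a new positive record.\<close>

lemma N_unbounded_or_mem:
  assumes f: "f \<in> carrier L" "g \<in> carrier L" "g \<otimes> f = \<one>" and r: "0 < r" and "(f, r) \<notin> G"
  shows "\<exists>T. \<forall>n. N (g [^] n) * r ^ n \<le> T"
proof -
  define t where "t n = N (g [^] (n::nat)) * r ^ n" for n
  have t0: "0 \<le> t n" for n using r f N_nonneg by (simp add: t_def)
  \<comment> \<open>\<open>D\<close> grows by one with each Horner step, because the new factor
    \<open>f\<close> cancels one factor of \<open>g [^] m\<close>.\<close>
  have key: "\<exists>D. \<forall>m\<ge>D. \<forall>T. (\<forall>n\<le>m. t n \<le> T) \<longrightarrow> N (y \<otimes> g [^] m) * r ^ m \<le> s * T"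
    if "(y, s) \<in> adj G f r" for y s
    using that
  proof (induction rule: adj.induct)
    case (base h q)
    have "N (h \<otimes> g [^] m) * r ^ m \<le> q * T" if T: "\<forall>n\<le>m. t n \<le> T" for m T
    proof -
      have hc: "h \<in> carrier L" "0 \<le> q" using presemiD[OF pre] base by auto
      have "N (h \<otimes> g [^] m) * r ^ m \<le> N h * N (g [^] m) * r ^ m"
        using N_mult[of h "g [^] m"] hc f r by (intro mult_right_mono) auto
      also have "\<dots> = N h * t m" by (simp add: t_def)
      also have "\<dots> \<le> q * T" using N_le[OF base] T t0 hc by (intro mult_mono) auto
      finally show ?thesis .
    qed
    thus ?case by blast
  next
    case (step h q y s)
    then obtain D where D: "\<And>m T. m \<ge> D \<Longrightarrow> \<forall>n\<le>m. t n \<le> T \<Longrightarrow> N (y \<otimes> g [^] m) * r ^ m \<le> s * T" by blast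
    have hc: "h \<in> carrier L" "0 \<le> q" using presemiD[OF pre] step(1) by auto
    have yc: "y \<in> carrier L" using adj_carrier[OF pre f(1) less_imp_le[OF r] step(2)] by simp
    have "N ((h \<oplus> f \<otimes> y) \<otimes> g [^] m) * r ^ m \<le> (q + r * s) * T" if m: "m \<ge> Suc D" and T: "\<forall>n\<le>m. t n \<le> T" for m T
    proof -
      obtain k where k: "m = Suc k" "k \<ge> D" using m by (cases m) auto
      have "(h \<oplus> f \<otimes> y) \<otimes> g [^] m = h \<otimes> g [^] m \<oplus> f \<otimes> y \<otimes> (g [^] k \<otimes> g)"
        using hc yc f by (simp add: k l_distr)
      also have "f \<otimes> y \<otimes> (g [^] k \<otimes> g) = (g \<otimes> f) \<otimes> (y \<otimes> g [^] k)"
        using yc f(1,2) by (simp add: m_ac)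
      finally have "(h \<oplus> f \<otimes> y) \<otimes> g [^] m = h \<otimes> g [^] m \<oplus> y \<otimes> g [^] k" using f yc by simp
      hence "N ((h \<oplus> f \<otimes> y) \<otimes> g [^] m) \<le> N (h \<otimes> g [^] m) + N (y \<otimes> g [^] k)"
        using N_add[of "h \<otimes> g [^] m" "y \<otimes> g [^] k"] hc yc f by simp
      also have "N (h \<otimes> g [^] m) \<le> q * N (g [^] m)"
        using N_mult[of h "g [^] m"] N_le[OF step(1)] hc f N_nonneg[of "g [^] m"]
        by (meson mult_right_mono nat_pow_closed order_trans)
      finally have "N ((h \<oplus> f \<otimes> y) \<otimes> g [^] m) * r ^ m \<le> (q * N (g [^] m) + N (y \<otimes> g [^] k)) * r ^ m"
        using r by (intro mult_right_mono) auto
      also have "\<dots> = q * t m + r * (N (y \<otimes> g [^] k) * r ^ k)" by (simp add: t_def k algebra_simps)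
      also have "\<dots> \<le> q * T + r * (s * T)"
        using D[OF k(2), of T] T k(1) hc r by (intro add_mono mult_left_mono) auto
      finally show ?thesis by (simp add: algebra_simps)
    qed
    thus ?case by blast
  qed
  obtain q where q: "q < 1" "(\<one>, q) \<in> adj G f r"
    using normsemi_adj[OF G max f(1) less_imp_le[OF r] assms(5)] by blast
  obtain D where D: "\<And>m T. m \<ge> D \<Longrightarrow> \<forall>n\<le>m. t n \<le> T \<Longrightarrow> N (\<one> \<otimes> g [^] m) * r ^ m \<le> q * T"
    using key[OF q(2)] by blast
  have q0: "0 \<le> q" using adj_carrier[OF pre f(1) less_imp_le[OF r] q(2)] by simp
  define T where "T = Max (t ` {..D})"
  have T: "t n \<le> T" if "n \<le> D" for n unfolding T_def using that by auto
  have T0: "0 \<le> T" using T[of 0] t0[of 0] by simp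
  have "t n \<le> T" for n
  proof (induction n rule: less_induct)
    case (less n)
    show ?case
    proof (rule ccontr)
      assume not: "\<not> t n \<le> T"
      hence n: "n \<ge> D" using T[of n] by (meson linear)
      have "\<forall>k\<le>n. t k \<le> t n" using less not by (metis linear nless_le order_trans)
      from D[OF n this] have "t n \<le> q * t n" using f by (simp add: t_def)
      hence "(1 - q) * t n \<le> 0" by (simp add: algebra_simps)
      hence "t n \<le> 0" using q by (simp add: mult_le_0_iff)
      thus False using not T0 by simp
    qed
  qed
  thus ?thesis unfolding t_def by blast
qed

text \<open>If the product exceeded 1, there would be \<open>r\<close> below \<open>N f\<close> and
  \<open>s\<close> below \<open>N g\<close> with \<open>r * s\<close> still above 1. Both sequences
  in \<open>N_unbounded_or_mem\<close> would be bounded, while their product is at least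
  \<open>(r * s) ^ n\<close> because the powers of \<open>f\<close> and \<open>g\<close> are
  mutually inverse.\<close>

lemma N_inverse:
  assumes f: "f \<in> carrier L" "g \<in> carrier L" "g \<otimes> f = \<one>"
  shows "N f * N g = 1"
proof (rule antisym)
  show "1 \<le> N f * N g" using N_mult[OF f(1,2)] f N_one by (simp add: m_comm)
  show "N f * N g \<le> 1"
  proof (rule ccontr)
    assume "\<not> N f * N g \<le> 1"
    hence *: "1 < N f * N g" by simp
    have pos: "N f > 0" "N g > 0" using * N_nonneg f by (metis less_irrefl mult_eq_0_iff not_one_less_zero order_le_less)+
    have "1 / N g < N f" using * pos by (simp add: field_simps)
    then obtain r where r: "1 / N g < r" "r < N f" using dense by blast
    have r0: "r > 0" using r(1) pos by (meson less_trans zero_less_divide_1_iff)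
    have "1 / r < N g" using r r0 pos by (simp add: field_simps)
    then obtain s where s: "1 / r < s" "s < N g" using dense by blast
    have s0: "s > 0" using s(1) r0 by (meson less_trans zero_less_divide_1_iff)
    have rs: "1 < r * s" using s(1) r0 by (simp add: field_simps)
    have nf: "(f, r) \<notin> G" using N_le r by force
    have ng: "(g, s) \<notin> G" using N_le s by force
    obtain T where T: "\<And>n. N (g [^] n) * r ^ n \<le> T" using N_unbounded_or_mem[OF f r0 nf] by blast
    obtain S where S: "\<And>n. N (f [^] n) * s ^ n \<le> S"
      using N_unbounded_or_mem[OF f(2,1) _ s0 ng] f by (auto simp: m_comm)
    have "(r * s) ^ n \<le> T * S" for n
    proof -
      have "f [^] n \<otimes> g [^] n = \<one>" using f by (simp flip: pow_mult_distrib add: m_comm nat_pow_distrib)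
      hence "1 \<le> N (f [^] n) * N (g [^] n)" using N_mult[of "f [^] n" "g [^] n"] f N_one by simp
      hence "(r * s) ^ n \<le> (N (f [^] n) * N (g [^] n)) * (r * s) ^ n" using rs by simp
      also have "\<dots> = (N (g [^] n) * r ^ n) * (N (f [^] n) * s ^ n)" by (simp add: power_mult_distrib)
      also have "\<dots> \<le> T * S" using T[of n] S[of n] f r0 s0 N_nonneg
        by (intro mult_mono order_trans[OF _ T[of n]]) auto
      finally show ?thesis .
    qed
    moreover obtain n where "T * S < (r * s) ^ n" using real_arch_pow[OF rs] by blast
    ultimately show False by (meson not_le)
  qed
qed

text \<open>With \<open>N_inverse\<close>, submultiplicativity applied to
  \<open>(x \<otimes> y) \<otimes> inv y\<close> gives the missing inequality. On \<open>F\<close>,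
  the bound \<open>N \<le> a\<close> at both \<open>x\<close> and its inverse forces
  equality.\<close>

lemma N_abs_value: "abs_value L N" and N_extends: "x \<in> F \<Longrightarrow> N x = a x"
proof -
  have inv: "inv x \<in> carrier L" "inv x \<otimes> x = \<one>" if "x \<in> carrier L" "x \<noteq> \<zero>" for x
    using that field_Units by auto
  have pos: "0 < N x" if "x \<in> carrier L" "x \<noteq> \<zero>" for x
    using N_inverse[OF that(1) inv[OF that]] N_nonneg[OF that(1)] by (metis less_eq_real_def mult_zero_left zero_neq_one)
  have zero: "N \<zero> = 0" using N_F[OF F_zero] a_zero N_nonneg[of \<zero>] by simp
  have mult: "N (x \<otimes> y) = N x * N y" if xy: "x \<in> carrier L" "y \<in> carrier L" for x y
  proof (cases "y = \<zero>")
    case True thus ?thesis using xy zero by simp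
  next
    case False
    note i = inv[OF xy(2) False]
    have "x = (x \<otimes> y) \<otimes> inv y" using xy i by (simp add: m_assoc m_comm[of y])
    hence "N x \<le> N (x \<otimes> y) * N (inv y)" using N_mult[of "x \<otimes> y" "inv y"] xy i by simp
    also have "N (inv y) = inverse (N y)" using N_inverse[OF xy(2) i] by (metis inverse_unique)
    finally have "N x * N y \<le> N (x \<otimes> y)" using pos[OF xy(2) False] by (simp add: field_simps)
    thus ?thesis using N_mult[OF xy] by simp
  qed
  show "abs_value L N" unfolding abs_value_def
    using N_nonneg pos zero mult N_add by (metis less_irrefl)
  assume x: "x \<in> F"
  show "N x = a x"
  proof (cases "x = \<zero>")
    case False
    interpret F: valued_field "L\<lparr>carrier := F\<rparr>" a by (rule F_valued)
    have xc: "x \<in> carrier L" using x F_subset by simp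
    note i = inv[OF xc False]
    have iF: "inv x \<in> F" using subfield_m_inv(1)[OF subfield_F] x False by simp
    have "a (inv x) * a x = 1" using F.abs_mult[of "inv x" x] iF x i a_one by simp
    moreover have nn: "N x * N (inv x) = 1" by (rule N_inverse[OF xc i])
    moreover have le: "N x \<le> a x" "N (inv x) \<le> a (inv x)" using N_F x iF by auto
    have p0: "0 < N x" by (rule pos[OF xc False])
    have "inv x \<noteq> \<zero>" using i xc by (metis l_null zero_not_one)
    hence "0 < N (inv x)" by (rule pos[OF i(1)])
    hence pos': "0 < N x" "0 < a (inv x)" using p0 le(2) by simp_all
    moreover have "N x * N (inv x) \<le> N x * a (inv x)" using le(2) pos'(1) by simp
    ultimately have "a (inv x) * a x \<le> a (inv x) * N x" by (simp add: mult.commute)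
    thus ?thesis using le(1) pos'(2) by simp
  qed (use zero a_zero in simp)
qed

end

theorem exists_extension: "\<exists>b. abs_value L b \<and> (\<forall>x\<in>F. b x = a x)"
  using exists_max_normsemi N_abs_value N_extends by metis

end

section \<open>Linear combinations over a complete subfield\<close>

text \<open>A quantitative form of linear independence: the coefficients are controlled by the value
  of the combination. It makes sense over a subfield that is not complete, passes to limits of the
  coefficients with the same \<open>c\<close>, and survives small changes of the vectors.\<close>

definition abs_free ::
  "('a, 'm) ring_scheme \<Rightarrow> ('a \<Rightarrow> real) \<Rightarrow> 'a set \<Rightarrow> real \<Rightarrow> 'a list \<Rightarrow> bool" where
  "abs_free R b F c Us \<longleftrightarrow> (\<forall>Ks. set Ks \<subseteq> F \<longrightarrow> length Ks = length Us \<longrightarrow>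
     (\<forall>k\<in>set Ks. c * b k \<le> b (ring.combine R Ks Us)))"

context valued_field
begin

lemma abs_tendsto_combine:
  assumes "length l = length Us" "\<And>n. length (K n) = length Us"
    "set Us \<subseteq> carrier R" "set l \<subseteq> carrier R" "\<And>n. set (K n) \<subseteq> carrier R"
    "\<And>i. i < length Us \<Longrightarrow> abs_tendsto R a (\<lambda>n. K n ! i) (l ! i)"
  shows "abs_tendsto R a (\<lambda>n. combine (K n) Us) (combine l Us)"
  using assms
proof (induction Us arbitrary: l K)
  case Nil
  thus ?case using abs_tendsto_const[of \<zero>] by simp
next
  case (Cons u Us)
  obtain k ks where l: "l = k # ks" using Cons.prems(1) by (cases l) auto
  have K: "K n = hd (K n) # tl (K n)" for n using Cons.prems(2)[of n] by (cases "K n") auto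
  have hK: "hd (K n) \<in> carrier R" "set (tl (K n)) \<subseteq> carrier R" "length (tl (K n)) = length Us" for n
    using Cons.prems(5)[of n] Cons.prems(2)[of n] by (subst (asm) (1) K, auto)+
  have "abs_tendsto R a (\<lambda>n. combine (tl (K n)) Us) (combine ks Us)"
  proof (rule Cons.IH)
    fix i assume "i < length Us"
    thus "abs_tendsto R a (\<lambda>n. tl (K n) ! i) (ks ! i)"
      using Cons.prems(6)[of "Suc i"] l hK(3) by (simp add: nth_tl)
  qed (use Cons.prems l hK in auto)
  moreover have "(\<lambda>n. hd (K n)) = (\<lambda>n. K n ! 0)" by (rule ext) (subst (2) K, simp)
  hence "abs_tendsto R a (\<lambda>n. hd (K n)) k"
    using Cons.prems(6)[of 0] l by simp
  ultimately have "abs_tendsto R a (\<lambda>n. hd (K n) \<otimes> u \<oplus> combine (tl (K n)) Us) (k \<otimes> u \<oplus> combine ks Us)"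
    using Cons.prems l hK by (intro abs_tendsto_add abs_tendsto_mult abs_tendsto_const) auto
  thus ?case unfolding l by (subst K) simp
qed

lemma combine_diff:
  assumes "length Ks = length Us" "length Ls = length Us"
    "set Us \<subseteq> carrier R" "set Ks \<subseteq> carrier R" "set Ls \<subseteq> carrier R"
  shows "combine Ks Us \<ominus> combine Ls Us = combine (map2 (\<lambda>x y. x \<ominus> y) Ks Ls) Us"
  using assms
proof (induction Us arbitrary: Ks Ls)
  case (Cons u Us)
  obtain k ks where K: "Ks = k # ks" "length ks = length Us" using Cons.prems(1) by (cases Ks) auto
  obtain l ls where L: "Ls = l # ls" "length ls = length Us" using Cons.prems(2) by (cases Ls) auto
  have c: "combine ks Us \<in> carrier R" "combine ls Us \<in> carrier R" "u \<in> carrier R" "k \<in> carrier R" "l \<in> carrier R"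
    using Cons.prems K L by auto
  have "(k \<otimes> u \<oplus> combine ks Us) \<ominus> (l \<otimes> u \<oplus> combine ls Us)
    = (k \<ominus> l) \<otimes> u \<oplus> (combine ks Us \<ominus> combine ls Us)"
    using c by (simp add: a_minus_def l_distr l_minus minus_add a_ac)
  thus ?case using Cons K L by simp
qed (simp add: a_minus_def)

lemma abs_combine_le:
  assumes "length Ks = length Us" "set Us \<subseteq> carrier R" "set Ks \<subseteq> carrier R"
    "\<And>k. k \<in> set Ks \<Longrightarrow> a k \<le> B"
  shows "a (combine Ks Us) \<le> B * sum_list (map a Us)"
  using assms
proof (induction Us arbitrary: Ks)
  case (Cons u Us)
  obtain k ks where K: "Ks = k # ks" "length ks = length Us" using Cons.prems(1) by (cases Ks) auto
  have c: "combine ks Us \<in> carrier R" "u \<in> carrier R" "k \<in> carrier R"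
    using Cons.prems K by auto
  have "a (k \<otimes> u \<oplus> combine ks Us) \<le> a k * a u + a (combine ks Us)"
    using abs_add_le[of "k \<otimes> u" "combine ks Us"] c by (simp add: abs_mult)
  also have "\<dots> \<le> B * a u + B * sum_list (map a Us)"
    using Cons K c abs_nonneg by (intro add_mono mult_right_mono Cons.IH) auto
  finally show ?case using K by (simp add: algebra_simps)
qed auto

lemma abs_freeD:
  "abs_free R a F c Us \<Longrightarrow> set Ks \<subseteq> F \<Longrightarrow> length Ks = length Us \<Longrightarrow> k \<in> set Ks \<Longrightarrow>
    c * a k \<le> a (combine Ks Us)"
  unfolding abs_free_def by blast

lemma abs_free_imp_independent:
  assumes "abs_free R a F c Us" "0 < c" "subfield F R" "set Us \<subseteq> carrier R"
  shows "independent F Us"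
proof (rule trivial_combine_imp_independent[OF assms(3,4)])
  fix Ks assume K: "set Ks \<subseteq> F" "combine Ks Us = \<zero>"
  have Fc: "F \<subseteq> carrier R" using subfieldE(3)[OF assms(3)] .
  have tz: "set (take n Ks) \<subseteq> F" for n using K(1) set_take_subset[of n Ks] by blast
  obtain Ls where Ls: "set (take (length Us) Ks) \<subseteq> set Ls" "set Ls \<subseteq> set (take (length Us) Ks) \<union> {\<zero>}"
    "length Ls = length Us" "combine Ls Us = \<zero>"
    using combine_normalize[of Ks Us \<zero>] K Fc assms(4) by (metis subset_trans)
  have LF: "set Ls \<subseteq> F" using Ls(2) tz[of "length Us"] subringE(2)[OF subfieldE(1)[OF assms(3)]] by blast
  have "k = \<zero>" if "k \<in> set Ls" for k
  proof -
    have "c * a k \<le> 0" using abs_freeD[OF assms(1) LF Ls(3) that] Ls(4) by simp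
    hence "a k \<le> 0" using assms(2) by (simp add: mult_le_0_iff)
    thus ?thesis using abs_nonneg[of k] abs_eq_0[of k] that LF Fc by force
  qed
  thus "set (take (length Us) Ks) \<subseteq> {\<zero>}" using Ls(1) by blast
qed

text \<open>The span is closed. Combinations approaching the negative of \<open>u\<close> have
  coefficients that are Cauchy by \<open>abs_free\<close>; their limits lie in the complete field
  \<open>F\<close> and would put \<open>u\<close> into the span.\<close>

lemma complete_Span_gap:
  assumes sub: "subfield F R" and compl: "abs_complete R a F" and fr: "abs_free R a F c Us" "0 < c"
    and Us: "set Us \<subseteq> carrier R" and u: "u \<in> carrier R" "u \<notin> Span F Us"
  shows "\<exists>\<delta>>0. \<forall>v\<in>Span F Us. \<delta> \<le> a (u \<oplus> v)"
proof (rule ccontr)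
  assume not: "\<not> ?thesis"
  have Fc: "F \<subseteq> carrier R" using subfieldE(3)[OF sub] .
  have "\<exists>Ks. set Ks \<subseteq> F \<and> length Ks = length Us \<and> a (u \<oplus> combine Ks Us) < inverse (real (Suc n))" for n
  proof -
    have "\<not> (\<forall>v\<in>Span F Us. inverse (real (Suc n)) \<le> a (u \<oplus> v))"
      using not by (metis inverse_positive_iff_positive of_nat_0_less_iff zero_less_Suc)
    then obtain v where "v \<in> Span F Us" "a (u \<oplus> v) < inverse (real (Suc n))" by (auto simp: not_le)
    thus ?thesis using Span_mem_iff_length_version[OF sub Us] by metis
  qed
  then obtain K where K: "\<And>n. set (K n) \<subseteq> F" "\<And>n. length (K n) = length Us"
    "\<And>n. a (u \<oplus> combine (K n) Us) < inverse (real (Suc n))" by metis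
  have KR: "set (K n) \<subseteq> carrier R" for n using K(1) Fc by blast
  have cc: "combine (K n) Us \<in> carrier R" for n using KR Us by simp
  have lim0: "(\<lambda>n. a (u \<oplus> combine (K n) Us)) \<longlonglongrightarrow> 0"
    by (rule tendsto_zero_sandwich[OF _ _ LIMSEQ_inverse_real_of_nat])
      (use K(3) u cc abs_nonneg in \<open>auto intro: less_imp_le\<close>)
  have Kc: "K n ! i \<in> F" if "i < length Us" for n i using K(1,2) that by (metis nth_mem subsetD)
  have cau: "(\<lambda>n. K n ! i) \<in> cauchy_seqs R a" if i: "i < length Us" for i
    unfolding cauchy_seqs_def
  proof safe
    fix e :: real assume e: "0 < e"
    \<comment> \<open>Two such values add up to less than \<open>c * e\<close>, which bounds
      \<open>c\<close> times the difference of two coefficients.\<close>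
    have "\<forall>\<^sub>F n in sequentially. a (u \<oplus> combine (K n) Us) < c * e / 2"
      using order_tendstoD(2)[OF lim0, of "c * e / 2"] e fr(2) by simp
    then obtain k where k: "\<And>n. n \<ge> k \<Longrightarrow> a (u \<oplus> combine (K n) Us) < c * e / 2"
      unfolding eventually_sequentially by auto
    have "a (K m ! i \<ominus> K n ! i) < e" if mn: "m \<ge> k" "n \<ge> k" for m n
    proof -
      let ?D = "map2 (\<lambda>x y. x \<ominus> y) (K m) (K n)"
      have D: "?D ! i = K m ! i \<ominus> K n ! i" using i K(2) by simp
      have mem: "?D ! i \<in> set ?D" using i K(2) by (intro nth_mem) simp
      have "set ?D \<subseteq> F"
      proof
        fix x assume "x \<in> set ?D"
        then obtain y z where "y \<in> set (K m)" "z \<in> set (K n)" "x = y \<ominus> z"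
          by (auto dest: set_zip_leftD set_zip_rightD)
        thus "x \<in> F" using K(1) subringE(5,7)[OF subfieldE(1)[OF sub]] unfolding a_minus_def by blast
      qed
      hence "c * a (?D ! i) \<le> a (combine ?D Us)"
        using abs_freeD[OF fr(1) _ _ mem] K(2) by simp
      also have "combine ?D Us = combine (K m) Us \<ominus> combine (K n) Us"
        by (rule combine_diff[symmetric]) (use K(2) Us KR in auto)
      also have "\<dots> = (u \<oplus> combine (K m) Us) \<ominus> (u \<oplus> combine (K n) Us)"
        using u cc[of m] cc[of n] by (simp add: a_minus_def minus_add a_ac r_neg)
          (metis a_assoc a_comm a_inv_closed add.m_closed r_neg2)
      also have "a \<dots> \<le> a (u \<oplus> combine (K m) Us) + a (u \<oplus> combine (K n) Us)"
        using u cc by (intro abs_diff_le) auto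
      also have "\<dots> < c * e" using k[OF mn(1)] k[OF mn(2)] by simp
      finally show ?thesis using fr(2) by (simp add: D)
    qed
    thus "\<exists>k. \<forall>m\<ge>k. \<forall>n\<ge>k. a (K m ! i \<ominus> K n ! i) < e" by blast
  qed (use Kc[OF i] Fc in auto)
  have "\<exists>l\<in>F. abs_tendsto R a (\<lambda>n. K n ! i) l" if "i < length Us" for i
    using compl[unfolded abs_complete_def, rule_format, OF cau[OF that] Kc[OF that]] .
  then obtain f where f: "\<And>i. i < length Us \<Longrightarrow> f i \<in> F" "\<And>i. i < length Us \<Longrightarrow> abs_tendsto R a (\<lambda>n. K n ! i) (f i)"
    by metis
  define l where "l = map f [0..<length Us]"
  have l: "set l \<subseteq> F" "length l = length Us" using f by (auto simp: l_def)
  have lc: "combine l Us \<in> carrier R" using l Us Fc by (intro combine_in_carrier) auto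
  have "abs_tendsto R a (\<lambda>n. combine (K n) Us) (combine l Us)"
    by (rule abs_tendsto_combine) (use l K Us KR Fc f in \<open>auto simp: l_def\<close>)
  hence "abs_tendsto R a (\<lambda>n. u \<oplus> combine (K n) Us) (u \<oplus> combine l Us)"
    by (intro abs_tendsto_add abs_tendsto_const) (use u cc lc in auto)
  moreover have "abs_tendsto R a (\<lambda>n. u \<oplus> combine (K n) Us) \<zero>"
    using lim0 u cc unfolding abs_tendsto_def by (simp add: a_minus_def)
  ultimately have "u \<oplus> combine l Us = \<zero>"
    using u cc lc by (intro abs_tendsto_unique[of "\<lambda>n. u \<oplus> combine (K n) Us"]) auto
  hence "u = \<ominus> combine l Us" using u lc by (metis minus_equality)
  also have "combine l Us \<in> Span F Us" using Span_mem_iff_length_version[OF sub Us] l by blast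
  hence "\<ominus> combine l Us \<in> Span F Us"
    using Span_smult_closed[OF sub Us, of "\<ominus> \<one>" "combine l Us"] lc subringE(3,5)[OF subfieldE(1)[OF sub]]
    by (simp add: l_minus)
  finally show False using u(2) by simp
qed

text \<open>Equivalence of norms in finite dimension. The gap between \<open>u\<close> and the span
  of the other vectors bounds the coefficient of \<open>u\<close>; subtracting that term, the
  induction hypothesis bounds the others.\<close>

theorem independent_imp_abs_free:
  assumes sub: "subfield F R" and compl: "abs_complete R a F" and ind: "independent F Us"
  shows "\<exists>c>0. abs_free R a F c Us"
  using ind
proof (induction Us rule: list.induct)
  case Nil
  show ?case by (intro exI[of _ 1]) (auto simp: abs_free_def)
next
  case (Cons u Us)
  note u = independent_backwards[OF Cons.prems]
  have Fc: "F \<subseteq> carrier R" using subfieldE(3)[OF sub] .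
  have Us: "set Us \<subseteq> carrier R" by (rule independent_in_carrier[OF u(2)])
  obtain c where c: "0 < c" "abs_free R a F c Us" using Cons.IH[OF u(2)] by blast
  obtain \<delta> where \<delta>: "0 < \<delta>" "\<And>v. v \<in> Span F Us \<Longrightarrow> \<delta> \<le> a (u \<oplus> v)"
    using complete_Span_gap[OF sub compl c(2,1) Us u(3,1)] by blast
  have au: "0 \<le> a u" using abs_nonneg u(3) by simp
  \<comment> \<open>For \<open>y = h \<otimes> u \<oplus> z\<close> with \<open>z\<close> in the
    span, \<open>a h \<le> a y / \<delta>\<close>, hence \<open>a z \<le> M * a y\<close>.\<close>
  define M where "M = 1 + a u / \<delta>"
  have M: "M > 0" using au \<delta>(1) by (simp add: M_def add_pos_nonneg)
  have "abs_free R a F (min \<delta> (c / M)) (u # Us)"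
    unfolding abs_free_def
  proof (intro allI impI ballI)
    fix Ks k assume K: "set Ks \<subseteq> F" "length Ks = length (u # Us)" "k \<in> set Ks"
    obtain h hs where h: "Ks = h # hs" "length hs = length Us" using K(2) by (cases Ks) auto
    have hF: "h \<in> F" "set hs \<subseteq> F" using K h by auto
    hence hc: "h \<in> carrier R" "combine hs Us \<in> carrier R" using Fc Us by (auto intro!: combine_in_carrier)
    let ?y = "h \<otimes> u \<oplus> combine hs Us"
    have yc: "?y \<in> carrier R" using hc u by simp
    have span: "combine hs Us \<in> Span F Us" using Span_mem_iff_length_version[OF sub Us] hF h by blast
    have 1: "\<delta> * a h \<le> a ?y"
    proof (cases "h = \<zero>")
      case True thus ?thesis using abs_nonneg[OF yc] by simp
    next
      case False
      have i: "inv h \<in> F" "inv h \<in> carrier R" "h \<otimes> inv h = \<one>"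
        using subfield_m_inv[OF sub, of h] hF False Fc by auto
      have "?y = h \<otimes> (u \<oplus> inv h \<otimes> combine hs Us)"
        using hc u i by (simp add: r_distr m_assoc[symmetric])
      hence "a ?y = a h * a (u \<oplus> inv h \<otimes> combine hs Us)" using hc u i by (simp add: abs_mult)
      moreover have "\<delta> \<le> a (u \<oplus> inv h \<otimes> combine hs Us)"
        by (rule \<delta>(2)) (use Span_smult_closed[OF sub Us i(1) span] in simp)
      hence "a h * \<delta> \<le> a h * a (u \<oplus> inv h \<otimes> combine hs Us)"
        using abs_nonneg[OF hc(1)] by (rule mult_left_mono)
      ultimately show ?thesis by (simp add: mult.commute)
    qed
    have "combine hs Us = ?y \<ominus> h \<otimes> u" using hc u
      by (simp add: a_minus_def a_comm[of "h \<otimes> u"] a_assoc r_neg)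
    hence "a (combine hs Us) \<le> a ?y + a h * a u"
      using abs_diff_le[of ?y "h \<otimes> u"] hc u by (simp add: abs_mult)
    also have "a h * a u \<le> (a ?y / \<delta>) * a u"
      using 1 \<delta>(1) au by (intro mult_right_mono) (auto simp: field_simps)
    finally have "a (combine hs Us) \<le> a ?y + (a ?y / \<delta>) * a u" by simp
    moreover have "M * Y = Y + (Y / \<delta>) * a u" for Y by (simp add: M_def distrib_right)
    ultimately have 2: "a (combine hs Us) \<le> M * a ?y" by simp
    have cb: "combine Ks (u # Us) = ?y" using h by simp
    show "min \<delta> (c / M) * a k \<le> a (combine Ks (u # Us))"
    proof (cases "k = h")
      case True
      have "min \<delta> (c / M) * a h \<le> \<delta> * a h" using abs_nonneg[OF hc(1)] by (intro mult_right_mono) auto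
      thus ?thesis using 1 True cb by simp
    next
      case False
      hence k: "k \<in> set hs" using K(3) h by simp
      have "min \<delta> (c / M) * a k \<le> c / M * a k"
        using abs_nonneg[of k] k hF Fc by (intro mult_right_mono) auto
      also have "\<dots> \<le> a (combine hs Us) / M"
        using abs_freeD[OF c(2) hF(2) h(2) k] M by (simp add: divide_right_mono)
      also have "\<dots> \<le> a ?y" using 2 M by (simp add: field_simps)
      finally show ?thesis using cb by simp
    qed
  qed
  moreover have "min \<delta> (c / M) > 0" using \<delta>(1) c(1) M by simp
  ultimately show ?case by blast
qed

end

text \<open>All powers of \<open>x\<close> lie in the finite-dimensional space generated by
  \<open>x\<close> over \<open>F\<close>. There \<open>b1\<close> controls the coefficients, on
  which \<open>b2\<close> agrees with it, so \<open>b2 \<le> C * b1\<close> with a fixed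
  \<open>C\<close>. Applied to large powers of \<open>x\<close>, this rules out
  \<open>b1 x < b2 x\<close>.\<close>

lemma extension_le:
  assumes "valued_field R b1" "valued_field R b2" "subfield F R" "abs_complete R b1 F"
    "\<And>x. x \<in> F \<Longrightarrow> b2 x = b1 x" "x \<in> carrier R" "ring.algebraic R F x"
  shows "b2 x \<le> b1 x"
proof -
  interpret A: valued_field R b1 by fact
  interpret B: valued_field R b2 by fact
  have alg: "(A.algebraic over F) x" using assms(7) by (simp add: over_def)
  define Us where "Us = A.exp_base x (length (A.Irr F x) - 1)"
  have Us: "A.independent F Us" "A.Span F Us = A.simple_extension F x" "set Us \<subseteq> carrier R"
    unfolding Us_def using A.exp_base_independent[OF assms(3,6) alg] A.Span_exp_base[OF assms(3,6) alg]
      A.exp_base_closed[OF assms(6)] by auto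
  have Fc: "F \<subseteq> carrier R" using subfieldE(3)[OF assms(3)] .
  obtain c where c: "c > 0" "abs_free R b1 F c Us"
    using A.independent_imp_abs_free[OF assms(3,4) Us(1)] by blast
  define C where "C = sum_list (map b2 Us) / c"
  have bound: "b2 y \<le> C * b1 y" if y: "y \<in> A.simple_extension F x" for y
  proof -
    obtain Ks where K: "set Ks \<subseteq> F" "length Ks = length Us" "y = A.combine Ks Us"
      using y A.Span_mem_iff_length_version[OF assms(3) Us(3), of y] Us(2) by blast
    have "b2 k \<le> b1 y / c" if "k \<in> set Ks" for k
      using A.abs_freeD[OF c(2) K(1,2) that] assms(5)[of k] that K c(1) by (auto simp: field_simps)
    hence "b2 y \<le> b1 y / c * sum_list (map b2 Us)"
      unfolding K(3) by (intro B.abs_combine_le) (use K Us Fc in auto)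
    thus ?thesis by (simp add: C_def mult.commute)
  qed
  have pw: "x [^]\<^bsub>R\<^esub> n \<in> A.simple_extension F x" for n :: nat
  proof -
    have "subring (A.simple_extension F x) R"
      by (rule A.simple_extension_is_subring[OF subfieldE(1)[OF assms(3)] assms(6)])
    moreover have "x \<in> A.simple_extension F x"
      by (rule A.simple_extension_mem[OF subfieldE(1)[OF assms(3)] assms(6)])
    ultimately show ?thesis by (induction n) (auto dest: subringE)
  qed
  have pows: "b2 x ^ n \<le> C * b1 x ^ n" for n
    using bound[OF pw[of n]] assms(6) by (simp add: A.abs_pow B.abs_pow)
  show ?thesis
  proof (rule ccontr)
    assume "\<not> b2 x \<le> b1 x"
    hence lt: "b1 x < b2 x" by simp
    have "b1 x \<noteq> 0" using lt A.abs_eq_0[OF assms(6)] B.abs_zero by auto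
    hence pos: "b1 x > 0" using A.abs_nonneg[OF assms(6)] by simp
    have "1 < b2 x / b1 x" using lt pos by simp
    then obtain n where "C < (b2 x / b1 x) ^ n" using real_arch_pow by blast
    hence "C * b1 x ^ n < b2 x ^ n" using pos by (simp add: power_divide field_simps)
    thus False using pows[of n] by simp
  qed
qed

theorem extension_unique:
  assumes "valued_field R b1" "valued_field R b2" "subfield F R" "abs_complete R b1 F" "abs_complete R b2 F"
    "\<And>x. x \<in> F \<Longrightarrow> b2 x = b1 x" "x \<in> carrier R" "ring.algebraic R F x"
  shows "b2 x = b1 x"
  using extension_le[of R b1 b2 F x] extension_le[of R b2 b1 F x] assms by (simp add: order_antisym)

section \<open>Completions and algebraic closures of valued fields\<close>

text \<open>\<open>local_base\<close> for a general subset: by \<open>completion_closure_iff\<close>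
  this is the topological closure of the image of \<open>F\<close>.\<close>

definition completion_closure :: "('a, 'm) ring_scheme \<Rightarrow> ('a \<Rightarrow> real) \<Rightarrow> 'a set \<Rightarrow> (nat \<Rightarrow> 'a) set set" where
  "completion_closure R a F = {C \<in> carrier (completion R a). \<exists>s\<in>C. \<forall>n. s n \<in> F}"

lemma (in ring) finite_Span_base:
  assumes "subfield K R" "set Us \<subseteq> carrier R"
  shows "\<exists>Vs. independent K Vs \<and> Span K Vs = Span K Us \<and> length Vs \<le> length Us"
  using assms(2)
proof (induction Us)
  case Nil
  show ?case by (intro exI[of _ "[]"]) auto
next
  case (Cons u Us)
  then obtain Vs where V: "independent K Vs" "Span K Vs = Span K Us" "length Vs \<le> length Us" by auto
  have eq: "Span K (u # Vs) = Span K (u # Us)" using V(2) by simp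
  show ?case
  proof (cases "u \<in> Span K Vs")
    case True
    have Vc: "set Vs \<subseteq> carrier R" by (rule independent_in_carrier[OF V(1)])
    have uc: "u \<in> carrier R" using Cons.prems by simp
    have "Span K (u # Vs) \<subseteq> Span K Vs"
      using mono_Span_subset[OF assms(1) _ Vc, of "u # Vs"] True Span_base_incl[OF assms(1) Vc] by simp
    hence "Span K (u # Vs) = Span K Vs" using mono_Span[OF assms(1) Vc uc] by blast
    thus ?thesis using V eq by (intro exI[of _ Vs]) auto
  next
    case False
    hence "independent K (u # Vs)" using V(1) Cons.prems by (intro li_Cons) auto
    thus ?thesis using V eq by (intro exI[of _ "u # Vs"]) auto
  qed
qed

lemma (in ring) combine_diff_right:
  assumes "length Us = length Ks" "length Vs = length Ks"
    "set Us \<subseteq> carrier R" "set Ks \<subseteq> carrier R" "set Vs \<subseteq> carrier R"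
  shows "combine Ks Us \<ominus> combine Ks Vs = combine Ks (map2 (\<lambda>x y. x \<ominus> y) Us Vs)"
  using assms
proof (induction Ks arbitrary: Us Vs)
  case (Cons k Ks)
  obtain u us where U: "Us = u # us" "length us = length Ks" using Cons.prems(1) by (cases Us) auto
  obtain v vs where V: "Vs = v # vs" "length vs = length Ks" using Cons.prems(2) by (cases Vs) auto
  have c: "combine Ks us \<in> carrier R" "combine Ks vs \<in> carrier R" "u \<in> carrier R" "k \<in> carrier R" "v \<in> carrier R"
    using Cons.prems U V by auto
  have "(k \<otimes> u \<oplus> combine Ks us) \<ominus> (k \<otimes> v \<oplus> combine Ks vs)
    = k \<otimes> (u \<ominus> v) \<oplus> (combine Ks us \<ominus> combine Ks vs)"
    using c by (simp add: a_minus_def r_distr r_minus minus_add a_ac)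
  thus ?case using Cons U V by simp
qed (simp add: a_minus_def)

text \<open>After scaling to sum 1 this is \<open>t \<le> t powr s\<close> on the unit interval. It
  is the reason why \<open>d\<^sub>v/d\<close> must not exceed 1.\<close>

lemma powr_add_le:
  fixes x y s :: real
  assumes "0 \<le> x" "0 \<le> y" "0 < s" "s \<le> 1"
  shows "(x + y) powr s \<le> x powr s + y powr s"
proof (cases "x + y = 0")
  case False
  hence z: "x + y > 0" using assms by simp
  have *: "t \<le> t powr s" if "0 \<le> t" "t \<le> 1" for t :: real
  proof (cases "t = 0")
    case False
    have "t powr 1 \<le> t powr s" using that assms False by (intro powr_mono') auto
    thus ?thesis using that False by simp
  qed simp
  have "1 = x / (x + y) + y / (x + y)" using z by (simp add: add_divide_distrib[symmetric])
  also have "\<dots> \<le> (x / (x + y)) powr s + (y / (x + y)) powr s"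
    using assms z by (intro add_mono *) auto
  also have "\<dots> = (x powr s + y powr s) / (x + y) powr s"
    using assms by (simp add: powr_divide add_divide_distrib)
  finally show ?thesis using z by (simp add: field_simps)
qed (use assms in auto)

section \<open>Powers of an absolute value, closures of subfields, algebraic closures\<close>

context valued_field
begin

lemma valued_field_powr:
  assumes "0 < s" "s \<le> 1" shows "valued_field R (\<lambda>x. a x powr s)"
proof -
  have "abs_value R (\<lambda>x. a x powr s)"
    unfolding abs_value_def
  proof (intro conjI ballI)
    fix x y assume "x \<in> carrier R" "y \<in> carrier R"
    thus "a (x \<otimes> y) powr s = a x powr s * a y powr s"
      and "a (x \<oplus> y) powr s \<le> a x powr s + a y powr s"
      using abs_nonneg[of x] abs_nonneg[of y] abs_nonneg[of "x \<oplus> y"] assms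
      by (auto simp: abs_mult powr_mult intro!: order_trans[OF powr_mono2[OF _ _ abs_add_le] powr_add_le])
  qed (use abs_eq_0 in auto)
  thus ?thesis by (simp add: valued_field_def valued_field_axioms_def field_axioms)
qed

lemma abs_complete_powr:
  assumes s: "0 < s" and compl: "abs_complete R a F" and F: "F \<subseteq> carrier R"
  shows "abs_complete R (\<lambda>x. a x powr s) F"
  unfolding abs_complete_def
proof (intro ballI impI)
  fix t assume t: "t \<in> cauchy_seqs R (\<lambda>x. a x powr s)" "\<forall>n. t n \<in> F"
  have tc: "t n \<in> carrier R" for n using t F by auto
  have "t \<in> cauchy_seqs R a" unfolding cauchy_seqs_def
  proof safe
    fix e :: real assume e: "0 < e"
    hence "\<exists>k. \<forall>m\<ge>k. \<forall>n\<ge>k. a (t m \<ominus> t n) powr s < e powr s"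
      using t(1) unfolding cauchy_seqs_def by simp
    thus "\<exists>k. \<forall>m\<ge>k. \<forall>n\<ge>k. a (t m \<ominus> t n) < e"
      using s e tc abs_nonneg by (meson less_imp_le minus_closed not_le powr_mono2)
  qed (rule tc)
  then obtain l where l: "l \<in> F" "abs_tendsto R a t l" using compl t(2) unfolding abs_complete_def by blast
  have "(\<lambda>n. a (t n \<ominus> l) powr s) \<longlonglongrightarrow> 0 powr s"
    using l(2) s tc F l(1) abs_nonneg unfolding abs_tendsto_def
    by (intro tendsto_powr2) (auto intro!: always_eventually simp: subset_iff)
  thus "\<exists>l\<in>F. abs_tendsto R (\<lambda>x. a x powr s) t l"
    using l(1) s unfolding abs_tendsto_def by auto
qed

lemma emb_hom_ring: "ring_hom_ring R (completion R a) (completion_emb R a)"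
  by (rule ring_hom_ringI2[OF ring_axioms _ completion_emb_hom])
    (rule cring.axioms(1)[OF completion_cring])

lemma completion_emb_closed: "x \<in> carrier R \<Longrightarrow> completion_emb R a x \<in> carrier (completion R a)"
  using Ring.ring_hom_closed[OF completion_emb_hom] .

lemma completion_closure_iff:
  assumes F: "F \<subseteq> carrier R"
  shows "C \<in> completion_closure R a F \<longleftrightarrow> C \<in> carrier (completion R a) \<and>
    (\<exists>s. (\<forall>n. s n \<in> F) \<and> abs_tendsto (completion R a) (completion_abs a) (\<lambda>n. completion_emb R a (s n)) C)"
proof
  assume "C \<in> completion_closure R a F"
  then obtain s where s: "C \<in> carrier (completion R a)" "s \<in> C" "\<forall>n. s n \<in> F"
    unfolding completion_closure_def by blast
  thus "C \<in> carrier (completion R a) \<and>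
    (\<exists>s. (\<forall>n. s n \<in> F) \<and> abs_tendsto (completion R a) (completion_abs a) (\<lambda>n. completion_emb R a (s n)) C)"
    using completion_rep_tendsto[OF s(1,2)] by blast
next
  assume *: "C \<in> carrier (completion R a) \<and>
    (\<exists>s. (\<forall>n. s n \<in> F) \<and> abs_tendsto (completion R a) (completion_abs a) (\<lambda>n. completion_emb R a (s n)) C)"
  then obtain s where s: "\<forall>n. s n \<in> F" "abs_tendsto (completion R a) (completion_abs a) (\<lambda>n. completion_emb R a (s n)) C"
    by blast
  have "s \<in> C" by (rule completion_mem_of_tendsto) (use * s F in auto)
  thus "C \<in> completion_closure R a F" unfolding completion_closure_def using * s by blast
qed

context
  fixes F assumes F: "subfield F R"
begin

lemma Fc: "F \<subseteq> carrier R" using subfieldE(3)[OF F] .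

lemma emb_in_closure: "x \<in> F \<Longrightarrow> completion_emb R a x \<in> completion_closure R a F"
proof -
  interpret C: valued_field "completion R a" "completion_abs a" by (rule completion_valued_field)
  assume x: "x \<in> F"
  have c: "completion_emb R a x \<in> carrier (completion R a)" using x Fc completion_emb_closed by blast
  show ?thesis unfolding completion_closure_iff[OF Fc]
    using c x C.abs_tendsto_const[OF c] by (intro conjI exI[of _ "\<lambda>n. x"]) auto
qed

lemma completion_closure_subfield: "subfield (completion_closure R a F) (completion R a)"
proof -
  interpret C: valued_field "completion R a" "completion_abs a" by (rule completion_valued_field)
  interpret h: ring_hom_ring R "completion R a" "completion_emb R a" by (rule emb_hom_ring)
  let ?C = "completion R a" and ?e = "completion_emb R a" and ?A = "completion_abs a"
  note sr = subringE[OF subfieldE(1)[OF F]]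
  have lim: "\<exists>s. (\<forall>n. s n \<in> F) \<and> abs_tendsto ?C ?A (\<lambda>n. ?e (s n)) c" if "c \<in> completion_closure R a F" for c
    using that completion_closure_iff[OF Fc] by blast
  have car: "c \<in> carrier ?C" if "c \<in> completion_closure R a F" for c
    using that completion_closure_iff[OF Fc] by blast
  show ?thesis
  proof (rule C.subfieldI')
    show "subring (completion_closure R a F) ?C"
    proof (rule C.subringI)
      show "completion_closure R a F \<subseteq> carrier ?C" using car by blast
      show "\<one>\<^bsub>?C\<^esub> \<in> completion_closure R a F" using emb_in_closure[OF sr(3)] by simp
      fix c assume c: "c \<in> completion_closure R a F"
      obtain s where s: "\<And>n. s n \<in> F" "abs_tendsto ?C ?A (\<lambda>n. ?e (s n)) c" using lim[OF c] by blast
      have sR: "s n \<in> carrier R" for n using s(1) Fc by blast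
      note sC = completion_emb_closed[OF sR]
      have "abs_tendsto ?C ?A (\<lambda>n. ?e (\<ominus> s n)) (\<ominus>\<^bsub>?C\<^esub> c)"
        using C.abs_tendsto_minus[OF sC car[OF c] s(2)] h.hom_a_inv[OF sR] by simp
      thus "\<ominus>\<^bsub>?C\<^esub> c \<in> completion_closure R a F"
        unfolding completion_closure_iff[OF Fc] using car[OF c] s(1) sr(5) by (intro conjI exI[of _ "\<lambda>n. \<ominus> s n"]) auto
      fix d assume d: "d \<in> completion_closure R a F"
      obtain t where t: "\<And>n. t n \<in> F" "abs_tendsto ?C ?A (\<lambda>n. ?e (t n)) d" using lim[OF d] by blast
      have tR: "t n \<in> carrier R" for n using t(1) Fc by blast
      note tC = completion_emb_closed[OF tR]
      have "abs_tendsto ?C ?A (\<lambda>n. ?e (s n \<otimes> t n)) (c \<otimes>\<^bsub>?C\<^esub> d)"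
        using C.abs_tendsto_mult[OF sC tC car[OF c] car[OF d] s(2) t(2)] h.hom_mult[OF sR tR] by simp
      thus "c \<otimes>\<^bsub>?C\<^esub> d \<in> completion_closure R a F"
        unfolding completion_closure_iff[OF Fc] using car[OF c] car[OF d] s(1) t(1) sr(6)
        by (intro conjI exI[of _ "\<lambda>n. s n \<otimes> t n"]) auto
      have "abs_tendsto ?C ?A (\<lambda>n. ?e (s n \<oplus> t n)) (c \<oplus>\<^bsub>?C\<^esub> d)"
        using C.abs_tendsto_add[OF sC tC car[OF c] car[OF d] s(2) t(2)] h.hom_add[OF sR tR] by simp
      thus "c \<oplus>\<^bsub>?C\<^esub> d \<in> completion_closure R a F"
        unfolding completion_closure_iff[OF Fc] using car[OF c] car[OF d] s(1) t(1) sr(7)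
        by (intro conjI exI[of _ "\<lambda>n. s n \<oplus> t n"]) auto
    qed
    fix c assume c: "c \<in> completion_closure R a F - {\<zero>\<^bsub>?C\<^esub>}"
    hence cc: "c \<in> completion_closure R a F" "c \<noteq> \<zero>\<^bsub>?C\<^esub>" by auto
    obtain s where s: "\<And>n. s n \<in> F" "abs_tendsto ?C ?A (\<lambda>n. ?e (s n)) c" using lim[OF cc(1)] by blast
    have sR: "s n \<in> carrier R" for n using s(1) Fc by blast
    note sC = completion_emb_closed[OF sR]
    have "(\<lambda>n. ?A (?e (s n))) \<longlonglongrightarrow> ?A c" by (rule C.abs_tendsto_abs[OF sC car[OF cc(1)] s(2)])
    hence "\<forall>\<^sub>F n in sequentially. 0 < ?A (?e (s n))"
      using C.abs_pos[OF car[OF cc(1)] cc(2)] by (rule order_tendstoD(1))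
    then obtain k where k: "\<And>n. n \<ge> k \<Longrightarrow> 0 < ?A (?e (s n))" unfolding eventually_sequentially by blast
    have nz: "s n \<noteq> \<zero>" if "n \<ge> k" for n using k[OF that] by auto
    \<comment> \<open>Passing to a tail removes the zeros of \<open>s\<close>, so that the inverses
      converge.\<close>
    define t where "t n = s (n + k)" for n
    have t: "t n \<in> F" "t n \<in> carrier R" "t n \<noteq> \<zero>" for n using s(1) sR nz by (auto simp: t_def)
    have "abs_tendsto ?C ?A (\<lambda>n. ?e (t n)) c"
      using LIMSEQ_ignore_initial_segment[OF s(2)[unfolded abs_tendsto_def], of k] by (simp add: abs_tendsto_def t_def)
    moreover have enz: "?e (t n) \<noteq> \<zero>\<^bsub>?C\<^esub>" for n
      using k[of "n + k"] by (auto simp: t_def)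
    ultimately have lim': "abs_tendsto ?C ?A (\<lambda>n. inv\<^bsub>?C\<^esub> ?e (t n)) (inv\<^bsub>?C\<^esub> c)"
      using t(2) car[OF cc(1)] cc(2) by (intro C.abs_tendsto_inv) auto
    have einv: "?e (inv (t n)) = inv\<^bsub>?C\<^esub> ?e (t n)" for n
    proof -
      have U: "t n \<in> Units R" using t field_Units by blast
      have "?e (inv (t n)) \<otimes>\<^bsub>?C\<^esub> ?e (t n) = \<one>\<^bsub>?C\<^esub>"
        using h.hom_mult[of "inv (t n)" "t n"] U Units_l_inv[OF U] h.hom_one t(2) by simp
      thus ?thesis using U t(2) C.inv_unique' C.comm_inv_char C.m_comm by (metis Units_inv_closed h.hom_closed)
    qed
    have "inv (t n) \<in> F" for n using subfield_m_inv(1)[OF F] t by blast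
    thus "inv\<^bsub>?C\<^esub> c \<in> completion_closure R a F"
      unfolding completion_closure_iff[OF Fc] using lim' cc car[OF cc(1)] C.field_Units
      by (intro conjI exI[of _ "\<lambda>n. inv (t n)"]) (auto simp: einv)
  qed
qed

lemma completion_closure_complete:
  "abs_complete (completion R a) (completion_abs a) (completion_closure R a F)"
  unfolding abs_complete_def
proof (intro ballI impI)
  interpret C: valued_field "completion R a" "completion_abs a" by (rule completion_valued_field)
  let ?C = "completion R a" and ?e = "completion_emb R a" and ?A = "completion_abs a"
  fix S assume S: "S \<in> cauchy_seqs ?C ?A" "\<forall>n. S n \<in> completion_closure R a F"
  have SC: "S n \<in> carrier ?C" for n using S(2) completion_closure_iff[OF Fc] by blast
  obtain l where l: "l \<in> carrier ?C" "abs_tendsto ?C ?A S l"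
    using completion_complete S(1) SC unfolding abs_complete_def by blast
  have "\<exists>x\<in>F. ?A (?e x \<ominus>\<^bsub>?C\<^esub> S n) < inverse (real (Suc n))" for n
  proof -
    obtain s where s: "\<And>m. s m \<in> F" "abs_tendsto ?C ?A (\<lambda>m. ?e (s m)) (S n)"
      using S(2) completion_closure_iff[OF Fc] by blast
    have "\<forall>\<^sub>F m in sequentially. ?A (?e (s m) \<ominus>\<^bsub>?C\<^esub> S n) < inverse (real (Suc n))"
      using s(2) unfolding abs_tendsto_def by (rule order_tendstoD(2)) simp
    thus ?thesis using s(1) by (auto simp: eventually_sequentially)
  qed
  then obtain x where x: "\<And>n. x n \<in> F" "\<And>n. ?A (?e (x n) \<ominus>\<^bsub>?C\<^esub> S n) < inverse (real (Suc n))" by metis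
  have xC: "?e (x n) \<in> carrier ?C" for n using x(1) Fc completion_emb_closed by blast
  have lim: "(\<lambda>n. inverse (real (Suc n)) + ?A (S n \<ominus>\<^bsub>?C\<^esub> l)) \<longlonglongrightarrow> 0 + 0"
    using l(2) unfolding abs_tendsto_def by (intro tendsto_add LIMSEQ_inverse_real_of_nat)
  have "abs_tendsto ?C ?A (\<lambda>n. ?e (x n)) l"
    unfolding abs_tendsto_def
  proof (rule tendsto_zero_sandwich[OF _ _ lim[simplified]])
    fix n
    show "?A (?e (x n) \<ominus>\<^bsub>?C\<^esub> l) \<le> inverse (1 + real n) + ?A (S n \<ominus>\<^bsub>?C\<^esub> l)"
      using C.abs_triangle[OF xC[of n] SC[of n] l(1)] x(2)[of n] by simp
  qed (use xC l in \<open>auto intro: C.abs_nonneg\<close>)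
  hence "l \<in> completion_closure R a F" unfolding completion_closure_iff[OF Fc] using l(1) x(1) by blast
  thus "\<exists>l\<in>completion_closure R a F. abs_tendsto ?C ?A S l" using l(2) by blast
qed

end

text \<open>The description in \<open>closure_abs\<close> denotes: existence is
  \<open>exists_extension\<close> over the image of \<open>R\<close>, and uniqueness is
  \<open>extension_unique\<close>. The latter applies because the image is a copy of the complete
  field \<open>R\<close> for every extension of \<open>a\<close>.\<close>

lemma closure_abs_props:
  assumes "abs_complete R a (carrier R)"
  shows "valued_field alg_closure (closure_abs R a)"
    "x \<in> carrier R \<Longrightarrow> closure_abs R a (indexed_const x) = a x"
    "indexed_const \<in> Ring.ring_hom R alg_closure"
proof -
  let ?L = "alg_closure" and ?ic = "indexed_const :: 'a \<Rightarrow> ('a list \<times> nat) multiset \<Rightarrow> 'a"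
  define F :: "(('a list \<times> nat) multiset \<Rightarrow> 'a) set" where "F = ?ic ` carrier R"
  interpret L: algebraic_closure ?L F unfolding F_def by (rule alg_closureE(1))
  show hom: "?ic \<in> Ring.ring_hom R ?L" by (rule alg_closureE(2))
  interpret h: ring_hom_ring R ?L ?ic by (rule ring_hom_ringI2[OF ring_axioms L.ring_axioms hom])
  have inj: "inj_on ?ic (carrier R)"
    using h.img_is_subfield(1)[OF carrier_is_subfield] L.one_not_zero by simp
  define g where "g = inv_into (carrier R) ?ic"
  have g: "g (?ic x) = x" if "x \<in> carrier R" for x
    unfolding g_def using inj that by (rule inv_into_f_f)
  define a' where "a' = a \<circ> g"
  have a': "a' (?ic x) = a x" if "x \<in> carrier R" for x using g[OF that] by (simp add: a'_def)
  have subF: "subfield F ?L" by (rule L.subfield_axioms)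
  have avF: "abs_value (?L\<lparr>carrier := F\<rparr>) a'"
    unfolding abs_value_def
  proof (intro conjI ballI)
    fix y assume "y \<in> carrier (?L\<lparr>carrier := F\<rparr>)"
    then obtain x where x: "x \<in> carrier R" "y = ?ic x" by (auto simp: F_def)
    have "?ic x = \<zero>\<^bsub>?L\<^esub> \<longleftrightarrow> x = \<zero>"
      using inj x(1) h.hom_zero by (metis inj_onD zero_closed)
    thus "0 \<le> a' y" "(a' y = 0) = (y = \<zero>\<^bsub>?L\<lparr>carrier := F\<rparr>\<^esub>)"
      using x abs_nonneg abs_eq_0 by (auto simp: a')
    fix z assume "z \<in> carrier (?L\<lparr>carrier := F\<rparr>)"
    then obtain w where w: "w \<in> carrier R" "z = ?ic w" by (auto simp: F_def)
    show "a' (y \<otimes>\<^bsub>?L\<lparr>carrier := F\<rparr>\<^esub> z) = a' y * a' z"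
      and "a' (y \<oplus>\<^bsub>?L\<lparr>carrier := F\<rparr>\<^esub> z) \<le> a' y + a' z"
      using x w abs_mult abs_add_le by (simp_all add: a' flip: h.hom_mult h.hom_add)
  qed
  have complF: "abs_complete ?L b F" if b: "\<And>x. x \<in> carrier R \<Longrightarrow> b (?ic x) = a x" for b
    unfolding abs_complete_def
  proof (intro ballI impI)
    fix s assume s: "s \<in> cauchy_seqs ?L b" "\<forall>n. s n \<in> F"
    define t where "t n = g (s n)" for n
    have t: "t n \<in> carrier R" "s n = ?ic (t n)" for n
      using s(2) g unfolding t_def F_def by (metis imageE)+
    have d: "b (?ic x \<ominus>\<^bsub>?L\<^esub> ?ic y) = a (x \<ominus> y)" if "x \<in> carrier R" "y \<in> carrier R" for x y
    proof -
      have "?ic x \<ominus>\<^bsub>?L\<^esub> ?ic y = ?ic (x \<ominus> y)"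
        using that by (simp add: a_minus_def)
      thus ?thesis using b that by simp
    qed
    have "t \<in> cauchy_seqs R a"
      using s(1) t(1) unfolding cauchy_seqs_def by (simp add: t(2) d)
    then obtain l where l: "l \<in> carrier R" "abs_tendsto R a t l"
      using assms t(1) unfolding abs_complete_def by blast
    hence "abs_tendsto ?L b s (?ic l)" unfolding abs_tendsto_def t(2) using t(1) by (simp add: d)
    thus "\<exists>l\<in>F. abs_tendsto ?L b s l" using l(1) unfolding F_def by blast
  qed
  interpret E: abs_extension ?L F a'
    by unfold_locales (use subF avF L.algebraic_extension in auto)
  obtain b where b: "abs_value ?L b" "\<forall>x\<in>F. b x = a' x" using E.exists_extension by blast
  have vfI: "valued_field ?L c" if "abs_value ?L c" for c
    using that L.field_axioms by (simp add: valued_field_def valued_field_axioms_def)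
  \<comment> \<open>An arbitrary extension, made extensional so that agreement on the carrier
    becomes equality of functions.\<close>
  define b' where "b' = restrict b (carrier ?L)"
  have "abs_value ?L b'" using b(1) unfolding abs_value_def b'_def by simp
  have "closure_abs R a = b'"
    unfolding closure_abs_def
  proof (rule the_equality)
    have "b' (?ic x) = a x" if "x \<in> carrier R" for x
      using b(2) a'[OF that] that by (simp add: b'_def F_def)
    thus "b' \<in> extensional (carrier ?L) \<and> abs_value ?L b' \<and> (\<forall>x\<in>carrier R. b' (?ic x) = a x)"
      using \<open>abs_value ?L b'\<close> by (auto simp: b'_def)
    fix c assume c: "c \<in> extensional (carrier ?L) \<and> abs_value ?L c \<and> (\<forall>x\<in>carrier R. c (?ic x) = a x)"
    show "c = b'"
    proof (rule extensionalityI)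
      show "c \<in> extensional (carrier ?L)" "b' \<in> extensional (carrier ?L)" using c by (auto simp: b'_def)
      fix y assume y: "y \<in> carrier ?L"
      show "c y = b' y"
      proof (rule extension_unique[of ?L b' c F])
        show "valued_field ?L b'" "valued_field ?L c" using vfI \<open>abs_value ?L b'\<close> c by auto
        show "abs_complete ?L b' F" "abs_complete ?L c F"
          by (rule complF, use \<open>\<And>x. x \<in> carrier R \<Longrightarrow> b' (?ic x) = a x\<close> in blast)
            (rule complF, use c in blast)
        show "c x = b' x" if "x \<in> F" for x
          using that c \<open>\<And>x. x \<in> carrier R \<Longrightarrow> b' (?ic x) = a x\<close> by (auto simp: F_def)
        show "L.algebraic F y" using L.algebraic_extension[OF y] by (simp add: over_def)
      qed (use y subF in auto)
    qed
  qed
  thus "valued_field ?L (closure_abs R a)" using vfI \<open>abs_value ?L b'\<close> by simp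
  assume "x \<in> carrier R"
  thus "closure_abs R a (?ic x) = a x"
    unfolding \<open>closure_abs R a = b'\<close> using b(2) a' by (simp add: b'_def F_def)
qed

end

section \<open>Places of a number field\<close>

definition rat_indep :: "qbar list \<Rightarrow> bool" where
  "rat_indep xs \<longleftrightarrow> (\<forall>q :: nat \<Rightarrow> rat. (\<Sum>j<length xs. of_rat (q j) * xs ! j) = 0 \<longrightarrow> (\<forall>j<length xs. q j = 0))"

text \<open>Rational form of linear independence over the closure of the rationals in the completion \<open>K\<^sub>v\<close>: the
  local degree is the largest length of a \<open>v\<close>-free list of elements of \<open>K\<close>.\<close>

definition v_free :: "(qbar \<Rightarrow> real) \<Rightarrow> qbar list \<Rightarrow> bool" where
  "v_free v xs \<longleftrightarrow> (\<exists>c>0. \<forall>q :: nat \<Rightarrow> rat. \<forall>i<length xs.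
     c * v (of_rat (q i)) \<le> v (\<Sum>j<length xs. of_rat (q j) * xs ! j))"

lemma class_ring_field: "field (class_ring :: 'a :: field ring)"
  by (rule class_field.field_axioms)

lemma class_ring_inv:
  fixes x :: "'a :: field"
  assumes "x \<noteq> 0" shows "inv\<^bsub>class_ring\<^esub> x = inverse x"
proof -
  define Z where "Z = (class_ring :: 'a ring)"
  have Zs [simp]: "carrier Z = UNIV" "monoid.mult Z = (*)" "monoid.one Z = 1" "ring.zero Z = 0" "ring.add Z = (+)"
    by (simp_all add: Z_def)
  interpret F: field Z unfolding Z_def by (rule class_ring_field)
  show ?thesis unfolding Z_def[symmetric] using F.comm_inv_char[of x "inverse x"] assms by simp
qed

lemma class_ring_minus: "\<ominus>\<^bsub>class_ring\<^esub> x = - (x :: 'a :: field)"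
proof -
  define Z where "Z = (class_ring :: 'a ring)"
  have Zs [simp]: "carrier Z = UNIV" "monoid.mult Z = (*)" "monoid.one Z = 1" "ring.zero Z = 0" "ring.add Z = (+)"
    by (simp_all add: Z_def)
  interpret F: field Z unfolding Z_def by (rule class_ring_field)
  show ?thesis unfolding Z_def[symmetric] using F.minus_equality[of "- x" x] by simp
qed

text \<open>A separate constant rather than an abbreviation, so that simplification sees only the
  operations in \<open>KR_simps\<close>.\<close>

definition KR :: "qbar set \<Rightarrow> qbar ring" where "KR K = field_of K"

lemma KR_simps [simp]: "carrier (KR K) = K" "monoid.mult (KR K) = (*)" "monoid.one (KR K) = 1"
    "ring.zero (KR K) = 0" "ring.add (KR K) = (+)"
  by (simp_all add: KR_def)

lemma combine_sum:
  fixes R :: "'a :: field ring"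
  assumes "ring R" "monoid.mult R = (*)" "ring.zero R = 0" "ring.add R = (+)" "length Ks = length Us"
  shows "ring.combine R Ks Us = (\<Sum>i<length Us. Ks ! i * Us ! i)"
proof -
  interpret R: ring R by fact
  show ?thesis using assms(5)
  proof (induction Us arbitrary: Ks)
    case (Cons u Us)
    then obtain k ks where "Ks = k # ks" "length ks = length Us" by (cases Ks) auto
    thus ?case using Cons.IH[of ks] assms(2-4) by (simp add: sum.lessThan_Suc_shift del: sum.lessThan_Suc)
  qed (simp add: assms)
qed

lemma Rats_list:
  assumes "set Ks \<subseteq> (\<rat> :: 'a :: field_char_0 set)"
  obtains q where "\<And>i. i < length Ks \<Longrightarrow> Ks ! i = of_rat (q i)"
proof -
  have "\<forall>i. \<exists>r. i < length Ks \<longrightarrow> Ks ! i = of_rat r"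
    using assms by (metis Rats_cases nth_mem subsetD)
  thus ?thesis using that by metis
qed

lemma subfield_Rats: "subfield \<rat> (class_ring :: qbar ring)"
proof -
  define Z where "Z = (class_ring :: qbar ring)"
  have Zs [simp]: "carrier Z = UNIV" "monoid.mult Z = (*)" "monoid.one Z = 1" "ring.zero Z = 0" "ring.add Z = (+)"
    by (simp_all add: Z_def)
  interpret F: field Z unfolding Z_def by (rule class_ring_field)
  show ?thesis unfolding Z_def[symmetric]
    by (intro F.subfieldI' F.subringI) (auto simp: class_ring_minus[where 'a = qbar, folded Z_def] class_ring_inv[where 'a = qbar, folded Z_def])
qed

section \<open>Number fields as rational vector spaces\<close>

locale numfield =
  fixes K :: "qbar set"
  assumes number_field: "number_field K"
begin

lemma subfield_K: "subfield K class_ring"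
  using number_field unfolding number_field_def by simp

lemma K_zero: "0 \<in> K" and K_one: "1 \<in> K"
  and K_uminus: "x \<in> K \<Longrightarrow> - x \<in> K"
  and K_add: "x \<in> K \<Longrightarrow> y \<in> K \<Longrightarrow> x + y \<in> K"
  and K_mult: "x \<in> K \<Longrightarrow> y \<in> K \<Longrightarrow> x * y \<in> K"
  using subringE[OF subfieldE(1)[OF subfield_K]] by (auto simp: class_ring_minus)

lemma K_diff: "x \<in> K \<Longrightarrow> y \<in> K \<Longrightarrow> x - y \<in> K"
  using K_add[of x "- y"] K_uminus by simp

lemma K_inverse: "x \<in> K \<Longrightarrow> inverse x \<in> K"
proof (cases "x = 0")
  case False
  assume "x \<in> K"
  define Z where "Z = (class_ring :: qbar ring)"
  have Zs [simp]: "carrier Z = UNIV" "monoid.mult Z = (*)" "monoid.one Z = 1" "ring.zero Z = 0" "ring.add Z = (+)"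
    by (simp_all add: Z_def)
  interpret F: field Z unfolding Z_def by (rule class_ring_field)
  show ?thesis using F.subfield_m_inv(1)[OF subfield_K[folded Z_def], of x] \<open>x \<in> K\<close> False
      class_ring_inv[OF False, folded Z_def] by simp
qed (use K_zero in auto)

lemma K_divide: "x \<in> K \<Longrightarrow> y \<in> K \<Longrightarrow> x / y \<in> K"
  using K_mult[of x "inverse y"] K_inverse by (simp add: divide_inverse)

lemma K_power: "x \<in> K \<Longrightarrow> x ^ n \<in> K"
  by (induction n) (auto simp: K_one K_mult)

lemma K_sum: "(\<And>i. i \<in> A \<Longrightarrow> f i \<in> K) \<Longrightarrow> sum f A \<in> K"
  by (induction A rule: infinite_finite_induct) (auto simp: K_zero K_add)

lemma K_of_nat: "of_nat n \<in> K"
  by (induction n) (auto simp: K_zero K_one K_add)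

lemma K_of_int: "of_int n \<in> K"
  using K_of_nat K_uminus by (cases n) (auto simp del: of_nat_Suc)

lemma K_of_rat: "of_rat q \<in> K"
proof (cases q)
  case (Fract a b)
  thus ?thesis using K_divide K_of_int by (simp add: of_rat_rat)
qed

lemma Rats_subset_K: "\<rat> \<subseteq> K"
  using K_of_rat by (auto elim!: Rats_cases)

lemma field_K: "field (KR K)"
proof -
  define Z where "Z = (class_ring :: qbar ring)"
  have Zs [simp]: "carrier Z = UNIV" "monoid.mult Z = (*)" "monoid.one Z = 1" "ring.zero Z = 0" "ring.add Z = (+)"
    by (simp_all add: Z_def)
  interpret F: field Z unfolding Z_def by (rule class_ring_field)
  show ?thesis using F.subfield_iff(2)[OF subfield_K[folded Z_def]] unfolding Z_def KR_def .
qed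

lemma subfield_Rats_K: "subfield \<rat> (KR K)"
proof -
  define Z where "Z = (class_ring :: qbar ring)"
  have Zs [simp]: "carrier Z = UNIV" "monoid.mult Z = (*)" "monoid.one Z = 1" "ring.zero Z = 0" "ring.add Z = (+)"
    by (simp_all add: Z_def)
  interpret F: field Z unfolding Z_def by (rule class_ring_field)
  interpret K: field "KR K" by (rule field_K)
  have "field ((KR K)\<lparr>carrier := \<rat>\<rparr>)" using F.subfield_iff(2)[OF subfield_Rats[folded Z_def]]
    by (simp add: Z_def KR_def)
  thus ?thesis using Rats_subset_K by (intro K.subfield_iff(1)) auto
qed

lemma ring_K: "ring (KR K)"
  using field_K by (simp add: field_def domain_def cring_def)

abbreviation d :: nat where "d \<equiv> global_degree K"

text \<open>Translates the dimension over \<open>\<rat>\<close>, given by lists and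
  \<open>combine\<close>, into sums with rational coefficients. The basis is also recorded as
  independent and spanning in \<open>KR K\<close>, from where it is mapped to the
  completions.\<close>

lemma exists_rat_base:
  "\<exists>xs. set xs \<subseteq> K \<and> length xs = d \<and> rat_indep xs \<and>
     ring.independent (KR K) \<rat> xs \<and> ring.Span (KR K) \<rat> xs = K \<and>
     (\<forall>x\<in>K. \<exists>q. x = (\<Sum>j<d. of_rat (q j) * xs ! j))"
  and rat_indep_length: "set ys \<subseteq> K \<Longrightarrow> rat_indep ys \<Longrightarrow> length ys \<le> d"
  and rat_basis_length: "set ys \<subseteq> K \<Longrightarrow> rat_indep ys \<Longrightarrow>
     (\<And>x. x \<in> K \<Longrightarrow> \<exists>q. x = (\<Sum>j<length ys. of_rat (q j) * ys ! j)) \<Longrightarrow> length ys = d"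
proof -
  define Z where "Z = (class_ring :: qbar ring)"
  have Zs [simp]: "carrier Z = UNIV" "monoid.mult Z = (*)" "monoid.one Z = 1" "ring.zero Z = 0" "ring.add Z = (+)"
    by (simp_all add: Z_def)
  interpret F: field Z unfolding Z_def by (rule class_ring_field)
  note sQ = subfield_Rats[folded Z_def]
  interpret R: field "KR K" by (rule field_K)
  have Rsum: "R.combine Ks Us = (\<Sum>i<length Us. Ks ! i * Us ! i)" if "length Ks = length Us" for Ks Us
    using combine_sum[OF R.ring_axioms _ _ _ that] by simp
  have Fsum: "F.combine Ks Us = (\<Sum>i<length Us. Ks ! i * Us ! i)" if "length Ks = length Us" for Ks Us
    using combine_sum[OF F.ring_axioms _ _ _ that] by simp
  obtain n where n: "F.dimension n \<rat> K"
    using number_field[unfolded number_field_def, folded Z_def] F.finite_dimension_def by blast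
  have dn: "d = n"
    unfolding global_degree_def Z_def[symmetric] using F.dimI[OF sQ n] by (simp add: over_def)
  have indep: "F.independent \<rat> ys" if ys: "rat_indep ys" for ys
  proof (rule F.trivial_combine_imp_independent[OF sQ])
    fix Ks assume Ks: "set Ks \<subseteq> \<rat>" "F.combine Ks ys = \<zero>\<^bsub>Z\<^esub>"
    obtain Ls where Ls: "set (take (length ys) Ks) \<subseteq> set Ls" "set Ls \<subseteq> set (take (length ys) Ks) \<union> {\<zero>\<^bsub>Z\<^esub>}"
      "length Ls = length ys" "F.combine Ls ys = \<zero>\<^bsub>Z\<^esub>"
      using F.combine_normalize[of Ks ys "\<zero>\<^bsub>Z\<^esub>"] Ks by auto
    have "set Ls \<subseteq> \<rat>" using Ls(2) Ks(1) set_take_subset[of "length ys" Ks] Rats_0 unfolding Zs by blast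
    then obtain q where q: "\<And>i. i < length Ls \<Longrightarrow> Ls ! i = of_rat (q i)" by (rule Rats_list) blast
    have "(\<Sum>j<length ys. of_rat (q j) * ys ! j) = 0"
      using Ls(4) unfolding Fsum[OF Ls(3)] using q Ls(3) by (simp cong: sum.cong_simp)
    hence "\<forall>j<length ys. q j = 0" using ys unfolding rat_indep_def by blast
    hence "\<forall>i<length Ls. Ls ! i = 0" using q Ls(3) by simp
    hence "set Ls \<subseteq> {0}" by (auto simp: set_conv_nth)
    thus "set (take (length ys) Ks) \<subseteq> {\<zero>\<^bsub>Z\<^esub>}" using Ls(1) by auto
  qed simp
  show "length ys \<le> d" if "set ys \<subseteq> K" "rat_indep ys"
    using F.independent_length_le_dimension[OF sQ n indep[OF that(2)] that(1)] dn by simp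
  show "length ys = d" if ys: "set ys \<subseteq> K" "rat_indep ys"
     "\<And>x. x \<in> K \<Longrightarrow> \<exists>q. x = (\<Sum>j<length ys. of_rat (q j) * ys ! j)"
  proof -
    have "x \<in> F.Span \<rat> ys" if x: "x \<in> K" for x
    proof -
      obtain q where q: "x = (\<Sum>j<length ys. of_rat (q j) * ys ! j)" using ys(3)[OF x] by blast
      let ?Ks = "map (\<lambda>j. of_rat (q j)) [0..<length ys] :: qbar list"
      have 1: "x = F.combine ?Ks ys" unfolding q by (subst Fsum) simp_all
      have 2: "set ?Ks \<subseteq> \<rat>" and 3: "length ?Ks = length ys" by auto
      have ysc: "set ys \<subseteq> carrier Z" by simp
      show ?thesis unfolding F.Span_mem_iff_length_version[OF sQ ysc]
        by (intro exI[of _ ?Ks] conjI 1 2 3)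
    qed
    moreover have "F.Span \<rat> ys \<subseteq> K"
    proof
      fix x assume "x \<in> F.Span \<rat> ys"
      then obtain Ks where Ks: "set Ks \<subseteq> \<rat>" "length Ks = length ys" "x = F.combine Ks ys"
        using F.Span_mem_iff_length_version[OF sQ, of ys x] by auto
      have "Ks ! i \<in> K" "ys ! i \<in> K" if "i < length ys" for i
        using Ks(1,2) ys(1) Rats_subset_K that by (metis nth_mem subsetD)+
      thus "x \<in> K" unfolding Ks(3) Fsum[OF Ks(2)] by (intro K_sum K_mult) auto
    qed
    ultimately have "F.dimension (length ys) \<rat> K"
      using F.dimensionI[OF sQ indep[OF ys(2)]] by blast
    thus ?thesis using F.dimension_is_inj[OF sQ n] dn by simp
  qed
  obtain xs where xs: "F.independent \<rat> xs" "length xs = n" "F.Span \<rat> xs = K"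
    using F.exists_base[OF sQ n] by blast
  have xsK: "set xs \<subseteq> K" using F.Span_base_incl[OF sQ, of xs] xs(3) by simp
  have ri: "rat_indep xs"
    unfolding rat_indep_def
  proof (intro allI impI)
    fix q :: "nat \<Rightarrow> rat" and j
    assume q: "(\<Sum>j<length xs. of_rat (q j) * xs ! j) = 0" and j: "j < length xs"
    let ?Ks = "map (\<lambda>j. of_rat (q j)) [0..<length xs] :: qbar list"
    have "F.combine ?Ks xs = 0" using q by (subst Fsum) simp_all
    moreover have "set ?Ks \<subseteq> \<rat>" by auto
    ultimately have "set (take (length xs) ?Ks) \<subseteq> {\<zero>\<^bsub>Z\<^esub>}"
      by (intro F.independent_imp_trivial_combine[OF sQ xs(1)]) simp_all
    moreover have "?Ks ! j \<in> set (take (length xs) ?Ks)" using j nth_mem[of j ?Ks] by simp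
    ultimately have "?Ks ! j = 0" unfolding Zs by blast
    thus "q j = 0" using j by simp
  qed
  have sp: "\<exists>q. x = (\<Sum>j<d. of_rat (q j) * xs ! j)" if "x \<in> K" for x
  proof -
    have xsc: "set xs \<subseteq> carrier Z" by simp
    have "x \<in> F.Span \<rat> xs" using that unfolding xs(3) .
    from iffD1[OF F.Span_mem_iff_length_version[OF sQ xsc] this]
    obtain Ks where Ks: "set Ks \<subseteq> \<rat>" "length Ks = length xs" "x = F.combine Ks xs" by blast
    obtain q where q: "\<And>i. i < length Ks \<Longrightarrow> Ks ! i = of_rat (q i)" using Ks(1) by (rule Rats_list) blast
    have "x = (\<Sum>j<d. of_rat (q j) * xs ! j)"
      unfolding Ks(3) Fsum[OF Ks(2)] using q Ks(2) xs(2) dn by (intro sum.cong) auto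
    thus ?thesis by blast
  qed
  have RSpan: "R.Span \<rat> xs = K"
    using F.Span_consistent[OF subfieldE(1)[OF subfield_K[folded Z_def]]] xs(3) unfolding Z_def KR_def by metis
  have Rind: "R.independent \<rat> xs"
  proof (rule R.trivial_combine_imp_independent[OF subfield_Rats_K])
    show "set xs \<subseteq> carrier (KR K)" using xsK by simp
    fix Ks assume Ks: "set Ks \<subseteq> \<rat>" "R.combine Ks xs = \<zero>\<^bsub>KR K\<^esub>"
    have "F.combine Ks xs = R.combine Ks xs"
    proof (induction Ks xs rule: list_induct2')
    qed auto
    thus "set (take (length xs) Ks) \<subseteq> {\<zero>\<^bsub>KR K\<^esub>}"
      using F.independent_imp_trivial_combine[OF sQ xs(1) Ks(1)] Ks(2) by simp
  qed
  show "\<exists>xs. set xs \<subseteq> K \<and> length xs = d \<and> rat_indep xs \<and>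
     R.independent \<rat> xs \<and> R.Span \<rat> xs = K \<and>
     (\<forall>x\<in>K. \<exists>q. x = (\<Sum>j<d. of_rat (q j) * xs ! j))"
    using xsK xs(2) dn ri Rind RSpan sp by (intro exI[of _ xs]) auto
qed

end

section \<open>The completion at a place and its degree\<close>

locale place = numfield +
  fixes v :: "qbar \<Rightarrow> real"
  assumes v: "v \<in> places K"
begin

sublocale P: valued_field "KR K" v
  using v field_K unfolding places_def valued_field_def valued_field_axioms_def KR_def by simp

lemma local_field_KR: "local_field K v = completion (KR K) v"
  unfolding local_field_def KR_def ..

sublocale C: valued_field "local_field K v" "completion_abs v"
  unfolding local_field_KR by (rule P.completion_valued_field)

abbreviation emb :: "qbar \<Rightarrow> (nat \<Rightarrow> qbar) set" where "emb \<equiv> completion_emb (KR K) v"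

sublocale e: ring_hom_ring "KR K" "local_field K v" emb
  unfolding local_field_KR by (rule P.emb_hom_ring)

lemma local_base_eq: "local_base K v = completion_closure (KR K) v \<rat>"
  unfolding local_base_def completion_closure_def local_field_KR ..

lemma base_subfield: "subfield (local_base K v) (local_field K v)"
  unfolding local_base_eq local_field_KR by (rule P.completion_closure_subfield[OF subfield_Rats_K])

lemma base_complete: "abs_complete (local_field K v) (completion_abs v) (local_base K v)"
  unfolding local_base_eq local_field_KR by (rule P.completion_closure_complete[OF subfield_Rats_K])

lemma emb_base: "x \<in> \<rat> \<Longrightarrow> emb x \<in> local_base K v"
  unfolding local_base_eq by (rule P.emb_in_closure[OF subfield_Rats_K])

lemma abs_emb: "x \<in> K \<Longrightarrow> completion_abs v (emb x) = v x"
  using P.completion_abs_emb by simp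

lemma local_dense:
  assumes "c \<in> carrier (local_field K v)" "e > 0"
  obtains x where "x \<in> K" "completion_abs v (emb x \<ominus>\<^bsub>local_field K v\<^esub> c) < e"
  using P.completion_dense[OF assms[unfolded local_field_KR]] unfolding local_field_KR by auto

text \<open>The images of a rational basis of \<open>K\<close> span a space of dimension at most
  \<open>d\<close> over the complete field \<open>local_base K v\<close>. By
  \<open>complete_Span_gap\<close> this space is closed; it contains the dense image of
  \<open>K\<close>, so it is all of \<open>K\<^sub>v\<close>.\<close>

lemma local_dimension:
  "C.dimension (local_degree K v) (local_base K v) (carrier (local_field K v))"
  and local_degree_le: "local_degree K v \<le> d"
proof -
  let ?C = "local_field K v" and ?B = "local_base K v"
  obtain xs where xs: "set xs \<subseteq> K" "length xs = d" "P.Span \<rat> xs = K"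
    using exists_rat_base by blast
  have exs: "set (map emb xs) \<subseteq> carrier ?C" using xs(1) e.hom_closed by auto
  obtain Vs where Vs: "C.independent ?B Vs" "C.Span ?B Vs = C.Span ?B (map emb xs)" "length Vs \<le> length (map emb xs)"
    using C.finite_Span_base[OF base_subfield exs] by blast
  have Vc: "set Vs \<subseteq> carrier ?C" by (rule C.independent_in_carrier[OF Vs(1)])
  obtain c where c: "0 < c" "abs_free ?C (completion_abs v) ?B c Vs"
    using C.independent_imp_abs_free[OF base_subfield base_complete Vs(1)] by blast
  have emb_Span: "emb x \<in> C.Span ?B Vs" if "x \<in> K" for x
  proof -
    have xsc: "set xs \<subseteq> carrier (KR K)" and "x \<in> P.Span \<rat> xs" using that xs(1,3) by (simp, blast)
    from iffD1[OF P.Span_mem_iff_length_version[OF subfield_Rats_K xsc] this(2)]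
    obtain Ks where Ks: "set Ks \<subseteq> \<rat>" "length Ks = length xs" "x = P.combine Ks xs" by blast
    have 1: "emb x = C.combine (map emb Ks) (map emb xs)"
      unfolding Ks(3) by (rule e.combine_hom[symmetric]) (use Ks Rats_subset_K xs in auto)
    have 2: "set (map emb Ks) \<subseteq> ?B" using Ks(1) emb_base by auto
    have 3: "length (map emb Ks) = length (map emb xs)" using Ks(2) by simp
    show ?thesis
      unfolding Vs(2) C.Span_mem_iff_length_version[OF base_subfield exs]
      by (intro exI[of _ "map emb Ks"] conjI 1 2 3)
  qed
  have "carrier ?C \<subseteq> C.Span ?B Vs"
  proof
    fix y assume y: "y \<in> carrier ?C"
    show "y \<in> C.Span ?B Vs"
    proof (rule ccontr)
      assume ny: "y \<notin> C.Span ?B Vs"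
      obtain \<delta> where \<delta>: "\<delta> > 0" "\<And>w. w \<in> C.Span ?B Vs \<Longrightarrow> \<delta> \<le> completion_abs v (y \<oplus>\<^bsub>?C\<^esub> w)"
        using C.complete_Span_gap[OF base_subfield base_complete c(2,1) Vc y ny] by blast
      obtain x where x: "x \<in> K" "completion_abs v (emb x \<ominus>\<^bsub>?C\<^esub> y) < \<delta>"
        by (rule local_dense[OF y \<delta>(1)])
      have exc: "emb x \<in> carrier ?C" using x(1) e.hom_closed by simp
      have "\<ominus>\<^bsub>?C\<^esub> emb x = emb (- x)" using e.hom_a_inv[of x] x(1) P.minus_equality[of "- x" x] K_uminus by simp
      hence "\<delta> \<le> completion_abs v (y \<ominus>\<^bsub>?C\<^esub> emb x)"
        using \<delta>(2)[OF emb_Span[OF K_uminus[OF x(1)]]] by (simp add: a_minus_def)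
      thus False using x(2) C.abs_diff_commute[OF y exc] by simp
    qed
  qed
  hence "C.Span ?B Vs = carrier ?C" using C.Span_in_carrier[OF subfieldE(3)[OF base_subfield] Vc] by blast
  hence dim: "C.dimension (length Vs) ?B (carrier ?C)"
    using C.dimensionI[OF base_subfield Vs(1)] by blast
  hence "local_degree K v = length Vs"
    unfolding local_degree_def using C.dimI[OF base_subfield dim] by (simp add: over_def)
  thus "C.dimension (local_degree K v) ?B (carrier ?C)" "local_degree K v \<le> d"
    using dim Vs(3) xs(2) by auto
qed

lemma local_degree_pos: "0 < local_degree K v"
proof (rule ccontr)
  assume "\<not> 0 < local_degree K v"
  hence "carrier (local_field K v) = {\<zero>\<^bsub>local_field K v\<^esub>}"
    using C.dimension_zero[OF base_subfield, of "carrier (local_field K v)"] local_dimension by simp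
  thus False using C.one_closed C.one_not_zero by blast
qed

lemma degree_pos: "0 < d" using local_degree_pos local_degree_le by simp

lemma Rats_abs_free_iff:
  assumes "set xs \<subseteq> K"
  shows "v_free v xs \<longleftrightarrow> (\<exists>c>0. abs_free (KR K) v \<rat> c xs)"
proof -
  have comb: "P.combine Ks xs = (\<Sum>i<length xs. Ks ! i * xs ! i)" if "length Ks = length xs" for Ks
    using combine_sum[OF ring_K _ _ _ that] by simp
  have "(\<forall>q :: nat \<Rightarrow> rat. \<forall>i<length xs. c * v (of_rat (q i)) \<le> v (\<Sum>j<length xs. of_rat (q j) * xs ! j))
    \<longleftrightarrow> abs_free (KR K) v \<rat> c xs" for c
  proof
    assume *: "\<forall>q :: nat \<Rightarrow> rat. \<forall>i<length xs. c * v (of_rat (q i)) \<le> v (\<Sum>j<length xs. of_rat (q j) * xs ! j)"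
    show "abs_free (KR K) v \<rat> c xs"
      unfolding abs_free_def
    proof (intro allI impI ballI)
      fix Ks :: "qbar list" and k assume Ks: "set Ks \<subseteq> \<rat>" "length Ks = length xs" "k \<in> set Ks"
      obtain q where q: "\<And>i. i < length Ks \<Longrightarrow> Ks ! i = of_rat (q i)" using Ks(1) by (rule Rats_list) blast
      obtain i where i: "i < length Ks" "k = Ks ! i" using Ks(3) by (auto simp: in_set_conv_nth)
      have "P.combine Ks xs = (\<Sum>j<length xs. of_rat (q j) * xs ! j)"
        unfolding comb[OF Ks(2)] using q Ks(2) by (intro sum.cong) auto
      thus "c * v k \<le> v (P.combine Ks xs)" using *[rule_format, of i q] i q Ks(2) by simp
    qed
  next
    assume *: "abs_free (KR K) v \<rat> c xs"
    show "\<forall>q :: nat \<Rightarrow> rat. \<forall>i<length xs. c * v (of_rat (q i)) \<le> v (\<Sum>j<length xs. of_rat (q j) * xs ! j)"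
    proof (intro allI impI)
      fix q :: "nat \<Rightarrow> rat" and i assume i: "i < length xs"
      let ?Ks = "map (\<lambda>j. of_rat (q j)) [0..<length xs] :: qbar list"
      have 1: "P.combine ?Ks xs = (\<Sum>j<length xs. of_rat (q j) * xs ! j)"
        by (subst comb) simp_all
      have 2: "of_rat (q i) \<in> set ?Ks" using i by auto
      have 3: "set ?Ks \<subseteq> \<rat>" and 4: "length ?Ks = length xs" by auto
      show "c * v (of_rat (q i)) \<le> v (\<Sum>j<length xs. of_rat (q j) * xs ! j)"
        using P.abs_freeD[OF * 3 4 2] unfolding 1 .
    qed
  qed
  thus ?thesis unfolding v_free_def by simp
qed

text \<open>Coefficients in \<open>local_base K v\<close> are limits of rational ones, and the
  inequality of \<open>abs_free\<close> survives the limit with the same constant. Hence a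
  \<open>v\<close>-free list stays independent in \<open>K\<^sub>v\<close>.\<close>

lemma free_list_length_le:
  assumes xs: "set xs \<subseteq> K" and "v_free v xs"
  shows "length xs \<le> local_degree K v"
proof -
  let ?C = "local_field K v" and ?B = "local_base K v"
  obtain c where c: "c > 0" "abs_free (KR K) v \<rat> c xs" using assms Rats_abs_free_iff by blast
  have exs: "set (map emb xs) \<subseteq> carrier ?C" using xs e.hom_closed by auto
  have "abs_free ?C (completion_abs v) ?B c (map emb xs)"
    unfolding abs_free_def
  proof (intro allI impI ballI)
    fix Ks k assume Ks: "set Ks \<subseteq> ?B" "length Ks = length (map emb xs)" "k \<in> set Ks"
    have KC: "set Ks \<subseteq> carrier ?C" using Ks(1) subfieldE(3)[OF base_subfield] by blast
    have "\<forall>c\<in>?B. \<exists>s. (\<forall>n. s n \<in> \<rat>) \<and> abs_tendsto ?C (completion_abs v) (\<lambda>n. emb (s n)) c"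
      using P.completion_closure_iff[of \<rat>] Rats_subset_K unfolding local_base_eq local_field_KR by simp
    then obtain S where S: "\<And>c n. c \<in> ?B \<Longrightarrow> S c n \<in> \<rat>"
      "\<And>c. c \<in> ?B \<Longrightarrow> abs_tendsto ?C (completion_abs v) (\<lambda>n. emb (S c n)) c" by metis
    define L where "L n = map (\<lambda>k. S k n) Ks" for n
    have L: "set (L n) \<subseteq> \<rat>" "length (L n) = length xs" for n using Ks S(1) by (auto simp: L_def)
    have SK: "S c n \<in> K" if "c \<in> ?B" for c n using S(1)[OF that] Rats_subset_K by blast
    have LK: "set (L n) \<subseteq> K" for n using L(1) Rats_subset_K by blast
    have comb: "C.combine (map emb (L n)) (map emb xs) = emb (P.combine (L n) xs)" for n
      by (rule e.combine_hom) (use LK xs in auto)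
    have combK: "P.combine (L n) xs \<in> K" for n using P.combine_in_carrier[of "L n" xs] LK xs by simp
    have "abs_tendsto ?C (completion_abs v) (\<lambda>n. C.combine (map emb (L n)) (map emb xs)) (C.combine Ks (map emb xs))"
    proof (rule C.abs_tendsto_combine)
      fix i assume "i < length (map emb xs)"
      hence i: "i < length Ks" using Ks(2) by simp
      hence "Ks ! i \<in> ?B" using Ks(1) by (metis nth_mem subsetD)
      thus "abs_tendsto ?C (completion_abs v) (\<lambda>n. map emb (L n) ! i) (Ks ! i)"
        using S(2) i by (simp add: L_def)
    qed (use Ks KC exs L LK e.hom_closed in \<open>auto simp: subset_iff\<close>)
    hence "(\<lambda>n. completion_abs v (C.combine (map emb (L n)) (map emb xs))) \<longlonglongrightarrow> completion_abs v (C.combine Ks (map emb xs))"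
      by (rule C.abs_tendsto_abs[rotated 2]) (use combK KC exs e.hom_closed in \<open>auto simp: comb\<close>)
    hence lim1: "(\<lambda>n. v (P.combine (L n) xs)) \<longlonglongrightarrow> completion_abs v (C.combine Ks (map emb xs))"
      using combK unfolding comb by (simp add: abs_emb)
    have kB: "k \<in> ?B" using Ks by blast
    have "(\<lambda>n. completion_abs v (emb (S k n))) \<longlonglongrightarrow> completion_abs v k"
      by (rule C.abs_tendsto_abs[OF _ _ S(2)[OF kB]]) (use SK[OF kB] kB subfieldE(3)[OF base_subfield] in auto)
    hence lim2: "(\<lambda>n. c * v (S k n)) \<longlonglongrightarrow> c * completion_abs v k"
      using SK[OF kB] by (intro tendsto_mult_left) (simp add: abs_emb)
    have "c * v (S k n) \<le> v (P.combine (L n) xs)" for n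
      by (rule P.abs_freeD[OF c(2) L]) (use Ks(3) in \<open>auto simp: L_def\<close>)
    thus "c * completion_abs v k \<le> completion_abs v (C.combine Ks (map emb xs))"
      by (intro LIMSEQ_le[OF lim2 lim1]) auto
  qed
  hence "C.independent ?B (map emb xs)"
    by (rule C.abs_free_imp_independent[OF _ c(1) base_subfield exs])
  thus ?thesis
    using C.independent_length_le_dimension[OF base_subfield local_dimension _ exs] by simp
qed

text \<open>A basis of \<open>K\<^sub>v\<close> is moved slightly into the dense subfield
  \<open>K\<close>; a small enough change costs at most half of the constant
  \<open>c\<close>.\<close>

lemma exists_free_list:
  "\<exists>xs. set xs \<subseteq> K \<and> length xs = local_degree K v \<and> v_free v xs"
proof -
  let ?C = "local_field K v" and ?B = "local_base K v" and ?A = "completion_abs v"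
  obtain Vs where Vs: "set Vs \<subseteq> carrier ?C" "C.independent ?B Vs" "length Vs = local_degree K v"
    using C.exists_base[OF base_subfield local_dimension] by blast
  obtain c where c: "0 < c" "abs_free ?C ?A ?B c Vs"
    using C.independent_imp_abs_free[OF base_subfield base_complete Vs(2)] by blast
  define m where "m = length Vs"
  \<comment> \<open>The errors of the \<open>m\<close> vectors sum to at most
    \<open>m * \<epsilon>\<close>, hence to at most \<open>c / 2\<close>; the summand 1 keeps the
    denominator positive.\<close>
  define \<epsilon> where "\<epsilon> = c / (2 * (real m + 1))"
  have \<epsilon>: "\<epsilon> > 0" using c(1) by (simp add: \<epsilon>_def add_pos_nonneg)
  have "\<forall>y\<in>set Vs. \<exists>x\<in>K. ?A (emb x \<ominus>\<^bsub>?C\<^esub> y) < \<epsilon>"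
  proof
    fix y assume "y \<in> set Vs"
    hence "y \<in> carrier ?C" using Vs(1) by blast
    thus "\<exists>x\<in>K. ?A (emb x \<ominus>\<^bsub>?C\<^esub> y) < \<epsilon>" using \<epsilon> by (rule local_dense) blast
  qed
  then obtain g where g: "\<And>y. y \<in> set Vs \<Longrightarrow> g y \<in> K" "\<And>y. y \<in> set Vs \<Longrightarrow> ?A (emb (g y) \<ominus>\<^bsub>?C\<^esub> y) < \<epsilon>" by metis
  define xs where "xs = map g Vs"
  have xs: "set xs \<subseteq> K" "length xs = m" using g(1) by (auto simp: xs_def m_def)
  have exs: "set (map emb xs) \<subseteq> carrier ?C" using xs e.hom_closed by auto
  have "abs_free (KR K) v \<rat> (c/2) xs"
    unfolding abs_free_def
  proof (intro allI impI ballI)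
    fix Ks :: "qbar list" and k assume Ks: "set Ks \<subseteq> \<rat>" "length Ks = length xs" "k \<in> set Ks"
    have KK: "set Ks \<subseteq> K" using Ks(1) Rats_subset_K by blast
    define E where "E = map emb Ks"
    have EB: "set E \<subseteq> ?B" using Ks(1) emb_base by (auto simp: E_def)
    have EC: "set E \<subseteq> carrier ?C" using EB subfieldE(3)[OF base_subfield] by blast
    have lE: "length E = length Vs" using Ks(2) xs(2) m_def by (simp add: E_def)
    \<comment> \<open>The error is proportional to the largest coefficient, so the freeness
      inequality is used for a coefficient attaining it and then passed to the others.\<close>
    define M where "M = Max (v ` set Ks)"
    have fin: "finite (v ` set Ks)" "v ` set Ks \<noteq> {}" using Ks(3) by auto
    obtain k0 where k0: "k0 \<in> set Ks" "M = v k0" using Max_in[OF fin] unfolding M_def by blast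
    have M: "v x \<le> M" if "x \<in> set Ks" for x using fin that unfolding M_def by auto
    have M0: "0 \<le> M" using k0 P.abs_nonneg[of k0] KK by auto
    have "c * M \<le> ?A (C.combine E Vs)"
      using C.abs_freeD[OF c(2) EB lE, of "emb k0"] k0 KK abs_emb[of k0] by (auto simp: E_def)
    also have "\<dots> \<le> ?A (C.combine E (map emb xs)) + M * sum_list (map ?A (map2 (\<lambda>x y. x \<ominus>\<^bsub>?C\<^esub> y) (map emb xs) Vs))"
    proof -
      let ?D = "map2 (\<lambda>x y. x \<ominus>\<^bsub>?C\<^esub> y) (map emb xs) Vs"
      have DC: "set ?D \<subseteq> carrier ?C"
      proof
        fix z assume "z \<in> set ?D"
        then obtain x y where xy: "(x, y) \<in> set (zip (map emb xs) Vs)" "z = x \<ominus>\<^bsub>?C\<^esub> y" by auto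
        hence "x \<in> carrier ?C" "y \<in> carrier ?C"
          using set_zip_leftD[OF xy(1)] set_zip_rightD[OF xy(1)] exs Vs(1) by blast+
        thus "z \<in> carrier ?C" using xy(2) by simp
      qed
      have "C.combine E (map emb xs) \<ominus>\<^bsub>?C\<^esub> C.combine E Vs = C.combine E ?D"
        by (rule C.combine_diff_right) (use exs Vs(1) EC lE xs m_def in auto)
      moreover have "?A (C.combine E ?D) \<le> M * sum_list (map ?A ?D)"
        by (rule C.abs_combine_le[OF _ DC EC]) (use lE xs m_def M KK abs_emb in \<open>auto simp: E_def\<close>)
      moreover have "C.combine E Vs \<in> carrier ?C" "C.combine E (map emb xs) \<in> carrier ?C"
        using EC Vs(1) exs by auto
      ultimately show ?thesis
        using C.abs_diff_ge[of "C.combine E (map emb xs)" "C.combine E Vs"] by simp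
    qed
    also have "sum_list (map ?A (map2 (\<lambda>x y. x \<ominus>\<^bsub>?C\<^esub> y) (map emb xs) Vs)) \<le> c / 2"
    proof -
      have "sum_list (map ?A (map2 (\<lambda>x y. x \<ominus>\<^bsub>?C\<^esub> y) (map emb (map g ws)) ws)) \<le> real (length ws) * \<epsilon>"
        if "set ws \<subseteq> set Vs" for ws using that
        by (induction ws) (use less_imp_le[OF g(2)] in \<open>auto simp: algebra_simps intro!: add_mono\<close>)
      from this[of Vs] have "sum_list (map ?A (map2 (\<lambda>x y. x \<ominus>\<^bsub>?C\<^esub> y) (map emb xs) Vs)) \<le> real m * \<epsilon>"
        by (simp add: xs_def m_def)
      also have "\<dots> \<le> (real m + 1) * \<epsilon>" using \<epsilon> by simp
      also have "\<dots> = c / 2"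
      proof -
        have "real m + 1 \<noteq> 0" by linarith
        thus ?thesis unfolding \<epsilon>_def by (simp add: field_simps)
      qed
      finally show ?thesis .
    qed
    finally have "c * M \<le> ?A (C.combine E (map emb xs)) + M * (c / 2)" using M0 by (simp add: mult_left_mono)
    moreover have "C.combine E (map emb xs) = emb (P.combine Ks xs)"
      unfolding E_def by (rule e.combine_hom) (use KK xs in auto)
    moreover have "P.combine Ks xs \<in> K" using P.combine_in_carrier[of Ks xs] KK xs by simp
    ultimately have "c / 2 * M \<le> v (P.combine Ks xs)" by (simp add: abs_emb algebra_simps)
    moreover have "c / 2 * v k \<le> c / 2 * M" using M[OF Ks(3)] c(1) by simp
    ultimately show "c / 2 * v k \<le> v (P.combine Ks xs)" by simp
  qed
  moreover have "0 < c / 2" using c(1) by simp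
  ultimately have "v_free v xs" unfolding Rats_abs_free_iff[OF xs(1)] by blast
  thus ?thesis using xs Vs(3) m_def by (intro exI[of _ xs]) simp
qed

abbreviation exponent :: real where "exponent \<equiv> real (local_degree K v) / real d"

lemma exponent: "0 < exponent" "exponent \<le> 1"
  using local_degree_pos local_degree_le degree_pos by auto

text \<open>These three facts are all that is used about \<open>Omega\<close>. They climb the tower:
  the power with exponent at most 1 on \<open>K\<^sub>v\<close>, which stays complete, then the
  unique extension to the algebraic closure, then the completion.\<close>

lemma Omega_valued_field: "valued_field (Omega K v) (Omega_abs K v)"
  and Omega_emb_hom: "Omega_emb K v \<in> Ring.ring_hom (KR K) (Omega K v)"
  and Omega_emb_abs: "x \<in> K \<Longrightarrow> Omega_abs K v (Omega_emb K v x) = v x powr exponent"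
proof -
  have la: "local_abs K v = (\<lambda>C. completion_abs v C powr exponent)"
    unfolding local_abs_def by (rule ext) simp
  interpret L: valued_field "local_field K v" "local_abs K v"
    unfolding la by (rule C.valued_field_powr[OF exponent])
  have "abs_complete (local_field K v) (completion_abs v) (carrier (local_field K v))"
    unfolding local_field_KR by (rule P.completion_complete)
  hence compl: "abs_complete (local_field K v) (local_abs K v) (carrier (local_field K v))"
    unfolding la by (rule C.abs_complete_powr[OF exponent(1)]) simp
  note cl = L.closure_abs_props[OF compl]
  interpret A: valued_field "local_closure K v" "local_closure_abs K v"
    unfolding local_closure_def local_closure_abs_def by (rule cl(1))
  show "valued_field (Omega K v) (Omega_abs K v)"
    unfolding Omega_def Omega_abs_def by (rule A.completion_valued_field)
  have h2: "ring.indexed_const (local_field K v) \<in> Ring.ring_hom (local_field K v) (local_closure K v)"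
    unfolding local_closure_def by (rule cl(3))
  have h3: "completion_emb (local_closure K v) (local_closure_abs K v) \<in> Ring.ring_hom (local_closure K v) (Omega K v)"
    unfolding Omega_def by (rule A.completion_emb_hom)
  have eq: "Omega_emb K v = completion_emb (local_closure K v) (local_closure_abs K v) \<circ> (ring.indexed_const (local_field K v) \<circ> emb)"
    unfolding Omega_emb_def KR_def by (rule ext) simp
  show "Omega_emb K v \<in> Ring.ring_hom (KR K) (Omega K v)"
    unfolding eq by (rule ring_hom_trans[OF ring_hom_trans[OF e.homh h2] h3])
  assume x: "x \<in> K"
  have ex: "emb x \<in> carrier (local_field K v)" using x e.hom_closed by simp
  have "ring.indexed_const (local_field K v) (emb x) \<in> carrier (local_closure K v)" by (rule Ring.ring_hom_closed[OF h2 ex])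
  hence "Omega_abs K v (Omega_emb K v x) = local_closure_abs K v (ring.indexed_const (local_field K v) (emb x))"
    unfolding eq Omega_abs_def comp_def by (rule A.completion_abs_emb)
  also have "\<dots> = local_abs K v (emb x)"
    unfolding local_closure_abs_def by (rule cl(2)[OF ex])
  finally show "Omega_abs K v (Omega_emb K v x) = v x powr exponent"
    unfolding la using abs_emb[OF x] by simp
qed

end

section \<open>Determinants and exterior powers over a commutative ring\<close>

context cring
begin

lemma fsum_cong:
  "(\<And>i. i \<in> A \<Longrightarrow> f i = g i) \<Longrightarrow> (\<And>i. i \<in> A \<Longrightarrow> g i \<in> carrier R) \<Longrightarrow> finsum R f A = finsum R g A"
  by (rule finsum_cong') auto

lemma fprod_cong:
  "(\<And>i. i \<in> A \<Longrightarrow> f i = g i) \<Longrightarrow> (\<And>i. i \<in> A \<Longrightarrow> g i \<in> carrier R) \<Longrightarrow> finprod R f A = finprod R g A"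
  by (rule finprod_cong') auto

lemma fprod_zero:
  assumes "finite A" "i \<in> A" "f i = \<zero>" "\<And>i. i \<in> A \<Longrightarrow> f i \<in> carrier R"
  shows "finprod R f A = \<zero>"
proof -
  have "finprod R f (insert i (A - {i})) = f i \<otimes> finprod R f (A - {i})"
    by (rule finprod_insert) (use assms in auto)
  moreover have "finprod R f (A - {i}) \<in> carrier R" by (rule finprod_closed) (use assms in auto)
  ultimately show ?thesis using assms by (simp add: insert_absorb)
qed

lemma fsum_single:
  assumes "finite A" "i \<in> A" "\<And>j. j \<in> A \<Longrightarrow> j \<noteq> i \<Longrightarrow> f j = \<zero>" "f i \<in> carrier R"
  shows "finsum R f A = f i"
proof -
  have "finsum R f (insert i (A - {i})) = f i \<oplus> finsum R f (A - {i})"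
    by (rule finsum_insert) (use assms in auto)
  moreover have "finsum R f (A - {i}) = \<zero>" by (rule add.finprod_one_eqI) (use assms in auto)
  ultimately show ?thesis using assms by (simp add: insert_absorb)
qed

lemma fsum_swap:
  assumes "finite A" "finite B" "\<And>i j. i \<in> A \<Longrightarrow> j \<in> B \<Longrightarrow> f i j \<in> carrier R"
  shows "(\<Oplus>i\<in>A. \<Oplus>j\<in>B. f i j) = (\<Oplus>j\<in>B. \<Oplus>i\<in>A. f i j)"
  using assms(1,3)
proof (induction A)
  case empty
  have "(\<Oplus>j\<in>B. \<zero>) = \<zero>" by (rule add.finprod_one_eqI) simp
  thus ?case by simp
next
  case (insert a A)
  have r: "(\<Oplus>j\<in>B. f i j) \<in> carrier R" if "i \<in> insert a A" for i
    by (rule finsum_closed) (use insert.prems that in auto)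
  have c: "(\<Oplus>i\<in>A. f i j) \<in> carrier R" if "j \<in> B" for j
    by (rule finsum_closed) (use insert.prems that in auto)
  have "(\<Oplus>i\<in>insert a A. \<Oplus>j\<in>B. f i j) = (\<Oplus>j\<in>B. f a j) \<oplus> (\<Oplus>i\<in>A. \<Oplus>j\<in>B. f i j)"
    by (rule finsum_insert) (use insert r in auto)
  also have "(\<Oplus>i\<in>A. \<Oplus>j\<in>B. f i j) = (\<Oplus>j\<in>B. \<Oplus>i\<in>A. f i j)" using insert by simp
  also have "(\<Oplus>j\<in>B. f a j) \<oplus> (\<Oplus>j\<in>B. \<Oplus>i\<in>A. f i j) = (\<Oplus>j\<in>B. f a j \<oplus> (\<Oplus>i\<in>A. f i j))"
    by (rule finsum_addf[symmetric]) (use insert.prems c in auto)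
  also have "\<dots> = (\<Oplus>j\<in>B. \<Oplus>i\<in>insert a A. f i j)"
  proof (rule fsum_cong)
    fix j assume j: "j \<in> B"
    show "f a j \<oplus> (\<Oplus>i\<in>A. f i j) = (\<Oplus>i\<in>insert a A. f i j)"
      by (rule finsum_insert[symmetric]) (use insert j in auto)
    show "(\<Oplus>i\<in>insert a A. f i j) \<in> carrier R" by (rule finsum_closed) (use insert.prems j in auto)
  qed
  finally show ?case .
qed

text \<open>The functions are sorted by their value at \<open>i\<close>; the classes are disjoint
  images of the functions on \<open>I\<close>.\<close>

lemma fsum_PiE_insert:
  assumes "finite I" "finite T" "i \<notin> I"
    "\<And>f. f \<in> PiE (insert i I) (\<lambda>_. T) \<Longrightarrow> g f \<in> carrier R"
  shows "finsum R g (PiE (insert i I) (\<lambda>_. T)) = (\<Oplus>j\<in>T. \<Oplus>f\<in>PiE I (\<lambda>_. T). g (f(i := j)))"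
proof -
  let ?B = "\<lambda>j. (\<lambda>f. f(i := j)) ` PiE I (\<lambda>_. T)"
  have eq: "PiE (insert i I) (\<lambda>_. T) = (\<Union>j\<in>T. ?B j)"
    unfolding PiE_insert_eq by force
  have gB: "g f \<in> carrier R" if "j \<in> T" "f \<in> ?B j" for j f
    by (rule assms(4)) (use UN_I[of j T f ?B] that eq in simp)
  have "finsum R g (\<Union>j\<in>T. ?B j) = (\<Oplus>j\<in>T. finsum R g (?B j))"
  proof (rule add.finprod_UN_disjoint)
    show "pairwise (\<lambda>j k. disjnt (?B j) (?B k)) T"
      unfolding pairwise_def disjnt_def
    proof (intro ballI impI equals0I)
      fix j k f assume ne: "j \<noteq> k" and f: "f \<in> ?B j \<inter> ?B k"
      have "f i = j" using IntD1[OF f] by (elim imageE) simp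
      moreover have "f i = k" using IntD2[OF f] by (elim imageE) simp
      ultimately show False using ne by simp
    qed
    show "g f \<in> carrier R" if "j \<in> T" "f \<in> ?B j" for j f
      by (rule gB[OF that])
    show "finite (?B j)" for j using assms(1,2) by (simp add: finite_PiE)
  qed (rule assms(2))
  also have "\<dots> = (\<Oplus>j\<in>T. \<Oplus>f\<in>PiE I (\<lambda>_. T). g (f(i := j)))"
  proof (rule fsum_cong)
    fix j assume j: "j \<in> T"
    have gc: "g f \<in> carrier R" if "f \<in> ?B j" for f by (rule gB[OF j that])
    show "finsum R g (?B j) = (\<Oplus>f\<in>PiE I (\<lambda>_. T). g (f(i := j)))"
    proof (rule add.finprod_reindex)
      show "inj_on (\<lambda>f. f(i := j)) (PiE I (\<lambda>_. T))"
      proof (rule inj_onI)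
        fix f h assume f: "f \<in> PiE I (\<lambda>_. T)" and h: "h \<in> PiE I (\<lambda>_. T)" and e: "f(i := j) = h(i := j)"
        show "f = h"
        proof (rule PiE_ext[OF f h])
          fix x assume "x \<in> I"
          hence "x \<noteq> i" using assms(3) by auto
          thus "f x = h x" using fun_cong[OF e, of x] by simp
        qed
      qed
    qed (use gc in blast)
    show "(\<Oplus>f\<in>PiE I (\<lambda>_. T). g (f(i := j))) \<in> carrier R"
      by (rule finsum_closed) (use gc in blast)
  qed
  finally show ?thesis unfolding eq .
qed

text \<open>General distributivity: expanding the product means choosing one summand
  \<open>f i\<close> from each factor.\<close>

lemma fprod_fsum:
  assumes "finite I" "finite T" "\<And>i j. i \<in> I \<Longrightarrow> j \<in> T \<Longrightarrow> B i j \<in> carrier R"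
  shows "(\<Otimes>i\<in>I. \<Oplus>j\<in>T. B i j) = (\<Oplus>f\<in>PiE I (\<lambda>_. T). \<Otimes>i\<in>I. B i (f i))"
  using assms(1,3)
proof (induction I)
  case empty
  show ?case using finsum_insert[of "{}" "\<lambda>_. undefined" "\<lambda>_. \<one>"] by simp
next
  case (insert i I)
  have c: "(\<Otimes>k\<in>I. B k (f k)) \<in> carrier R" if "f \<in> PiE I (\<lambda>_. T)" for f
    by (rule finprod_closed) (use that insert.prems in \<open>auto simp: PiE_def Pi_def\<close>)
  have s: "(\<Oplus>j\<in>T. B k j) \<in> carrier R" if "k \<in> insert i I" for k
    by (rule finsum_closed) (use insert.prems that in auto)
  have S: "(\<Oplus>f\<in>PiE I (\<lambda>_. T). \<Otimes>k\<in>I. B k (f k)) \<in> carrier R"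
    by (rule finsum_closed) (use c in auto)
  have "(\<Otimes>k\<in>insert i I. \<Oplus>j\<in>T. B k j) = (\<Oplus>j\<in>T. B i j) \<otimes> (\<Otimes>k\<in>I. \<Oplus>j\<in>T. B k j)"
    by (rule finprod_insert) (use insert s in auto)
  also have "\<dots> = (\<Oplus>j\<in>T. B i j) \<otimes> (\<Oplus>f\<in>PiE I (\<lambda>_. T). \<Otimes>k\<in>I. B k (f k))"
    using insert.IH insert.prems by simp
  also have "\<dots> = (\<Oplus>j\<in>T. B i j \<otimes> (\<Oplus>f\<in>PiE I (\<lambda>_. T). \<Otimes>k\<in>I. B k (f k)))"
    by (rule finsum_ldistr) (use assms(2) S insert.prems in auto)
  also have "\<dots> = (\<Oplus>j\<in>T. \<Oplus>f\<in>PiE I (\<lambda>_. T). \<Otimes>k\<in>insert i I. B k ((f(i := j)) k))"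
  proof (rule fsum_cong)
    fix j assume j: "j \<in> T"
    have m: "B i j \<otimes> (\<Otimes>k\<in>I. B k (f k)) = (\<Otimes>k\<in>insert i I. B k ((f(i := j)) k))"
      if f: "f \<in> PiE I (\<lambda>_. T)" for f
    proof -
      have "(\<Otimes>k\<in>insert i I. B k ((f(i := j)) k)) = B i ((f(i := j)) i) \<otimes> (\<Otimes>k\<in>I. B k ((f(i := j)) k))"
        by (rule finprod_insert) (use insert j f in \<open>auto simp: PiE_def Pi_def\<close>)
      also have "(\<Otimes>k\<in>I. B k ((f(i := j)) k)) = (\<Otimes>k\<in>I. B k (f k))"
        by (rule fprod_cong) (use insert f in \<open>auto simp: PiE_def Pi_def\<close>)
      finally show ?thesis by simp
    qed
    have "B i j \<otimes> (\<Oplus>f\<in>PiE I (\<lambda>_. T). \<Otimes>k\<in>I. B k (f k)) = (\<Oplus>f\<in>PiE I (\<lambda>_. T). B i j \<otimes> (\<Otimes>k\<in>I. B k (f k)))"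
      by (rule finsum_rdistr) (use c insert j assms(2) in \<open>auto simp: finite_PiE\<close>)
    also have "\<dots> = (\<Oplus>f\<in>PiE I (\<lambda>_. T). \<Otimes>k\<in>insert i I. B k ((f(i := j)) k))"
    proof (rule fsum_cong)
      fix f assume f: "f \<in> PiE I (\<lambda>_. T)"
      show "B i j \<otimes> (\<Otimes>k\<in>I. B k (f k)) = (\<Otimes>k\<in>insert i I. B k ((f(i := j)) k))" by (rule m[OF f])
      show "(\<Otimes>k\<in>insert i I. B k ((f(i := j)) k)) \<in> carrier R"
        unfolding m[OF f, symmetric] using c[OF f] insert.prems j by simp
    qed
    finally have e: "B i j \<otimes> (\<Oplus>f\<in>PiE I (\<lambda>_. T). \<Otimes>k\<in>I. B k (f k))
      = (\<Oplus>f\<in>PiE I (\<lambda>_. T). \<Otimes>k\<in>insert i I. B k ((f(i := j)) k))" .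
    show "B i j \<otimes> (\<Oplus>f\<in>PiE I (\<lambda>_. T). \<Otimes>k\<in>I. B k (f k))
      = (\<Oplus>f\<in>PiE I (\<lambda>_. T). \<Otimes>k\<in>insert i I. B k ((f(i := j)) k))" by (rule e)
    show "(\<Oplus>f\<in>PiE I (\<lambda>_. T). \<Otimes>k\<in>insert i I. B k ((f(i := j)) k)) \<in> carrier R"
      unfolding e[symmetric] by (rule m_closed) (use S insert.prems j in auto)
  qed
  also have "\<dots> = (\<Oplus>f\<in>PiE (insert i I) (\<lambda>_. T). \<Otimes>k\<in>insert i I. B k (f k))"
  proof (rule fsum_PiE_insert[symmetric])
    fix f assume f: "f \<in> PiE (insert i I) (\<lambda>_. T)"
    show "(\<Otimes>k\<in>insert i I. B k (f k)) \<in> carrier R"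
      by (rule finprod_closed) (use insert.prems f in \<open>auto simp: PiE_def Pi_def\<close>)
  qed (use insert assms in auto)
  finally show ?case .
qed

section \<open>Determinants as sums over permutations\<close>

definition sgn_elt :: "(nat \<Rightarrow> nat) \<Rightarrow> 'a" where
  "sgn_elt p = (if evenperm p then \<one> else \<ominus> \<one>)"

lemma sgn_elt_closed [simp]: "sgn_elt p \<in> carrier R"
  by (simp add: sgn_elt_def)

lemma sgn_elt_comp:
  "p permutes {..<M} \<Longrightarrow> q permutes {..<M} \<Longrightarrow> sgn_elt (p \<circ> q) = sgn_elt p \<otimes> sgn_elt q"
  unfolding sgn_elt_def
  by (subst evenperm_comp) (auto intro: permutes_imp_permutation simp: l_minus r_minus)

lemma ring_det_alt:
  "ring_det R M B = (\<Oplus>p\<in>{p. p permutes {..<M}}. sgn_elt p \<otimes> (\<Otimes>i\<in>{..<M}. B i (p i)))"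
  unfolding ring_det_def sgn_elt_def ..

definition square_closed :: "nat \<Rightarrow> (nat \<Rightarrow> nat \<Rightarrow> 'a) \<Rightarrow> bool" where
  "square_closed M B \<longleftrightarrow> (\<forall>i<M. \<forall>j<M. B i j \<in> carrier R)"

lemma fprod_perm_closed:
  assumes "square_closed M B" "p permutes {..<M}" "q permutes {..<M}"
  shows "(\<Otimes>i\<in>{..<M}. B (q i) (p i)) \<in> carrier R"
  using assms permutes_in_image[OF assms(2)] permutes_in_image[OF assms(3)]
  by (intro finprod_closed) (auto simp: square_closed_def)

lemma det_term_closed:
  assumes "square_closed M B" "p permutes {..<M}"
  shows "sgn_elt p \<otimes> (\<Otimes>i\<in>{..<M}. B i (p i)) \<in> carrier R"
  using fprod_perm_closed[OF assms permutes_id] by simp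

lemma ring_det_closed: "square_closed M B \<Longrightarrow> ring_det R M B \<in> carrier R"
  unfolding ring_det_alt by (rule finsum_closed) (use det_term_closed in auto)

lemma ring_det_cong:
  assumes "square_closed M B" "\<And>i j. i < M \<Longrightarrow> j < M \<Longrightarrow> A i j = B i j"
  shows "ring_det R M A = ring_det R M B"
  unfolding ring_det_alt
proof (rule fsum_cong)
  fix p assume p: "p \<in> {p. p permutes {..<M}}"
  have "(\<Otimes>i\<in>{..<M}. A i (p i)) = (\<Otimes>i\<in>{..<M}. B i (p i))"
    using p assms permutes_in_image[of p "{..<M}"]
    by (intro fprod_cong) (auto simp: square_closed_def)
  thus "sgn_elt p \<otimes> (\<Otimes>i\<in>{..<M}. A i (p i)) = sgn_elt p \<otimes> (\<Otimes>i\<in>{..<M}. B i (p i))" by simp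
  show "sgn_elt p \<otimes> (\<Otimes>i\<in>{..<M}. B i (p i)) \<in> carrier R" using det_term_closed assms p by simp
qed

lemma fprod_permute:
  assumes "square_closed M B" "p permutes {..<M}" "s permutes {..<M}"
  shows "(\<Otimes>i\<in>{..<M}. B (s i) (p (s i))) = (\<Otimes>i\<in>{..<M}. B i (p i))"
proof -
  have "(\<Otimes>i\<in>s ` {..<M}. B i (p i)) = (\<Otimes>i\<in>{..<M}. B (s i) (p (s i)))"
    by (rule finprod_reindex)
      (use assms permutes_in_image[OF assms(2)] permutes_image[OF assms(3)] permutes_inj_on[OF assms(3)] in
        \<open>auto simp: square_closed_def\<close>)
  thus ?thesis using permutes_image[OF assms(3)] by simp
qed

lemma ring_det_permute_rows:
  assumes B: "square_closed M B" and s: "s permutes {..<M}"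
  shows "ring_det R M (\<lambda>i. B (s i)) = sgn_elt s \<otimes> ring_det R M B"
proof -
  let ?P = "{p. p permutes {..<M}}"
  have bij: "(\<lambda>p. p \<circ> s) ` ?P = ?P"
  proof -
    have "p \<in> (\<lambda>p. p \<circ> s) ` ?P" if "p permutes {..<M}" for p
    proof (rule image_eqI)
      show "p = (p \<circ> inv_into UNIV s) \<circ> s" using permutes_inv_o(2)[OF s] by (simp add: comp_assoc)
      show "p \<circ> inv_into UNIV s \<in> ?P" using permutes_compose[OF permutes_inv[OF s] that] by simp
    qed
    thus ?thesis using permutes_compose[OF s] by auto
  qed
  have inj: "inj_on (\<lambda>p. p \<circ> s) ?P"
    using permutes_surj[OF s] by (auto simp: inj_on_def fun_eq_iff comp_def) (metis surjD)
  have sB: "square_closed M (\<lambda>i. B (s i))" using B permutes_in_image[OF s] by (auto simp: square_closed_def)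
  have "ring_det R M (\<lambda>i. B (s i)) = (\<Oplus>p\<in>(\<lambda>p. p \<circ> s) ` ?P. sgn_elt p \<otimes> (\<Otimes>i\<in>{..<M}. B (s i) (p i)))"
    unfolding ring_det_alt bij ..
  also have "\<dots> = (\<Oplus>p\<in>?P. sgn_elt (p \<circ> s) \<otimes> (\<Otimes>i\<in>{..<M}. B (s i) ((p \<circ> s) i)))"
    by (rule finsum_reindex) (use inj bij det_term_closed[OF sB] in auto)
  also have "\<dots> = (\<Oplus>p\<in>?P. sgn_elt s \<otimes> (sgn_elt p \<otimes> (\<Otimes>i\<in>{..<M}. B i (p i))))"
  proof (rule fsum_cong)
    fix p assume p: "p \<in> ?P"
    have "(\<Otimes>i\<in>{..<M}. B (s i) ((p \<circ> s) i)) = (\<Otimes>i\<in>{..<M}. B i (p i))"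
      using fprod_permute[OF B _ s] p by simp
    thus "sgn_elt (p \<circ> s) \<otimes> (\<Otimes>i\<in>{..<M}. B (s i) ((p \<circ> s) i)) = sgn_elt s \<otimes> (sgn_elt p \<otimes> (\<Otimes>i\<in>{..<M}. B i (p i)))"
      using p s sgn_elt_comp fprod_perm_closed[OF B _ permutes_id, of p] by (simp add: m_ac)
    show "sgn_elt s \<otimes> (sgn_elt p \<otimes> (\<Otimes>i\<in>{..<M}. B i (p i))) \<in> carrier R"
      using det_term_closed[OF B] p by simp
  qed
  also have "\<dots> = sgn_elt s \<otimes> ring_det R M B"
    unfolding ring_det_alt by (rule finsum_rdistr[symmetric]) (use det_term_closed[OF B] in \<open>auto simp: finite_permutations\<close>)
  finally show ?thesis .
qed

text \<open>Composition with the transposition of \<open>a\<close> and \<open>b\<close> pairs each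
  even term with an odd one having the same product. Deducing the claim from the sign change in
  \<open>ring_det_permute_rows\<close> would leave out characteristic 2.\<close>

lemma ring_det_equal_rows:
  assumes B: "square_closed M B" and ab: "a < M" "b < M" "a \<noteq> b" and eq: "\<And>k. k < M \<Longrightarrow> B a k = B b k"
  shows "ring_det R M B = \<zero>"
proof -
  let ?P = "{p. p permutes {..<M}}" and ?E = "{p. p permutes {..<M} \<and> evenperm p}"
    and ?O = "{p. p permutes {..<M} \<and> \<not> evenperm p}"
  let ?t = "Transposition.transpose a b"
  let ?T = "\<lambda>p. \<Otimes>i\<in>{..<M}. B i (p i)"
  have t: "?t permutes {..<M}" using ab by (intro permutes_swap_id) auto
  have tt: "?t \<circ> ?t = id" by (rule ext) simp
  have fin: "finite ?P" by (simp add: finite_permutations)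
  have Tc: "?T p \<in> carrier R" if "p permutes {..<M}" for p
    using fprod_perm_closed[OF B that permutes_id] by simp
  have odd: "evenperm (p \<circ> ?t) \<longleftrightarrow> \<not> evenperm p" if "p permutes {..<M}" for p
    using that ab t by (subst evenperm_comp) (auto intro: permutes_imp_permutation simp: evenperm_swap)
  have img: "?O = (\<lambda>p. p \<circ> ?t) ` ?E"
  proof (intro Set.set_eqI iffI)
    fix p assume "p \<in> ?O"
    hence "p \<circ> ?t \<in> ?E" "p = (p \<circ> ?t) \<circ> ?t"
      using odd permutes_compose[OF t] by (auto simp: comp_assoc tt)
    thus "p \<in> (\<lambda>p. p \<circ> ?t) ` ?E" by blast
  next
    fix p assume "p \<in> (\<lambda>p. p \<circ> ?t) ` ?E"
    then obtain q where "q permutes {..<M}" "evenperm q" "p = q \<circ> ?t" by blast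
    thus "p \<in> ?O" using odd permutes_compose[OF t] by auto
  qed
  have inj: "inj_on (\<lambda>p. p \<circ> ?t) ?E"
  proof (rule inj_onI)
    fix p q assume "p \<circ> ?t = q \<circ> ?t"
    hence "(p \<circ> ?t) \<circ> ?t = (q \<circ> ?t) \<circ> ?t" by simp
    thus "p = q" by (simp add: comp_assoc tt)
  qed
  have Tt: "?T (p \<circ> ?t) = ?T p" if p: "p permutes {..<M}" for p
  proof -
    have "?T (p \<circ> ?t) = (\<Otimes>i\<in>{..<M}. B (?t i) ((p \<circ> ?t) (?t i)))"
      by (rule fprod_permute[symmetric, OF B permutes_compose[OF t p] t])
    also have "\<dots> = ?T p"
    proof (rule fprod_cong)
      fix i assume i: "i \<in> {..<M}"
      have pi: "p i < M" using permutes_in_image[OF p] i by simp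
      show "B (?t i) ((p \<circ> ?t) (?t i)) = B i (p i)"
        using eq[OF pi] by (auto simp: Transposition.transpose_def)
      show "B i (p i) \<in> carrier R" using B i pi by (auto simp: square_closed_def)
    qed
    finally show ?thesis .
  qed
  have E: "finsum R ?T ?E \<in> carrier R" by (rule finsum_closed) (use Tc in auto)
  have "ring_det R M B = (\<Oplus>p\<in>?E \<union> ?O. sgn_elt p \<otimes> ?T p)"
    unfolding ring_det_alt by (rule arg_cong[where f = "finsum R _"]) auto
  also have "\<dots> = (\<Oplus>p\<in>?E. sgn_elt p \<otimes> ?T p) \<oplus> (\<Oplus>p\<in>?O. sgn_elt p \<otimes> ?T p)"
    by (rule finsum_Un_disjoint) (use fin Tc in \<open>auto intro: finite_subset[OF _ fin]\<close>)
  also have "(\<Oplus>p\<in>?E. sgn_elt p \<otimes> ?T p) = finsum R ?T ?E"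
    by (rule fsum_cong) (use Tc in \<open>auto simp: sgn_elt_def\<close>)
  also have "(\<Oplus>p\<in>?O. sgn_elt p \<otimes> ?T p) = (\<Oplus>p\<in>?O. \<ominus> \<one> \<otimes> ?T p)"
    by (rule fsum_cong) (use Tc in \<open>auto simp: sgn_elt_def\<close>)
  also have "\<dots> = \<ominus> \<one> \<otimes> finsum R ?T ?O"
    by (rule finsum_rdistr[symmetric]) (use fin Tc in \<open>auto intro: finite_subset[OF _ fin]\<close>)
  also have "finsum R ?T ?O = (\<Oplus>p\<in>?E. ?T (p \<circ> ?t))"
    unfolding img by (rule finsum_reindex[OF _ inj]) (use Tc permutes_compose[OF t] in auto)
  also have "\<dots> = finsum R ?T ?E" by (rule fsum_cong) (use Tt Tc in auto)
  finally show ?thesis using E by (simp add: l_minus r_neg)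
qed

lemma ring_det_zero_row:
  assumes B: "square_closed M B" and a: "a < M" and z: "\<And>k. k < M \<Longrightarrow> B a k = \<zero>"
  shows "ring_det R M B = \<zero>"
  unfolding ring_det_alt
proof (rule add.finprod_one_eqI)
  fix p assume p: "p \<in> {p. p permutes {..<M}}"
  have pM: "p i < M" if "i < M" for i using permutes_in_image[of p "{..<M}"] p that by simp
  have "(\<Otimes>i\<in>{..<M}. B i (p i)) = \<zero>"
    by (rule fprod_zero[of _ a]) (use B a z pM in \<open>auto simp: square_closed_def\<close>)
  thus "sgn_elt p \<otimes> (\<Otimes>i\<in>{..<M}. B i (p i)) = \<zero>" by simp
qed

lemma ring_det_one: "ring_det R M (\<lambda>i j. if i = j then \<one> else \<zero>) = \<one>"
proof -
  let ?B = "\<lambda>i j. if i = j then \<one> else \<zero> :: 'a"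
  have B: "square_closed M ?B" by (simp add: square_closed_def)
  have id: "sgn_elt id \<otimes> (\<Otimes>i\<in>{..<M}. ?B i (id i)) = \<one>" by (simp add: sgn_elt_def)
  have "ring_det R M ?B = sgn_elt id \<otimes> (\<Otimes>i\<in>{..<M}. ?B i (id i))"
    unfolding ring_det_alt
  proof (rule fsum_single)
    fix p assume p: "p \<in> {p. p permutes {..<M}}" "p \<noteq> id"
    obtain i where i: "p i \<noteq> i" using p(2) by (auto simp: fun_eq_iff)
    hence iM: "i < M" using p(1) permutes_not_in[of p "{..<M}" i] by auto
    have "(\<Otimes>i\<in>{..<M}. ?B i (p i)) = \<zero>" by (rule fprod_zero[of _ i]) (use i iM in auto)
    thus "sgn_elt p \<otimes> (\<Otimes>i\<in>{..<M}. ?B i (p i)) = \<zero>" by simp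
  qed (simp_all add: finite_permutations permutes_id id del: id_apply)
  thus ?thesis using id by simp
qed

section \<open>Minors and the Cauchy-Binet formula\<close>

lemma ext_index_props:
  assumes "I \<in> ext_index M N"
  shows "length (sorted_list_of_set I) = M" "distinct (sorted_list_of_set I)"
    "set (sorted_list_of_set I) = I" "i < M \<Longrightarrow> sorted_list_of_set I ! i < N"
    "i < M \<Longrightarrow> sorted_list_of_set I ! i \<in> I"
    "bij_betw ((!) (sorted_list_of_set I)) {..<M} I"
proof -
  have I: "I \<subseteq> {..<N}" "card I = M" using assms by (auto simp: ext_index_def)
  have fin: "finite I" using I(1) finite_subset by blast
  show 1: "length (sorted_list_of_set I) = M" "distinct (sorted_list_of_set I)" "set (sorted_list_of_set I) = I"
    using I fin by auto
  show 2: "sorted_list_of_set I ! i \<in> I" if "i < M" for i using 1 that nth_mem by metis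
  thus "i < M \<Longrightarrow> sorted_list_of_set I ! i < N" using I(1) by auto
  show "bij_betw ((!) (sorted_list_of_set I)) {..<M} I"
    using 1 by (intro bij_betw_nth) auto
qed

lemma finite_ext_index: "finite (ext_index M N)"
  unfolding ext_index_def by (rule finite_subset[of _ "Pow {..<N}"]) auto

abbreviation sl :: "nat set \<Rightarrow> nat \<Rightarrow> nat" where "sl I i \<equiv> sorted_list_of_set I ! i"

text \<open>Expanding the sums in all rows gives a sum over functions \<open>f\<close> that choose a
  column for each row. The determinant attached to a non-injective \<open>f\<close> has two equal
  rows. An injective \<open>f\<close> with image \<open>I\<close> is the increasing enumeration of
  \<open>I\<close> after a permutation, whose sign completes the minor of \<open>u\<close> on
  \<open>I\<close>.\<close>

theorem cauchy_binet:
  assumes A: "\<And>k j. k < M \<Longrightarrow> j < N \<Longrightarrow> A k j \<in> carrier R"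
    and u: "\<And>i j. i < M \<Longrightarrow> j < N \<Longrightarrow> u i j \<in> carrier R"
  shows "ring_det R M (\<lambda>i k. \<Oplus>j\<in>{..<N}. A k j \<otimes> u i j) =
    (\<Oplus>I\<in>ext_index M N. ring_det R M (\<lambda>i j. u i (sl I j)) \<otimes> ring_det R M (\<lambda>i k. A k (sl I i)))"
proof -
  let ?P = "{p. p permutes {..<M}}" and ?F = "PiE {..<M} (\<lambda>_. {..<N})"
  let ?U = "\<lambda>f. \<Otimes>i\<in>{..<M}. u i (f i)" and ?D = "\<lambda>f. ring_det R M (\<lambda>i k. A k (f i))"
  have finP: "finite ?P" by (simp add: finite_permutations)
  have finF: "finite ?F" by (simp add: finite_PiE)
  have pM: "p i < M" if "p \<in> ?P" "i < M" for p i using permutes_in_image[of p "{..<M}"] that by simp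
  have fN: "f i < N" if "f \<in> ?F" "i < M" for f i using that by (auto simp: PiE_def Pi_def)
  have Uc: "?U f \<in> carrier R" if "f \<in> ?F" for f
    by (rule finprod_closed) (use u fN that in auto)
  have sq: "square_closed M (\<lambda>i k. A k (f i))" if "f \<in> ?F" for f
    using A fN[OF that] by (auto simp: square_closed_def)
  have Ac: "(\<Otimes>i\<in>{..<M}. A (p i) (f i)) \<in> carrier R" if "p \<in> ?P" "f \<in> ?F" for p f
    by (rule finprod_closed) (use A pM fN that in auto)
  have Dc: "?D f \<in> carrier R" if "f \<in> ?F" for f by (rule ring_det_closed[OF sq[OF that]])
  have "ring_det R M (\<lambda>i k. \<Oplus>j\<in>{..<N}. A k j \<otimes> u i j) = (\<Oplus>p\<in>?P. \<Oplus>f\<in>?F. ?U f \<otimes> (sgn_elt p \<otimes> (\<Otimes>i\<in>{..<M}. A (p i) (f i))))"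
    unfolding ring_det_alt
  proof (rule fsum_cong)
    fix p assume p: "p \<in> ?P"
    have "(\<Otimes>i\<in>{..<M}. \<Oplus>j\<in>{..<N}. A (p i) j \<otimes> u i j) = (\<Oplus>f\<in>?F. \<Otimes>i\<in>{..<M}. A (p i) (f i) \<otimes> u i (f i))"
      by (rule fprod_fsum) (use A u pM[OF p] in auto)
    also have "\<dots> = (\<Oplus>f\<in>?F. (\<Otimes>i\<in>{..<M}. A (p i) (f i)) \<otimes> ?U f)"
    proof (rule fsum_cong)
      fix f assume f: "f \<in> ?F"
      show "(\<Otimes>i\<in>{..<M}. A (p i) (f i) \<otimes> u i (f i)) = (\<Otimes>i\<in>{..<M}. A (p i) (f i)) \<otimes> ?U f"
        by (rule finprod_multf) (use A u pM[OF p] fN[OF f] in auto)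
      show "(\<Otimes>i\<in>{..<M}. A (p i) (f i)) \<otimes> ?U f \<in> carrier R" using Ac[OF p f] Uc[OF f] by simp
    qed
    finally have "sgn_elt p \<otimes> (\<Otimes>i\<in>{..<M}. \<Oplus>j\<in>{..<N}. A (p i) j \<otimes> u i j)
      = sgn_elt p \<otimes> (\<Oplus>f\<in>?F. (\<Otimes>i\<in>{..<M}. A (p i) (f i)) \<otimes> ?U f)" by simp
    also have "\<dots> = (\<Oplus>f\<in>?F. sgn_elt p \<otimes> ((\<Otimes>i\<in>{..<M}. A (p i) (f i)) \<otimes> ?U f))"
      by (rule finsum_rdistr) (use finF Ac[OF p] Uc in auto)
    also have "\<dots> = (\<Oplus>f\<in>?F. ?U f \<otimes> (sgn_elt p \<otimes> (\<Otimes>i\<in>{..<M}. A (p i) (f i))))"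
      by (rule fsum_cong) (use Ac[OF p] Uc in \<open>auto simp: m_ac\<close>)
    finally show "sgn_elt p \<otimes> (\<Otimes>i\<in>{..<M}. \<Oplus>j\<in>{..<N}. A (p i) j \<otimes> u i j)
      = (\<Oplus>f\<in>?F. ?U f \<otimes> (sgn_elt p \<otimes> (\<Otimes>i\<in>{..<M}. A (p i) (f i))))" .
    show "(\<Oplus>f\<in>?F. ?U f \<otimes> (sgn_elt p \<otimes> (\<Otimes>i\<in>{..<M}. A (p i) (f i)))) \<in> carrier R"
      by (rule finsum_closed) (use Ac[OF p] Uc in auto)
  qed
  also have "\<dots> = (\<Oplus>f\<in>?F. \<Oplus>p\<in>?P. ?U f \<otimes> (sgn_elt p \<otimes> (\<Otimes>i\<in>{..<M}. A (p i) (f i))))"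
    by (rule fsum_swap) (use finP finF Ac Uc in auto)
  also have "\<dots> = (\<Oplus>f\<in>?F. ?U f \<otimes> ?D f)"
  proof (rule fsum_cong)
    fix f assume f: "f \<in> ?F"
    show "(\<Oplus>p\<in>?P. ?U f \<otimes> (sgn_elt p \<otimes> (\<Otimes>i\<in>{..<M}. A (p i) (f i)))) = ?U f \<otimes> ?D f"
      unfolding ring_det_alt by (rule finsum_rdistr[symmetric]) (use finP Ac[OF _ f] Uc[OF f] in auto)
    show "?U f \<otimes> ?D f \<in> carrier R" using Uc[OF f] Dc[OF f] by simp
  qed
  finally have step1: "ring_det R M (\<lambda>i k. \<Oplus>j\<in>{..<N}. A k j \<otimes> u i j) = (\<Oplus>f\<in>?F. ?U f \<otimes> ?D f)" .
  \<comment> \<open>The injective choices with image \<open>I\<close>: the enumeration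
    \<open>sl I\<close> composed with the permutations.\<close>
  let ?G = "\<lambda>I. (\<lambda>p. \<lambda>i\<in>{..<M}. sl I (p i)) ` ?P"
  let ?X = "ext_index M N"
  have GF: "?G I \<subseteq> ?F" if "I \<in> ?X" for I
    using pM ext_index_props(4)[OF that] by (auto simp: PiE_def Pi_def)
  have rep: "f \<in> (\<Union>I\<in>?X. ?G I)" if f: "f \<in> ?F" and inj: "inj_on f {..<M}" for f
  proof -
    define I where "I = f ` {..<M}"
    have I: "I \<in> ?X" using fN[OF f] card_image[OF inj] by (auto simp: ext_index_def I_def)
    note b = ext_index_props(6)[OF I]
    have bf: "bij_betw f {..<M} I" using inj by (simp add: bij_betw_def I_def)
    define p where "p i = (if i < M then inv_into {..<M} (sl I) (f i) else i)" for i
    have "bij_betw (inv_into {..<M} (sl I) \<circ> f) {..<M} {..<M}"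
      using bij_betw_trans[OF bf bij_betw_inv_into[OF b]] .
    hence "bij_betw p {..<M} {..<M}"
      by (subst bij_betw_cong[of _ _ "inv_into {..<M} (sl I) \<circ> f"]) (auto simp: p_def)
    hence p: "p permutes {..<M}" by (intro bij_imp_permutes) (auto simp: p_def)
    have "f = (\<lambda>i\<in>{..<M}. sl I (p i))"
    proof (rule PiE_ext[OF f])
      show "(\<lambda>i\<in>{..<M}. sl I (p i)) \<in> ?F" using GF[OF I] p by blast
      fix i assume i: "i \<in> {..<M}"
      thus "f i = (\<lambda>i\<in>{..<M}. sl I (p i)) i"
        using bij_betw_inv_into_right[OF b, of "f i"] by (simp add: p_def I_def)
    qed
    thus ?thesis using I p by blast
  qed
  have disj: "pairwise (\<lambda>I J. disjnt (?G I) (?G J)) ?X"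
  proof (unfold pairwise_def disjnt_def, intro ballI impI, rule ccontr)
    fix I J assume I: "I \<in> ?X" and J: "J \<in> ?X" and ne: "I \<noteq> J" and "?G I \<inter> ?G J \<noteq> {}"
    then obtain p q where pq: "p permutes {..<M}" "q permutes {..<M}" "(\<lambda>i\<in>{..<M}. sl I (p i)) = (\<lambda>i\<in>{..<M}. sl J (q i))"
      by blast
    have im: "(\<lambda>i\<in>{..<M}. sl I (p i)) ` {..<M} = I" if "p permutes {..<M}" "I \<in> ?X" for p I
    proof -
      have "(\<lambda>i\<in>{..<M}. sl I (p i)) ` {..<M} = sl I ` (p ` {..<M})" by (auto simp: image_iff)
      also have "p ` {..<M} = {..<M}" using permutes_image[OF that(1)] .
      finally show ?thesis using ext_index_props(6)[OF that(2)] by (simp add: bij_betw_def)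
    qed
    show False using im[OF pq(1) I] im[OF pq(2) J] pq(3) ne by simp
  qed
  have tc: "?U f \<otimes> ?D f \<in> carrier R" if "f \<in> ?F" for f using Uc Dc that by simp
  \<comment> \<open>Only injective choices survive, and by \<open>rep\<close> they are exhausted by
    the sets \<open>?G I\<close>.\<close>
  have "(\<Oplus>f\<in>?F. ?U f \<otimes> ?D f) = (\<Oplus>f\<in>(\<Union>I\<in>?X. ?G I). ?U f \<otimes> ?D f)"
  proof (rule add.finprod_mono_neutral_cong_right)
    show "(\<Union>I\<in>?X. ?G I) \<subseteq> ?F" using GF by blast
    fix f assume f: "f \<in> ?F - (\<Union>I\<in>?X. ?G I)"
    hence "\<not> inj_on f {..<M}" using rep by blast
    then obtain a b where ab: "a < M" "b < M" "a \<noteq> b" "f a = f b" by (auto simp: inj_on_def)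
    have "?D f = \<zero>" by (rule ring_det_equal_rows[OF sq _ _ ab(3)]) (use f ab in auto)
    thus "?U f \<otimes> ?D f = \<zero>" using Uc f by simp
  qed (use finF tc in auto)
  also have "\<dots> = (\<Oplus>I\<in>?X. \<Oplus>f\<in>?G I. ?U f \<otimes> ?D f)"
  proof (rule add.finprod_UN_disjoint)
    show "?U f \<otimes> ?D f \<in> carrier R" if "I \<in> ?X" "f \<in> ?G I" for I f
      by (rule tc) (use GF that in blast)
  qed (use finite_ext_index finP disj in auto)
  also have "\<dots> = (\<Oplus>I\<in>?X. ring_det R M (\<lambda>i j. u i (sl I j)) \<otimes> ring_det R M (\<lambda>i k. A k (sl I i)))"
  proof (rule fsum_cong)
    fix I assume I: "I \<in> ?X"
    note ip = ext_index_props[OF I]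
    have sqA: "square_closed M (\<lambda>i k. A k (sl I i))" using A ip(4) by (auto simp: square_closed_def)
    have sqU: "square_closed M (\<lambda>i j. u i (sl I j))" using u ip(4) by (auto simp: square_closed_def)
    note dA = ring_det_closed[OF sqA] and dU = ring_det_closed[OF sqU]
    have inj: "inj_on (\<lambda>p. \<lambda>i\<in>{..<M}. sl I (p i)) ?P"
    proof (rule inj_onI)
      fix p q assume p: "p \<in> ?P" and q: "q \<in> ?P" and eq: "(\<lambda>i\<in>{..<M}. sl I (p i)) = (\<lambda>i\<in>{..<M}. sl I (q i))"
      show "p = q"
      proof
        fix i
        show "p i = q i"
        proof (cases "i < M")
          case True
          hence "sl I (p i) = sl I (q i)" using fun_cong[OF eq, of i] by simp
          thus ?thesis using ip(1,2) pM[OF p True] pM[OF q True] by (simp add: nth_eq_iff_index_eq)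
        qed (use p q in \<open>simp add: permutes_def\<close>)
      qed
    qed
    have "(\<Oplus>f\<in>?G I. ?U f \<otimes> ?D f) = (\<Oplus>p\<in>?P. ?U (\<lambda>i\<in>{..<M}. sl I (p i)) \<otimes> ?D (\<lambda>i\<in>{..<M}. sl I (p i)))"
      by (rule finsum_reindex[OF _ inj]) (use tc GF[OF I] in blast)
    also have "\<dots> = (\<Oplus>p\<in>?P. (sgn_elt p \<otimes> (\<Otimes>i\<in>{..<M}. u i (sl I (p i)))) \<otimes> ring_det R M (\<lambda>i k. A k (sl I i)))"
    proof (rule fsum_cong)
      fix p assume p: "p \<in> ?P"
      have uc: "(\<Otimes>i\<in>{..<M}. u i (sl I (p i))) \<in> carrier R"
        by (rule finprod_closed) (use u pM[OF p] ip(4) in auto)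
      have 1: "?U (\<lambda>i\<in>{..<M}. sl I (p i)) = (\<Otimes>i\<in>{..<M}. u i (sl I (p i)))"
        by (rule fprod_cong) (use u pM[OF p] ip(4) in auto)
      have "?D (\<lambda>i\<in>{..<M}. sl I (p i)) = ring_det R M (\<lambda>i k. A k (sl I (p i)))"
        by (rule ring_det_cong) (use A pM[OF p] ip(4) in \<open>auto simp: square_closed_def\<close>)
      also have "\<dots> = sgn_elt p \<otimes> ring_det R M (\<lambda>i k. A k (sl I i))"
        using ring_det_permute_rows[OF sqA, of p] p by simp
      finally have 2: "?D (\<lambda>i\<in>{..<M}. sl I (p i)) = sgn_elt p \<otimes> ring_det R M (\<lambda>i k. A k (sl I i))" .
      show "?U (\<lambda>i\<in>{..<M}. sl I (p i)) \<otimes> ?D (\<lambda>i\<in>{..<M}. sl I (p i))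
        = (sgn_elt p \<otimes> (\<Otimes>i\<in>{..<M}. u i (sl I (p i)))) \<otimes> ring_det R M (\<lambda>i k. A k (sl I i))"
        unfolding 1 2 using uc dA by (simp add: m_ac)
      show "(sgn_elt p \<otimes> (\<Otimes>i\<in>{..<M}. u i (sl I (p i)))) \<otimes> ring_det R M (\<lambda>i k. A k (sl I i)) \<in> carrier R"
        using uc dA by simp
    qed
    also have "\<dots> = ring_det R M (\<lambda>i j. u i (sl I j)) \<otimes> ring_det R M (\<lambda>i k. A k (sl I i))"
      unfolding ring_det_alt[of M "\<lambda>i j. u i (sl I j)"]
      by (rule finsum_ldistr[symmetric]) (use finP dA det_term_closed[OF sqU] in auto)
    finally show "(\<Oplus>f\<in>?G I. ?U f \<otimes> ?D f) = ring_det R M (\<lambda>i j. u i (sl I j)) \<otimes> ring_det R M (\<lambda>i k. A k (sl I i))" .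
    show "ring_det R M (\<lambda>i j. u i (sl I j)) \<otimes> ring_det R M (\<lambda>i k. A k (sl I i)) \<in> carrier R"
      using dA dU by simp
  qed
  finally show ?thesis using step1 by simp
qed

end

section \<open>Linear forms on exterior powers\<close>

context cring
begin

abbreviation (input) ext_carrier :: "nat \<Rightarrow> nat \<Rightarrow> (nat set \<Rightarrow> 'a) set" where
  "ext_carrier M N \<equiv> PiE (ext_index M N) (\<lambda>_. carrier R)"

lemma func_space_simps:
  "carrier (func_space S) = PiE S (\<lambda>_. carrier R)"
  "f \<oplus>\<^bsub>func_space S\<^esub> g = (\<lambda>v\<in>S. f v \<oplus> g v)"
  "c \<odot>\<^bsub>func_space S\<^esub> f = (\<lambda>v\<in>S. c \<otimes> f v)"
  by (simp_all add: func_space_def)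

lemma ext_dual_iff:
  "\<phi> \<in> ext_dual R M N \<longleftrightarrow> \<phi> \<in> extensional (ext_carrier M N) \<and>
     (\<forall>x\<in>ext_carrier M N. \<phi> x \<in> carrier R) \<and>
     (\<forall>x\<in>ext_carrier M N. \<forall>y\<in>ext_carrier M N. \<phi> (\<lambda>I\<in>ext_index M N. x I \<oplus> y I) = \<phi> x \<oplus> \<phi> y) \<and>
     (\<forall>c\<in>carrier R. \<forall>x\<in>ext_carrier M N. \<phi> (\<lambda>I\<in>ext_index M N. c \<otimes> x I) = c \<otimes> \<phi> x)"
  unfolding ext_dual_def module_hom_def self_module_def func_space_simps by (auto simp: Pi_def)

lemma ext_dualD:
  assumes "\<phi> \<in> ext_dual R M N"
  shows "\<phi> \<in> extensional (ext_carrier M N)"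
    "x \<in> ext_carrier M N \<Longrightarrow> \<phi> x \<in> carrier R"
    "x \<in> ext_carrier M N \<Longrightarrow> y \<in> ext_carrier M N \<Longrightarrow> \<phi> (\<lambda>I\<in>ext_index M N. x I \<oplus> y I) = \<phi> x \<oplus> \<phi> y"
    "c \<in> carrier R \<Longrightarrow> x \<in> ext_carrier M N \<Longrightarrow> \<phi> (\<lambda>I\<in>ext_index M N. c \<otimes> x I) = c \<otimes> \<phi> x"
  using assms unfolding ext_dual_iff by blast+

text \<open>The basis vector of the exterior power indexed by \<open>I\<close>.\<close>

definition ext_delta :: "nat \<Rightarrow> nat \<Rightarrow> nat set \<Rightarrow> nat set \<Rightarrow> 'a" where
  "ext_delta M N I = (\<lambda>J\<in>ext_index M N. if J = I then \<one> else \<zero>)"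

lemma ext_delta_closed: "ext_delta M N I \<in> ext_carrier M N"
  by (auto simp: ext_delta_def)

text \<open>By induction on a set \<open>S\<close> of coordinates that are kept while the others are
  set to zero.\<close>

lemma ext_dual_expand:
  assumes \<phi>: "\<phi> \<in> ext_dual R M N" and x: "x \<in> ext_carrier M N"
  shows "\<phi> x = (\<Oplus>I\<in>ext_index M N. x I \<otimes> \<phi> (ext_delta M N I))"
proof -
  let ?X = "ext_index M N"
  note D = ext_dualD[OF \<phi>]
  have xc: "x I \<in> carrier R" if "I \<in> ?X" for I using x that by auto
  have "\<phi> (\<lambda>J\<in>?X. if J \<in> S then x J else \<zero>) = (\<Oplus>I\<in>S. x I \<otimes> \<phi> (ext_delta M N I))"
    if "finite S" "S \<subseteq> ?X" for S
    using that
  proof (induction S)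
    case empty
    have z: "(\<lambda>J\<in>?X. \<zero>) \<in> ext_carrier M N" by auto
    have "\<phi> (\<lambda>J\<in>?X. \<zero> \<otimes> (\<lambda>J\<in>?X. \<zero>) J) = \<zero> \<otimes> \<phi> (\<lambda>J\<in>?X. \<zero>)" by (rule D(4)[OF zero_closed z])
    moreover have "(\<lambda>J\<in>?X. \<zero> \<otimes> (\<lambda>J\<in>?X. \<zero>) J) = (\<lambda>J\<in>?X. \<zero>)" by (rule restrict_ext) simp
    ultimately have "\<phi> (\<lambda>J\<in>?X. \<zero>) = \<zero>" using D(2)[OF z] by (simp only: l_null)
    thus ?case by (simp only: empty_iff if_False finsum_empty)
  next
    case (insert I S)
    let ?v = "\<lambda>J\<in>?X. if J \<in> S then x J else \<zero>" and ?w = "\<lambda>J\<in>?X. x I \<otimes> ext_delta M N I J"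
    have I: "I \<in> ?X" using insert by simp
    have vc: "?v \<in> ext_carrier M N" using xc by auto
    have wc: "?w \<in> ext_carrier M N" using xc[OF I] ext_delta_closed[of M N I] by auto
    have "(\<lambda>J\<in>?X. if J \<in> insert I S then x J else \<zero>) = (\<lambda>J\<in>?X. ?w J \<oplus> ?v J)"
      by (rule restrict_ext) (use insert.hyps xc xc[OF I] in \<open>auto simp: ext_delta_def\<close>)
    hence "\<phi> (\<lambda>J\<in>?X. if J \<in> insert I S then x J else \<zero>) = \<phi> ?w \<oplus> \<phi> ?v"
      using D(3)[OF wc vc] by simp
    also have "\<phi> ?w = x I \<otimes> \<phi> (ext_delta M N I)" by (rule D(4)[OF xc[OF I] ext_delta_closed])
    also have "\<phi> ?v = (\<Oplus>I\<in>S. x I \<otimes> \<phi> (ext_delta M N I))"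
      by (rule insert.IH) (use insert.prems in blast)
    also have "x I \<otimes> \<phi> (ext_delta M N I) \<oplus> \<dots> = (\<Oplus>I\<in>insert I S. x I \<otimes> \<phi> (ext_delta M N I))"
      by (rule finsum_insert[symmetric]) (use insert xc D(2)[OF ext_delta_closed] in auto)
    finally show ?case .
  qed
  from this[OF finite_ext_index order_refl]
  have "\<phi> (\<lambda>J\<in>?X. if J \<in> ?X then x J else \<zero>) = (\<Oplus>I\<in>?X. x I \<otimes> \<phi> (ext_delta M N I))" .
  moreover have "(\<lambda>J\<in>?X. if J \<in> ?X then x J else \<zero>) = x"
    using x by (auto simp: PiE_def extensional_def restrict_def fun_eq_iff)
  ultimately show ?thesis by simp
qed

definition lin_form :: "nat \<Rightarrow> nat \<Rightarrow> (nat set \<Rightarrow> 'a) \<Rightarrow> (nat set \<Rightarrow> 'a) \<Rightarrow> 'a" where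
  "lin_form M N c = (\<lambda>x\<in>ext_carrier M N. \<Oplus>I\<in>ext_index M N. x I \<otimes> c I)"

lemma lin_form_dual:
  assumes c: "\<And>I. I \<in> ext_index M N \<Longrightarrow> c I \<in> carrier R"
  shows "lin_form M N c \<in> ext_dual R M N"
  unfolding ext_dual_iff
proof (intro conjI ballI)
  let ?X = "ext_index M N"
  show "lin_form M N c \<in> extensional (ext_carrier M N)" by (simp add: lin_form_def)
  fix x assume x: "x \<in> ext_carrier M N"
  have xc: "x I \<in> carrier R" if "I \<in> ?X" for I using x that by auto
  show "lin_form M N c x \<in> carrier R"
    using x by (auto simp: lin_form_def intro!: finsum_closed xc c)
  fix y assume y: "y \<in> ext_carrier M N"
  have yc: "y I \<in> carrier R" if "I \<in> ?X" for I using y that by auto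
  have xyc: "(\<lambda>I\<in>?X. x I \<oplus> y I) \<in> ext_carrier M N" using xc yc by auto
  have "lin_form M N c (\<lambda>I\<in>?X. x I \<oplus> y I) = (\<Oplus>I\<in>?X. x I \<otimes> c I \<oplus> y I \<otimes> c I)"
    unfolding lin_form_def restrict_apply'[OF xyc]
    by (rule fsum_cong) (use xc yc c in \<open>auto simp: l_distr\<close>)
  also have "\<dots> = lin_form M N c x \<oplus> lin_form M N c y"
    unfolding lin_form_def restrict_apply'[OF x] restrict_apply'[OF y]
    by (rule finsum_addf) (use xc yc c in auto)
  finally show "lin_form M N c (\<lambda>I\<in>?X. x I \<oplus> y I) = lin_form M N c x \<oplus> lin_form M N c y" .
next
  let ?X = "ext_index M N"
  fix k x assume k: "k \<in> carrier R" and x: "x \<in> ext_carrier M N"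
  have xc: "x I \<in> carrier R" if "I \<in> ?X" for I using x that by auto
  have kxc: "(\<lambda>I\<in>?X. k \<otimes> x I) \<in> ext_carrier M N" using xc k by auto
  have "lin_form M N c (\<lambda>I\<in>?X. k \<otimes> x I) = (\<Oplus>I\<in>?X. k \<otimes> (x I \<otimes> c I))"
    unfolding lin_form_def restrict_apply'[OF kxc]
    by (rule fsum_cong) (use xc k c in \<open>auto simp: m_assoc\<close>)
  also have "\<dots> = k \<otimes> lin_form M N c x"
    unfolding lin_form_def restrict_apply'[OF x]
    by (rule finsum_rdistr[symmetric]) (use finite_ext_index xc k c in auto)
  finally show "lin_form M N c (\<lambda>I\<in>?X. k \<otimes> x I) = k \<otimes> lin_form M N c x" .
qed

lemma wedge_closed:
  assumes "\<And>i j. i < M \<Longrightarrow> j < N \<Longrightarrow> u i j \<in> carrier R"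
  shows "wedge R M N u \<in> ext_carrier M N"
proof -
  have "ring_det R M (\<lambda>i j. u i (sl I j)) \<in> carrier R" if "I \<in> ext_index M N" for I
    by (rule ring_det_closed) (use assms ext_index_props(4)[OF that] in \<open>auto simp: square_closed_def\<close>)
  thus ?thesis by (auto simp: wedge_def)
qed

text \<open>On the columns of some \<open>J \<noteq> I\<close> the minor has a zero row: as both
  sets have \<open>M\<close> elements, some index of \<open>I\<close> is missing from
  \<open>J\<close>. On \<open>I\<close> itself it is the identity matrix. Thus the basis vectors are
  wedges, and a form is determined by its values on wedges.\<close>

lemma wedge_unit_vectors:
  assumes I: "I \<in> ext_index M N"
  shows "wedge R M N (\<lambda>i. \<lambda>j\<in>{..<N}. if j = sl I i then \<one> else \<zero>) = ext_delta M N I"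
  unfolding wedge_def ext_delta_def
proof (rule restrict_ext)
  fix J assume J: "J \<in> ext_index M N"
  note ip = ext_index_props[OF I] and jp = ext_index_props[OF J]
  let ?B = "\<lambda>i j. (\<lambda>j\<in>{..<N}. if j = sl I i then \<one> else \<zero>) (sl J j)"
  have sq: "square_closed M ?B" using jp(4) by (auto simp: square_closed_def)
  show "ring_det R M ?B = (if J = I then \<one> else \<zero>)"
  proof (cases "J = I")
    case True
    have "ring_det R M ?B = ring_det R M (\<lambda>i j. if i = j then \<one> else \<zero>)"
      by (rule ring_det_cong)
        (use True ip(1,2,4) in \<open>auto simp: square_closed_def nth_eq_iff_index_eq\<close>)
    thus ?thesis using True ring_det_one by simp
  next
    case False
    have "card I = M" "card J = M" "finite J" "finite I"
      using I J finite_subset[OF _ finite_lessThan] by (auto simp: ext_index_def)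
    hence "\<not> I \<subseteq> J" using False card_subset_eq[of J I] by auto
    then obtain x where x: "x \<in> I" "x \<notin> J" by blast
    then obtain a where a: "a < M" "sl I a = x" using ip(1,3) by (metis in_set_conv_nth)
    have "ring_det R M ?B = \<zero>"
    proof (rule ring_det_zero_row[OF sq a(1)])
      fix k assume k: "k < M"
      have "sl J k \<noteq> x" using jp(5)[OF k] x(2) by blast
      thus "?B a k = \<zero>" using jp(4)[OF k] a(2) by simp
    qed
    thus ?thesis using False by simp
  qed
qed

text \<open>The description in \<open>ext_map\<close> denotes. The form whose coefficients are the
  maximal minors of \<open>A\<close> has the required values by Cauchy-Binet; uniqueness holds
  because the basis vectors are themselves wedges.\<close>

theorem ext_map_props:
  assumes A: "\<And>k j. k < M \<Longrightarrow> j < N \<Longrightarrow> A k j \<in> carrier R"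
  shows "ext_map R M N A \<in> ext_dual R M N"
    "u \<in> {..<M} \<rightarrow> PiE {..<N} (\<lambda>_. carrier R) \<Longrightarrow> ext_map R M N A (wedge R M N u) =
        ring_det R M (\<lambda>i k. \<Oplus>j\<in>{..<N}. A k j \<otimes> u i j)"
proof -
  let ?c = "\<lambda>I. ring_det R M (\<lambda>i k. A k (sl I i))"
  let ?Q = "\<lambda>\<phi>. \<phi> \<in> ext_dual R M N \<and>
     (\<forall>u\<in>{..<M} \<rightarrow> carrier (func_space {..<N}). \<phi> (wedge R M N u) =
        ring_det R M (\<lambda>i k. \<Oplus>j\<in>{..<N}. A k j \<otimes> u i j))"
  have cc: "?c I \<in> carrier R" if "I \<in> ext_index M N" for I
    by (rule ring_det_closed) (use A ext_index_props(4)[OF that] in \<open>auto simp: square_closed_def\<close>)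
  have uc: "u i j \<in> carrier R" if "u \<in> {..<M} \<rightarrow> PiE {..<N} (\<lambda>_. carrier R)" "i < M" "j < N" for u i j
    using that by (metis PiE_mem PiE_E Pi_mem lessThan_iff)
  have ex: "?Q (lin_form M N ?c)"
  proof (intro conjI ballI)
    show "lin_form M N ?c \<in> ext_dual R M N" by (rule lin_form_dual[OF cc])
    fix u assume "u \<in> {..<M} \<rightarrow> carrier (func_space {..<N})"
    hence u: "u \<in> {..<M} \<rightarrow> PiE {..<N} (\<lambda>_. carrier R)" unfolding func_space_simps .
    have w: "wedge R M N u \<in> ext_carrier M N" by (rule wedge_closed) (use uc[OF u] in auto)
    have "lin_form M N ?c (wedge R M N u) = (\<Oplus>I\<in>ext_index M N. ring_det R M (\<lambda>i j. u i (sl I j)) \<otimes> ?c I)"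
      unfolding lin_form_def restrict_apply'[OF w]
    proof (rule fsum_cong)
      fix I assume I: "I \<in> ext_index M N"
      show "wedge R M N u I \<otimes> ?c I = ring_det R M (\<lambda>i j. u i (sl I j)) \<otimes> ?c I" using I by (simp add: wedge_def)
      show "ring_det R M (\<lambda>i j. u i (sl I j)) \<otimes> ?c I \<in> carrier R"
        using PiE_mem[OF w I] I cc by (simp add: wedge_def)
    qed
    thus "lin_form M N ?c (wedge R M N u) = ring_det R M (\<lambda>i k. \<Oplus>j\<in>{..<N}. A k j \<otimes> u i j)"
      using cauchy_binet[of M N A u] A uc[OF u] by simp
  qed
  have uniq: "\<phi> = \<psi>" if \<phi>: "?Q \<phi>" and \<psi>: "?Q \<psi>" for \<phi> \<psi>
  proof (rule extensionalityI)
    show "\<phi> \<in> extensional (ext_carrier M N)" "\<psi> \<in> extensional (ext_carrier M N)"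
      using ext_dualD(1) \<phi> \<psi> by blast+
    fix x assume x: "x \<in> ext_carrier M N"
    have d: "\<phi> (ext_delta M N I) = \<psi> (ext_delta M N I)" if "I \<in> ext_index M N" for I
    proof -
      have "(\<lambda>i. \<lambda>j\<in>{..<N}. if j = sl I i then \<one> else \<zero>) \<in> {..<M} \<rightarrow> carrier (func_space {..<N})"
        unfolding func_space_simps by auto
      thus ?thesis using \<phi> \<psi> unfolding wedge_unit_vectors[OF that, symmetric] by simp
    qed
    have 1: "\<phi> \<in> ext_dual R M N" and 2: "\<psi> \<in> ext_dual R M N" using \<phi> \<psi> by blast+
    show "\<phi> x = \<psi> x"
      unfolding ext_dual_expand[OF 1 x] ext_dual_expand[OF 2 x]
      by (rule fsum_cong) (use d x ext_dualD(2)[OF 2 ext_delta_closed] in \<open>auto simp: PiE_mem\<close>)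
  qed
  have "?Q (ext_map R M N A)"
    unfolding ext_map_def by (rule theI[of ?Q, OF ex]) (rule uniq[OF _ ex])
  thus "ext_map R M N A \<in> ext_dual R M N"
    "u \<in> {..<M} \<rightarrow> PiE {..<N} (\<lambda>_. carrier R) \<Longrightarrow> ext_map R M N A (wedge R M N u) =
        ring_det R M (\<lambda>i k. \<Oplus>j\<in>{..<N}. A k j \<otimes> u i j)"
    unfolding func_space_simps by blast+
qed

end

lemma ext_index_nonempty: "M \<le> N \<Longrightarrow> ext_index M N \<noteq> {}"
  by (auto simp: ext_index_def intro!: exI[of _ "{..<M}"])

lemma ext_height_ge:
  assumes "I \<in> ext_index M N" shows "a (x I) \<le> ext_height a M N x"
proof -
  have "finite (ext_index M N)"
    unfolding ext_index_def by (rule finite_subset[of _ "Pow {..<N}"]) auto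
  thus ?thesis unfolding ext_height_def using assms by (intro Max_ge) auto
qed

lemma ext_height_attained:
  assumes "M \<le> N" shows "\<exists>I\<in>ext_index M N. ext_height a M N x = a (x I)"
proof -
  have "finite (ext_index M N)"
    unfolding ext_index_def by (rule finite_subset[of _ "Pow {..<N}"]) auto
  hence "Max ((\<lambda>I. a (x I)) ` ext_index M N) \<in> (\<lambda>I. a (x I)) ` ext_index M N"
    using ext_index_nonempty[OF assms] by (intro Max_in) auto
  thus ?thesis unfolding ext_height_def by blast
qed

section \<open>The distance from a linear form to the forms vanishing at a vector\<close>

context valued_field
begin

lemma abs_finsum_le:
  assumes "finite A" "\<And>i. i \<in> A \<Longrightarrow> f i \<in> carrier R"
  shows "a (finsum R f A) \<le> (\<Sum>i\<in>A. a (f i))"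
  using assms
proof (induction A)
  case (insert i A)
  have "finsum R f (insert i A) = f i \<oplus> finsum R f A" by (rule finsum_insert) (use insert in auto)
  moreover have "finsum R f A \<in> carrier R" by (rule finsum_closed) (use insert in auto)
  ultimately show ?case using insert abs_add_le[of "f i" "finsum R f A"] by auto
qed simp

lemma eq_minusI:
  assumes "x \<oplus> y = z" "x \<in> carrier R" "y \<in> carrier R" shows "x = z \<ominus> y"
  unfolding assms(1)[symmetric] using assms(2,3) by (simp add: a_minus_def a_assoc r_neg)

lemma minus_minus_cancel: "x \<in> carrier R \<Longrightarrow> y \<in> carrier R \<Longrightarrow> x \<ominus> (x \<ominus> y) = y"
  by (simp add: a_minus_def minus_add a_assoc[symmetric] r_neg)

text \<open>If \<open>w\<close> attains its height at the coordinate \<open>I\<close>, the infimum is attained by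
  \<open>\<psi> - (\<psi>(w)/w\<^sub>I) x\<^sub>I\<close>; evaluating at \<open>w/w\<^sub>I\<close> gives the lower bound.\<close>

theorem local_U_eq:
  assumes MN: "M \<le> N" and w: "w \<in> ext_carrier M N" and w0: "\<exists>I\<in>ext_index M N. w I \<noteq> \<zero>"
    and \<psi>: "\<psi> \<in> ext_dual R M N"
  shows "local_U R a M N w \<psi> = a (\<psi> w) / ext_height a M N w" and "0 < ext_height a M N w"
proof -
  let ?X = "ext_index M N" and ?C = "ext_carrier M N" and ?H = "ext_height a M N"
  have carr: "carrier (ext_power R M N) = ?C" unfolding func_space_simps ..
  have wc: "w I \<in> carrier R" if "I \<in> ?X" for I using w that by auto
  obtain K where K: "K \<in> ?X" "?H w = a (w K)" using ext_height_attained[OF MN] by blast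
  obtain J where J: "J \<in> ?X" "w J \<noteq> \<zero>" using w0 by blast
  have "0 < a (w J)" using abs_pos[OF wc[OF J(1)] J(2)] .
  also have "\<dots> \<le> ?H w" by (rule ext_height_ge[OF J(1)])
  finally show H: "0 < ?H w" .
  have wK: "w K \<noteq> \<zero>" using H K(2) by auto
  let ?r = "inv (w K)"
  have r: "?r \<in> carrier R" "?r \<otimes> w K = \<one>" "w K \<otimes> ?r = \<one>" using wc[OF K(1)] wK field_Units by auto
  have ar: "a ?r = 1 / ?H w" using abs_inv[OF wc[OF K(1)] wK] K(2) by (simp add: inverse_eq_divide)
  note P = ext_dualD[OF \<psi>]
  have \<psi>w: "\<psi> w \<in> carrier R" by (rule P(2)[OF w])
  let ?S = "{dual_norm R a M N (\<lambda>x\<in>carrier (ext_power R M N). \<psi> x \<ominus> \<phi> x) | \<phi>.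
            \<phi> \<in> ext_dual R M N \<and> \<phi> w = \<zero>}"
  have lower: "a (\<psi> w) / ?H w \<le> s" if s: "s \<in> ?S" for s
  proof -
    obtain \<phi> where \<phi>: "\<phi> \<in> ext_dual R M N" "\<phi> w = \<zero>"
      "s = dual_norm R a M N (\<lambda>x\<in>?C. \<psi> x \<ominus> \<phi> x)" using s unfolding carr by blast
    note Q = ext_dualD[OF \<phi>(1)]
    let ?T = "{a ((\<lambda>x\<in>?C. \<psi> x \<ominus> \<phi> x) x) | x. x \<in> ?C \<and> ?H x \<le> 1}"
    let ?x = "\<lambda>I\<in>?X. ?r \<otimes> w I"
    have xC: "?x \<in> ?C" using r wc by auto
    have "?H ?x \<le> 1"
    proof -
      obtain L where L: "L \<in> ?X" "?H ?x = a (?x L)" using ext_height_attained[OF MN] by blast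
      have "a (?x L) = a (w L) / ?H w" using L(1) r wc ar by (simp add: abs_mult)
      also have "\<dots> \<le> 1" using ext_height_ge[OF L(1), of a w] H by simp
      finally show ?thesis using L(2) by simp
    qed
    hence mem: "a (\<psi> ?x \<ominus> \<phi> ?x) \<in> ?T" using xC by (intro CollectI exI[of _ ?x]) simp
    have "\<phi> ?x = \<zero>" using Q(4)[OF r(1) w] \<phi>(2) r(1) by simp
    hence val: "a (\<psi> ?x \<ominus> \<phi> ?x) = a (\<psi> w) / ?H w"
      using P(4)[OF r(1) w] r(1) \<psi>w ar by (simp add: abs_mult a_minus_def)
    \<comment> \<open>A crude bound on the unit ball through the coefficients. Without boundedness
      the \<open>Sup\<close> in \<open>dual_norm\<close> would say nothing about its
      elements.\<close>
    let ?B = "\<Sum>I\<in>?X. a (\<psi> (ext_delta M N I)) + a (\<phi> (ext_delta M N I))"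
    have bdd: "t \<le> ?B" if "t \<in> ?T" for t
    proof -
      obtain x where x: "x \<in> ?C" "?H x \<le> 1" "t = a (\<psi> x \<ominus> \<phi> x)" using \<open>t \<in> ?T\<close> by auto
      have xc: "x I \<in> carrier R" if "I \<in> ?X" for I using x that by auto
      have x1: "a (x I) \<le> 1" if "I \<in> ?X" for I using ext_height_ge[OF that, of a x] x(2) by simp
      have bound: "a (\<theta> x) \<le> (\<Sum>I\<in>?X. a (\<theta> (ext_delta M N I)))" if \<theta>: "\<theta> \<in> ext_dual R M N" for \<theta>
      proof -
        note T = ext_dualD[OF \<theta>]
        have "a (\<theta> x) \<le> (\<Sum>I\<in>?X. a (x I \<otimes> \<theta> (ext_delta M N I)))"
          unfolding ext_dual_expand[OF \<theta> x(1)]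
          by (rule abs_finsum_le) (use finite_ext_index xc T(2)[OF ext_delta_closed] in auto)
        also have "\<dots> \<le> (\<Sum>I\<in>?X. a (\<theta> (ext_delta M N I)))"
        proof (rule sum_mono)
          fix I assume I: "I \<in> ?X"
          have "a (x I) * a (\<theta> (ext_delta M N I)) \<le> 1 * a (\<theta> (ext_delta M N I))"
            by (rule mult_right_mono[OF x1[OF I] abs_nonneg[OF T(2)[OF ext_delta_closed]]])
          thus "a (x I \<otimes> \<theta> (ext_delta M N I)) \<le> a (\<theta> (ext_delta M N I))"
            using xc[OF I] T(2)[OF ext_delta_closed] by (simp add: abs_mult)
        qed
        finally show ?thesis .
      qed
      have "t \<le> a (\<psi> x) + a (\<phi> x)" unfolding x(3) by (rule abs_diff_le[OF P(2)[OF x(1)] Q(2)[OF x(1)]])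
      thus ?thesis using bound[OF \<psi>] bound[OF \<phi>(1)] by (simp add: sum.distrib)
    qed
    have "a (\<psi> ?x \<ominus> \<phi> ?x) \<le> Sup ?T" by (rule cSup_upper[OF mem]) (rule bdd_aboveI[of _ ?B], rule bdd)
    thus ?thesis unfolding \<phi>(3) dual_norm_def carr val .
  qed
  let ?c = "\<lambda>I. if I = K then \<psi> w \<otimes> ?r else \<zero>"
  let ?\<theta> = "lin_form M N ?c"
  have cc: "?c I \<in> carrier R" for I using \<psi>w r by simp
  have \<theta>: "?\<theta> \<in> ext_dual R M N" by (rule lin_form_dual[OF cc])
  have \<theta>x: "?\<theta> x = x K \<otimes> (\<psi> w \<otimes> ?r)" if x: "x \<in> ?C" for x
  proof -
    have "(\<Oplus>I\<in>?X. x I \<otimes> ?c I) = x K \<otimes> ?c K"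
      by (rule fsum_single) (use finite_ext_index K(1) PiE_mem[OF x] \<psi>w r(1) in auto)
    thus ?thesis using x by (simp add: lin_form_def)
  qed
  \<comment> \<open>The difference of \<open>\<psi>\<close> and \<open>?\<theta>\<close> is built
    from its coefficients, so that \<open>lin_form_dual\<close> makes it an element of the
    dual.\<close>
  let ?e = "\<lambda>I. \<psi> (ext_delta M N I) \<ominus> ?c I"
  let ?\<phi> = "lin_form M N ?e"
  have ec: "?e I \<in> carrier R" for I using P(2)[OF ext_delta_closed] cc by (intro minus_closed)
  have \<phi>: "?\<phi> \<in> ext_dual R M N" by (rule lin_form_dual[OF ec])
  have \<phi>x: "?\<phi> x = \<psi> x \<ominus> ?\<theta> x" if x: "x \<in> ?C" for x
  proof -
    have xc: "x I \<in> carrier R" if "I \<in> ?X" for I using x that by auto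
    note dc = P(2)[OF ext_delta_closed]
    have "?\<phi> x \<oplus> ?\<theta> x = (\<Oplus>I\<in>?X. x I \<otimes> ?e I \<oplus> x I \<otimes> ?c I)"
      unfolding lin_form_def restrict_apply'[OF x] by (rule finsum_addf[symmetric]) (use xc ec cc in auto)
    also have "\<dots> = (\<Oplus>I\<in>?X. x I \<otimes> \<psi> (ext_delta M N I))"
    proof (rule fsum_cong)
      fix I assume I: "I \<in> ?X"
      have "x I \<otimes> ?e I \<oplus> x I \<otimes> ?c I = x I \<otimes> (?e I \<oplus> ?c I)" using xc[OF I] ec cc by (simp only: r_distr)
      also have "?e I \<oplus> ?c I = \<psi> (ext_delta M N I)"
        unfolding a_minus_def using dc[of I] cc[of I] by (simp only: a_assoc a_inv_closed l_neg r_zero)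
      finally show "x I \<otimes> ?e I \<oplus> x I \<otimes> ?c I = x I \<otimes> \<psi> (ext_delta M N I)" .
      show "x I \<otimes> \<psi> (ext_delta M N I) \<in> carrier R" using xc[OF I] dc by simp
    qed
    also have "\<dots> = \<psi> x" by (rule ext_dual_expand[OF \<psi> x, symmetric])
    finally have "?\<phi> x \<oplus> ?\<theta> x = \<psi> x" .
    moreover have "?\<phi> x \<in> carrier R" "?\<theta> x \<in> carrier R" using ext_dualD(2)[OF \<phi> x] ext_dualD(2)[OF \<theta> x] by auto
    ultimately show ?thesis by (intro eq_minusI)
  qed
  have "?\<theta> w = \<psi> w" unfolding \<theta>x[OF w] using m_lcomm[of "w K" "\<psi> w" ?r] \<psi>w r wc[OF K(1)] by simp
  hence \<phi>w: "?\<phi> w = \<zero>" unfolding \<phi>x[OF w] using \<psi>w by (simp add: a_minus_def r_neg)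
  have dn: "dual_norm R a M N (\<lambda>x\<in>?C. \<psi> x \<ominus> ?\<phi> x) \<le> a (\<psi> w) / ?H w"
    unfolding dual_norm_def carr
  proof (rule cSup_least)
    have "(\<lambda>I\<in>?X. \<zero>) \<in> ?C" by auto
    moreover have "?H (\<lambda>I\<in>?X. \<zero>) \<le> 1" using ext_height_attained[OF MN, of a "\<lambda>I\<in>?X. \<zero>"] by auto
    ultimately show "{a ((\<lambda>x\<in>?C. \<psi> x \<ominus> ?\<phi> x) x) | x. x \<in> ?C \<and> ?H x \<le> 1} \<noteq> {}" by blast
    fix t assume "t \<in> {a ((\<lambda>x\<in>?C. \<psi> x \<ominus> ?\<phi> x) x) | x. x \<in> ?C \<and> ?H x \<le> 1}"
    then obtain x where x: "x \<in> ?C" "?H x \<le> 1" "t = a (\<psi> x \<ominus> ?\<phi> x)" by auto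
    have xK: "x K \<in> carrier R" using x(1) K(1) by auto
    have \<theta>c: "?\<theta> x \<in> carrier R" by (rule ext_dualD(2)[OF \<theta> x(1)])
    have "\<psi> x \<ominus> ?\<phi> x = ?\<theta> x"
      unfolding \<phi>x[OF x(1)] by (rule minus_minus_cancel[OF P(2)[OF x(1)] \<theta>c])
    hence "t = a (x K) * (a (\<psi> w) / ?H w)"
      unfolding x(3) using \<theta>x[OF x(1)] xK \<psi>w r ar by (simp add: abs_mult)
    also have "\<dots> \<le> 1 * (a (\<psi> w) / ?H w)"
      using ext_height_ge[OF K(1), of a x] x(2) abs_nonneg[OF \<psi>w] H by (intro mult_right_mono) auto
    finally show "t \<le> a (\<psi> w) / ?H w" by simp
  qed
  have mem: "dual_norm R a M N (\<lambda>x\<in>?C. \<psi> x \<ominus> ?\<phi> x) \<in> ?S"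
    unfolding carr using \<phi> \<phi>w by blast
  have "dual_norm R a M N (\<lambda>x\<in>?C. \<psi> x \<ominus> ?\<phi> x) = a (\<psi> w) / ?H w"
    using dn lower[OF mem] by simp
  hence "Inf ?S = a (\<psi> w) / ?H w"
    using mem lower by (intro cInf_eq_minimum) auto
  thus "local_U R a M N w \<psi> = a (\<psi> w) / ?H w" unfolding local_U_def .
qed

end

section \<open>Primitive elements and embeddings\<close>

hide_const (open) Polynomials.degree Polynomials.lead_coeff up_ring.coeff up_ring.monom

definition ev :: "rat poly \<Rightarrow> qbar \<Rightarrow> qbar" where
  "ev p x = poly (map_poly of_rat p) x"

interpretation rp: map_poly_inj_idom_hom "of_rat :: rat \<Rightarrow> qbar" ..

lemma ev_simps [simp]: "ev 0 x = 0" "ev 1 x = 1" "ev (p + q) x = ev p x + ev q x"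
  "ev (p - q) x = ev p x - ev q x" "ev (- p) x = - ev p x" "ev (p * q) x = ev p x * ev q x"
  "ev (p ^ n) x = ev p x ^ n" "ev (pCons a p) x = of_rat a + x * ev p x"
  "ev (Polynomial.smult a p) x = of_rat a * ev p x"
  by (simp_all add: ev_def hom_distribs)

lemma ev_sum: "ev (sum p A) x = (\<Sum>i\<in>A. ev (p i) x)"
  by (simp add: ev_def hom_distribs poly_sum)

lemma ev_monom: "ev (monom a n) x = of_rat a * x ^ n"
  by (simp add: ev_def map_poly_monom poly_monom)

lemma ev_mod: "ev g x = ev f x * ev (g div f) x + ev (g mod f) x"
proof -
  have "ev (f * (g div f) + g mod f) x = ev g x" by simp
  thus ?thesis by (simp only: ev_simps)
qed

lemma ev_alt:
  assumes "p = 0 \<or> degree p < n"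
  shows "ev p x = (\<Sum>i<n. of_rat (coeff p i) * x ^ i)"
proof -
  have "ev p x = (\<Sum>i\<le>degree p. of_rat (coeff p i) * x ^ i)"
    by (simp add: ev_def poly_altdef)
  also have "\<dots> = (\<Sum>i<n. of_rat (coeff p i) * x ^ i)"
  proof (cases "p = 0")
    case True thus ?thesis by simp
  next
    case False
    thus ?thesis using assms by (intro sum.mono_neutral_left) (auto intro: coeff_eq_0)
  qed
  finally show ?thesis .
qed

lemma ev_pcompose: "ev (pcompose p q) x = ev p (ev q x)"
  by (induction p) (simp_all add: pcompose_pCons)

lemma ev_0_finite: "p \<noteq> 0 \<Longrightarrow> finite {x. ev p x = 0}"
  unfolding ev_def by (rule poly_roots_finite) simp

context numfield
begin

lemma ev_in_K: "x \<in> K \<Longrightarrow> ev p x \<in> K"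
  by (induction p) (auto simp: K_zero intro: K_add K_mult K_of_rat)

lemma K_algebraic:
  assumes "x \<in> K" shows "\<exists>p. p \<noteq> 0 \<and> ev p x = 0"
proof -
  let ?ys = "map (\<lambda>i. x ^ i) [0..<Suc d]"
  have "\<not> rat_indep ?ys"
  proof
    assume "rat_indep ?ys"
    hence "length ?ys \<le> d" using assms by (intro rat_indep_length) (auto intro: K_power)
    thus False by simp
  qed
  then obtain q :: "nat \<Rightarrow> rat" and j where q: "(\<Sum>j<Suc d. of_rat (q j) * x ^ j) = 0" "j < Suc d" "q j \<noteq> 0"
    unfolding rat_indep_def by (auto simp del: upt_Suc sum.lessThan_Suc)
  define p where "p = (\<Sum>j<Suc d. monom (q j) j)"
  have "coeff p j = q j" using q(2) by (simp add: p_def coeff_sum del: sum.lessThan_Suc)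
  hence "p \<noteq> 0" using q(3) by auto
  moreover have "ev p x = 0"
    using q(1) by (simp add: p_def ev_sum ev_monom del: sum.lessThan_Suc)
  ultimately show ?thesis by blast
qed

lemma exists_min_poly:
  assumes "x \<in> K"
  shows "\<exists>f. f \<noteq> 0 \<and> ev f x = 0 \<and> (\<forall>g. ev g x = 0 \<longrightarrow> f dvd g)"
proof -
  obtain p where p: "p \<noteq> 0 \<and> ev p x = 0" using K_algebraic[OF assms] by blast
  obtain f where f: "f \<noteq> 0 \<and> ev f x = 0" and min: "\<And>g. g \<noteq> 0 \<and> ev g x = 0 \<Longrightarrow> degree f \<le> degree g"
    using ex_has_least_nat[of "\<lambda>p. p \<noteq> 0 \<and> ev p x = 0" p degree, OF p] by blast
  have "f dvd g" if "ev g x = 0" for g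
  proof (rule ccontr)
    assume "\<not> f dvd g"
    hence nz: "g mod f \<noteq> 0" by (simp add: mod_eq_0_iff_dvd)
    have "ev (g mod f) x = 0" using ev_mod[of g x f] that f by simp
    hence "degree f \<le> degree (g mod f)" using min nz by blast
    thus False using degree_mod_less[of f g] f nz by auto
  qed
  thus ?thesis using f by blast
qed

text \<open>The constant coefficient of a minimal polynomial of \<open>x \<noteq> 0\<close> is
  nonzero, since otherwise dividing by the variable would lower the degree. Solving the relation for
  this coefficient exhibits the inverse.\<close>

lemma inverse_ev:
  assumes "x \<in> K" "x \<noteq> 0" shows "\<exists>p. inverse x = ev p x"
proof -
  obtain f where f: "f \<noteq> 0" "ev f x = 0" "\<And>g. ev g x = 0 \<Longrightarrow> f dvd g" using exists_min_poly[OF assms(1)] by blast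
  obtain c q where cq: "f = pCons c q" by (cases f)
  have "c \<noteq> 0"
  proof
    assume c: "c = 0"
    hence "q \<noteq> 0" "ev q x = 0" using f(1,2) cq assms(2) by auto
    hence "degree f \<le> degree q" using f(3) by (intro dvd_imp_degree_le) auto
    thus False using cq \<open>q \<noteq> 0\<close> by simp
  qed
  have e: "x * ev q x = - of_rat c" using f(2) cq by (simp add: add_eq_0_iff)
  have "x * ev (Polynomial.smult (- inverse c) q) x = - inverse (of_rat c) * (x * ev q x)"
    by (simp add: of_rat_minus of_rat_inverse mult_ac)
  also have "\<dots> = 1" unfolding e using \<open>c \<noteq> 0\<close> by simp
  finally have "x * ev (Polynomial.smult (- inverse c) q) x = 1" .
  hence "inverse x = ev (Polynomial.smult (- inverse c) q) x" by (rule inverse_unique)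
  thus ?thesis by blast
qed

text \<open>Take \<open>\<gamma> = a + c b\<close> and let \<open>E\<close> be the field generated
  by \<open>\<gamma>\<close>. Both \<open>g\<close> and the polynomial \<open>h\<close>, obtained
  from \<open>f\<close> by substituting \<open>\<gamma> - c X\<close>, have coefficients in
  \<open>E\<close> and vanish at \<open>b\<close>; for all but finitely many rational
  \<open>c\<close> they share no other root. A monic polynomial \<open>m\<close> of least degree
  over \<open>E\<close> vanishing at \<open>b\<close> then has \<open>b\<close> as its only root, so
  it is a power of \<open>X - b\<close>, and its second coefficient puts \<open>b\<close> into
  \<open>E\<close>.\<close>

lemma primitive_two:
  assumes a: "a \<in> K" and b: "b \<in> K"
  shows "\<exists>\<gamma>\<in>K. (\<exists>p. a = ev p \<gamma>) \<and> (\<exists>p. b = ev p \<gamma>)"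
proof -
  obtain f where f: "f \<noteq> 0" "ev f a = 0" using K_algebraic[OF a] by blast
  obtain g where g: "g \<noteq> 0" "ev g b = 0" using K_algebraic[OF b] by blast
  \<comment> \<open>The values of \<open>c\<close> for which a second root \<open>b'\<close> of
    \<open>g\<close> gives \<open>a + c b = a' + c b'\<close> with a root \<open>a'\<close> of
    \<open>f\<close>. At \<open>b' = b\<close> the quotient is 0 by default, so 0 counts as
    bad.\<close>
  define bad where "bad = (\<lambda>(a', b'). (a' - a) / (b - b')) ` ({x. ev f x = 0} \<times> {x. ev g x = 0})"
  have "finite bad" unfolding bad_def using ev_0_finite f g by blast
  hence "finite ((of_rat :: rat \<Rightarrow> qbar) -` bad)" by (rule finite_vimageI) (simp add: inj_def)
  then obtain c :: rat where c: "of_rat c \<notin> bad" using ex_new_if_finite[OF infinite_UNIV_char_0] by blast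
  define \<gamma> where "\<gamma> = a + of_rat c * b"
  have \<gamma>: "\<gamma> \<in> K" unfolding \<gamma>_def using a b by (intro K_add K_mult K_of_rat)
  define E where "E = range (\<lambda>p. ev p \<gamma>)"
  have EI: "ev p \<gamma> \<in> E" for p by (simp add: E_def)
  have E_ex: "\<exists>p. x = ev p \<gamma>" if "x \<in> E" for x using that by (auto simp: E_def)
  have E0: "0 \<in> E" and E1: "1 \<in> E" using EI[of 0] EI[of 1] by auto
  have Eadd: "x + y \<in> E" and Emult: "x * y \<in> E" and Ediff: "x - y \<in> E" if xy: "x \<in> E" "y \<in> E" for x y
  proof -
    obtain p q where "x = ev p \<gamma>" "y = ev q \<gamma>" using E_ex xy by blast
    thus "x + y \<in> E" "x * y \<in> E" "x - y \<in> E" using EI[of "p + q"] EI[of "p * q"] EI[of "p - q"] by auto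
  qed
  have Eumin: "- x \<in> E" if "x \<in> E" for x using Ediff[OF E0 that] by simp
  have Erat: "of_rat q \<in> E" for q using EI[of "[:q:]"] by simp
  have E\<gamma>: "\<gamma> \<in> E" using EI[of "[:0, 1:]"] by simp
  have Esum: "sum h A \<in> E" if "\<And>i. i \<in> A \<Longrightarrow> h i \<in> E" for h :: "nat \<Rightarrow> qbar" and A
    using that by (induction A rule: infinite_finite_induct) (auto simp: E0 intro: Eadd)
  have Einv: "inverse x \<in> E" if x: "x \<in> E" for x
  proof (cases "x = 0")
    case False
    obtain p where p: "x = ev p \<gamma>" using E_ex[OF x] by blast
    obtain q where "inverse x = ev q x" using inverse_ev[of x] ev_in_K[OF \<gamma>] p False by blast
    thus ?thesis using EI[of "pcompose q p"] by (simp add: ev_pcompose p)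
  qed (simp add: E0)
  define EP where "EP = {p :: qbar poly. \<forall>i. coeff p i \<in> E}"
  have EPmult: "p * q \<in> EP" if "p \<in> EP" "q \<in> EP" for p q
    using that unfolding EP_def by (auto simp: coeff_mult intro!: Esum Emult)
  have EPadd: "p + q \<in> EP" and EPdiff: "p - q \<in> EP" if "p \<in> EP" "q \<in> EP" for p q
    using that unfolding EP_def by (auto intro: Eadd Ediff)
  have EPmonom: "monom x n \<in> EP" if "x \<in> E" for x n using that E0 by (auto simp: EP_def)
  have EP0: "0 \<in> EP" using E0 by (simp add: EP_def)
  have EPconst: "[:x:] \<in> EP" if "x \<in> E" for x using EPmonom[OF that, of 0] by (simp add: monom_0)
  have EPrp: "map_poly of_rat p \<in> EP" for p using Erat by (simp add: EP_def)
  have EPcomp: "pcompose p q \<in> EP" if "p \<in> EP" "q \<in> EP" for p q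
    using that(1)
  proof (induction p)
    case (pCons x p)
    have "x \<in> E" using pCons.prems unfolding EP_def by (auto dest: spec[of _ 0])
    moreover have "p \<in> EP" using pCons.prems unfolding EP_def by (auto dest: spec[of _ "Suc _"])
    ultimately show ?case using pCons.IH that(2) by (auto simp: pcompose_pCons intro: EPadd EPmult EPconst)
  qed (simp add: EP0)
  define h where "h = pcompose (map_poly of_rat f) [:\<gamma>, - of_rat c:]"
  have lin: "[:\<gamma>, - of_rat c:] \<in> EP"
    using E\<gamma> Eumin[OF Erat] E0 by (auto simp: EP_def coeff_pCons split: nat.split)
  have hEP: "h \<in> EP" unfolding h_def by (rule EPcomp[OF EPrp lin])
  have hval: "poly h x = ev f (\<gamma> - of_rat c * x)" for x by (simp add: h_def poly_pcompose ev_def mult.commute)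
  have hb: "poly h b = 0" using f(2) by (simp add: hval \<gamma>_def)
  obtain p0 where p0: "p0 \<in> EP \<and> p0 \<noteq> 0 \<and> poly p0 b = 0"
    using EPrp[of g] g unfolding ev_def by auto
  obtain m0 where m0: "m0 \<in> EP \<and> m0 \<noteq> 0 \<and> poly m0 b = 0"
    and min0: "\<And>p. p \<in> EP \<and> p \<noteq> 0 \<and> poly p b = 0 \<Longrightarrow> degree m0 \<le> degree p"
    using ex_has_least_nat[of "\<lambda>p. p \<in> EP \<and> p \<noteq> 0 \<and> poly p b = 0" p0 degree, OF p0] by blast
  define m where "m = Polynomial.smult (inverse (lead_coeff m0)) m0"
  have m: "m \<in> EP" "m \<noteq> 0" "poly m b = 0" "lead_coeff m = 1" "degree m = degree m0"
  proof -
    show "m \<in> EP" using m0 Einv Emult unfolding m_def EP_def by auto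
  qed (use m0 in \<open>auto simp: m_def\<close>)
  have degm: "0 < degree m"
  proof (rule ccontr)
    assume "\<not> 0 < degree m"
    then obtain x where "m = [:x:]" using degree_eq_zeroE by blast
    thus False using m(2,3) by simp
  qed
  \<comment> \<open>Because \<open>m\<close> is monic, long division never leaves the polynomials
    with coefficients in \<open>E\<close>.\<close>
  have division: "\<exists>q r. q \<in> EP \<and> r \<in> EP \<and> p = m * q + r \<and> (r = 0 \<or> degree r < degree m)" if "p \<in> EP" for p
    using that
  proof (induction "degree p" arbitrary: p rule: less_induct)
    case less
    show ?case
    proof (cases "degree p < degree m")
      case True
      thus ?thesis using less.prems EP0 by (intro exI[of _ 0] exI[of _ p]) auto
    next
      case False
      hence ge: "degree m \<le> degree p" by simp
      let ?t = "monom (lead_coeff p) (degree p - degree m)"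
      define p' where "p' = p - ?t * m"
      have tEP: "?t \<in> EP" using less.prems by (intro EPmonom) (simp add: EP_def)
      have p'EP: "p' \<in> EP" unfolding p'_def by (intro EPdiff EPmult less.prems tEP m(1))
      have "coeff p' (degree p) = 0"
      proof -
        have "coeff (?t * m) (degree p) = lead_coeff p * coeff m (degree m)"
          using ge by (simp add: coeff_monom_mult)
        thus ?thesis using m(4) by (simp add: p'_def)
      qed
      moreover have "degree p' \<le> degree p"
        unfolding p'_def
      proof (rule degree_diff_le)
        have "degree (?t * m) \<le> degree ?t + degree m" by (rule degree_mult_le)
        also have "\<dots> \<le> degree p" using degree_monom_le[of "lead_coeff p" "degree p - degree m"] ge by simp
        finally show "degree (?t * m) \<le> degree p" .
      qed simp
      ultimately have "degree p' < degree p"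
        using degm ge leading_coeff_0_iff[of p'] by (cases "degree p' = degree p") auto
      then obtain q r where qr: "q \<in> EP" "r \<in> EP" "p' = m * q + r" "r = 0 \<or> degree r < degree m"
        using less.hyps[OF _ p'EP] by blast
      have "p = m * (q + ?t) + r" using qr(3) by (simp add: p'_def algebra_simps)
      thus ?thesis using qr tEP EPadd by (intro exI[of _ "q + ?t"] exI[of _ r]) auto
    qed
  qed
  have root: "poly p x = 0" if p: "p \<in> EP" "poly p b = 0" and x: "poly m x = 0" for p x
  proof -
    obtain q r where qr: "r \<in> EP" "p = m * q + r" "r = 0 \<or> degree r < degree m" using division[OF p(1)] by blast
    have "poly r b = 0" using p(2) m(3) qr(2) by simp
    hence "r = 0" using min0[of r] qr m(5) by (cases "r = 0") auto
    thus ?thesis using qr(2) x by simp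
  qed
  have only: "x = b" if x: "poly m x = 0" for x
  proof (rule ccontr)
    assume ne: "x \<noteq> b"
    have "ev g x = 0" using root[OF EPrp[of g] _ x] g(2) unfolding ev_def by simp
    moreover have "ev f (\<gamma> - of_rat c * x) = 0" using root[OF hEP hb x] by (simp add: hval)
    moreover have "of_rat c = ((\<gamma> - of_rat c * x) - a) / (b - x)" using ne by (simp add: \<gamma>_def field_simps)
    ultimately have "of_rat c \<in> bad" unfolding bad_def by force
    thus False using c by simp
  qed
  obtain A where A: "size A = degree m" "m = Polynomial.smult (lead_coeff m) (\<Prod>x\<in>#A. [:- x, 1:])"
    using alg_closed_imp_factorization[OF m(2)] by blast
  have "x = b" if "x \<in># A" for x
  proof (rule only)
    have "poly (\<Prod>x\<in>#A. [:- x, 1:]) x = 0" using that by (induction A) auto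
    thus "poly m x = 0" using A(2) by (metis mult_zero_right poly_smult)
  qed
  hence "set_mset A \<subseteq> {b}" by blast
  hence eq: "A = replicate_mset (size A) b" by (rule set_mset_subset_singletonD)
  have "m = (\<Prod>x\<in>#A. [:- x, 1:])" using A(2) m(4) by simp
  also have "\<dots> = (\<Prod>x\<in>#replicate_mset (size A) b. [:- x, 1:])" using eq by simp
  also have "\<dots> = [:- b, 1:] ^ degree m" using A(1) by simp
  finally have mpow: "m = [:- b, 1:] ^ degree m" .
  \<comment> \<open>In the expanded power, the coefficient just below the top is \<open>- b\<close>
    times the degree, which is invertible in characteristic 0.\<close>
  have ch: "degree m choose (degree m - 1) = degree m"
    using binomial_symmetric[of 1 "degree m"] degm by simp
  have "coeff ([:- b, 1:] ^ degree m) (degree m - 1) = of_nat (degree m) * (- b)"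
    using coeff_linear_poly_power[of "degree m - 1" "degree m" "- b" 1] degm ch by simp
  hence "coeff m (degree m - 1) = of_nat (degree m) * (- b)" using mpow by simp
  moreover have "coeff m (degree m - 1) \<in> E" using m(1) by (simp add: EP_def)
  ultimately have cm: "of_nat (degree m) * (- b) \<in> E" by simp
  have "of_nat (degree m) \<in> E" using Erat[of "of_nat (degree m)"] by simp
  hence "inverse (of_nat (degree m)) * - (of_nat (degree m) * (- b)) \<in> E"
    by (intro Emult Einv Eumin cm)
  moreover have "inverse (of_nat (degree m)) * - (of_nat (degree m) * (- b)) = b"
    using degm by (simp add: mult.assoc[symmetric])
  ultimately have bE: "b \<in> E" by (simp only:)
  have "\<gamma> - of_rat c * b \<in> E" by (intro Ediff Emult E\<gamma> bE Erat)
  hence aE: "a \<in> E" by (simp add: \<gamma>_def)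
  show ?thesis using \<gamma> E_ex[OF aE] E_ex[OF bE] by blast
qed

lemma primitive_list:
  assumes "set ys \<subseteq> K" shows "\<exists>\<gamma>\<in>K. \<forall>y\<in>set ys. \<exists>p. y = ev p \<gamma>"
  using assms
proof (induction ys)
  case Nil thus ?case using K_one by auto
next
  case (Cons y ys)
  then obtain \<gamma> where \<gamma>: "\<gamma> \<in> K" "\<And>z. z \<in> set ys \<Longrightarrow> \<exists>p. z = ev p \<gamma>" by auto
  obtain \<delta> p q where \<delta>: "\<delta> \<in> K" "y = ev p \<delta>" "\<gamma> = ev q \<delta>"
    using primitive_two[of y \<gamma>] Cons.prems \<gamma>(1) by auto
  have "\<exists>r. z = ev r \<delta>" if "z \<in> set ys" for z
    using \<gamma>(2)[OF that] \<delta>(3) by (metis ev_pcompose)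
  thus ?case using \<delta> by (intro bexI[of _ \<delta>]) auto
qed

theorem primitive_element: "\<exists>\<alpha>. \<alpha> \<in> K \<and> (\<forall>x\<in>K. \<exists>p. x = ev p \<alpha>)"
proof -
  obtain xs where xs: "set xs \<subseteq> K" "length xs = d" "\<And>x. x \<in> K \<Longrightarrow> \<exists>q. x = (\<Sum>j<d. of_rat (q j) * xs ! j)"
    using exists_rat_base by blast
  obtain \<alpha> where \<alpha>: "\<alpha> \<in> K" "\<And>y. y \<in> set xs \<Longrightarrow> \<exists>p. y = ev p \<alpha>" using primitive_list[OF xs(1)] by blast
  then obtain P where P: "\<And>y. y \<in> set xs \<Longrightarrow> y = ev (P y) \<alpha>" by metis
  have "\<exists>p. x = ev p \<alpha>" if x: "x \<in> K" for x
  proof -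
    obtain q where "x = (\<Sum>j<d. of_rat (q j) * xs ! j)" using xs(3)[OF x] by blast
    also have "\<dots> = ev (\<Sum>j<d. Polynomial.smult (q j) (P (xs ! j))) \<alpha>"
      unfolding ev_sum using P xs(2) by (intro sum.cong) auto
    finally show ?thesis by blast
  qed
  thus ?thesis using \<alpha>(1) by blast
qed

section \<open>Conjugates of a primitive element and the norm\<close>

definition \<alpha> :: qbar where "\<alpha> = (SOME \<alpha>. \<alpha> \<in> K \<and> (\<forall>x\<in>K. \<exists>p. x = ev p \<alpha>))"

lemma \<alpha>: "\<alpha> \<in> K" "x \<in> K \<Longrightarrow> \<exists>p. x = ev p \<alpha>"
  using someI_ex[OF primitive_element] unfolding \<alpha>_def[symmetric] by auto

definition mp :: "rat poly" where
  "mp = (SOME f. f \<noteq> 0 \<and> ev f \<alpha> = 0 \<and> (\<forall>g. ev g \<alpha> = 0 \<longrightarrow> f dvd g))"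

lemma mp: "mp \<noteq> 0" "ev mp \<alpha> = 0" "ev g \<alpha> = 0 \<Longrightarrow> mp dvd g"
  using someI_ex[OF exists_min_poly[OF \<alpha>(1)]] unfolding mp_def[symmetric] by auto

lemma degree_mp: "degree mp = d"
proof -
  let ?n = "degree mp" and ?ys = "map (\<lambda>i. \<alpha> ^ i) [0..<degree mp]"
  have "length ?ys = d"
  proof (rule rat_basis_length)
    show "set ?ys \<subseteq> K" using \<alpha>(1) by (auto intro: K_power)
    show "rat_indep ?ys"
      unfolding rat_indep_def
    proof (intro allI impI)
      fix q :: "nat \<Rightarrow> rat" and j assume "(\<Sum>j<length ?ys. of_rat (q j) * ?ys ! j) = 0" and j: "j < length ?ys"
      hence s: "(\<Sum>j<?n. of_rat (q j) * \<alpha> ^ j) = 0" by simp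
      define p where "p = (\<Sum>j<?n. monom (q j) j)"
      have c: "coeff p i = (if i < ?n then q i else 0)" for i by (simp add: p_def coeff_sum)
      have "ev p \<alpha> = 0" using s by (simp add: p_def ev_sum ev_monom)
      hence dv: "mp dvd p" by (rule mp(3))
      have "p = 0"
      proof (rule ccontr)
        assume "p \<noteq> 0"
        hence "?n \<le> degree p" using dv by (rule dvd_imp_degree_le[rotated])
        hence "coeff p (degree p) = 0" using c by simp
        thus False using \<open>p \<noteq> 0\<close> by simp
      qed
      thus "q j = 0" using c[of j] j by simp
    qed
    fix x assume "x \<in> K"
    then obtain p where p: "x = ev p \<alpha>" using \<alpha>(2) by blast
    have "x = ev (p mod mp) \<alpha>" using mp(2) p ev_mod[of p \<alpha> mp] by simp
    also have "\<dots> = (\<Sum>j<?n. of_rat (coeff (p mod mp) j) * \<alpha> ^ j)"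
      by (rule ev_alt) (use degree_mod_less[of mp p] mp(1) in auto)
    finally show "\<exists>q. x = (\<Sum>j<length ?ys. of_rat (q j) * ?ys ! j)" by (intro exI[of _ "coeff (p mod mp)"]) simp
  qed
  thus ?thesis by simp
qed

lemma ev_rep: "x \<in> K \<Longrightarrow> \<exists>p. x = ev p \<alpha> \<and> (p = 0 \<or> degree p < d)"
proof -
  assume "x \<in> K"
  then obtain p where p: "x = ev p \<alpha>" using \<alpha>(2) by blast
  have "x = ev (p mod mp) \<alpha>" using mp(2) p ev_mod[of p \<alpha> mp] by simp
  moreover have "p mod mp = 0 \<or> degree (p mod mp) < d" using degree_mod_less[of mp p] mp(1) degree_mp by auto
  ultimately show ?thesis by (intro exI[of _ "p mod mp"] conjI)
qed

definition conj :: "qbar set" where "conj = {\<beta>. ev mp \<beta> = 0}"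

lemma finite_conj: "finite conj"
  unfolding conj_def by (rule ev_0_finite[OF mp(1)])

text \<open>The gcd of \<open>mp\<close> and its derivative does not vanish at
  \<open>\<alpha>\<close>, since \<open>mp\<close> cannot divide a nonzero polynomial of smaller
  degree. So the cofactor does and has full degree, the gcd is constant, and the Bezout identity
  excludes a common root.\<close>

lemma conj_simple: "\<beta> \<in> conj \<Longrightarrow> ev (pderiv mp) \<beta> \<noteq> 0"
proof
  assume \<beta>: "\<beta> \<in> conj" "ev (pderiv mp) \<beta> = 0"
  define c where "c = gcd mp (pderiv mp)"
  have dnz: "degree mp \<noteq> 0"
  proof
    assume "degree mp = 0"
    then obtain x where "mp = [:x:]" using degree_eq_zeroE by blast
    thus False using mp(1,2) by simp
  qed
  have pd: "pderiv mp \<noteq> 0" using dnz by (simp add: pderiv_eq_0_iff)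
  have cd: "c dvd mp" "c dvd pderiv mp" by (simp_all add: c_def)
  have "ev c \<alpha> \<noteq> 0"
  proof
    assume "ev c \<alpha> = 0"
    hence "mp dvd pderiv mp" using mp(3) cd(2) dvd_trans by blast
    hence "degree mp \<le> degree (pderiv mp)" using pd by (rule dvd_imp_degree_le)
    thus False using dnz by (simp add: degree_pderiv)
  qed
  obtain k where k: "mp = c * k" using cd(1) by auto
  hence "ev k \<alpha> = 0" using mp(2) \<open>ev c \<alpha> \<noteq> 0\<close> by simp
  hence "mp dvd k" by (rule mp(3))
  moreover have knz: "k \<noteq> 0" "c \<noteq> 0" using k mp(1) by auto
  ultimately have "degree mp \<le> degree k" by (intro dvd_imp_degree_le)
  hence "degree c = 0" using k knz by (simp add: degree_mult_eq)
  then obtain x where x: "c = [:x:]" using degree_eq_zeroE by blast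
  obtain s t where "s * mp + t * pderiv mp = c"
    using bezout_coefficients_fst_snd[of mp "pderiv mp"] c_def by (metis mult.commute)
  hence "ev (s * mp + t * pderiv mp) \<beta> = ev c \<beta>" by simp
  hence "ev c \<beta> = 0" using \<beta> by (simp add: conj_def)
  thus False using x knz by simp
qed

text \<open>\<open>mp\<close> splits over the algebraic numbers, and a repeated linear factor would
  give a root of the derivative.\<close>

lemma card_conj: "card conj = d"
proof -
  let ?p = "map_poly of_rat mp :: qbar poly"
  have pnz: "?p \<noteq> 0" using mp(1) by simp
  obtain A where A: "size A = degree ?p" "?p = Polynomial.smult (lead_coeff ?p) (\<Prod>x\<in>#A. [:- x, 1:])"
    using alg_closed_imp_factorization[OF pnz] by blast
  have roots: "ev mp x = 0 \<longleftrightarrow> x \<in># A" for x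
  proof -
    have "ev mp x = lead_coeff ?p * poly (\<Prod>x\<in>#A. [:- x, 1:]) x"
      unfolding ev_def by (subst A(2)) simp
    also have "poly (\<Prod>x\<in>#A. [:- x, 1:]) x = (\<Prod>y\<in>#A. x - y)" by (induction A) (auto simp: algebra_simps)
    finally have "ev mp x = 0 \<longleftrightarrow> (\<Prod>y\<in>#A. x - y) = 0" using pnz by simp
    also have "\<dots> \<longleftrightarrow> x \<in># A" by (induction A) auto
    finally show ?thesis .
  qed
  have "count A x \<le> 1" for x
  proof (rule ccontr)
    assume "\<not> count A x \<le> 1"
    hence "{#x, x#} \<subseteq># A" by (auto simp: subseteq_mset_def)
    then obtain B where B: "A = {#x, x#} + B" by (metis subset_mset.le_iff_add)
    obtain q where q: "?p = [:- x, 1:] * ([:- x, 1:] * q)"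
      by (rule that[of "Polynomial.smult (lead_coeff ?p) (\<Prod>x\<in>#B. [:- x, 1:])"], subst A(2)) (simp add: B mult_ac)
    have "poly (pderiv ?p) x = 0" unfolding q pderiv_mult by (simp add: pderiv_pCons)
    moreover have "map_poly of_rat (pderiv mp) = pderiv ?p" by (rule of_rat_hom.map_poly_pderiv)
    ultimately have "ev (pderiv mp) x = 0" by (simp add: ev_def)
    moreover have "x \<in> conj" unfolding conj_def using roots B by simp
    ultimately show False using conj_simple by blast
  qed
  hence c1: "count A x \<le> 1" for x .
  have "A = mset_set (set_mset A)"
  proof (rule multiset_eqI)
    fix x
    show "count A x = count (mset_set (set_mset A)) x"
    proof (cases "x \<in># A")
      case True
      hence "0 < count A x" by simp
      hence "count A x = 1" using c1[of x] by linarith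
      thus ?thesis using True by simp
    qed (simp add: not_in_iff)
  qed
  hence "size A = card (set_mset A)" using size_mset_set[of "set_mset A"] by (simp only:)
  moreover have "set_mset A = conj" using roots by (auto simp: conj_def)
  ultimately show ?thesis using A(1) degree_mp by simp
qed

text \<open>The embedding of \<open>K\<close> that sends \<open>\<alpha>\<close> to
  \<open>\<beta>\<close>. By \<open>\<sigma>_ev\<close> the choice of the polynomial does not matter
  when \<open>\<beta>\<close> is a conjugate.\<close>

definition \<sigma> :: "qbar \<Rightarrow> qbar \<Rightarrow> qbar" where
  "\<sigma> \<beta> x = ev (SOME p. x = ev p \<alpha>) \<beta>"

lemma \<sigma>_ev:
  assumes "\<beta> \<in> conj" shows "\<sigma> \<beta> (ev p \<alpha>) = ev p \<beta>"
proof -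
  define q where "q = (SOME q. ev p \<alpha> = ev q \<alpha>)"
  have q: "ev p \<alpha> = ev q \<alpha>" unfolding q_def by (rule someI[of _ p]) simp
  hence "mp dvd q - p" by (intro mp(3)) simp
  then obtain k where "q - p = mp * k" by auto
  hence "ev (q - p) \<beta> = 0" using assms by (simp add: conj_def del: ev_simps(4))
  thus ?thesis unfolding \<sigma>_def q_def[symmetric] by simp
qed

lemma \<sigma>_hom:
  assumes \<beta>: "\<beta> \<in> conj" and x: "x \<in> K" and y: "y \<in> K"
  shows "\<sigma> \<beta> (x + y) = \<sigma> \<beta> x + \<sigma> \<beta> y" "\<sigma> \<beta> (x * y) = \<sigma> \<beta> x * \<sigma> \<beta> y"
proof -
  obtain p q where pq: "x = ev p \<alpha>" "y = ev q \<alpha>" using \<alpha>(2) x y by blast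
  show "\<sigma> \<beta> (x + y) = \<sigma> \<beta> x + \<sigma> \<beta> y" "\<sigma> \<beta> (x * y) = \<sigma> \<beta> x * \<sigma> \<beta> y"
    using \<sigma>_ev[OF \<beta>, of "p + q"] \<sigma>_ev[OF \<beta>, of "p * q"] \<sigma>_ev[OF \<beta>] pq by simp_all
qed

lemma \<sigma>_of_rat: "\<beta> \<in> conj \<Longrightarrow> \<sigma> \<beta> (of_rat q) = of_rat q"
  using \<sigma>_ev[of \<beta> "[:q:]"] by simp

lemma \<sigma>_eq_0:
  assumes "\<beta> \<in> conj" "x \<in> K" shows "\<sigma> \<beta> x = 0 \<longleftrightarrow> x = 0"
proof
  assume *: "\<sigma> \<beta> x = 0"
  show "x = 0"
  proof (rule ccontr)
    assume "x \<noteq> 0"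
    hence "\<sigma> \<beta> (x * inverse x) = 1" using \<sigma>_of_rat[OF assms(1), of 1] by simp
    thus False using \<sigma>_hom(2)[OF assms K_inverse[OF assms(2)]] * by simp
  qed
qed (use \<sigma>_of_rat[OF assms(1), of 0] in simp)

text \<open>In the basis of powers of \<open>\<alpha>\<close>, multiplication by \<open>x\<close>
  has a rational matrix. The Vandermonde matrix \<open>V\<close> of the conjugates diagonalises it
  with the entries \<open>\<sigma> \<beta> x\<close>, whose product is therefore a rational
  determinant.\<close>

theorem norm_rational:
  assumes x: "x \<in> K" shows "\<exists>n. (\<Prod>\<beta>\<in>conj. \<sigma> \<beta> x) = of_rat n"
proof -
  obtain bs where bs: "set bs = conj" "distinct bs" using finite_distinct_list[OF finite_conj] by blast
  have lbs: "length bs = d" using distinct_card[OF bs(2)] bs(1) card_conj by simp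
  have bc: "bs ! j \<in> conj" if "j < d" for j using bs(1) lbs that nth_mem by metis
  have "\<exists>q :: nat \<Rightarrow> rat. x * \<alpha> ^ i = (\<Sum>j<d. of_rat (q j) * \<alpha> ^ j)" for i
  proof -
    have "x * \<alpha> ^ i \<in> K" using x \<alpha>(1) by (intro K_mult K_power)
    then obtain p where p: "x * \<alpha> ^ i = ev p \<alpha>" "p = 0 \<or> degree p < d" using ev_rep by blast
    show ?thesis using ev_alt[OF p(2), of \<alpha>] p(1) by auto
  qed
  then obtain Q :: "nat \<Rightarrow> nat \<Rightarrow> rat" where Q: "\<And>i. x * \<alpha> ^ i = (\<Sum>j<d. of_rat (Q i j) * \<alpha> ^ j)" by metis
  define Mr where "Mr = mat d d (\<lambda>(i, j). Q i j)"
  define Mm where "Mm = (map_mat of_rat Mr :: qbar mat)"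
  define V where "V = mat d d (\<lambda>(i, j). (bs ! j) ^ i)"
  define D where "D = mat d d (\<lambda>(i, j). if i = j then \<sigma> (bs ! j) x else 0)"
  have car: "Mr \<in> carrier_mat d d" "Mm \<in> carrier_mat d d" "V \<in> carrier_mat d d" "D \<in> carrier_mat d d"
    by (simp_all add: Mr_def Mm_def V_def D_def)
  have key: "\<sigma> \<beta> x * \<beta> ^ i = (\<Sum>j<d. of_rat (Q i j) * \<beta> ^ j)" if \<beta>: "\<beta> \<in> conj" for \<beta> i
  proof -
    have pw: "\<beta> ^ j = \<sigma> \<beta> (\<alpha> ^ j)" for j using \<sigma>_ev[OF \<beta>, of "[:0, 1:] ^ j"] by simp
    have "\<sigma> \<beta> x * \<beta> ^ i = \<sigma> \<beta> (x * \<alpha> ^ i)" unfolding pw by (rule \<sigma>_hom(2)[symmetric, OF \<beta> x K_power[OF \<alpha>(1)]])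
    also have "x * \<alpha> ^ i = ev (\<Sum>j<d. Polynomial.smult (Q i j) ([:0, 1:] ^ j)) \<alpha>" unfolding Q by (simp add: ev_sum)
    also have "\<sigma> \<beta> \<dots> = (\<Sum>j<d. of_rat (Q i j) * \<beta> ^ j)" unfolding \<sigma>_ev[OF \<beta>] by (simp add: ev_sum)
    finally show ?thesis .
  qed
  have "Mm * V = V * D"
  proof (rule eq_matI)
    fix i j assume "i < dim_row (V * D)" "j < dim_col (V * D)"
    hence ij: "i < d" "j < d" using car by auto
    have "(Mm * V) $$ (i, j) = (\<Sum>k<d. of_rat (Q i k) * (bs ! j) ^ k)"
      using ij by (simp add: Mm_def Mr_def V_def scalar_prod_def atLeast0LessThan)
    also have "\<dots> = \<sigma> (bs ! j) x * (bs ! j) ^ i" using key[OF bc[OF ij(2)]] by simp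
    also have "\<dots> = (\<Sum>k<d. (bs ! k) ^ i * (if k = j then \<sigma> (bs ! j) x else 0))"
      using ij by (simp add: if_distrib sum.delta mult.commute cong: if_cong)
    also have "\<dots> = (V * D) $$ (i, j)"
      using ij by (simp add: V_def D_def scalar_prod_def atLeast0LessThan)
    finally show "(Mm * V) $$ (i, j) = (V * D) $$ (i, j)" .
  qed (use car in auto)
  hence "det (Mm * V) = det (V * D)" by simp
  hence "det Mm * det V = det V * det D" using det_mult[OF car(2,3)] det_mult[OF car(3,4)] by simp
  \<comment> \<open>A vector in the kernel of the transpose would be the coefficient list of a
    nonzero polynomial of degree below \<open>d\<close> vanishing at all \<open>d\<close>
    conjugates.\<close>
  moreover have "det V \<noteq> 0"
  proof
    assume "det V = 0"
    hence "det (transpose_mat V) = 0" using det_transpose[OF car(3)] by simp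
    then obtain z where z: "z \<in> carrier_vec d" "z \<noteq> 0\<^sub>v d" "transpose_mat V *\<^sub>v z = 0\<^sub>v d"
      using det_0_iff_vec_prod_zero_field[of "transpose_mat V" d] car(3) by auto
    define p where "p = (\<Sum>i<d. monom (z $ i) i)"
    have cp: "coeff p i = (if i < d then z $ i else 0)" for i by (simp add: p_def coeff_sum)
    have "poly p \<beta> = 0" if "\<beta> \<in> conj" for \<beta>
    proof -
      have "\<beta> \<in> set bs" using that bs(1) by simp
      then obtain j where j: "j < d" "\<beta> = bs ! j" using lbs by (auto simp: in_set_conv_nth)
      have "(transpose_mat V *\<^sub>v z) $ j = (\<Sum>i<d. (bs ! j) ^ i * z $ i)"
        using j(1) z(1) car(3) by (simp add: V_def scalar_prod_def atLeast0LessThan)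
      thus ?thesis using z(3) j by (simp add: p_def poly_sum poly_monom mult.commute)
    qed
    hence sub: "conj \<subseteq> {x. poly p x = 0}" by auto
    have pnz: "p \<noteq> 0"
    proof
      assume "p = 0"
      hence "z $ i = 0" if "i < d" for i using cp[of i] that by simp
      hence "z = 0\<^sub>v d" using z(1) by (intro eq_vecI) auto
      thus False using z(2) by simp
    qed
    have "degree p < d"
    proof (rule ccontr)
      assume "\<not> degree p < d"
      hence "coeff p (degree p) = 0" using cp by simp
      thus False using pnz by simp
    qed
    moreover have "card conj \<le> card {x. poly p x = 0}" by (rule card_mono[OF poly_roots_finite[OF pnz] sub])
    ultimately show False using card_conj card_poly_roots_bound[OF pnz] by simp
  qed
  ultimately have "det D = det Mm" by simp
  also have "\<dots> = of_rat (det Mr)" unfolding Mm_def by simp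
  finally have "det D = of_rat (det Mr)" .
  moreover have "det D = (\<Prod>\<beta>\<in>conj. \<sigma> \<beta> x)"
  proof -
    have "det D = prod_list (diag_mat D)" by (rule det_upper_triangular[OF _ car(4)]) (auto simp: D_def upper_triangular_def)
    also have "diag_mat D = map (\<lambda>\<beta>. \<sigma> \<beta> x) bs"
      by (rule nth_equalityI) (auto simp: diag_mat_def D_def lbs)
    also have "prod_list \<dots> = (\<Prod>\<beta>\<in>conj. \<sigma> \<beta> x)" using prod.distinct_set_conv_list[OF bs(2), of "\<lambda>\<beta>. \<sigma> \<beta> x"] bs(1) by simp
    finally show ?thesis .
  qed
  ultimately have "(\<Prod>\<beta>\<in>conj. \<sigma> \<beta> x) = of_rat (det Mr)" by simp
  thus ?thesis by (intro exI[of _ "det Mr"])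
qed

end

section \<open>The usual absolute values of the rationals\<close>

text \<open>Frees \<open>padic_abs\<close> from lowest terms: after cross multiplication the
  multiplicities of \<open>p\<close> can be compared.\<close>

lemma padic_abs_frac:
  assumes p: "Factorial_Ring.prime p" and "a \<noteq> 0" "b \<noteq> 0"
  shows "padic_abs p (of_int a / of_int b) =
    real p powi (int (multiplicity (int p) b) - int (multiplicity (int p) a))"
proof -
  obtain n e where q: "quotient_of (of_int a / of_int b) = (n, e)" by (cases "quotient_of (of_int a / of_int b)")
  have e: "e > 0" by (rule quotient_of_denom_pos[OF q])
  have eq: "of_int a / of_int b = (of_int n / of_int e :: rat)" by (rule quotient_of_div[OF q])
  hence "of_int (a * e) = (of_int (n * b) :: rat)" using assms e by (simp add: frac_eq_eq)
  hence ae: "a * e = n * b" by (simp only: of_int_eq_iff)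
  have n: "n \<noteq> 0" using ae assms e by auto
  have pe: "prime_elem (int p)" using p by (simp add: prime_int_nat_transfer prime_imp_prime_elem)
  have "multiplicity (int p) (a * e) = multiplicity (int p) (n * b)" using ae by simp
  hence "multiplicity (int p) a + multiplicity (int p) e = multiplicity (int p) n + multiplicity (int p) b"
    using pe assms e n by (simp add: prime_elem_multiplicity_mult_distrib)
  hence "int (multiplicity (int p) e) - int (multiplicity (int p) n)
    = int (multiplicity (int p) b) - int (multiplicity (int p) a)" by linarith
  moreover have "of_int a / of_int b \<noteq> (0 :: rat)" using assms by simp
  ultimately show ?thesis unfolding padic_abs_def q by simp
qed

lemma rat_frac:
  fixes x :: rat
  obtains a b :: int where "x = of_int a / of_int b" "b \<noteq> 0"
proof -
  obtain n e where q: "quotient_of x = (n, e)" by (cases "quotient_of x")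
  show ?thesis by (rule that[of n e]) (use quotient_of_div[OF q] quotient_of_denom_pos[OF q] in auto)
qed

lemma padic_abs_nonneg: "0 \<le> padic_abs p x"
  by (simp add: padic_abs_def zero_le_power_int)

lemma padic_abs_0 [simp]: "padic_abs p 0 = 0"
  by (simp add: padic_abs_def)

lemma padic_abs_mult:
  assumes p: "Factorial_Ring.prime p" shows "padic_abs p (x * y) = padic_abs p x * padic_abs p y"
proof (cases "x = 0 \<or> y = 0")
  case False
  obtain a b where x: "x = of_int a / of_int b" "b \<noteq> 0" by (rule rat_frac)
  obtain c e where y: "y = of_int c / of_int e" "e \<noteq> 0" by (rule rat_frac)
  have nz: "a \<noteq> 0" "c \<noteq> 0" using False x y by auto
  have pe: "prime_elem (int p)" using p by (simp add: prime_int_nat_transfer prime_imp_prime_elem)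
  have "x * y = of_int (a * c) / of_int (b * e)" by (simp add: x y)
  hence "padic_abs p (x * y) = real p powi (int (multiplicity (int p) (b * e)) - int (multiplicity (int p) (a * c)))"
    using padic_abs_frac[OF p, of "a * c" "b * e"] nz x(2) y(2) by simp
  also have "\<dots> = real p powi ((int (multiplicity (int p) b) - int (multiplicity (int p) a))
      + (int (multiplicity (int p) e) - int (multiplicity (int p) c)))"
    using nz x(2) y(2) pe by (simp add: prime_elem_multiplicity_mult_distrib algebra_simps)
  also have "\<dots> = padic_abs p x * padic_abs p y"
    using padic_abs_frac[OF p, of a b] padic_abs_frac[OF p, of c e] nz x y prime_gt_0_nat[OF p]
    by (simp add: power_int_add)
  finally show ?thesis .
qed auto

lemma padic_abs_pos: "Factorial_Ring.prime p \<Longrightarrow> x \<noteq> 0 \<Longrightarrow> 0 < padic_abs p x"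
  by (simp add: padic_abs_def prime_gt_0_nat zero_less_power_int)

text \<open>Over a common denominator, the power of \<open>p\<close> dividing both numerators
  divides their sum.\<close>

lemma padic_abs_add:
  assumes p: "Factorial_Ring.prime p" shows "padic_abs p (x + y) \<le> max (padic_abs p x) (padic_abs p y)"
proof (cases "x = 0 \<or> y = 0 \<or> x + y = 0")
  case True
  thus ?thesis using padic_abs_nonneg[of p x] padic_abs_nonneg[of p y] by auto
next
  case False
  obtain a b where x: "x = of_int a / of_int b" "b \<noteq> 0" by (rule rat_frac)
  obtain c e where y: "y = of_int c / of_int e" "e \<noteq> 0" by (rule rat_frac)
  define A where "A = a * e"
  define C where "C = c * b"
  define B where "B = b * e"
  have eqs: "x = of_int A / of_int B" "y = of_int C / of_int B" "x + y = of_int (A + C) / of_int B"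
    using x y by (simp_all add: A_def B_def C_def field_simps)
  have nz: "A \<noteq> 0" "C \<noteq> 0" "A + C \<noteq> 0" "B \<noteq> 0" using False eqs x(2) y(2) by (auto simp: B_def)
  define k where "k = min (multiplicity (int p) A) (multiplicity (int p) C)"
  have "int p ^ k dvd A" "int p ^ k dvd C"
    unfolding k_def by (meson min.cobounded1 min.cobounded2 multiplicity_dvd')+
  hence "int p ^ k dvd A + C" by simp
  moreover have "\<not> is_unit (int p)" using prime_gt_1_nat[OF p] by auto
  ultimately have "k \<le> multiplicity (int p) (A + C)" using nz(3) by (intro multiplicity_geI) auto
  moreover have p1: "1 < real p" using prime_gt_1_nat[OF p] by simp
  moreover have "padic_abs p (x + y) = real p powi (int (multiplicity (int p) B) - int (multiplicity (int p) (A + C)))"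
    unfolding eqs(3) by (rule padic_abs_frac[OF p nz(3,4)])
  ultimately have "padic_abs p (x + y) \<le> real p powi (int (multiplicity (int p) B) - int k)"
    by (simp add: power_int_mono_iff power_int_increasing)
  also have "\<dots> \<le> max (padic_abs p x) (padic_abs p y)"
    unfolding eqs(1,2) padic_abs_frac[OF p nz(1,4)] padic_abs_frac[OF p nz(2,4)] k_def
    by (cases "multiplicity (int p) A \<le> multiplicity (int p) C") (auto simp: min_def)
  finally show ?thesis .
qed

lemma padic_abs_of_int:
  assumes p: "Factorial_Ring.prime p" "n \<noteq> 0"
  shows "padic_abs p (of_int n) = 1 / real p ^ multiplicity (int p) n"
  using padic_abs_frac[OF p(1), of n 1] p(2) by (simp add: power_int_minus inverse_eq_divide)

lemma padic_abs_prime: "Factorial_Ring.prime p \<Longrightarrow> padic_abs p (of_nat p) = 1 / real p"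
proof -
  assume p: "Factorial_Ring.prime p"
  have "multiplicity (int p) (int p) = 1"
    using p prime_gt_1_nat[OF p] by (intro multiplicity_self) auto
  thus ?thesis using padic_abs_of_int[OF p, of "int p"] prime_gt_0_nat[OF p] by simp
qed

text \<open>The last clause, nontriviality, supplies the rational scaling factors in the separation
  of places.\<close>

lemma usual_abs:
  assumes "u \<in> usual_abs_values"
  shows "0 \<le> u x" "u x = 0 \<longleftrightarrow> x = 0" "u (x * y) = u x * u y" "u (x + y) \<le> u x + u y" "\<exists>t. 1 < u t"
proof -
  consider "u = (\<lambda>x. \<bar>of_rat x\<bar>)" | p where "Factorial_Ring.prime p" "u = padic_abs p"
    using assms unfolding usual_abs_values_def by blast
  hence "0 \<le> u x \<and> (u x = 0 \<longleftrightarrow> x = 0) \<and> u (x * y) = u x * u y \<and> u (x + y) \<le> u x + u y \<and> (\<exists>t. 1 < u t)"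
  proof cases
    case 1
    have "\<bar>real_of_rat (x + y)\<bar> \<le> \<bar>real_of_rat x\<bar> + \<bar>real_of_rat y\<bar>"
      unfolding of_rat_add by (rule abs_triangle_ineq)
    moreover have "\<bar>real_of_rat (x * y)\<bar> = \<bar>real_of_rat x\<bar> * \<bar>real_of_rat y\<bar>"
      unfolding of_rat_mult by (rule abs_mult)
    moreover have "1 < \<bar>real_of_rat 2\<bar>" by simp
    moreover have "\<bar>real_of_rat x\<bar> = 0 \<longleftrightarrow> x = 0" "0 \<le> \<bar>real_of_rat x\<bar>" by simp_all
    ultimately show ?thesis unfolding 1 by blast
  next
    case p: 2
    have "padic_abs p (inverse (of_nat p)) * padic_abs p (of_nat p) = padic_abs p (inverse (of_nat p) * of_nat p)"
      by (rule padic_abs_mult[OF p(1), symmetric])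
    also have "\<dots> = 1" using prime_gt_0_nat[OF p(1)] padic_abs_of_int[OF p(1), of 1] by simp
    finally have "padic_abs p (inverse (of_nat p)) = real p"
      using padic_abs_prime[OF p(1)] prime_gt_0_nat[OF p(1)] by (simp add: field_simps)
    hence "1 < padic_abs p (inverse (of_nat p))" using prime_gt_1_nat[OF p(1)] by simp
    moreover have "padic_abs p x = 0 \<longleftrightarrow> x = 0"
      using padic_abs_pos[OF p(1), of x] by (cases "x = 0") simp_all
    moreover have "padic_abs p (x + y) \<le> padic_abs p x + padic_abs p y"
      using padic_abs_add[OF p(1), of x y] padic_abs_nonneg[of p x] padic_abs_nonneg[of p y] by linarith
    ultimately show ?thesis unfolding p(2) using padic_abs_nonneg padic_abs_mult[OF p(1)] by blast
  qed
  thus "0 \<le> u x" "u x = 0 \<longleftrightarrow> x = 0" "u (x * y) = u x * u y" "u (x + y) \<le> u x + u y" "\<exists>t. 1 < u t" by auto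
qed

section \<open>Places above a given absolute value\<close>

context place
begin

lemma KR_uminus: "x \<in> K \<Longrightarrow> \<ominus>\<^bsub>KR K\<^esub> x = - x"
  using P.minus_equality[of "- x" x] K_uminus by simp

lemma KR_pow: "x [^]\<^bsub>KR K\<^esub> (n :: nat) = x ^ n"
  by (induction n) simp_all

lemma v_nonneg: "x \<in> K \<Longrightarrow> 0 \<le> v x"
  and v_eq_0: "x \<in> K \<Longrightarrow> v x = 0 \<longleftrightarrow> x = 0"
  and v_pos: "x \<in> K \<Longrightarrow> x \<noteq> 0 \<Longrightarrow> 0 < v x"
  and v_mult: "x \<in> K \<Longrightarrow> y \<in> K \<Longrightarrow> v (x * y) = v x * v y"
  and v_add: "x \<in> K \<Longrightarrow> y \<in> K \<Longrightarrow> v (x + y) \<le> v x + v y"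
  and v_power: "x \<in> K \<Longrightarrow> v (x ^ n) = v x ^ n"
  and v_uminus: "x \<in> K \<Longrightarrow> v (- x) = v x"
  and v_1: "v 1 = 1"
  and v_0: "v 0 = 0"
  using P.abs_nonneg[of x] P.abs_eq_0[of x] P.abs_pos[of x] P.abs_mult[of x y] P.abs_add_le[of x y]
    P.abs_pow[of x n] P.abs_minus[of x] P.abs_one P.abs_zero
  by (simp_all add: KR_pow KR_uminus)

lemma v_diff: "x \<in> K \<Longrightarrow> y \<in> K \<Longrightarrow> v (x - y) \<le> v x + v y"
  using v_add[of x "- y"] K_uminus v_uminus by simp

lemma v_diff_ge: "x \<in> K \<Longrightarrow> y \<in> K \<Longrightarrow> v x - v y \<le> v (x + y)"
  using v_diff[of "x + y" y] K_add by simp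

lemma v_inverse: "x \<in> K \<Longrightarrow> v (inverse x) = inverse (v x)"
proof (cases "x = 0")
  case False
  assume x: "x \<in> K"
  have "v (x * inverse x) = v x * v (inverse x)" by (rule v_mult[OF x K_inverse[OF x]])
  thus ?thesis using False v_1 by (simp add: inverse_unique)
qed (simp add: v_0)

lemma v_divide: "x \<in> K \<Longrightarrow> y \<in> K \<Longrightarrow> v (x / y) = v x / v y"
  using v_mult[of x "inverse y"] v_inverse K_inverse by (simp add: divide_inverse)

lemma v_sum: "(\<And>i. i \<in> A \<Longrightarrow> f i \<in> K) \<Longrightarrow> v (sum f A) \<le> (\<Sum>i\<in>A. v (f i))"
proof (induction A rule: infinite_finite_induct)
  case (insert i A)
  have "v (f i + sum f A) \<le> v (f i) + v (sum f A)" using insert by (intro v_add K_sum) auto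
  thus ?case using insert by auto
qed (auto simp: v_0)

end

lemma exists_power_between:
  fixes c B :: real
  assumes "1 < c" "0 < B" shows "\<exists>k :: int. B < c powi k \<and> c powi k \<le> B * c"
proof -
  define k where "k = \<lfloor>log c B\<rfloor> + 1"
  have eq: "c powi k = c powr real_of_int k" using assms(1) by (simp add: powr_real_of_int')
  have B: "B = c powr (log c B)" using assms by simp
  have "c powr (log c B) < c powr real_of_int k"
    using assms(1) by (intro powr_less_mono) (auto simp: k_def)
  moreover have "c powr real_of_int k \<le> c powr (log c B + 1)"
    using assms(1) by (intro powr_mono) (auto simp: k_def)
  moreover have "c powr (log c B + 1) = B * c" using assms by (simp add: powr_add)
  ultimately show ?thesis using eq B by (intro exI[of _ k]) simp
qed

section \<open>Weak approximation for the places above one rational absolute value\<close>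

locale base_place = numfield +
  fixes u :: "rat \<Rightarrow> real"
  assumes u: "u \<in> usual_abs_values"
begin

definition above :: "(qbar \<Rightarrow> real) set" where
  "above = {v \<in> places K. \<forall>q. v (of_rat q) = u q}"

lemma above_place: "v \<in> above \<Longrightarrow> place K v"
  unfolding above_def by unfold_locales simp

lemma above_rat: "v \<in> above \<Longrightarrow> v (of_rat q) = u q"
  unfolding above_def by simp

text \<open>Distinct places differ at some element of \<open>K\<close>; if necessary its inverse
  gives \<open>w x < v x\<close>. As \<open>v\<close> and \<open>w\<close> agree on the rationals,
  dividing a high power of \<open>x\<close> by a rational of intermediate value moves 1 between the
  two.\<close>

lemma separate_two:
  assumes v: "v \<in> above" and w: "w \<in> above" and ne: "v \<noteq> w"
  shows "\<exists>x\<in>K. 1 < v x \<and> w x < 1"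
proof -
  interpret v: place K v by (rule above_place[OF v])
  interpret w: place K w by (rule above_place[OF w])
  have "\<exists>x\<in>K. v x \<noteq> w x"
  proof (rule ccontr)
    assume "\<not> ?thesis"
    hence "v = w" using v w unfolding above_def places_def
      by (intro extensionalityI[of v K w]) auto
    thus False using ne by simp
  qed
  then obtain x0 where x0: "x0 \<in> K" "v x0 \<noteq> w x0" by blast
  have "\<exists>x\<in>K. w x < v x"
  proof (cases "w x0 < v x0")
    case False
    hence lt: "v x0 < w x0" using x0(2) by simp
    hence "x0 \<noteq> 0" using v.v_0 w.v_0 by auto
    hence "0 < v x0" using v.v_pos x0(1) by simp
    hence "w (inverse x0) < v (inverse x0)" using lt x0(1) by (simp add: v.v_inverse w.v_inverse)
    thus ?thesis using K_inverse[OF x0(1)] by blast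
  qed (use x0 in blast)
  then obtain x where x: "x \<in> K" "w x < v x" by blast
  have "x \<noteq> 0" using x(2) v.v_0 w.v_0 by auto
  hence pos: "0 < w x" "0 < v x" using v.v_pos w.v_pos x(1) by auto
  obtain t where t: "1 < u t" using usual_abs(5)[OF u] by blast
  have "1 < v x / w x" using x(2) pos by simp
  \<comment> \<open>For such \<open>n\<close> the ratio of \<open>v x ^ n\<close> to
    \<open>w x ^ n\<close> exceeds \<open>u t\<close>, so a power of \<open>u t\<close> lies between
    them.\<close>
  then obtain n where n: "u t < (v x / w x) ^ n" using real_arch_pow by blast
  have Bpos: "0 < w x ^ n" using pos by simp
  obtain k :: int where k: "w x ^ n < u t powi k" "u t powi k \<le> w x ^ n * u t"
    using exists_power_between[OF t Bpos] by blast
  have "w x ^ n * u t < v x ^ n" using n pos by (simp add: power_divide field_simps)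
  hence k2: "u t powi k < v x ^ n" using k(2) by simp
  have tn0: "t \<noteq> 0" using t usual_abs(2)[OF u, of t] by auto
  define r where "r = t powi k"
  have upow: "u (s ^ m) = u s ^ m" for s m
  proof (induction m)
    case 0 show ?case using above_rat[OF v, of 1] v.v_1 by simp
  qed (simp add: usual_abs(3)[OF u])
  have uinv: "u (inverse s) = inverse (u s)" for s
    using v.v_inverse[OF K_of_rat, of s] above_rat[OF v, of "inverse s"] above_rat[OF v, of s]
    by (simp add: of_rat_inverse)
  have ur: "u r = u t powi k"
    unfolding r_def power_int_def by (simp add: upow uinv)
  have upos: "0 < u t powi k" using t by simp
  have y: "x ^ n / of_rat r \<in> K" using x(1) by (intro K_divide K_power K_of_rat)
  have "v (x ^ n / of_rat r) = v x ^ n / u r" "w (x ^ n / of_rat r) = w x ^ n / u r"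
    using v.v_divide[OF K_power[OF x(1)] K_of_rat] w.v_divide[OF K_power[OF x(1)] K_of_rat]
      v.v_power[OF x(1)] w.v_power[OF x(1)] above_rat[OF v] above_rat[OF w] by simp_all
  moreover have "1 < v x ^ n / u r" "w x ^ n / u r < 1" using k(1) k2 upos by (simp_all add: ur)
  ultimately show ?thesis using y by metis
qed

lemma tendsto_ratio_1: "1 < (V :: real) \<Longrightarrow> (\<lambda>n. V ^ n / (V ^ n + c)) \<longlonglongrightarrow> 1"
proof -
  assume V: "1 < V"
  have "(\<lambda>n. 1 / (1 + c * (1 / V) ^ n)) \<longlonglongrightarrow> 1 / (1 + c * 0)"
    using V by (intro tendsto_intros LIMSEQ_power_zero) auto
  moreover have "1 / (1 + c * (1 / V) ^ n) = V ^ n / (V ^ n + c)" for n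
  proof -
    have "V ^ n \<noteq> 0" using V by simp
    thus ?thesis by (simp add: power_divide divide_simps) (auto simp: field_simps)
  qed
  ultimately show ?thesis by simp
qed

lemma tendsto_ratio_0: "0 \<le> W \<Longrightarrow> (W :: real) < 1 \<Longrightarrow> (\<lambda>n. W ^ n / (1 - W ^ n)) \<longlonglongrightarrow> 0"
proof -
  assume W: "0 \<le> W" "W < 1"
  have "(\<lambda>n. W ^ n / (1 - W ^ n)) \<longlonglongrightarrow> 0 / (1 - 0)"
    using W by (intro tendsto_intros LIMSEQ_power_zero) auto
  thus ?thesis by simp
qed

lemma ratio_in_K: "y \<in> K \<Longrightarrow> y ^ n / (1 + y ^ n) \<in> K"
  by (intro K_divide K_add K_power K_one)

lemma ratio_small:
  assumes w: "w \<in> above" and y: "y \<in> K" and lt: "w y < 1" and "0 < n"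
  shows "w (y ^ n / (1 + y ^ n)) \<le> w y ^ n / (1 - w y ^ n)"
proof -
  interpret w: place K w by (rule above_place[OF w])
  have 0: "0 \<le> w y" by (rule w.v_nonneg[OF y])
  have "w y ^ n < 1" using lt 0 assms(4) by (simp add: power_less_one_iff)
  moreover have "1 - w y ^ n \<le> w (1 + y ^ n)"
    using w.v_diff_ge[OF K_one K_power[OF y], of n] w.v_1 w.v_power[OF y] by simp
  ultimately show ?thesis
    using w.v_divide[OF K_power[OF y] K_add[OF K_one K_power[OF y]]] w.v_power[OF y] 0
    by (simp add: divide_left_mono frac_le)
qed

text \<open>In the induction step \<open>y\<close> serves \<open>T\<close> and \<open>z\<close>
  separates \<open>v\<close> from the new \<open>w\<close>. If \<open>w y \<le> 1\<close>, take
  \<open>y ^ n * z\<close>. Otherwise replace \<open>y ^ n\<close> by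
  \<open>y ^ n / (1 + y ^ n)\<close>, which has values tending to 1 at \<open>v\<close> and
  \<open>w\<close> and to 0 on \<open>T\<close>.\<close>

lemma separate:
  assumes "finite T" "T \<subseteq> above" "v \<in> above" "v \<notin> T"
  shows "\<exists>x\<in>K. 1 < v x \<and> (\<forall>w\<in>T. w x < 1)"
  using assms(1,2,4)
proof (induction T)
  case empty
  obtain t where "1 < u t" using usual_abs(5)[OF u] by blast
  thus ?case using above_rat[OF assms(3)] by (intro bexI[of _ "of_rat t"] K_of_rat) simp
next
  case (insert w T)
  have w: "w \<in> above" "v \<noteq> w" using insert.prems by auto
  interpret v: place K v by (rule above_place[OF assms(3)])
  interpret w: place K w by (rule above_place[OF w(1)])
  obtain y where y: "y \<in> K" "1 < v y" "\<And>w. w \<in> T \<Longrightarrow> w y < 1" using insert.IH insert.prems by auto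
  obtain z where z: "z \<in> K" "1 < v z" "w z < 1" using separate_two[OF assms(3) w] by blast
  have T_lim: "(\<lambda>n. w' y ^ n * w' z) \<longlonglongrightarrow> 0" "(\<lambda>n. w' y ^ n / (1 - w' y ^ n) * w' z) \<longlonglongrightarrow> 0" "0 \<le> w' y" "0 \<le> w' z"
    if "w' \<in> T" for w'
  proof -
    interpret w': place K w' using that insert.prems by (intro above_place) auto
    show 0: "0 \<le> w' y" "0 \<le> w' z" using w'.v_nonneg y(1) z(1) by auto
    have "(\<lambda>n. w' y ^ n * w' z) \<longlonglongrightarrow> 0 * w' z"
      using y(3)[OF that] 0 by (intro tendsto_intros LIMSEQ_power_zero) auto
    thus "(\<lambda>n. w' y ^ n * w' z) \<longlonglongrightarrow> 0" by simp
    have "(\<lambda>n. w' y ^ n / (1 - w' y ^ n) * w' z) \<longlonglongrightarrow> 0 * w' z"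
      using y(3)[OF that] 0 by (intro tendsto_mult tendsto_ratio_0 tendsto_const) auto
    thus "(\<lambda>n. w' y ^ n / (1 - w' y ^ n) * w' z) \<longlonglongrightarrow> 0" by simp
  qed
  show ?case
  proof (cases "w y \<le> 1")
    case True
    have "\<forall>\<^sub>F n in sequentially. \<forall>w'\<in>T. w' y ^ n * w' z < 1"
      using insert.hyps(1) order_tendstoD(2)[OF T_lim(1), of _ 1] by (intro eventually_ball_finite) auto
    then obtain n where n: "\<And>w'. w' \<in> T \<Longrightarrow> w' y ^ n * w' z < 1" unfolding eventually_sequentially by blast
    have x: "y ^ n * z \<in> K" using y z by (intro K_mult K_power)
    have "1 \<le> v y ^ n" using y(2) by (simp add: one_le_power)
    hence "1 * 1 < v y ^ n * v z" using z(2) by (intro mult_le_less_imp_less) auto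
    hence "1 < v (y ^ n * z)" using v.v_mult[OF K_power[OF y(1)] z(1)] v.v_power[OF y(1)] by simp
    moreover have "w (y ^ n * z) < 1"
    proof -
      have "w y ^ n * w z \<le> 1 * w z"
        using True w.v_nonneg y(1) z(1) by (intro mult_right_mono) (auto simp: power_le_one)
      thus ?thesis using z(3) w.v_mult[OF K_power[OF y(1)] z(1)] w.v_power[OF y(1)] by simp
    qed
    moreover have "w' (y ^ n * z) < 1" if "w' \<in> T" for w'
    proof -
      interpret w': place K w' using that insert.prems by (intro above_place) auto
      show ?thesis using n[OF that] w'.v_mult[OF K_power[OF y(1)] z(1)] w'.v_power[OF y(1)] by simp
    qed
    ultimately show ?thesis using x by blast
  next
    case False
    hence W: "1 < w y" by simp
    have 1: "\<forall>\<^sub>F n in sequentially. \<forall>w'\<in>T. w' y ^ n / (1 - w' y ^ n) * w' z < 1"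
      using insert.hyps(1) order_tendstoD(2)[OF T_lim(2), of _ 1] by (intro eventually_ball_finite) auto
    have "(\<lambda>n. v y ^ n / (v y ^ n + 1) * v z) \<longlonglongrightarrow> 1 * v z"
      by (intro tendsto_mult tendsto_ratio_1 tendsto_const y(2))
    hence 2: "\<forall>\<^sub>F n in sequentially. 1 < v y ^ n / (v y ^ n + 1) * v z"
      using z(2) by (intro order_tendstoD(1)) auto
    \<comment> \<open>The sign \<open>- 1\<close> comes from the lower estimate
      \<open>w (1 + y ^ n) \<ge> w y ^ n - 1\<close>; at \<open>v\<close> the upper estimate gives
      \<open>+ 1\<close>.\<close>
    have "(\<lambda>n. w y ^ n / (w y ^ n + (- 1)) * w z) \<longlonglongrightarrow> 1 * w z"
      by (intro tendsto_mult tendsto_ratio_1 tendsto_const W)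
    hence 3: "\<forall>\<^sub>F n in sequentially. w y ^ n / (w y ^ n + (- 1)) * w z < 1"
      using z(3) by (intro order_tendstoD(2)) auto
    have "\<forall>\<^sub>F n in sequentially. (\<forall>w'\<in>T. w' y ^ n / (1 - w' y ^ n) * w' z < 1) \<and>
      1 < v y ^ n / (v y ^ n + 1) * v z \<and> w y ^ n / (w y ^ n + (- 1)) * w z < 1 \<and> 0 < n"
      using 1 2 3 eventually_gt_at_top[of 0] by eventually_elim blast
    then obtain n where n: "\<And>w'. w' \<in> T \<Longrightarrow> w' y ^ n / (1 - w' y ^ n) * w' z < 1"
      "1 < v y ^ n / (v y ^ n + 1) * v z" "w y ^ n / (w y ^ n + (- 1)) * w z < 1" "0 < n"
      unfolding eventually_sequentially by blast
    let ?e = "y ^ n / (1 + y ^ n)"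
    have eK: "?e \<in> K" by (rule ratio_in_K[OF y(1)])
    have dK: "1 + y ^ n \<in> K" by (intro K_add K_one K_power y(1))
    have x: "?e * z \<in> K" using eK z(1) by (rule K_mult)
    have "v y ^ n / (v y ^ n + 1) \<le> v ?e"
    proof -
      have "v (1 + y ^ n) \<le> 1 + v y ^ n" using v.v_add[OF K_one K_power[OF y(1)], of n] v.v_1 v.v_power[OF y(1)] by simp
      moreover have "0 < v (1 + y ^ n)"
      proof -
        have "1 < v y ^ n" using y(2) n(4) by (simp add: one_less_power)
        thus ?thesis using v.v_diff_ge[OF K_power[OF y(1)] K_one, of n] v.v_1 v.v_power[OF y(1)] by (simp add: add.commute)
      qed
      ultimately show ?thesis using v.v_divide[OF K_power[OF y(1)] dK] v.v_power[OF y(1)] v.v_nonneg[OF y(1)]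
        by (simp add: frac_le add.commute)
    qed
    hence "v y ^ n / (v y ^ n + 1) * v z \<le> v ?e * v z" using v.v_nonneg[OF z(1)] by (rule mult_right_mono)
    hence "1 < v (?e * z)" using n(2) v.v_mult[OF eK z(1)] by simp
    moreover have "w (?e * z) < 1"
    proof -
      have "1 < w y ^ n" using W n(4) by (simp add: one_less_power)
      moreover have "w y ^ n - 1 \<le> w (1 + y ^ n)"
        using w.v_diff_ge[OF K_power[OF y(1)] K_one, of n] w.v_1 w.v_power[OF y(1)] by (simp add: add.commute)
      ultimately have "w ?e \<le> w y ^ n / (w y ^ n + (- 1))"
        using w.v_divide[OF K_power[OF y(1)] dK] w.v_power[OF y(1)] w.v_nonneg[OF y(1)] by (simp add: frac_le)
      hence "w ?e * w z \<le> w y ^ n / (w y ^ n + (- 1)) * w z" using w.v_nonneg[OF z(1)] by (rule mult_right_mono)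
      thus ?thesis using n(3) w.v_mult[OF eK z(1)] by simp
    qed
    moreover have "w' (?e * z) < 1" if w': "w' \<in> T" for w'
    proof -
      have ab: "w' \<in> above" using w' insert.prems by auto
      interpret w': place K w' by (rule above_place[OF ab])
      have "w' ?e \<le> w' y ^ n / (1 - w' y ^ n)" by (rule ratio_small[OF ab y(1) y(3)[OF w'] n(4)])
      hence "w' ?e * w' z \<le> w' y ^ n / (1 - w' y ^ n) * w' z" using w'.v_nonneg[OF z(1)] by (rule mult_right_mono)
      thus ?thesis using n(1)[OF w'] w'.v_mult[OF eK z(1)] by simp
    qed
    ultimately show ?thesis using x by blast
  qed
qed

text \<open>With \<open>y\<close> from \<open>separate\<close>, the element
  \<open>y ^ n / (1 + y ^ n)\<close> is small on \<open>T\<close>, and it differs from 1 by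
  \<open>1 / (1 + y ^ n)\<close>, which is small at \<open>v\<close>.\<close>

lemma approx_idempotent:
  assumes "finite T" "T \<subseteq> above" "v \<in> above" "v \<notin> T" "0 < \<epsilon>"
  shows "\<exists>e\<in>K. v (e - 1) < \<epsilon> \<and> (\<forall>w\<in>T. w e < \<epsilon>)"
proof -
  interpret v: place K v by (rule above_place[OF assms(3)])
  obtain y where y: "y \<in> K" "1 < v y" "\<And>w. w \<in> T \<Longrightarrow> w y < 1" using separate[OF assms(1-4)] by blast
  have "\<forall>\<^sub>F n in sequentially. w y ^ n / (1 - w y ^ n) < \<epsilon>" if "w \<in> T" for w
  proof -
    interpret w: place K w using that assms(2) by (intro above_place) auto
    show ?thesis using tendsto_ratio_0[OF w.v_nonneg[OF y(1)] y(3)[OF that]] assms(5) by (rule order_tendstoD(2))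
  qed
  hence 1: "\<forall>\<^sub>F n in sequentially. \<forall>w\<in>T. w y ^ n / (1 - w y ^ n) < \<epsilon>"
    using assms(1) by (intro eventually_ball_finite) auto
  \<comment> \<open>Above this threshold \<open>v (1 + y ^ n)\<close> exceeds
    \<open>1 / \<epsilon>\<close>.\<close>
  have 2: "\<forall>\<^sub>F n in sequentially. 1 + 1 / \<epsilon> < v y ^ n"
    using filterlim_realpow_sequentially_gt1[of "v y"] y(2) by (simp add: filterlim_at_infinity_imp_eventually_ne
        filterlim_at_top_dense eventually_mono filterlim_at_infinity_conv_norm_at_top v.v_nonneg[OF y(1)])
  have "\<forall>\<^sub>F n in sequentially. (\<forall>w\<in>T. w y ^ n / (1 - w y ^ n) < \<epsilon>) \<and> 1 + 1 / \<epsilon> < v y ^ n \<and> 0 < n"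
    using 1 2 eventually_gt_at_top[of 0] by eventually_elim blast
  then obtain n where n: "\<And>w. w \<in> T \<Longrightarrow> w y ^ n / (1 - w y ^ n) < \<epsilon>" "1 + 1 / \<epsilon> < v y ^ n" "0 < n"
    unfolding eventually_sequentially by blast
  let ?e = "y ^ n / (1 + y ^ n)"
  have dK: "1 + y ^ n \<in> K" by (intro K_add K_one K_power y(1))
  have ge: "1 / \<epsilon> < v (1 + y ^ n)"
    using n(2) v.v_diff_ge[OF K_power[OF y(1)] K_one, of n] v.v_1 v.v_power[OF y(1)] by (simp add: add.commute)
  have pos: "0 < v (1 + y ^ n)" using ge assms(5) by (meson less_trans zero_less_divide_1_iff)
  hence nz: "1 + y ^ n \<noteq> 0" using v.v_0 by auto
  have "?e - 1 = - (1 / (1 + y ^ n))" using nz by (simp add: field_simps)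
  hence "v (?e - 1) = 1 / v (1 + y ^ n)"
    using v.v_uminus[OF K_divide[OF K_one dK]] v.v_divide[OF K_one dK] v.v_1 by simp
  also have "\<dots> < \<epsilon>" using ge pos assms(5) by (simp add: field_simps)
  finally have "v (?e - 1) < \<epsilon>" .
  moreover have "w ?e < \<epsilon>" if w: "w \<in> T" for w
    using ratio_small[of w y n] n(1)[OF w] y(1) y(3)[OF w] n(3) w assms(2) by fastforce
  ultimately show ?thesis using ratio_in_K[OF y(1)] by blast
qed

end

section \<open>Extension of the usual absolute values to the algebraic numbers\<close>

lemma to_ac_of_rat: "to_ac q = (of_rat q :: qbar)"
proof -
  obtain a b :: int where ab: "q = of_int a / of_int b" "b \<noteq> 0" by (rule rat_frac)
  show ?thesis unfolding ab(1) by (simp add: of_rat_divide)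
qed

lemma qbar_algebraic: "\<exists>p. p \<noteq> 0 \<and> ev p x = 0"
proof -
  obtain p :: "rat poly" where "p \<noteq> 0" "poly (map_poly to_ac p) x = 0" by (rule alg_closure_algebraic)
  thus ?thesis unfolding ev_def by (intro exI[of _ p]) (simp add: to_ac_of_rat[abs_def])
qed

lemma class_ring_algebraic: "(ring.algebraic class_ring over \<rat>) (x :: qbar)"
proof -
  define Z where "Z = (class_ring :: qbar ring)"
  have Zs [simp]: "carrier Z = UNIV" "monoid.mult Z = (*)" "monoid.one Z = 1" "ring.zero Z = 0" "ring.add Z = (+)"
    by (simp_all add: Z_def)
  interpret F: field Z unfolding Z_def by (rule class_ring_field)
  obtain p where p: "p \<noteq> 0" "ev p x = 0" using qbar_algebraic by blast
  define q :: "qbar poly" where "q = map_poly of_rat p"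
  \<comment> \<open>\<open>eval\<close> reads the leading coefficient first, \<open>Poly\<close> the
    constant one, hence the reversal.\<close>
  have eval: "F.eval (rev as) x = poly (Poly as) x" for as :: "qbar list"
    by (induction as) (simp_all add: F.eval_append_aux algebra_simps)
  have q: "q \<noteq> 0" using p(1) by (simp add: q_def)
  have "set (coeffs q) \<subseteq> \<rat>" using p(1) by (auto simp: q_def coeffs_map_poly)
  hence "rev (coeffs q) \<in> carrier (univ_poly Z \<rat>)"
    unfolding univ_poly_carrier[symmetric] polynomial_def using q
    by (auto simp: hd_rev last_coeffs_eq_coeff_degree)
  moreover have "poly q x = 0" using p(2) by (simp add: ev_def q_def)
  hence "F.eval (rev (coeffs q)) x = 0" by (simp add: eval)
  ultimately show ?thesis unfolding Z_def[symmetric] using q by (intro F.algebraicI[of "rev (coeffs q)"]) auto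
qed

text \<open>\<open>exists_extension\<close> over the rationals; \<open>inv_into\<close> carries
  \<open>u\<close> over to their image in the algebraic numbers.\<close>

lemma extend_usual_abs:
  assumes u: "u \<in> usual_abs_values"
  shows "\<exists>P. abs_value (class_ring :: qbar ring) P \<and> (\<forall>q. P (of_rat q) = u q)"
proof -
  define a where "a x = u (inv_into UNIV (of_rat :: rat \<Rightarrow> qbar) x)" for x
  have inj: "inj (of_rat :: rat \<Rightarrow> qbar)" by (simp add: inj_def)
  have a: "a (of_rat q) = u q" for q unfolding a_def by (simp add: inj)
  have a0: "a 0 = 0" using a[of 0] usual_abs(2)[OF u, of 0] by simp
  have av: "abs_value (class_ring\<lparr>carrier := \<rat>\<rparr>) a"
    unfolding abs_value_def
    by (auto elim!: Rats_cases simp: a a0 usual_abs(1-4)[OF u] simp flip: of_rat_mult of_rat_add)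
  have "abs_extension (class_ring :: qbar ring) \<rat> a"
    by (intro abs_extension.intro class_ring_field abs_extension_axioms.intro subfield_Rats av class_ring_algebraic)
  then obtain b where "abs_value (class_ring :: qbar ring) b" "\<forall>x\<in>\<rat>. b x = a x"
    using abs_extension.exists_extension by blast
  thus ?thesis using a by (intro exI[of _ b]) simp
qed

text \<open>\<open>l \<beta> i\<close> is the \<open>i\<close>-th coefficient of the Lagrange basis
  polynomial at \<open>\<beta>\<close>. As it does not depend on \<open>q\<close>, it bounds
  coefficients by values uniformly.\<close>

lemma lagrange_coeffs:
  fixes B :: "'a :: field set"
  assumes B: "finite B"
  shows "\<exists>l. \<forall>q. \<forall>i<card B. q i = (\<Sum>\<beta>\<in>B. (\<Sum>j<card B. q j * \<beta> ^ j) * l \<beta> i)"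
proof -
  define L where "L \<beta> = (\<Prod>\<gamma>\<in>B - {\<beta>}. Polynomial.smult (1 / (\<beta> - \<gamma>)) [:- \<gamma>, 1:])" for \<beta>
  have L: "poly (L \<beta>) \<gamma> = (if \<gamma> = \<beta> then 1 else 0)" if "\<gamma> \<in> B" for \<beta> \<gamma>
  proof (cases "\<gamma> = \<beta>")
    case True
    thus ?thesis by (auto simp: L_def poly_prod simp flip: diff_divide_distrib split: if_splits intro!: prod.neutral)
  next
    case False
    thus ?thesis using B that by (auto simp: L_def poly_prod intro!: prod_zero)
  qed
  have degL: "degree (L \<beta>) < card B" if "\<beta> \<in> B" for \<beta>
  proof -
    have "degree (L \<beta>) \<le> (\<Sum>\<gamma>\<in>B - {\<beta>}. degree (Polynomial.smult (1 / (\<beta> - \<gamma>)) [:- \<gamma>, 1:]))"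
      unfolding L_def by (rule order_trans[OF degree_prod_sum_le]) (use B in \<open>auto simp: o_def\<close>)
    also have "\<dots> \<le> (\<Sum>\<gamma>\<in>B - {\<beta>}. 1)"
      by (intro sum_mono) simp
    also have "\<dots> < card B" using B that card_gt_0_iff[of B] by (auto simp: card_Diff_singleton)
    finally show ?thesis .
  qed
  have "q i = (\<Sum>\<beta>\<in>B. (\<Sum>j<card B. q j * \<beta> ^ j) * coeff (L \<beta>) i)" if i: "i < card B" for q i
  proof -
    define f where "f = (\<Sum>j<card B. monom (q j) j)"
    define g where "g = f - (\<Sum>\<beta>\<in>B. Polynomial.smult (poly f \<beta>) (L \<beta>))"
    have pf: "poly f \<beta> = (\<Sum>j<card B. q j * \<beta> ^ j)" for \<beta>
      by (simp add: f_def poly_sum poly_monom)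
    have cf: "coeff f i = q i" using i by (simp add: f_def coeff_sum if_distrib sum.delta' cong: if_cong)
    have n: "0 < card B" using i by simp
    have "degree f < card B"
      unfolding f_def using n by (intro degree_sum_less) (auto intro: le_less_trans[OF degree_monom_le])
    moreover have "degree (\<Sum>\<beta>\<in>B. Polynomial.smult (poly f \<beta>) (L \<beta>)) < card B"
      using n degL by (intro degree_sum_less) (auto intro: le_less_trans[OF degree_smult_le])
    ultimately have "degree g < card B" unfolding g_def by (rule degree_diff_less)
    moreover have "poly g \<gamma> = 0" if "\<gamma> \<in> B" for \<gamma>
    proof -
      have "(\<Sum>\<beta>\<in>B. poly f \<beta> * poly (L \<beta>) \<gamma>) = (\<Sum>\<beta>\<in>B. if \<beta> = \<gamma> then poly f \<gamma> else 0)"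
        using L[OF that] by (intro sum.cong) auto
      also have "\<dots> = poly f \<gamma>" using B that by simp
      finally show ?thesis by (simp add: g_def poly_sum)
    qed
    ultimately have "g = 0"
      using poly_roots_degree[of g] card_mono[OF poly_roots_finite[of g], of B] by (cases "g = 0") auto
    hence "coeff g i = 0" by simp
    thus ?thesis by (simp add: g_def coeff_sum pf cf)
  qed
  thus ?thesis by (intro exI[of _ "\<lambda>\<beta>. coeff (L \<beta>)"]) blast
qed

context numfield
begin

lemma rat_independent_card:
  fixes g :: "'i \<Rightarrow> qbar"
  assumes I: "finite I" "\<And>i. i \<in> I \<Longrightarrow> g i \<in> K"
    and indep: "\<And>q i. (\<Sum>i\<in>I. of_rat (q i) * g i) = 0 \<Longrightarrow> i \<in> I \<Longrightarrow> q i = 0"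
  shows "card I \<le> d"
proof -
  obtain h where h: "bij_betw h {0..<card I} I" using ex_bij_betw_nat_finite[OF I(1)] by blast
  let ?ys = "map (\<lambda>i. g (h i)) [0..<card I]"
  have "length ?ys \<le> d"
  proof (rule rat_indep_length)
    show "set ?ys \<subseteq> K" using I(2) bij_betwE[OF h] by auto
    show "rat_indep ?ys" unfolding rat_indep_def
    proof (intro allI impI)
      fix q :: "nat \<Rightarrow> rat" and j
      assume q: "(\<Sum>j<length ?ys. of_rat (q j) * ?ys ! j) = 0" and j: "j < length ?ys"
      define q' where "q' i = q (inv_into {0..<card I} h i)" for i
      have q'h: "q' (h j) = q j" if "j < card I" for j
        unfolding q'_def using bij_betw_inv_into_left[OF h, of j] that by simp
      have "(\<Sum>i\<in>I. of_rat (q' i) * g i) = (\<Sum>j\<in>{0..<card I}. of_rat (q' (h j)) * g (h j))"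
        by (rule sum.reindex_bij_betw[OF h, symmetric])
      also have "\<dots> = (\<Sum>j<length ?ys. of_rat (q j) * ?ys ! j)"
        using q'h by (intro sum.cong) auto
      finally have "(\<Sum>i\<in>I. of_rat (q' i) * g i) = 0" using q by simp
      hence "q' (h j) = 0" by (rule indep) (use bij_betwE[OF h] j in auto)
      thus "q j = 0" using q'h j by simp
    qed
  qed
  thus ?thesis by simp
qed

end

section \<open>The places above a usual absolute value of the rationals\<close>

context base_place
begin

definition P :: "qbar \<Rightarrow> real" where
  "P = (SOME P. abs_value (class_ring :: qbar ring) P \<and> (\<forall>q. P (of_rat q) = u q))"

lemma P_abs: "abs_value (class_ring :: qbar ring) P" and P_of_rat: "P (of_rat q) = u q"
  using someI_ex[OF extend_usual_abs[OF u]] unfolding P_def[symmetric] by auto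

lemma P_nonneg: "0 \<le> P x" and P_eq_0: "P x = 0 \<longleftrightarrow> x = 0" and P_mult: "P (x * y) = P x * P y"
  and P_add: "P (x + y) \<le> P x + P y"
  using P_abs unfolding abs_value_def by simp_all

lemma P_1: "P 1 = 1"
  using P_mult[of 1 1] P_eq_0[of 1] by simp

lemma P_0: "P 0 = 0"
  by (simp add: P_eq_0)

lemma P_prod: "P (prod f A) = (\<Prod>i\<in>A. P (f i))"
  by (induction A rule: infinite_finite_induct) (simp_all add: P_1 P_mult)

lemma P_sum: "P (sum f A) \<le> (\<Sum>i\<in>A. P (f i))"
proof (induction A rule: infinite_finite_induct)
  case (insert i A)
  thus ?case using P_add[of "f i" "sum f A"] by simp
qed (simp_all add: P_0)

definition conj_place :: "qbar \<Rightarrow> qbar \<Rightarrow> real" where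
  "conj_place \<beta> = (\<lambda>x\<in>K. P (\<sigma> \<beta> x))"

lemma conj_place_above: "\<beta> \<in> conj \<Longrightarrow> conj_place \<beta> \<in> above"
proof -
  assume \<beta>: "\<beta> \<in> conj"
  have "abs_value (field_of K) (conj_place \<beta>)"
    unfolding abs_value_def conj_place_def
    by (auto simp: P_nonneg P_eq_0 \<sigma>_eq_0[OF \<beta>] K_zero K_mult K_add \<sigma>_hom[OF \<beta>] P_mult P_add)
  moreover have "conj_place \<beta> (of_rat q) = u q" for q
    by (simp add: conj_place_def K_of_rat \<sigma>_of_rat[OF \<beta>] P_of_rat)
  moreover have "conj_place \<beta> \<in> extensional K" by (simp add: conj_place_def)
  ultimately show ?thesis unfolding above_def places_def using u by auto
qed

text \<open>The powers \<open>1, \<alpha>, \<dots>, \<alpha>\<^sup>n\<^sup>-\<^sup>1\<close> are \<open>v\<close>-free, \<open>n\<close> being the size of the fibre: the coefficients of a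
  polynomial of degree \<open>< n\<close> are bounded by its values at the \<open>\<beta>\<close> in the fibre, and the absolute values
  of these all equal \<open>v\<close> of the value at \<open>\<alpha>\<close>.\<close>

lemma conj_fibre_le:
  assumes v: "v \<in> above"
  shows "card {\<beta>\<in>conj. conj_place \<beta> = v} \<le> local_degree K v"
proof -
  interpret v: place K v by (rule above_place[OF v])
  define B where "B = {\<beta>\<in>conj. conj_place \<beta> = v}"
  have B: "finite B" "B \<subseteq> conj" using finite_conj by (auto simp: B_def)
  obtain l where l: "\<And>q i. i < card B \<Longrightarrow> q i = (\<Sum>\<beta>\<in>B. (\<Sum>j<card B. q j * \<beta> ^ j) * l \<beta> i)"
    using lagrange_coeffs[OF B(1)] by metis
  let ?ys = "map (\<lambda>i. \<alpha> ^ i) [0..<card B]"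
  have ys: "set ?ys \<subseteq> K" using \<alpha>(1) K_power by auto
  \<comment> \<open>Summing over all \<open>i\<close> gives one constant for all coefficients; the
    summand 1 keeps it positive.\<close>
  define C where "C = 1 + (\<Sum>i<card B. \<Sum>\<beta>\<in>B. P (l \<beta> i))"
  have C1: "1 \<le> C" unfolding C_def by (simp add: sum_nonneg P_nonneg)
  have vB: "v (\<Sum>j<card B. of_rat (q j) * \<alpha> ^ j) = P (\<Sum>j<card B. of_rat (q j) * \<beta> ^ j)"
    if \<beta>: "\<beta> \<in> B" for q \<beta>
  proof -
    have eq: "(\<Sum>j<card B. of_rat (q j) * x ^ j) = ev (\<Sum>j<card B. monom (q j) j) x" for x
      by (simp add: ev_sum ev_monom)
    have "v = conj_place \<beta>" "\<beta> \<in> conj" using \<beta> by (auto simp: B_def)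
    thus ?thesis unfolding eq by (simp add: conj_place_def ev_in_K[OF \<alpha>(1)] \<sigma>_ev)
  qed
  have "v_free v ?ys" unfolding v_free_def
  proof (intro exI[of _ "1 / C"] conjI allI impI)
    show "0 < 1 / C" using C1 by simp
    fix q :: "nat \<Rightarrow> rat" and i assume "i < length ?ys"
    hence i: "i < card B" by simp
    let ?s = "\<Sum>j<card B. of_rat (q j) * \<alpha> ^ j"
    have "v (of_rat (q i)) = P (of_rat (q i))" using above_rat[OF v] by (simp add: P_of_rat)
    also have "\<dots> = P (\<Sum>\<beta>\<in>B. (\<Sum>j<card B. of_rat (q j) * \<beta> ^ j) * l \<beta> i)"
      using l[OF i, of "\<lambda>i. of_rat (q i)"] by simp
    also have "\<dots> \<le> (\<Sum>\<beta>\<in>B. P ((\<Sum>j<card B. of_rat (q j) * \<beta> ^ j) * l \<beta> i))" by (rule P_sum)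
    also have "\<dots> = (\<Sum>\<beta>\<in>B. v ?s * P (l \<beta> i))"
      by (intro sum.cong refl) (simp only: P_mult vB)
    also have "\<dots> = v ?s * (\<Sum>\<beta>\<in>B. P (l \<beta> i))" by (simp add: sum_distrib_left)
    also have "\<dots> \<le> v ?s * C"
    proof (rule mult_left_mono)
      have "(\<Sum>\<beta>\<in>B. P (l \<beta> i)) \<le> (\<Sum>i<card B. \<Sum>\<beta>\<in>B. P (l \<beta> i))"
        using i by (intro member_le_sum) (auto intro: sum_nonneg P_nonneg)
      thus "(\<Sum>\<beta>\<in>B. P (l \<beta> i)) \<le> C" by (simp add: C_def)
      show "0 \<le> v ?s" by (intro v.v_nonneg K_sum K_mult K_of_rat K_power \<alpha>(1))
    qed
    finally have "v (of_rat (q i)) \<le> v ?s * C" .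
    moreover have "(\<Sum>j<length ?ys. of_rat (q j) * ?ys ! j) = ?s" by (intro sum.cong) auto
    ultimately show "1 / C * v (of_rat (q i)) \<le> v (\<Sum>j<length ?ys. of_rat (q j) * ?ys ! j)"
      using C1 by (simp add: field_simps)
  qed
  hence "length ?ys \<le> local_degree K v" by (rule v.free_list_length_le[OF ys])
  thus ?thesis by (simp add: B_def)
qed

text \<open>The \<open>v\<close>-free lists for the various \<open>v\<close>, each multiplied by an element close to \<open>1\<close> at \<open>v\<close> and to \<open>0\<close>
  at the other places, together are independent over the rationals.\<close>

lemma sum_local_degree_le:
  assumes T: "finite T" "T \<subseteq> above"
  shows "(\<Sum>v\<in>T. local_degree K v) \<le> d"
proof -
  define G where "G v xs c \<longleftrightarrow> set xs \<subseteq> K \<and> length xs = local_degree K v \<and> 0 < c \<and>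
    (\<forall>q :: nat \<Rightarrow> rat. \<forall>i<length xs. c * v (of_rat (q i)) \<le> v (\<Sum>j<length xs. of_rat (q j) * xs ! j))"
    for v :: "qbar \<Rightarrow> real" and xs c
  have "\<exists>xs c. G v xs c" if "v \<in> T" for v
  proof -
    interpret v: place K v by (rule above_place) (use that T(2) in auto)
    obtain xs where xs: "set xs \<subseteq> K" "length xs = local_degree K v" "v_free v xs" using v.exists_free_list by blast
    obtain c where "0 < c" "\<forall>q :: nat \<Rightarrow> rat. \<forall>i<length xs.
        c * v (of_rat (q i)) \<le> v (\<Sum>j<length xs. of_rat (q j) * xs ! j)"
      using xs(3) unfolding v_free_def by (elim exE conjE)
    thus ?thesis unfolding G_def using xs(1,2) by (intro exI[of _ xs] exI[of _ c] conjI)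
  qed
  hence "\<exists>a c. \<forall>v\<in>T. G v (a v) (c v)" by metis
  then obtain a c where G: "\<And>v. v \<in> T \<Longrightarrow> G v (a v) (c v)" by blast
  have ac: "set (a v) \<subseteq> K" "length (a v) = local_degree K v" "0 < c v" if "v \<in> T" for v
    using G[OF that] unfolding G_def by simp_all
  have free: "c v * v (of_rat (q i)) \<le> v (\<Sum>j<length (a v). of_rat (q j) * a v ! j)"
    if "v \<in> T" "i < length (a v)" for v q i
  proof -
    have "\<forall>q :: nat \<Rightarrow> rat. \<forall>i<length (a v).
        c v * v (of_rat (q i)) \<le> v (\<Sum>j<length (a v). of_rat (q j) * a v ! j)"
      using G[OF that(1)] unfolding G_def by (elim conjE)
    from this[rule_format, OF that(2)] show ?thesis .
  qed
  have aK: "a v ! j \<in> K" if "v \<in> T" "j < local_degree K v" for v j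
    using ac(1,2)[OF that(1)] that(2) nth_mem by (metis subsetD)
  define I where "I = (SIGMA v:T. {..<local_degree K v})"
  have I: "finite I" unfolding I_def using T(1) by auto
  define M where "M = Max (insert 0 ((\<lambda>(v, w, j). v (a w ! j)) ` (T \<times> I)))"
  have M: "v (a w ! j) \<le> M" if "v \<in> T" "w \<in> T" "j < local_degree K w" for v w j
  proof -
    have "(w, j) \<in> I" using that unfolding I_def by simp
    hence "v (a w ! j) \<in> (\<lambda>(v, w, j). v (a w ! j)) ` (T \<times> I)"
      using that(1) by (intro image_eqI[of _ _ "(v, w, j)"]) simp_all
    thus ?thesis unfolding M_def using T(1) I by (intro Max_ge finite.insertI finite_imageI finite_SigmaI insertI2)
  qed
  have M0: "0 \<le> M" using T(1) I unfolding M_def by (intro Max_ge) auto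
  \<comment> \<open>At most \<open>card I\<close> errors arise, each at most
    \<open>\<epsilon> * M\<close> times the largest coefficient. This choice keeps their sum
    strictly below \<open>c v\<close> times that coefficient, for every \<open>v\<close> in
    \<open>T\<close>.\<close>
  define \<epsilon> where "\<epsilon> = Min (insert 1 (c ` T)) / (real (card I) * M + 1)"
  have D: "0 < real (card I) * M + 1" using M0 by (simp add: add_nonneg_pos)
  have \<epsilon>: "0 < \<epsilon>" unfolding \<epsilon>_def using T(1) ac(3) D by (intro divide_pos_pos) auto
  have \<epsilon>c: "real (card I) * (\<epsilon> * M) < c v" if "v \<in> T" for v
  proof -
    have "\<epsilon> * (real (card I) * M + 1) = Min (insert 1 (c ` T))" unfolding \<epsilon>_def using D by simp
    also have "\<dots> \<le> c v" using T(1) that by (intro Min_le) auto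
    finally show ?thesis using \<epsilon> by (simp add: algebra_simps)
  qed
  have "\<exists>e. e \<in> K \<and> v (e - 1) < \<epsilon> \<and> (\<forall>w\<in>T - {v}. w e < \<epsilon>)" if v: "v \<in> T" for v
  proof -
    have "T - {v} \<subseteq> above" "v \<in> above" "v \<notin> T - {v}" "finite (T - {v})" using T v by auto
    from approx_idempotent[OF this(4,1,2,3) \<epsilon>] show ?thesis unfolding Bex_def .
  qed
  hence "\<exists>e. \<forall>v\<in>T. e v \<in> K \<and> v (e v - 1) < \<epsilon> \<and> (\<forall>w\<in>T - {v}. w (e v) < \<epsilon>)"
    by (intro bchoice ballI)
  then obtain e where e': "\<forall>v\<in>T. e v \<in> K \<and> v (e v - 1) < \<epsilon> \<and> (\<forall>w\<in>T - {v}. w (e v) < \<epsilon>)" by (elim exE)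
  have e: "e v \<in> K" "v (e v - 1) < \<epsilon>" "w \<in> T \<Longrightarrow> w \<noteq> v \<Longrightarrow> w (e v) < \<epsilon>" if "v \<in> T" for v w
    using bspec[OF e' that] by simp_all
  have "card I \<le> d"
  proof (rule rat_independent_card[OF I, of "\<lambda>(v, j). e v * a v ! j"])
    fix i assume "i \<in> I"
    thus "(case i of (v, j) \<Rightarrow> e v * a v ! j) \<in> K" using e(1) aK K_mult by (auto simp: I_def)
  next
    fix q :: "(qbar \<Rightarrow> real) \<times> nat \<Rightarrow> rat" and i0
    assume q0: "(\<Sum>i\<in>I. of_rat (q i) * (case i of (v, j) \<Rightarrow> e v * a v ! j)) = 0" and i0: "i0 \<in> I"
    \<comment> \<open>The coefficients are rational, so they have the same value at every place of
      \<open>T\<close>. The contradiction arises at the place \<open>v\<close> whose list carries a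
      coefficient of largest value.\<close>
    define Q where "Q = Max ((\<lambda>i. u (q i)) ` I)"
    have Qge: "u (q i) \<le> Q" if "i \<in> I" for i using I that unfolding Q_def by (intro Max_ge) auto
    have "Q \<in> (\<lambda>i. u (q i)) ` I" unfolding Q_def using I i0 by (intro Max_in) auto
    then obtain v i where vi: "(v, i) \<in> I" "u (q (v, i)) = Q" by auto
    hence v: "v \<in> T" "i < local_degree K v" by (auto simp: I_def)
    have vab: "v \<in> above" using v(1) T(2) by auto
    interpret v: place K v by (rule above_place[OF vab])
    let ?n = "local_degree K"
    let ?\<delta> = "\<lambda>w. if w = v then 1 else 0 :: qbar"
    have nested: "(\<Sum>i\<in>I. f (fst i) (snd i)) = (\<Sum>w\<in>T. \<Sum>j<?n w. f w j)" for f :: "_ \<Rightarrow> _ \<Rightarrow> qbar"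
      unfolding I_def using T(1) by (subst sum.Sigma) (auto intro!: sum.cong)
    have "(\<Sum>j<?n v. of_rat (q (v, j)) * a v ! j) = (\<Sum>w\<in>T. \<Sum>j<?n w. of_rat (q (w, j)) * (?\<delta> w * a w ! j))"
    proof -
      have "(\<Sum>w\<in>T. \<Sum>j<?n w. of_rat (q (w, j)) * (?\<delta> w * a w ! j)) =
        (\<Sum>w\<in>T. if w = v then \<Sum>j<?n v. of_rat (q (v, j)) * a v ! j else 0)"
        by (intro sum.cong) auto
      thus ?thesis using T(1) v(1) by simp
    qed
    also have "\<dots> = (\<Sum>i\<in>I. of_rat (q i) * (?\<delta> (fst i) * a (fst i) ! snd i))"
      using nested[of "\<lambda>w j. of_rat (q (w, j)) * (?\<delta> w * a w ! j)"] by simp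
    \<comment> \<open>Subtracting the vanishing combination leaves only the deviations of
      \<open>e w\<close> from 1 at \<open>w = v\<close> and from 0 at
      \<open>w \<noteq> v\<close>.\<close>
    also have "\<dots> = (\<Sum>i\<in>I. of_rat (q i) * (?\<delta> (fst i) * a (fst i) ! snd i))
        - (\<Sum>i\<in>I. of_rat (q i) * (case i of (v, j) \<Rightarrow> e v * a v ! j))"
      using q0 by simp
    also have "\<dots> = (\<Sum>i\<in>I. of_rat (q i) * ((?\<delta> (fst i) - e (fst i)) * a (fst i) ! snd i))"
      unfolding sum_subtractf[symmetric] by (intro sum.cong refl) (auto simp: algebra_simps split: prod.splits)
    finally have eq: "(\<Sum>j<?n v. of_rat (q (v, j)) * a v ! j) =
      (\<Sum>i\<in>I. of_rat (q i) * ((?\<delta> (fst i) - e (fst i)) * a (fst i) ! snd i))" .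
    have Q0: "0 \<le> Q" using vi(2) usual_abs(1)[OF u] by metis
    have inK: "?\<delta> w - e w \<in> K" if "w \<in> T" for w using e(1)[OF that] by (auto intro!: K_diff K_uminus K_zero K_one)
    have \<delta>: "v (?\<delta> w - e w) \<le> \<epsilon>" if w: "w \<in> T" for w
    proof (cases "w = v")
      case True
      have "v (1 - e v) = v (e v - 1)" using v.v_uminus[OF K_diff[OF e(1) K_one], of v] v(1) by simp
      thus ?thesis using e(2)[OF v(1)] True by simp
    next
      case False
      thus ?thesis using e(3)[OF w v(1)] v.v_uminus[OF e(1)[OF w]] by simp
    qed
    have "v (\<Sum>j<?n v. of_rat (q (v, j)) * a v ! j) \<le>
      (\<Sum>i\<in>I. v (of_rat (q i) * ((?\<delta> (fst i) - e (fst i)) * a (fst i) ! snd i)))"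
      unfolding eq by (rule v.v_sum, rule K_mult[OF K_of_rat K_mult[OF inK aK]]) (auto simp: I_def)
    also have "\<dots> \<le> (\<Sum>i\<in>I. Q * (\<epsilon> * M))"
    proof (rule sum_mono)
      fix i assume i: "i \<in> I"
      then obtain w j where wj: "i = (w, j)" "w \<in> T" "j < ?n w" by (auto simp: I_def)
      have "v (of_rat (q i) * ((?\<delta> w - e w) * a w ! j)) = u (q i) * (v (?\<delta> w - e w) * v (a w ! j))"
        using v.v_mult[OF K_of_rat K_mult[OF inK[OF wj(2)] aK[OF wj(2,3)]]] v.v_mult[OF inK[OF wj(2)] aK[OF wj(2,3)]]
          above_rat[OF vab] by simp
      also have "\<dots> \<le> Q * (\<epsilon> * M)"
        by (rule mult_mono[OF Qge[OF i] mult_mono[OF \<delta>[OF wj(2)] M[OF v(1) wj(2,3)]] Q0])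
          (use \<epsilon> v.v_nonneg inK[OF wj(2)] aK[OF wj(2,3)] in auto)
      finally show "v (of_rat (q i) * ((?\<delta> (fst i) - e (fst i)) * a (fst i) ! snd i)) \<le> Q * (\<epsilon> * M)"
        by (simp add: wj(1))
    qed
    also have "\<dots> = Q * (real (card I) * (\<epsilon> * M))" by simp
    finally have "c v * Q \<le> Q * (real (card I) * (\<epsilon> * M))"
      using free[OF v(1), of i "\<lambda>j. q (v, j)"] ac(2)[OF v(1)] v(2) vi(2) above_rat[OF vab] by simp
    hence "Q * (c v - real (card I) * (\<epsilon> * M)) \<le> 0" by (simp add: algebra_simps)
    hence "Q \<le> 0" using \<epsilon>c[OF v(1)] by (simp add: mult_le_0_iff)
    hence "u (q i0) = 0" using Qge[OF i0] usual_abs(1)[OF u, of "q i0"] by linarith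
    thus "q i0 = 0" using usual_abs(2)[OF u] by simp
  qed
  moreover have "card I = (\<Sum>v\<in>T. local_degree K v)" unfolding I_def using T(1) by simp
  ultimately show ?thesis by simp
qed

lemma sum_conj_fibres: "(\<Sum>v\<in>conj_place ` conj. card {\<beta>\<in>conj. conj_place \<beta> = v}) = d"
  using sum.image_gen[OF finite_conj, of "\<lambda>_. 1 :: nat" conj_place] card_conj by simp

text \<open>The fibres already account for a total local degree of at least \<open>d\<close>. One
  more place would add a positive amount, against \<open>sum_local_degree_le\<close>.\<close>

lemma above_eq: "above = conj_place ` conj"
proof (rule antisym)
  show "conj_place ` conj \<subseteq> above" using conj_place_above by auto
  have 1: "d \<le> (\<Sum>v\<in>conj_place ` conj. local_degree K v)"
    unfolding sum_conj_fibres[symmetric] by (rule sum_mono) (use conj_fibre_le conj_place_above in auto)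
  show "above \<subseteq> conj_place ` conj"
  proof
    fix w assume w: "w \<in> above"
    interpret w: place K w by (rule above_place[OF w])
    show "w \<in> conj_place ` conj"
    proof (rule ccontr)
      assume n: "w \<notin> conj_place ` conj"
      have "(\<Sum>v\<in>insert w (conj_place ` conj). local_degree K v) \<le> d"
        using w finite_conj conj_place_above by (intro sum_local_degree_le) auto
      moreover have "(\<Sum>v\<in>insert w (conj_place ` conj). local_degree K v) =
          local_degree K w + (\<Sum>v\<in>conj_place ` conj. local_degree K v)"
        using n finite_conj by (intro sum.insert) auto
      ultimately show False using 1 w.local_degree_pos by linarith
    qed
  qed
qed

lemma finite_above: "finite above"
  using finite_conj by (simp add: above_eq)

text \<open>Termwise inequality between sums that are both equal to \<open>d\<close>.\<close>

lemma local_degree_eq: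
  assumes "v \<in> above" shows "card {\<beta>\<in>conj. conj_place \<beta> = v} = local_degree K v"
proof (rule sum_mono_inv[where I = above])
  have "(\<Sum>v\<in>above. card {\<beta>\<in>conj. conj_place \<beta> = v}) \<le> (\<Sum>v\<in>above. local_degree K v)"
    by (rule sum_mono) (rule conj_fibre_le)
  moreover have "(\<Sum>v\<in>above. local_degree K v) \<le> d"
    by (rule sum_local_degree_le[OF finite_above]) simp
  ultimately show "(\<Sum>v\<in>above. card {\<beta>\<in>conj. conj_place \<beta> = v}) = (\<Sum>v\<in>above. local_degree K v)"
    using sum_conj_fibres by (simp add: above_eq)
qed (use assms finite_above conj_fibre_le in auto)

text \<open>The conjugates of \<open>x\<close> are grouped by the place they induce; the fibre size
  is the exponent.\<close>

theorem prod_above: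
  assumes x: "x \<in> K" and n: "(\<Prod>\<beta>\<in>conj. \<sigma> \<beta> x) = of_rat n"
  shows "(\<Prod>v\<in>above. v x ^ local_degree K v) = u n"
proof -
  have "u n = P (of_rat n)" by (rule P_of_rat[symmetric])
  also have "\<dots> = P (\<Prod>\<beta>\<in>conj. \<sigma> \<beta> x)" by (simp only: n)
  also have "\<dots> = (\<Prod>\<beta>\<in>conj. P (\<sigma> \<beta> x))" by (rule P_prod)
  also have "\<dots> = (\<Prod>v\<in>conj_place ` conj. \<Prod>\<beta>\<in>{\<beta>\<in>conj. conj_place \<beta> = v}. P (\<sigma> \<beta> x))"
    by (rule prod.image_gen[OF finite_conj])
  also have "\<dots> = (\<Prod>v\<in>above. v x ^ local_degree K v)"
  proof (rule prod.cong[OF above_eq[symmetric]])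
    fix v assume v: "v \<in> above"
    have "(\<Prod>\<beta>\<in>{\<beta>\<in>conj. conj_place \<beta> = v}. P (\<sigma> \<beta> x)) = (\<Prod>\<beta>\<in>{\<beta>\<in>conj. conj_place \<beta> = v}. v x)"
      by (intro prod.cong) (use x in \<open>auto simp: conj_place_def\<close>)
    thus "(\<Prod>\<beta>\<in>{\<beta>\<in>conj. conj_place \<beta> = v}. P (\<sigma> \<beta> x)) = v x ^ local_degree K v"
      using local_degree_eq[OF v] by simp
  qed
  finally show ?thesis by simp
qed

end

section \<open>The product formula\<close>

lemma padic_abs_neq:
  assumes "Factorial_Ring.prime p" "Factorial_Ring.prime q" "p \<noteq> q"
  shows "padic_abs q (of_nat p) = 1"
proof -
  have "\<not> q dvd p" using primes_dvd_imp_eq[of q p] assms by auto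
  hence "multiplicity (int q) (int p) = 0" by (intro not_dvd_imp_multiplicity_0) simp
  thus ?thesis using padic_abs_of_int[OF assms(2), of "int p"] prime_gt_0_nat[OF assms(1)] by simp
qed

text \<open>Products run over sets of absolute values, so distinct primes must yield distinct
  functions.\<close>

lemma inj_padic_abs: "inj_on padic_abs {p. Factorial_Ring.prime p}"
proof (rule inj_onI)
  fix p q assume pq: "p \<in> {p. Factorial_Ring.prime p}" "q \<in> {p. Factorial_Ring.prime p}" "padic_abs p = padic_abs q"
  show "p = q"
  proof (rule ccontr)
    assume "p \<noteq> q"
    hence "padic_abs p (of_nat p) = 1" using padic_abs_neq[of p q] pq by simp
    thus False using padic_abs_prime[of p] prime_gt_1_nat[of p] pq(1) by simp
  qed
qed

lemma padic_abs_neq_real_abs: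
  assumes "Factorial_Ring.prime p" shows "padic_abs p \<noteq> (\<lambda>x. \<bar>of_rat x\<bar>)"
proof
  assume "padic_abs p = (\<lambda>x. \<bar>of_rat x\<bar>)"
  hence "padic_abs p (of_nat p) = \<bar>of_rat (of_nat p)\<bar>" by metis
  hence "1 / real p = real p" using padic_abs_prime[OF assms] by simp
  moreover have "1 / real p < 1" "1 < real p" using prime_gt_1_nat[OF assms] by simp_all
  ultimately show False by linarith
qed

lemma prod_prime_power_int:
  assumes "finite A" "prime_factors a \<subseteq> A" "a \<noteq> (0 :: int)" "\<And>p. p \<in> A \<Longrightarrow> Factorial_Ring.prime p"
  shows "(\<Prod>p\<in>A. real_of_int p ^ multiplicity p a) = \<bar>real_of_int a\<bar>"
proof -
  have "(\<Prod>p\<in>A. p ^ multiplicity p a) = (\<Prod>p\<in>prime_factors a. p ^ multiplicity p a)"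
    using assms by (intro prod.mono_neutral_right) (auto simp: prime_factors_multiplicity)
  also have "\<dots> = \<bar>a\<bar>" using prod_prime_factors[OF assms(3)] by simp
  finally have "real_of_int (\<Prod>p\<in>A. p ^ multiplicity p a) = real_of_int \<bar>a\<bar>" by simp
  thus ?thesis by simp
qed

text \<open>The infinite product is expressed by a finite set outside which all factors are 1: the
  real absolute value and the primes dividing numerator or denominator.\<close>

theorem product_formula_rat:
  assumes "n \<noteq> 0"
  shows "\<exists>S. finite S \<and> S \<subseteq> usual_abs_values \<and> (\<forall>u\<in>usual_abs_values - S. u n = 1) \<and> (\<Prod>u\<in>S. u n) = 1"
proof -
  obtain a b where n: "n = of_int a / of_int b" "b \<noteq> 0" by (rule rat_frac)
  have a: "a \<noteq> 0" using n assms by auto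
  define A where "A = prime_factors a \<union> prime_factors b"
  have A: "finite A" "\<And>p. p \<in> A \<Longrightarrow> Factorial_Ring.prime p" by (auto simp: A_def)
  have natp: "Factorial_Ring.prime (nat p)" "int (nat p) = p" if "p \<in> A" for p
  proof -
    show "Factorial_Ring.prime (nat p)"
      using A(2)[OF that] unfolding prime_int_nat_transfer by (rule conjunct2)
    show "int (nat p) = p" using prime_gt_0_int[OF A(2)[OF that]] by simp
  qed
  let ?R = "\<lambda>x :: rat. \<bar>of_rat x :: real\<bar>"
  let ?P = "\<lambda>p. padic_abs (nat p)"
  have inj: "inj_on ?P A"
  proof (rule inj_onI)
    fix p q assume pq: "p \<in> A" "q \<in> A" "?P p = ?P q"
    have "nat p = nat q" using inj_onD[OF inj_padic_abs pq(3)] natp(1)[OF pq(1)] natp(1)[OF pq(2)] by simp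
    thus "p = q" using natp(2)[OF pq(1)] natp(2)[OF pq(2)] by metis
  qed
  have Pn: "?P p n = real_of_int p ^ multiplicity p b / real_of_int p ^ multiplicity p a" if "p \<in> A" for p
  proof -
    have "real (nat p) = real_of_int p" using natp(2)[OF that] by (metis of_int_of_nat_eq)
    moreover have "p \<noteq> 0" using A(2)[OF that] by auto
    ultimately show ?thesis
      using padic_abs_frac[OF natp(1)[OF that] a n(2)] n(1) natp(2)[OF that] by (simp add: power_int_diff)
  qed
  have "?R \<notin> ?P ` A"
  proof
    assume "?R \<in> ?P ` A"
    then obtain p where p: "?R = ?P p" "p \<in> A" by (rule imageE)
    from padic_abs_neq_real_abs[OF natp(1)[OF p(2)]] p(1)[symmetric] show False by (rule notE)
  qed
  hence "(\<Prod>u\<in>insert ?R (?P ` A). u n) = ?R n * (\<Prod>u\<in>?P ` A. u n)"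
    using A(1) by (intro prod.insert) auto
  also have "(\<Prod>u\<in>?P ` A. u n) = (\<Prod>p\<in>A. ?P p n)" using prod.reindex[OF inj, of "\<lambda>u. u n"] by simp
  also have "\<dots> = (\<Prod>p\<in>A. real_of_int p ^ multiplicity p b / real_of_int p ^ multiplicity p a)"
    by (rule prod.cong[OF refl Pn])
  also have "\<dots> = \<bar>real_of_int b\<bar> / \<bar>real_of_int a\<bar>"
    using prod_prime_power_int[OF A(1) _ a A(2)] prod_prime_power_int[OF A(1) _ n(2) A(2)]
    by (simp add: prod_dividef A_def)
  also have "?R n * (\<bar>real_of_int b\<bar> / \<bar>real_of_int a\<bar>) = 1"
    using a n(2) by (simp add: n(1) of_rat_divide abs_divide)
  finally have "(\<Prod>u\<in>insert ?R (?P ` A). u n) = 1" .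
  moreover have "insert ?R (?P ` A) \<subseteq> usual_abs_values"
    unfolding usual_abs_values_def by (rule insert_mono, rule image_subsetI, rule CollectI, rule exI, rule conjI[OF refl natp(1)])
  moreover have "u n = 1" if u: "u \<in> usual_abs_values - insert ?R (?P ` A)" for u
  proof -
    obtain p where p: "Factorial_Ring.prime p" "u = padic_abs p" using u unfolding usual_abs_values_def by auto
    have "int p \<notin> A" using u p(2) by (auto intro: image_eqI[of _ _ "int p"])
    hence "multiplicity (int p) a = 0" "multiplicity (int p) b = 0"
      using p(1) unfolding A_def prime_factors_multiplicity by simp_all
    thus ?thesis unfolding p(2) n(1) padic_abs_frac[OF p(1) a n(2)] by simp
  qed
  ultimately show ?thesis using A(1) by (intro exI[of _ "insert ?R (?P ` A)"]) auto
qed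

section \<open>Values at almost all places, and the product formula for a number field\<close>

context numfield
begin

lemma place_base:
  assumes "v \<in> places K" obtains u where "u \<in> usual_abs_values" "v \<in> base_place.above K u"
proof -
  obtain u where hu: "u \<in> usual_abs_values" "\<forall>x. v (of_rat x) = u x" using assms unfolding places_def by blast
  interpret base_place K u by unfold_locales (rule hu(1))
  have "v \<in> above" unfolding above_def mem_Collect_eq using assms hu(2) by (rule conjI)
  thus ?thesis by (rule that[OF hu(1)])
qed

lemma monic_relation:
  assumes "x \<in> K"
  shows "\<exists>n c. x ^ Suc n = (\<Sum>i<Suc n. of_rat (c i) * x ^ i)"
proof -
  obtain p where p: "p \<noteq> 0" "ev p x = 0" using K_algebraic[OF assms] by blast
  have "degree p \<noteq> 0"
  proof
    assume "degree p = 0"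
    then obtain a where "p = [:a:]" by (rule degree_eq_zeroE)
    thus False using p by simp
  qed
  then obtain n where n: "degree p = Suc n" by (cases "degree p") auto
  have lc: "coeff p (Suc n) \<noteq> 0" using p(1) n by (metis leading_coeff_0_iff)
  have "ev p x = (\<Sum>i<Suc (Suc n). of_rat (coeff p i) * x ^ i)" by (rule ev_alt) (use n in simp)
  hence "(\<Sum>i<Suc n. of_rat (coeff p i) * x ^ i) + of_rat (coeff p (Suc n)) * x ^ Suc n = 0"
    unfolding p(2) sum.lessThan_Suc[where n = "Suc n"] by (rule sym)
  from minus_unique[OF this]
  have eq: "of_rat (coeff p (Suc n)) * x ^ Suc n = - (\<Sum>i<Suc n. of_rat (coeff p i) * x ^ i)" by (rule sym)
  have "of_rat (coeff p (Suc n)) \<noteq> (0 :: qbar)" using lc by simp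
  hence "x ^ Suc n = of_rat (coeff p (Suc n)) * x ^ Suc n / of_rat (coeff p (Suc n))"
    by (rule nonzero_mult_div_cancel_left[symmetric])
  also have "\<dots> = - (\<Sum>i<Suc n. of_rat (coeff p i) * x ^ i) / of_rat (coeff p (Suc n))"
    unfolding eq ..
  also have "\<dots> = (\<Sum>i<Suc n. of_rat (- coeff p i / coeff p (Suc n)) * x ^ i)"
    by (simp only: sum_negf[symmetric] sum_divide_distrib of_rat_divide of_rat_minus) (simp add: mult.commute)
  finally show ?thesis by (intro exI[of _ n] exI[of _ "\<lambda>i. - coeff p i / coeff p (Suc n)"])
qed

text \<open>Multiplying by \<open>x\<close> shifts the coefficients and produces one overflowing
  power, which the relation \<open>x\<close> replaces. The ultrametric inequality keeps the new
  coefficients bounded by 1.\<close>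

lemma integral_powers:
  assumes p: "Factorial_Ring.prime p" and c: "\<And>i. i < Suc n \<Longrightarrow> padic_abs p (c i) \<le> 1"
    and x: "x ^ Suc n = (\<Sum>i<Suc n. of_rat (c i) * (x :: qbar) ^ i)"
  shows "\<exists>q. (\<forall>i<Suc n. padic_abs p (q i) \<le> 1) \<and> x ^ k = (\<Sum>i<Suc n. of_rat (q i) * x ^ i)"
proof (induction k)
  case 0
  have "padic_abs p 1 = 1" using padic_abs_of_int[OF p, of 1] by simp
  moreover have "(\<Sum>i<Suc n. of_rat (if i = 0 then 1 else 0) * x ^ i) = 1"
    by (simp add: sum.lessThan_Suc_shift del: sum.lessThan_Suc)
  ultimately show ?case by (intro exI[of _ "\<lambda>i. if i = 0 then 1 else 0"]) simp
next
  case (Suc k)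
  then obtain q where q: "\<And>i. i < Suc n \<Longrightarrow> padic_abs p (q i) \<le> 1" "x ^ k = (\<Sum>i<Suc n. of_rat (q i) * x ^ i)" by blast
  \<comment> \<open>The shifted coefficient, plus the contribution of the overflow
    \<open>q n\<close>.\<close>
  define r where "r i = (if i = 0 then 0 else q (i - 1)) + q n * c i" for i
  have "x ^ Suc k = (\<Sum>i<Suc n. of_rat (q i) * x ^ Suc i)"
    by (simp only: power_Suc q(2) sum_distrib_left) (simp add: algebra_simps)
  also have "\<dots> = (\<Sum>i<n. of_rat (q i) * x ^ Suc i) + of_rat (q n) * (\<Sum>i<Suc n. of_rat (c i) * x ^ i)"
    unfolding x[symmetric] by (rule sum.lessThan_Suc)
  also have "(\<Sum>i<n. of_rat (q i) * x ^ Suc i) = (\<Sum>i<Suc n. of_rat (if i = 0 then 0 else q (i - 1)) * x ^ i)"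
    by (simp add: sum.lessThan_Suc_shift del: sum.lessThan_Suc)
  also have "\<dots> + of_rat (q n) * (\<Sum>i<Suc n. of_rat (c i) * x ^ i) = (\<Sum>i<Suc n. of_rat (r i) * x ^ i)"
    unfolding sum_distrib_left sum.distrib[symmetric] r_def of_rat_add of_rat_mult
    by (intro sum.cong refl) (simp add: algebra_simps)
  finally have "x ^ Suc k = (\<Sum>i<Suc n. of_rat (r i) * x ^ i)" .
  moreover have "padic_abs p (r i) \<le> 1" if i: "i < Suc n" for i
  proof -
    have "padic_abs p (q n * c i) \<le> 1 * 1" unfolding padic_abs_mult[OF p]
      by (intro mult_mono q(1) c i padic_abs_nonneg) auto
    moreover have "padic_abs p (if i = 0 then 0 else q (i - 1)) \<le> 1" using q(1) i by auto
    ultimately show ?thesis using padic_abs_add[OF p, of "if i = 0 then 0 else q (i - 1)" "q n * c i"]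
      unfolding r_def by linarith
  qed
  ultimately show ?case by (intro exI[of _ r]) blast
qed

text \<open>Outside finitely many \<open>u\<close>, all powers of \<open>x\<close> are \<open>u\<close>-integral combinations of \<open>1, \<dots>, x\<^sup>n\<close>, so they
  are bounded.\<close>

lemma almost_integral:
  assumes x: "x \<in> K"
  shows "\<exists>F. finite F \<and> F \<subseteq> usual_abs_values \<and> (\<forall>u\<in>usual_abs_values - F. \<forall>v\<in>base_place.above K u. v x \<le> 1)"
proof -
  obtain n c where c: "x ^ Suc n = (\<Sum>i<Suc n. of_rat (c i) * x ^ i)" using monic_relation[OF x] by blast
  have "\<exists>S. finite S \<and> S \<subseteq> usual_abs_values \<and> (\<forall>u\<in>usual_abs_values - S. u (c i) \<le> 1)" for i
  proof (cases "c i = 0")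
    case True
    have "u (c i) \<le> 1" if "u \<in> usual_abs_values" for u using usual_abs(2)[OF that, of "c i"] True by simp
    thus ?thesis by (intro exI[of _ "{}"]) simp
  next
    case False
    obtain S where S: "finite S" "S \<subseteq> usual_abs_values" "\<forall>u\<in>usual_abs_values - S. u (c i) = 1"
      using product_formula_rat[OF False] by (elim exE conjE)
    have "u (c i) \<le> 1" if "u \<in> usual_abs_values - S" for u
      using bspec[OF S(3) that] by (rule eq_refl)
    thus ?thesis using S(1,2) by (intro exI[of _ S]) blast
  qed
  then obtain S where S: "\<And>i. finite (S i)" "\<And>i. S i \<subseteq> usual_abs_values"
    "\<And>i u. u \<in> usual_abs_values - S i \<Longrightarrow> u (c i) \<le> 1" by metis
  define F where "F = insert (\<lambda>x. \<bar>of_rat x\<bar>) (\<Union>i<Suc n. S i)"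
  have "v x \<le> 1" if hu: "u \<in> usual_abs_values - F" and v: "v \<in> base_place.above K u" for u v
  proof (rule ccontr)
    interpret base_place K u by unfold_locales (use hu in simp)
    interpret v: place K v by (rule above_place[OF v])
    assume "\<not> v x \<le> 1"
    hence v1: "1 < v x" by simp
    obtain p where p: "Factorial_Ring.prime p" "u = padic_abs p"
      using hu unfolding usual_abs_values_def F_def by auto
    have ci: "padic_abs p (c i) \<le> 1" if "i < Suc n" for i
      using S(3)[of u i] hu that unfolding F_def p(2)[symmetric] by auto
    have bound: "v x ^ k \<le> (\<Sum>i<Suc n. v x ^ i)" for k
    proof -
      have "\<exists>q. (\<forall>i<Suc n. padic_abs p (q i) \<le> 1) \<and> x ^ k = (\<Sum>i<Suc n. of_rat (q i) * x ^ i)"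
        by (rule integral_powers[OF p(1) _ c]) (rule ci)
      then obtain q where q: "\<forall>i<Suc n. padic_abs p (q i) \<le> 1" "x ^ k = (\<Sum>i<Suc n. of_rat (q i) * x ^ i)"
        by (elim exE conjE)
      have "v x ^ k = v (\<Sum>i<Suc n. of_rat (q i) * x ^ i)" using v.v_power[OF x, of k] q(2) by simp
      also have "\<dots> \<le> (\<Sum>i<Suc n. v (of_rat (q i) * x ^ i))"
        by (intro v.v_sum K_mult K_of_rat K_power x)
      also have "\<dots> \<le> (\<Sum>i<Suc n. v x ^ i)"
      proof (rule sum_mono)
        fix i assume "i \<in> {..<Suc n}"
        hence "v (of_rat (q i)) \<le> 1" using q(1) above_rat[OF v] p(2) by simp
        hence "v (of_rat (q i)) * v x ^ i \<le> 1 * v x ^ i" using v1 by (intro mult_right_mono) auto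
        thus "v (of_rat (q i) * x ^ i) \<le> v x ^ i"
          using v.v_mult[OF K_of_rat K_power[OF x]] v.v_power[OF x] by simp
      qed
      finally show ?thesis .
    qed
    \<comment> \<open>The bound does not depend on \<open>k\<close>, while the powers of
      \<open>v x > 1\<close> grow beyond it.\<close>
    obtain k where "(\<Sum>i<Suc n. v x ^ i) < v x ^ k" using real_arch_pow[OF v1] by blast
    thus False using bound[of k] by linarith
  qed
  moreover have "finite F" "F \<subseteq> usual_abs_values"
    using S(1,2) unfolding F_def by (auto simp: usual_abs_values_def)
  ultimately show ?thesis by (intro exI[of _ F]) simp
qed

text \<open>\<open>almost_integral\<close> for \<open>x\<close> and for its inverse.\<close>

lemma almost_unit:
  assumes x: "x \<in> K" "x \<noteq> 0"
  shows "\<exists>F. finite F \<and> F \<subseteq> usual_abs_values \<and> (\<forall>u\<in>usual_abs_values - F. \<forall>v\<in>base_place.above K u. v x = 1)"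
proof -
  obtain F where F: "finite F" "F \<subseteq> usual_abs_values" "\<forall>u\<in>usual_abs_values - F. \<forall>v\<in>base_place.above K u. v x \<le> 1"
    using almost_integral[OF x(1)] by (elim exE conjE)
  obtain G where G: "finite G" "G \<subseteq> usual_abs_values"
    "\<forall>u\<in>usual_abs_values - G. \<forall>v\<in>base_place.above K u. v (inverse x) \<le> 1"
    using almost_integral[OF K_inverse[OF x(1)]] by (elim exE conjE)
  have "v x = 1" if hu: "u \<in> usual_abs_values - (F \<union> G)" and v: "v \<in> base_place.above K u" for u v
  proof -
    interpret base_place K u by unfold_locales (use hu in simp)
    interpret v: place K v by (rule above_place[OF v])
    have "v x \<le> 1" by (rule bspec[OF bspec[OF F(3)] v]) (use hu in simp)
    moreover have "v (inverse x) \<le> 1" by (rule bspec[OF bspec[OF G(3)] v]) (use hu in simp)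
    moreover have "0 < v x" by (rule v.v_pos[OF x])
    ultimately show ?thesis unfolding v.v_inverse[OF x(1)] by (simp add: inverse_le_1_iff)
  qed
  thus ?thesis using F(1,2) G(1,2) by (intro exI[of _ "F \<union> G"]) simp
qed

text \<open>Places are grouped by their restriction to the rationals; each group contributes the
  value of the norm, and the rational formula applies. The exponent \<open>1/d\<close> is taken at
  the end. \<open>S\<close> is any finite set containing the places where \<open>x\<close> has value
  other than 1, so that it can be shared with the heights.\<close>

theorem product_formula:
  assumes x: "x \<in> K" "x \<noteq> 0"
  shows "finite {v\<in>places K. v x \<noteq> 1}"
    and "finite S \<Longrightarrow> S \<subseteq> places K \<Longrightarrow> (\<And>v. v \<in> places K - S \<Longrightarrow> v x = 1) \<Longrightarrow>
      (\<Prod>v\<in>S. v x powr (real (local_degree K v) / real d)) = 1"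
proof -
  obtain F where F: "finite F" "F \<subseteq> usual_abs_values" "\<forall>u\<in>usual_abs_values - F. \<forall>v\<in>base_place.above K u. v x = 1"
    using almost_unit[OF x] by (elim exE conjE)
  obtain n where n: "(\<Prod>\<beta>\<in>conj. \<sigma> \<beta> x) = of_rat n" using norm_rational[OF x(1)] by (elim exE)
  have "(\<Prod>\<beta>\<in>conj. \<sigma> \<beta> x) \<noteq> 0" using finite_conj \<sigma>_eq_0[OF _ x(1)] x(2) by simp
  hence n0: "n \<noteq> 0" using n by auto
  obtain G where G: "finite G" "G \<subseteq> usual_abs_values" "\<forall>u\<in>usual_abs_values - G. u n = 1" "(\<Prod>u\<in>G. u n) = 1"
    using product_formula_rat[OF n0] by (elim exE conjE)
  define T where "T = (\<Union>u\<in>F \<union> G. base_place.above K u)"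
  have bp: "base_place K u" if "u \<in> F \<union> G" for u
    by unfold_locales (use that F(2) G(2) in auto)
  have T: "finite T" "T \<subseteq> places K"
    using F(1) G(1) base_place.finite_above[OF bp] bp by (auto simp: T_def base_place.above_def)
  have T1: "v x = 1" if v: "v \<in> places K - T" for v
  proof -
    obtain u where u: "u \<in> usual_abs_values" "v \<in> base_place.above K u" using v by (auto elim: place_base)
    have "u \<notin> F" using u(2) v by (auto simp: T_def)
    thus ?thesis using F(3) u by auto
  qed
  show fin: "finite {v\<in>places K. v x \<noteq> 1}" by (rule finite_subset[OF _ T(1)]) (use T1 in auto)
  have pos: "0 < v x" if "v \<in> places K" for v
  proof -
    interpret place K v by unfold_locales (rule that)
    show ?thesis by (rule v_pos[OF x])
  qed
  have "(\<Prod>v\<in>T. v x ^ local_degree K v) = (\<Prod>u\<in>F \<union> G. \<Prod>v\<in>base_place.above K u. v x ^ local_degree K v)"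
    unfolding T_def
  proof (rule prod.UNION_disjoint)
    show "\<forall>u\<in>F \<union> G. \<forall>u'\<in>F \<union> G. u \<noteq> u' \<longrightarrow> base_place.above K u \<inter> base_place.above K u' = {}"
    proof (intro ballI impI)
      fix u u' assume uu: "u \<in> F \<union> G" "u' \<in> F \<union> G" "u \<noteq> u'"
      show "base_place.above K u \<inter> base_place.above K u' = {}"
        using base_place.above_rat[OF bp[OF uu(1)]] base_place.above_rat[OF bp[OF uu(2)]] uu(3) by (auto 0 3 intro: ext)
    qed
  qed (use F(1) G(1) base_place.finite_above[OF bp] in auto)
  also have "\<dots> = (\<Prod>u\<in>F \<union> G. u n)"
    by (intro prod.cong refl base_place.prod_above bp x(1) n)
  also have "\<dots> = (\<Prod>u\<in>G. u n)" using F(1,2) G(1,3) by (intro prod.mono_neutral_right) auto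
  finally have prT: "(\<Prod>v\<in>T. v x ^ local_degree K v) = 1" using G(4) by simp
  assume S: "finite S" "S \<subseteq> places K" "\<And>v. v \<in> places K - S \<Longrightarrow> v x = 1"
  let ?f = "\<lambda>v. v x powr (real (local_degree K v) / real d)"
  have "?f v = 1" if "v \<in> S \<union> T - S" for v using S(3)[of v] T(2) that by auto
  \<comment> \<open>\<open>S\<close> and \<open>T\<close> are compared through their union, since
    they differ only at places where \<open>x\<close> has value 1.\<close>
  hence "prod ?f S = prod ?f (S \<union> T)" using S(1) T(1) by (intro prod.mono_neutral_left ballI) auto
  moreover have "?f v = 1" if "v \<in> S \<union> T - T" for v using T1[of v] S(2) that by auto
  hence "prod ?f (S \<union> T) = prod ?f T" using S(1) T(1) by (intro prod.mono_neutral_right ballI) auto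
  ultimately have "prod ?f S = prod ?f T" by simp
  also have "\<dots> = (\<Prod>v\<in>T. (v x ^ local_degree K v) powr (1 / real d))"
  proof (rule prod.cong[OF refl])
    fix v assume "v \<in> T"
    hence "0 < v x" using pos T(2) by auto
    thus "?f v = (v x ^ local_degree K v) powr (1 / real d)"
      by (simp add: powr_realpow[symmetric] powr_powr)
  qed
  also have "\<dots> = (\<Prod>v\<in>T. v x ^ local_degree K v) powr (1 / real d)"
    by (intro prod_powr_distrib[symmetric])
  finally show "prod ?f S = 1" using prT by simp
qed

end

section \<open>Determinants over number fields\<close>

lemma ring_det_hom:
  assumes "cring R" "cring S" "h \<in> Ring.ring_hom R S"
    and A: "\<And>i j. i < M \<Longrightarrow> j < M \<Longrightarrow> A i j \<in> carrier R"
  shows "h (ring_det R M A) = ring_det S M (\<lambda>i j. h (A i j))"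
proof -
  interpret R: cring R by fact
  interpret S: cring S by fact
  interpret h: ring_hom_cring R S h by unfold_locales (rule assms(3))
  have A': "R.square_closed M A" using A by (simp add: R.square_closed_def)
  have hom_term: "h (R.sgn_elt p \<otimes>\<^bsub>R\<^esub> (\<Otimes>\<^bsub>R\<^esub>i\<in>{..<M}. A i (p i))) =
      S.sgn_elt p \<otimes>\<^bsub>S\<^esub> (\<Otimes>\<^bsub>S\<^esub>i\<in>{..<M}. h (A i (p i)))" if p: "p permutes {..<M}" for p
  proof -
    have cl: "A i (p i) \<in> carrier R" if "i < M" for i
      using A that permutes_in_image[OF p, of i] by simp
    hence "h (\<Otimes>\<^bsub>R\<^esub>i\<in>{..<M}. A i (p i)) = (\<Otimes>\<^bsub>S\<^esub>i\<in>{..<M}. (h \<circ> (\<lambda>i. A i (p i))) i)"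
      by (subst h.hom_finprod) (auto simp: o_def)
    moreover have "h (R.sgn_elt p) = S.sgn_elt p" by (simp add: R.sgn_elt_def S.sgn_elt_def)
    moreover have "(\<Otimes>\<^bsub>R\<^esub>i\<in>{..<M}. A i (p i)) \<in> carrier R" using cl by (intro R.finprod_closed) auto
    ultimately show ?thesis by (simp add: o_def)
  qed
  have "h (ring_det R M A) =
      (\<Oplus>\<^bsub>S\<^esub>p\<in>{p. p permutes {..<M}}. (h \<circ> (\<lambda>p. R.sgn_elt p \<otimes>\<^bsub>R\<^esub> (\<Otimes>\<^bsub>R\<^esub>i\<in>{..<M}. A i (p i)))) p)"
    unfolding R.ring_det_alt using R.det_term_closed[OF A']
    by (subst h.hom_finsum) (auto simp: o_def)
  also have "\<dots> = ring_det S M (\<lambda>i j. h (A i j))"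
    unfolding S.ring_det_alt
  proof (rule S.fsum_cong)
    fix p assume "p \<in> {p. p permutes {..<M}}"
    hence p: "p permutes {..<M}" by simp
    show "(h \<circ> (\<lambda>p. R.sgn_elt p \<otimes>\<^bsub>R\<^esub> (\<Otimes>\<^bsub>R\<^esub>i\<in>{..<M}. A i (p i)))) p =
      S.sgn_elt p \<otimes>\<^bsub>S\<^esub> (\<Otimes>\<^bsub>S\<^esub>i\<in>{..<M}. h (A i (p i)))" using hom_term[OF p] by simp
    show "S.sgn_elt p \<otimes>\<^bsub>S\<^esub> (\<Otimes>\<^bsub>S\<^esub>i\<in>{..<M}. h (A i (p i))) \<in> carrier S"
      unfolding hom_term[OF p, symmetric] by (intro h.hom_closed R.det_term_closed A' p)
  qed
  finally show ?thesis .
qed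

context numfield
begin

lemma cring_K: "cring (KR K)"
  using field_K by (simp add: field_def domain_def)

lemma finsum_K: "(\<And>i. i \<in> A \<Longrightarrow> f i \<in> K) \<Longrightarrow> finsum (KR K) f A = sum f A"
proof (induction A rule: infinite_finite_induct)
  case (infinite A)
  interpret Kr: cring "KR K" by (rule cring_K)
  show ?case using infinite by simp
next
  case empty
  interpret Kr: cring "KR K" by (rule cring_K)
  show ?case by simp
next
  case (insert i A)
  interpret Kr: cring "KR K" by (rule cring_K)
  have "finsum (KR K) f (insert i A) = f i \<oplus>\<^bsub>KR K\<^esub> finsum (KR K) f A"
    using insert by (intro Kr.finsum_insert) auto
  thus ?case using insert by simp
qed

lemma finprod_K: "(\<And>i. i \<in> A \<Longrightarrow> f i \<in> K) \<Longrightarrow> finprod (KR K) f A = prod f A"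
proof (induction A rule: infinite_finite_induct)
  case (infinite A)
  interpret Kr: cring "KR K" by (rule cring_K)
  show ?case using infinite by simp
next
  case empty
  interpret Kr: cring "KR K" by (rule cring_K)
  show ?case by simp
next
  case (insert i A)
  interpret Kr: cring "KR K" by (rule cring_K)
  have "finprod (KR K) f (insert i A) = f i \<otimes>\<^bsub>KR K\<^esub> finprod (KR K) f A"
    using insert by (intro Kr.finprod_insert) auto
  thus ?case using insert by simp
qed

lemma ring_det_K:
  assumes A: "\<And>i j. i < M \<Longrightarrow> j < M \<Longrightarrow> A i j \<in> K"
  shows "ring_det (KR K) M A = det (mat M M (\<lambda>(i, j). A i j))"
proof -
  interpret Kr: cring "KR K" by (rule cring_K)
  have uminus: "\<ominus>\<^bsub>KR K\<^esub> 1 = - 1" using Kr.minus_equality[of "- 1" 1] K_uminus K_one by simp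
  have sgn: "Kr.sgn_elt p = signof p" for p :: "nat \<Rightarrow> nat"
    by (simp add: Kr.sgn_elt_def uminus sign_def)
  have cl: "A i (p i) \<in> K" if "p permutes {..<M}" "i < M" for i p
    using A that permutes_in_image[OF that(1), of i] by simp
  have tm: "Kr.sgn_elt p \<otimes>\<^bsub>KR K\<^esub> (\<Otimes>\<^bsub>KR K\<^esub>i\<in>{..<M}. A i (p i)) = signof p * (\<Prod>i = 0..<M. A i (p i))"
    if p: "p permutes {..<M}" for p
    using finprod_K[of "{..<M}" "\<lambda>i. A i (p i)"] cl[OF p] by (simp add: sgn atLeast0LessThan)
  have sq: "Kr.square_closed M A" using A by (simp add: Kr.square_closed_def)
  have "ring_det (KR K) M A =
      (\<Sum>p\<in>{p. p permutes {..<M}}. Kr.sgn_elt p \<otimes>\<^bsub>KR K\<^esub> (\<Otimes>\<^bsub>KR K\<^esub>i\<in>{..<M}. A i (p i)))"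
    unfolding Kr.ring_det_alt by (rule finsum_K) (use Kr.det_term_closed[OF sq] in auto)
  also have "\<dots> = (\<Sum>p\<in>{p. p permutes {..<M}}. signof p * (\<Prod>i = 0..<M. A i (p i)))"
    by (rule sum.cong) (use tm in auto)
  also have "\<dots> = det (mat M M (\<lambda>(i, j). A i j))"
    unfolding det_def'[OF mat_carrier] atLeast0LessThan[symmetric]
    by (intro sum.cong refl arg_cong2[where f = "(*)"] prod.cong) (auto dest: permutes_in_image[THEN iffD2])
  finally show ?thesis .
qed

end

no_notation vec_nth (infixl \<open>$\<close> 90) and fps_nth (infixl \<open>$\<close> 75)

section \<open>The matrix of a linear map on a basis of a complementary subspace\<close>

lemma linear_map_vec:
  assumes "linear_map class_ring (qbar_space N) (qbar_space M) \<Psi>"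
  shows "x \<in> carrier_vec N \<Longrightarrow> \<Psi> x \<in> carrier_vec M"
    and "x \<in> carrier_vec N \<Longrightarrow> y \<in> carrier_vec N \<Longrightarrow> \<Psi> (x + y) = \<Psi> x + \<Psi> y"
    and "x \<in> carrier_vec N \<Longrightarrow> \<Psi> (c \<cdot>\<^sub>v x) = c \<cdot>\<^sub>v \<Psi> x"
  using mod_hom.f_hom[OF linear_map.axioms(3)[OF assms]]
  unfolding module_hom_def module_vec_simps by auto

lemma linear_map_sum:
  fixes m :: nat
  assumes lin: "linear_map class_ring (qbar_space N) (qbar_space M) \<Psi>"
    and x: "\<And>i. i < m \<Longrightarrow> x i \<in> carrier_vec N"
  shows "\<Psi> (vec N (\<lambda>j. \<Sum>i<m. c i * x i $ j)) = vec M (\<lambda>k. \<Sum>i<m. c i * \<Psi> (x i) $ k)"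
  using x
proof (induction m)
  case 0
  have "vec N (\<lambda>j. 0) = 0 \<cdot>\<^sub>v (0\<^sub>v N :: qbar vec)" by (intro eq_vecI) auto
  hence "\<Psi> (vec N (\<lambda>j. 0)) = 0 \<cdot>\<^sub>v \<Psi> (0\<^sub>v N)" using linear_map_vec(3)[OF lin] by simp
  also have "\<dots> = vec M (\<lambda>k. 0)" using linear_map_vec(1)[OF lin, of "0\<^sub>v N"] by (intro eq_vecI) auto
  finally show ?case by simp
next
  case (Suc m)
  note xm = Suc.prems[of m, simplified] and IH = Suc.IH[OF Suc.prems[OF less_SucI]]
  have "vec N (\<lambda>j. \<Sum>i<Suc m. c i * x i $ j) = vec N (\<lambda>j. \<Sum>i<m. c i * x i $ j) + c m \<cdot>\<^sub>v x m"
    using xm by (intro eq_vecI) auto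
  hence "\<Psi> (vec N (\<lambda>j. \<Sum>i<Suc m. c i * x i $ j)) = vec M (\<lambda>k. \<Sum>i<m. c i * \<Psi> (x i) $ k) + c m \<cdot>\<^sub>v \<Psi> (x m)"
    using linear_map_vec(2)[OF lin, of "vec N (\<lambda>j. \<Sum>i<m. c i * x i $ j)" "c m \<cdot>\<^sub>v x m"]
      linear_map_vec(3)[OF lin xm] xm IH by simp
  also have "\<dots> = vec M (\<lambda>k. \<Sum>i<Suc m. c i * \<Psi> (x i) $ k)"
    using linear_map_vec(1)[OF lin xm] by (intro eq_vecI) auto
  finally show ?case .
qed

lemma linear_map_matrix:
  assumes lin: "linear_map class_ring (qbar_space N) (qbar_space M) \<Psi>"
    and x: "x \<in> carrier_vec N" and k: "k < M"
  shows "\<Psi> x $ k = (\<Sum>j<N. \<Psi> (unit_vec N j) $ k * x $ j)"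
proof -
  have "vec N (\<lambda>l. \<Sum>j<N. x $ j * unit_vec N j $ l) = x"
  proof (rule eq_vecI)
    fix l assume "l < dim_vec x"
    hence l: "l < N" using x by simp
    have "(\<Sum>j<N. x $ j * unit_vec N j $ l) = (\<Sum>j<N. if j = l then x $ l else 0)"
      using l by (intro sum.cong) (auto simp: unit_vec_def)
    thus "vec N (\<lambda>l. \<Sum>j<N. x $ j * unit_vec N j $ l) $ l = x $ l" using l by simp
  qed (use x in simp)
  hence "\<Psi> x = vec M (\<lambda>k. \<Sum>j<N. x $ j * \<Psi> (unit_vec N j) $ k)"
    using linear_map_sum[OF lin, of N "unit_vec N" "\<lambda>j. x $ j"] by simp
  thus ?thesis using k by (simp add: mult.commute)
qed

lemma subspace_sum_mem:
  fixes m :: nat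
  assumes W: "VectorSpace.subspace class_ring W (qbar_space N)" and x: "\<And>i. i < m \<Longrightarrow> x i \<in> W"
  shows "vec N (\<lambda>j. \<Sum>i<m. c i * x i $ j) \<in> W"
  using x
proof (induction m)
  case 0
  have "vec N (\<lambda>j. 0) = (0\<^sub>v N :: qbar vec)" by (intro eq_vecI) auto
  thus ?case using submodule.zero_closed[OF VectorSpace.subspace.submod[OF W]] by (simp add: module_vec_simps)
next
  case (Suc m)
  have xm: "x m \<in> W" using Suc.prems by simp
  have "x m \<in> carrier_vec N"
    using submodule.subset[OF VectorSpace.subspace.submod[OF W]] xm by (auto simp: module_vec_simps)
  hence "vec N (\<lambda>j. \<Sum>i<Suc m. c i * x i $ j) = vec N (\<lambda>j. \<Sum>i<m. c i * x i $ j) + c m \<cdot>\<^sub>v x m"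
    by (intro eq_vecI) auto
  moreover have "c m \<cdot>\<^sub>v x m \<in> W"
    using submodule.smult_closed[OF VectorSpace.subspace.submod[OF W], of "c m" "x m"] xm by (simp add: module_vec_simps)
  moreover have "vec N (\<lambda>j. \<Sum>i<m. c i * x i $ j) \<in> W" using Suc by simp
  ultimately show ?case
    using submodule.m_closed[OF VectorSpace.subspace.submod[OF W]] by (simp add: module_vec_simps)
qed

text \<open>A linear relation between the rows is a combination of the \<open>w i\<close> that
  \<open>\<Psi>\<close> maps to zero. It lies in \<open>W\<close> and in the kernel, hence vanishes,
  against the independence of the basis.\<close>

lemma det_nonzero:
  assumes W: "VectorSpace.subspace class_ring W (qbar_space N)"
    and lin: "linear_map class_ring (qbar_space N) (qbar_space M) \<Psi>"
    and ker: "W \<inter> mod_hom.ker (qbar_space N) (qbar_space M) \<Psi> = {0\<^sub>v N}"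
    and inj: "inj_on w {..<M}"
    and basis: "vectorspace.basis class_ring ((qbar_space N)\<lparr>carrier := W\<rparr>) (w ` {..<M})"
  shows "det (mat M M (\<lambda>(i, k). \<Psi> (w i) $ k)) \<noteq> 0"
proof
  let ?A = "mat M M (\<lambda>(i, k). \<Psi> (w i) $ k)"
  interpret V: vec_space "TYPE(qbar)" N .
  note sub = VectorSpace.subspace.submod[OF W]
  have vs: "vectorspace class_ring ((qbar_space N)\<lparr>carrier := W\<rparr>)" by (rule V.subspace_is_vs[OF W])
  have WN: "W \<subseteq> carrier_vec N" using submodule.subset[OF sub] by (simp add: module_vec_simps)
  have wW: "w ` {..<M} \<subseteq> W"
    and "\<not> module.lin_dep class_ring ((qbar_space N)\<lparr>carrier := W\<rparr>) (w ` {..<M})"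
    using basis unfolding vectorspace.basis_def[OF vs] by auto
  hence indep: "\<not> V.lin_dep (w ` {..<M})" using V.span_li_not_depend(2)[OF wW sub] by simp
  have wN: "w i \<in> carrier_vec N" if "i < M" for i using wW WN that by auto
  assume "det ?A = 0"
  hence "det (transpose_mat ?A) = 0" by (subst det_transpose[of _ M]) auto
  then obtain c where c: "c \<in> carrier_vec M" "c \<noteq> 0\<^sub>v M" "transpose_mat ?A *\<^sub>v c = 0\<^sub>v M"
    using det_0_iff_vec_prod_zero_field[of "transpose_mat ?A" M] by auto
  define x where "x = vec N (\<lambda>j. \<Sum>i<M. c $ i * w i $ j)"
  have x: "x \<in> W" unfolding x_def by (rule subspace_sum_mem[OF W]) (use wW in auto)
  have "\<Psi> x = vec M (\<lambda>k. \<Sum>i<M. c $ i * \<Psi> (w i) $ k)" unfolding x_def by (rule linear_map_sum[OF lin wN])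
  also have "\<dots> = 0\<^sub>v M"
  proof (rule eq_vecI)
    fix k assume "k < dim_vec (0\<^sub>v M :: qbar vec)"
    hence k: "k < M" by simp
    have "(transpose_mat ?A *\<^sub>v c) $ k = (\<Sum>i<M. \<Psi> (w i) $ k * c $ i)"
      using k c(1) by (auto simp: mult_mat_vec_def scalar_prod_def atLeast0LessThan intro!: sum.cong)
    thus "vec M (\<lambda>k. \<Sum>i<M. c $ i * \<Psi> (w i) $ k) $ k = 0\<^sub>v M $ k"
      using k c(3) by (simp add: mult.commute)
  qed simp
  finally have "\<Psi> x = 0\<^sub>v M" .
  hence "x \<in> mod_hom.ker (qbar_space N) (qbar_space M) \<Psi>"
    unfolding mod_hom.ker_def[OF linear_map.axioms(3)[OF lin]] using x WN by (auto simp: module_vec_simps)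
  hence x0: "x = 0\<^sub>v N" using ker x by auto
  obtain i where i: "i < M" "c $ i \<noteq> 0"
  proof (rule ccontr)
    assume "\<not> thesis"
    hence "c = 0\<^sub>v M" using that c(1) by (intro eq_vecI) auto
    thus False using c(2) by simp
  qed
  \<comment> \<open>\<open>lincomb\<close> takes its coefficients as a function of the vectors;
    injectivity of \<open>w\<close> makes this reindexing faithful.\<close>
  define b where "b y = c $ (inv_into {..<M} w y)" for y
  have b: "b (w i) = c $ i" if "i < M" for i unfolding b_def using inv_into_f_f[OF inj, of i] that by simp
  have "V.lincomb b (w ` {..<M}) = 0\<^sub>v N"
  proof (rule eq_vecI)
    have car: "V.lincomb b (w ` {..<M}) \<in> carrier_vec N"
      using V.lincomb_closed[of "w ` {..<M}" b] wW WN by (auto simp: module_vec_simps)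
    show "dim_vec (V.lincomb b (w ` {..<M})) = dim_vec (0\<^sub>v N :: qbar vec)" using car by simp
    fix j assume "j < dim_vec (0\<^sub>v N :: qbar vec)"
    hence j: "j < N" by simp
    have "V.lincomb b (w ` {..<M}) $ j = (\<Sum>y\<in>w ` {..<M}. b y * y $ j)"
      by (rule V.lincomb_index[OF j]) (use wW WN in auto)
    also have "\<dots> = (\<Sum>i<M. b (w i) * w i $ j)" using inj by (simp add: sum.reindex)
    also have "\<dots> = x $ j" using b j by (simp add: x_def)
    finally show "V.lincomb b (w ` {..<M}) $ j = 0\<^sub>v N $ j" by (simp add: x0)
  qed
  hence "V.lin_dep (w ` {..<M})"
    unfolding V.lin_dep_def using i b[OF i(1)]
    by (intro exI[of _ "w ` {..<M}"] exI[of _ b] exI[of _ "w i"]) (auto simp: module_vec_simps)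
  thus False using indep by simp
qed

section \<open>Products over the places\<close>

text \<open>The partial products are constant as soon as the finite set contains
  \<open>S\<close>.\<close>

lemma place_prod_finite:
  assumes "finite S" "S \<subseteq> places K" "\<And>v. v \<in> places K - S \<Longrightarrow> f v = 1"
  shows "place_prod K f = prod f S"
proof -
  have "\<forall>\<^sub>F T in finite_subsets_at_top (places K). prod f T = prod f S"
    unfolding eventually_finite_subsets_at_top
  proof (intro exI[of _ S] conjI allI impI)
    fix T assume T: "finite T \<and> S \<subseteq> T \<and> T \<subseteq> places K"
    show "prod f T = prod f S"
    proof (rule prod.mono_neutral_right)
      show "\<forall>v\<in>T - S. f v = 1" using T assms(3) by blast
    qed (use T in auto)
  qed (use assms in auto)
  hence "(prod f \<longlongrightarrow> prod f S) (finite_subsets_at_top (places K))" by (rule tendsto_eventually)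
  thus ?thesis unfolding place_prod_def by (intro tendsto_Lim finite_subsets_at_top_neq_bot)
qed

theorem theorem3p3:
  fixes M N :: nat
    and W :: "qbar vec set"
    and \<Psi> :: "qbar vec \<Rightarrow> qbar vec"
    and w :: "nat \<Rightarrow> qbar vec"
    and K :: "qbar set"
  assumes "0 < M" and "M \<le> N"
    and "VectorSpace.subspace class_ring W (qbar_space N)"
    and "vectorspace.dim class_ring ((qbar_space N)\<lparr>carrier := W\<rparr>) = M"
    and "linear_map class_ring (qbar_space N) (qbar_space M) \<Psi>"
    and "\<Psi> ` carrier_vec N = carrier_vec M"
    and "W \<inter> mod_hom.ker (qbar_space N) (qbar_space M) \<Psi> = {0\<^sub>v N}"
    and "inj_on w {..<M}"
    and "vectorspace.basis class_ring ((qbar_space N)\<lparr>carrier := W\<rparr>) (w ` {..<M})"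
    and "number_field K"
    and "\<forall>m<M. \<forall>j<N. w m $ j \<in> K"
    and "\<forall>j<N. \<forall>i<M. \<Psi> (unit_vec N j) $ i \<in> K"
  shows "1 = height_H K M N w * distance_U K M N w \<Psi>"
proof -
  note MN = assms(2) and lin = assms(5) and W = assms(3)
  interpret numfield K by unfold_locales (rule assms(10))
  interpret R: cring "KR K" by (rule cring_K)
  define A where "A k j = \<Psi> (unit_vec N j) $ k" for k j
  define x where "x m j = w m $ j" for m j
  have A: "A k j \<in> K" if "k < M" "j < N" for k j using assms(12) that by (simp add: A_def)
  have x: "x m j \<in> K" if "m < M" "j < N" for m j using assms(11) that by (simp add: x_def)
  have wN: "w m \<in> carrier_vec N" if "m < M" for m
  proof -
    interpret V: vec_space "TYPE(qbar)" N .
    have "w ` {..<M} \<subseteq> W"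
      using assms(9) unfolding vectorspace.basis_def[OF V.subspace_is_vs[OF W]] by auto
    thus ?thesis using submodule.subset[OF VectorSpace.subspace.submod[OF W]] that by (auto simp: module_vec_simps)
  qed
  define B where "B i k = (\<Oplus>\<^bsub>KR K\<^esub>j\<in>{..<N}. A k j \<otimes>\<^bsub>KR K\<^esub> x i j)" for i k
  have BK: "B i k \<in> K" if "i < M" "k < M" for i k
    using R.finsum_closed[of "\<lambda>j. A k j \<otimes>\<^bsub>KR K\<^esub> x i j" "{..<N}"] A x K_mult that by (auto simp: B_def)
  have B: "B i k = \<Psi> (w i) $ k" if "i < M" "k < M" for i k
    unfolding B_def linear_map_matrix[OF lin wN[OF that(1)] that(2)]
    by (subst finsum_K) (use A x K_mult that in \<open>auto simp: A_def x_def\<close>)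
  define D where "D = ring_det (KR K) M B"
  have "D = det (mat M M (\<lambda>(i, k). B i k))" unfolding D_def by (rule ring_det_K[OF BK])
  also have "mat M M (\<lambda>(i, k). B i k) = mat M M (\<lambda>(i, k). \<Psi> (w i) $ k)" using B by (intro eq_matI) auto
  finally have D0: "D \<noteq> 0" using det_nonzero[OF W lin assms(7-9)] by simp
  have DK: "D \<in> K"
    using R.ring_det_closed[of M B] BK by (simp add: D_def R.square_closed_def)
  define m where "m I = ring_det (KR K) M (\<lambda>i j. x i (sorted_list_of_set I ! j))" for I
  have mK: "m I \<in> K" if "I \<in> ext_index M N" for I
    using R.ring_det_closed[of M "\<lambda>i j. x i (sorted_list_of_set I ! j)"] x R.ext_index_props(4)[OF that]
    by (simp add: m_def R.square_closed_def)
  \<comment> \<open>If all maximal minors of the basis vanished, Cauchy-Binet would give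
    \<open>D = 0\<close>. A nonzero minor makes every local height positive.\<close>
  have "\<exists>I\<in>ext_index M N. m I \<noteq> 0"
  proof (rule ccontr)
    assume "\<not> ?thesis"
    hence z: "m I = 0" if "I \<in> ext_index M N" for I using that by blast
    have "D = (\<Oplus>\<^bsub>KR K\<^esub>I\<in>ext_index M N. m I \<otimes>\<^bsub>KR K\<^esub> ring_det (KR K) M (\<lambda>i k. A k (sorted_list_of_set I ! i)))"
      unfolding D_def B_def m_def by (rule R.cauchy_binet) (use A x in auto)
    also have "\<dots> = \<zero>\<^bsub>KR K\<^esub>"
      by (rule R.add.finprod_one_eqI) (use z in simp)
    finally show False using D0 by simp
  qed
  then obtain I0 where I0: "I0 \<in> ext_index M N" "m I0 \<noteq> 0" by blast
  let ?e = "\<lambda>v. Omega_emb K v" and ?w = "\<lambda>v. Omega_wedge K v M N w"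
  let ?H = "\<lambda>v. ext_height (Omega_abs K v) M N (?w v)"
  let ?U = "\<lambda>v. local_U (Omega K v) (Omega_abs K v) M N (?w v) (Omega_ext_map K v M N \<Psi>)"
  let ?D = "\<lambda>v. v D powr (real (local_degree K v) / real d)"
  \<comment> \<open>The coordinates in \<open>Omega\<close> are images of minors computed in
    \<open>K\<close>, so the local height is a maximum of powers of values of
    \<open>v\<close>.\<close>
  have wedge: "?w v I = ?e v (m I)" if v: "v \<in> places K" and I: "I \<in> ext_index M N" for v I
  proof -
    interpret place K v by unfold_locales (rule v)
    interpret O: valued_field "Omega K v" "Omega_abs K v" by (rule Omega_valued_field)
    have h: "?e v y \<in> carrier (Omega K v)" if "y \<in> K" for y
      using ring_hom_closed[OF Omega_emb_hom] that by simp
    note sl = R.ext_index_props(4)[OF I]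
    have "?e v (m I) = ring_det (Omega K v) M (\<lambda>i j. ?e v (x i (sorted_list_of_set I ! j)))"
      unfolding m_def by (rule ring_det_hom[OF cring_K O.is_cring Omega_emb_hom]) (use x sl in auto)
    also have "\<dots> = ring_det (Omega K v) M (\<lambda>i j. Omega_vec K v N (w i) (sorted_list_of_set I ! j))"
      by (rule O.ring_det_cong[symmetric])
        (use h x sl in \<open>auto simp: O.square_closed_def Omega_vec_def x_def\<close>)
    finally show ?thesis using I by (simp add: Omega_wedge_def wedge_def)
  qed
  have HU: "?H v * ?U v = ?D v" "0 < ?H v" if v: "v \<in> places K" for v
  proof -
    interpret place K v by unfold_locales (rule v)
    interpret O: valued_field "Omega K v" "Omega_abs K v" by (rule Omega_valued_field)
    interpret h: ring_hom_cring "KR K" "Omega K v" "?e v" by unfold_locales (rule Omega_emb_hom)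
    have h: "?e v y \<in> carrier (Omega K v)" if "y \<in> K" for y
      using ring_hom_closed[OF Omega_emb_hom] that by simp
    have vec: "Omega_vec K v N (w i) \<in> PiE {..<N} (\<lambda>_. carrier (Omega K v))" if "i < M" for i
      using h x[OF that] by (auto simp: Omega_vec_def x_def)
    have eA: "?e v (A k j) \<in> carrier (Omega K v)" if "k < M" "j < N" for k j using h A that by simp
    have psi: "Omega_ext_map K v M N \<Psi> \<in> ext_dual (Omega K v) M N"
      unfolding Omega_ext_map_def A_def[symmetric] by (rule O.ext_map_props(1)[OF eA])
    have "Omega_ext_map K v M N \<Psi> (?w v) =
        ring_det (Omega K v) M (\<lambda>i k. \<Oplus>\<^bsub>Omega K v\<^esub>j\<in>{..<N}. ?e v (A k j) \<otimes>\<^bsub>Omega K v\<^esub> Omega_vec K v N (w i) j)"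
      unfolding Omega_ext_map_def Omega_wedge_def A_def[symmetric]
      by (rule O.ext_map_props(2)[OF eA]) (use vec in auto)
    also have "\<dots> = ring_det (Omega K v) M (\<lambda>i k. ?e v (B i k))"
    proof (rule O.ring_det_cong)
      show "O.square_closed M (\<lambda>i k. ?e v (B i k))" using h BK by (simp add: O.square_closed_def)
      fix i k assume ik: "i < M" "k < M"
      have "?e v (B i k) = (\<Oplus>\<^bsub>Omega K v\<^esub>j\<in>{..<N}. (?e v \<circ> (\<lambda>j. A k j \<otimes>\<^bsub>KR K\<^esub> x i j)) j)"
        unfolding B_def using A x ik K_mult by (subst h.hom_finsum) (auto simp: o_def)
      also have "\<dots> = (\<Oplus>\<^bsub>Omega K v\<^esub>j\<in>{..<N}. ?e v (A k j) \<otimes>\<^bsub>Omega K v\<^esub> Omega_vec K v N (w i) j)"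
      proof (rule O.fsum_cong)
        fix j assume "j \<in> {..<N}"
        hence j: "j < N" by simp
        have A': "A k j \<in> carrier (KR K)" and x': "x i j \<in> carrier (KR K)" using A x ik j by simp_all
        have v': "Omega_vec K v N (w i) j = ?e v (x i j)" using j by (simp add: Omega_vec_def x_def)
        show "(?e v \<circ> (\<lambda>j. A k j \<otimes>\<^bsub>KR K\<^esub> x i j)) j = ?e v (A k j) \<otimes>\<^bsub>Omega K v\<^esub> Omega_vec K v N (w i) j"
          unfolding o_def v' by (rule h.hom_mult[OF A' x'])
        show "?e v (A k j) \<otimes>\<^bsub>Omega K v\<^esub> Omega_vec K v N (w i) j \<in> carrier (Omega K v)"
          unfolding v' by (intro O.m_closed h.hom_closed A' x')
      qed
      finally show "(\<Oplus>\<^bsub>Omega K v\<^esub>j\<in>{..<N}. ?e v (A k j) \<otimes>\<^bsub>Omega K v\<^esub> Omega_vec K v N (w i) j) = ?e v (B i k)" by simp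
    qed
    also have "\<dots> = ?e v D"
      unfolding D_def by (rule ring_det_hom[OF cring_K O.is_cring Omega_emb_hom, symmetric]) (use BK in simp)
    finally have val: "Omega_ext_map K v M N \<Psi> (?w v) = ?e v D" .
    have wc: "?w v \<in> PiE (ext_index M N) (\<lambda>_. carrier (Omega K v))"
      unfolding Omega_wedge_def by (rule O.wedge_closed) (use vec in auto)
    have "Omega_abs K v (?e v (m I0)) = v (m I0) powr exponent" by (rule Omega_emb_abs[OF mK[OF I0(1)]])
    also have "\<dots> \<noteq> 0" using v_pos[OF mK[OF I0(1)] I0(2)] by simp
    finally have "Omega_abs K v (?w v I0) \<noteq> 0" by (simp add: wedge[OF v I0(1)])
    hence "?w v I0 \<noteq> \<zero>\<^bsub>Omega K v\<^esub>" using O.abs_zero by auto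
    hence nz: "\<exists>I\<in>ext_index M N. ?w v I \<noteq> \<zero>\<^bsub>Omega K v\<^esub>" using I0(1) by blast
    show H: "0 < ?H v" by (rule O.local_U_eq(2)[OF MN wc nz psi])
    have "?U v = ?D v / ?H v"
      unfolding O.local_U_eq(1)[OF MN wc nz psi] val Omega_emb_abs[OF DK] ..
    thus "?H v * ?U v = ?D v" using H by simp
  qed
  \<comment> \<open>One finite set for both products: outside it \<open>D\<close> and all nonzero
    minors have value 1, so the local height is 1, and the local identity then makes the factor of
    \<open>U\<close> equal to 1.\<close>
  define S where "S = {v\<in>places K. v D \<noteq> 1} \<union>
    (\<Union>I\<in>{I\<in>ext_index M N. m I \<noteq> 0}. {v\<in>places K. v (m I) \<noteq> 1})"
  have S: "finite S" "S \<subseteq> places K"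
  proof -
    have "finite (\<Union>I\<in>{I\<in>ext_index M N. m I \<noteq> 0}. {v\<in>places K. v (m I) \<noteq> 1})"
      by (rule finite_UN_I) (use R.finite_ext_index product_formula(1)[OF mK] in auto)
    thus "finite S" unfolding S_def using product_formula(1)[OF DK D0] by simp
  qed (auto simp: S_def)
  have D1: "v D = 1" if "v \<in> places K - S" for v using that by (auto simp: S_def)
  have H1: "?H v = 1" if v: "v \<in> places K - S" for v
  proof -
    have vp: "v \<in> places K" "v \<notin> S" using v by simp_all
    interpret place K v by unfold_locales (rule vp(1))
    have a: "Omega_abs K v (?w v I) = v (m I) powr exponent" if "I \<in> ext_index M N" for I
      unfolding wedge[OF vp(1) that] by (rule Omega_emb_abs[OF mK[OF that]])
    have m1: "v (m I) = 1" if "I \<in> ext_index M N" "m I \<noteq> 0" for I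
      using vp that unfolding S_def by blast
    have "1 \<le> ?H v" using ext_height_ge[OF I0(1), of "Omega_abs K v" "?w v"] a[OF I0(1)] m1[OF I0] by simp
    moreover obtain I where I: "I \<in> ext_index M N" "?H v = Omega_abs K v (?w v I)"
      using ext_height_attained[OF MN] by blast
    moreover have "Omega_abs K v (?w v I) \<le> 1"
      using a[OF I(1)] m1[OF I(1)] v_0 by (cases "m I = 0") simp_all
    ultimately show ?thesis by simp
  qed
  have U1: "?U v = 1" if v: "v \<in> places K - S" for v
    using HU(1)[of v] H1[OF v] D1[OF v] v by simp
  have "height_H K M N w * distance_U K M N w \<Psi> = prod ?H S * prod ?U S"
    unfolding height_H_def distance_U_def
    using place_prod_finite[OF S H1] place_prod_finite[OF S U1] by simp
  also have "\<dots> = (\<Prod>v\<in>S. ?D v)"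
    unfolding prod.distrib[symmetric] using HU(1) S(2) by (intro prod.cong) auto
  also have "\<dots> = 1" by (rule product_formula(2)[OF DK D0 S]) (rule D1)
  finally show ?thesis by simp
qed

end
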